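(* Let $n\in\mathbb N$, let $\mathcal W^{(1)},\mathcal W^{(2)}\in I^n(\mathcal D\Omega^n)$, and let $\mathcal W^{(i)}_k$ ($k=1,\dots,n$) denote the $k$-th component of $\mathcal W^{(i)}$. Then \[ \widetilde{\mathcal E}^{\mathrm B}_{\mu,n}(\mathcal W^{(1)},\mathcal W^{(2)})=\sum_{k=1}^n\int_{\Gamma_X\times X^k}\mu^{(k)}(d\gamma,dx_1,\dots,dx_k)\Big[\langle\nabla^\Gamma_\gamma\mathcal W_k^{(1)}(\gamma,x_1,\dots,x_k),\nabla^\Gamma_\gamma\mathcal W_k^{(2)}(\gamma,x_1,\dots,x_k)\rangle_{T_\gamma\Gamma_X\otimes\mathbb T^{(n)}_{\{x_1,\dots,x_k\}}X^k} \] \[ \qquad+\langle\nabla^{X^k}_{(x_1,\dots,x_k)}\mathcal W_k^{(1)}(\gamma,x_1,\dots,x_k),\nabla^{X^k}_{(x_1,\dots,x_k)}\mathcal W_k^{(2)}(\gamma,x_1,\dots,x_k)\rangle_{T_{(x_1,\dots,x_k)}X^k\otimes\mathbb T^{(n)}_{\{x_1,\dots,x_k\}}X^k}\Big]. \] Here $\nabla^{X^k}$ is the covariant gradient of forms on $X^k$ in the variables $(x_1,\dots,x_k)$ and, for fixed $(x_1,\dots,x_k)\in\widetilde X^k$, $\nabla^\Gamma_\gamma$ denotes the gradient of a mapping from $\Gamma_X$ into the fixed space $\mathbb T^{(n)}_{\{x_1,\dots,x_k\}}X^k$, defined for $\mu$-a.e. $\gamma\in\Gamma_X$ in the same way as the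 gradient of a function on $\Gamma_X$.
   Context: **Configuration space.** $X$ is a complete, connected, oriented $C^\infty$ Riemannian manifold of infinite volume, $d=\dim X$, $m$ is its volume measure, $\langle\cdot,\cdot\rangle_x$, $|\cdot|_x$ the inner product and norm on $T_xX$, $\nabla^X$ the gradient (Levi-Civita covariant derivative). $C_0(X)$ = continuous functions with compact support, $\mathcal D=C_0^\infty(X)$, $\mathcal O_c(X)$ = open relatively compact subsets of $X$. $\Gamma_X$ is the set of all locally finite subsets $\gamma\subset X$; $\gamma_\Lambda=\gamma\cap\Lambda$. A configuration $\gamma$ is identified with the Radon measure $\sum_{x\in\gamma}\varepsilon_x$ ($\varepsilon_x$ = Dirac mass), so $\gamma+\varepsilon_x=\gamma\cup\{x\}$ for $x\notin\gamma$, $\gamma-\varepsilon_x=\gamma\setminus\{x\}$ for $x\in\gamma$, $\langle f,\gamma\rangle=\sum_{x\in\gamma}f(x)$. $\Gamma_X$ carries the vague topology and its Borel $\sigma$-algebra. $T_\gamma\Gamma_X:=\bigoplus_{x\in\gamma}T_xX$ (Hilbert direct sum). The gradient of a function $F$ on $\Gamma_X$ is $\nabla^\Gamma F(\gamma)=(\nabla^X_xF(\gamma))_{x\in\gamma}$, $\nabla^X_xF(\gamma)$ being the gradient at $y=x$ of $y\mapsto F(\gamma-\varepsilon_x+\varepsilon_y)$. **The measure.** $\mu$ is a probability measure on $\Gamma_X$ with all moments finite, $\int\langle\varphi,\gamma\rangle^k\mu(d\gamma)<\infty$ for all $k\in\mathbb N$, $0\le\varphi\in C_0(X)$, and such that for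 every measurable $F:\Gamma_X\times X\to\mathbb R$, $F\ge0$, $\int\mu(d\gamma)\sum_{x\in\gamma}F(\gamma,x)=\int\mu(d\gamma)\int_X\sigma(\gamma,dx)F(\gamma+\varepsilon_x,x)$, where $\sigma(\gamma,\cdot)$ is a Borel measure on $X$ (depending measurably on $\gamma$) with $\sigma(\gamma,\cdot)\ll m$ for $\mu$-a.e. $\gamma$; $\rho(\gamma,x)=\frac{d\sigma(\gamma,\cdot)}{dm}(x)$. Standing assumptions: $\rho(\gamma,x)>0$ for $\mu\otimes m$-a.e. $(\gamma,x)$; for $\mu$-a.e. $\gamma$, $\rho(\gamma,\cdot)$ is weakly differentiable on $X$; and, with $B_\mu(\gamma,x)=\nabla^X_x\rho(\gamma-\varepsilon_x,x)/\rho(\gamma-\varepsilon_x,x)$ for $x\in\gamma$, for every $\Lambda\in\mathcal O_c(X)$ there is $\epsilon>0$ with $\int(\sum_{x\in\gamma_\Lambda}|B_\mu(\gamma,x)|_x)^{2+\epsilon}\mu(d\gamma)<\infty$. Put $\sigma^{(k)}(\gamma,dx_1,\dots,dx_k)=\sigma(\gamma,dx_1)\sigma(\gamma+\varepsilon_{x_1},dx_2)\cdots\sigma(\gamma+\varepsilon_{x_1}+\dots+\varepsilon_{x_{k-1}},dx_k)$ and $\mu^{(k)}(d\gamma,dx_1,\dots,dx_k)=\mu(d\gamma)\sigma^{(k)}(\gamma,dx_1,\dots,dx_k)$ on $\Gamma_X\times X^k$. **Forms.** An $n$-form on $\Gamma_X$ is a map $\gamma\mapsto W(\gamma)\in\wedge^n(T_\gamma\Gamma_X)$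 ($\wedge^n$ = $n$-th antisymmetric Hilbert tensor power). For $x\in\gamma$ let $\mathcal O_{\gamma,x}$ be an open neighbourhood of $x$ with $\mathcal O_{\gamma,x}\cap(\gamma\setminus\{x\})=\varnothing$; $W_x(\gamma,y):=W(\gamma-\varepsilon_x+\varepsilon_y)$, $y\in\mathcal O_{\gamma,x}$, is a section of the bundle over $\mathcal O_{\gamma,x}$ with fibre $\wedge^n(T_{\gamma-\varepsilon_x+\varepsilon_y}\Gamma_X)$, which carries the connection induced by the Levi-Civita connection on $TX$ (the summands $T_zX$, $z\in\gamma\setminus\{x\}$, being constant). $\nabla^X_xW(\gamma)$ is the covariant derivative of $W_x(\gamma,\cdot)$ at $x$, $\nabla^\Gamma W(\gamma)=(\nabla^X_xW(\gamma))_{x\in\gamma}\in T_\gamma\Gamma_X\otimes\wedge^n(T_\gamma\Gamma_X)$; higher derivatives are defined analogously. $W$ is local if there is $\Lambda\in\mathcal O_c(X)$ with $W(\gamma)=W(\gamma_\Lambda)$ for all $\gamma$. $\mathcal F\Omega^n$ is the set of local, infinitely differentiable $n$-forms $W$ for which there are $0\le\varphi\in C_0(X)$, $l\in\mathbb N$ with $\|W(\gamma)\|^2\le\langle\varphi,\gamma\rangle^l$ for all $\gamma$. $L^2_\mu\Omega^n$ is the completion of (the $\mu$-classes of) $\mathcal F\Omega^n$ with respect to $(W_1,W_2)=\int\langle W_1(\gamma),W_2(\gamma)\rangle\,\mu(d\gamma)$. **The space $\mathcal D\Omega^n$.** $\widetilde X^k=\{(x_1,\dots,x_k)\in X^k: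 x_i\neq x_j\ (i\ne j)\}$. For distinct points put $\mathbb T^{(n)}_{\{x_1,\dots,x_k\}}X^k=\bigoplus_{1\le l_1,\dots,l_k\le d,\ l_1+\dots+l_k=n}(T_{x_1}X)^{\wedge l_1}\wedge\dots\wedge(T_{x_k}X)^{\wedge l_k}$. Then $\wedge^n(T_\gamma\Gamma_X)=\bigoplus_{k=1}^n\bigoplus_{\{x_1,\dots,x_k\}\subset\gamma}\mathbb T^{(n)}_{\{x_1,\dots,x_k\}}X^k$, and $W_k(\gamma,x_1,\dots,x_k)$ denotes the projection of $W(\gamma)$ onto $\mathbb T^{(n)}_{\{x_1,\dots,x_k\}}X^k$. $\mathcal FC_b^\infty(\mathcal D,\Gamma_X)$ = functions $F(\gamma)=g(\langle\varphi_1,\gamma\rangle,\dots,\langle\varphi_N,\gamma\rangle)$, $g\in C_b^\infty(\mathbb R^N)$, $\varphi_i\in\mathcal D$. $\Psi^n_{\rm sym}(X^k)$ = smooth compactly supported forms $\omega:X^k\to\wedge^n(TX^k)$ such that on $\widetilde X^k$: $\omega(x_1,\dots,x_k)\in\mathbb T^{(n)}_{\{x_1,\dots,x_k\}}X^k$, and $\omega$ is invariant under permutations of $(x_1,\dots,x_k)$. $\mathcal D\Omega^n$ is the linear span of the forms $W$ with $W_l=0$ for $l\ne k$ and $W_k(\gamma,x_1,\dots,x_k)=(k!)^{1/2}F(\gamma-\varepsilon_{x_1}-\dots-\varepsilon_{x_k})\,\omega(x_1,\dots,x_k)$ for $\{x_1,\dots,x_k\}\subset\gamma$, where $k\in\{1,\dots,n\}$,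 $F\in\mathcal FC_b^\infty(\mathcal D,\Gamma_X)$, $\omega\in\Psi^n_{\rm sym}(X^k)$. **The unitary $I^n$ and the forms.** $L^2_\Psi(\Gamma_X\times X^k\to\wedge^n(TX^k);\mu^{(k)})$ is the closed linear span in $L^2(\Gamma_X\times X^k\to\wedge^n(TX^k);\mu^{(k)})$ of the mappings $F(\gamma)\omega(x_1,\dots,x_k)$, $F\in\mathcal FC_b^\infty(\mathcal D,\Gamma_X)$, $\omega\in\Psi^n_{\rm sym}(X^k)$. $I^n:L^2_\mu\Omega^n\to\bigoplus_{k=1}^nL^2_\Psi(\Gamma_X\times X^k\to\wedge^n(TX^k);\mu^{(k)})$ is the unitary with components $(I^nW)_k(\gamma,x_1,\dots,x_k)=(k!)^{-1/2}W_k(\gamma+\varepsilon_{x_1}+\dots+\varepsilon_{x_k},x_1,\dots,x_k)$. $(\mathcal E^{\mathrm B}_{\mu,n},D(\mathcal E^{\mathrm B}_{\mu,n}))$ is the closure in $L^2_\mu\Omega^n$ of $\mathcal E^{\mathrm B}_{\mu,n}(W^{(1)},W^{(2)})=\int\langle\nabla^\Gamma W^{(1)}(\gamma),\nabla^\Gamma W^{(2)}(\gamma)\rangle\,\mu(d\gamma)$, $W^{(1)},W^{(2)}\in\mathcal D\Omega^n$ (closable under the assumptions above), and $\widetilde{\mathcal E}^{\mathrm B}_{\mu,n}$ is its image under $I^n$: $\widetilde{\mathcal E}^{\mathrm B}_{\mu,n}(\mathcal W^{(1)},\mathcal W^{(2)})=\mathcal E^{\mathrm B}_{\mu,n}((I^n)^{-1}\mathcal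 W^{(1)},(I^n)^{-1}\mathcal W^{(2)})$. *)

theory Defs
  imports "HOL-Probability.Probability" "HOL-Combinatorics.Permutations"
begin

section \<open>Smooth functions\<close>

text \<open>Iterated directional derivatives. On an open set, Frechet differentiability of all of them
  is the \<open>C\<close>-infinity property.\<close>

primrec ddir :: "'v list \<Rightarrow> ('v::real_normed_vector \<Rightarrow> 'w::real_normed_vector) \<Rightarrow> 'v \<Rightarrow> 'w" where
  "ddir [] f = f"
| "ddir (v # vs) f = (\<lambda>x. frechet_derivative (ddir vs f) (at x) v)"

definition smooth_on :: "'v::real_normed_vector set \<Rightarrow> ('v \<Rightarrow> 'w::real_normed_vector) \<Rightarrow> bool" where
  "smooth_on S f \<longleftrightarrow> (\<forall>vs. \<forall>x\<in>S. ddir vs f differentiable (at x))"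

text \<open>Functions of finitely many variables \<open>q i\<close>, \<open>i < N\<close>, where \<open>N\<close> is a number rather than a type.
  Here smoothness is: all iterated partial derivatives exist and are jointly continuous.\<close>

primrec dpart :: "(nat \<times> 'v) list \<Rightarrow> ((nat \<Rightarrow> 'v::real_normed_vector) \<Rightarrow> real) \<Rightarrow> (nat \<Rightarrow> 'v) \<Rightarrow> real" where
  "dpart [] f = f"
| "dpart (iv # ivs) f =
     (\<lambda>q. frechet_derivative (\<lambda>w. dpart ivs f (q(fst iv := w))) (at (q (fst iv))) (snd iv))"

definition smooth_on_prod ::
  "nat \<Rightarrow> (nat \<Rightarrow> 'v::real_normed_vector) set \<Rightarrow> ((nat \<Rightarrow> 'v) \<Rightarrow> real) \<Rightarrow> bool" where
  "smooth_on_prod N Q f \<longleftrightarrow>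
     (\<forall>ivs. fst ` set ivs \<subseteq> {..<N} \<longrightarrow>
        continuous_on Q (dpart ivs f) \<and>
        (\<forall>i<N. \<forall>q\<in>Q. (\<lambda>w. dpart ivs f (q(i := w))) differentiable (at (q i))))"

section \<open>Riemannian manifolds\<close>

text \<open>The underlying set is the whole type \<open>'a\<close> and the dimension is \<open>CARD('n)\<close>. A chart is a pair of
  its domain and its coordinate map. Every point \<open>x\<close> comes with a preferred chart
  \<open>chart_at x\<close>; the tangent space at \<open>x\<close> is the model space \<open>real ^ 'n\<close>, a vector being
  represented by its coordinates with respect to \<open>chart_at x\<close>. The choice of preferred charts is
  arbitrary (no continuity in \<open>x\<close>) and all notions below are independent of it.\<close>

type_synonym ('a, 'n) chart = "'a set \<times> ('a \<Rightarrow> real ^ 'n)"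

record ('a, 'n) riem =
  charts :: "('a, 'n) chart set"
  chart_at :: "'a \<Rightarrow> ('a, 'n) chart"
  metric :: "'a \<Rightarrow> real ^ 'n \<Rightarrow> real ^ 'n \<Rightarrow> real"

definition chart_inv :: "('a, 'n::finite) chart \<Rightarrow> real ^ 'n \<Rightarrow> 'a" where
  "chart_inv c = inv_into (fst c) (snd c)"

definition chart_ran :: "('a, 'n::finite) chart \<Rightarrow> (real ^ 'n) set" where
  "chart_ran c = snd c ` fst c"

definition to_tangent :: "('a, 'n::finite) riem \<Rightarrow> ('a, 'n) chart \<Rightarrow> 'a \<Rightarrow> real ^ 'n \<Rightarrow> real ^ 'n" where
  \<comment> \<open>the element of the tangent space at \<open>y\<close> with coordinates \<open>v\<close> in the chart \<open>c\<close>\<close>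
  "to_tangent M c y v = frechet_derivative (snd (chart_at M y) \<circ> chart_inv c) (at (snd c y)) v"

definition gram :: "('a, 'n::finite) riem \<Rightarrow> ('a, 'n) chart \<Rightarrow> real ^ 'n \<Rightarrow> real ^ 'n \<Rightarrow> real ^ 'n \<Rightarrow> real" where
  "gram M c p u v =
     metric M (chart_inv c p) (to_tangent M c (chart_inv c p) u) (to_tangent M c (chart_inv c p) v)"

definition smooth_manifold :: "('a::topological_space, 'n::finite) riem \<Rightarrow> bool" where
  "smooth_manifold M \<longleftrightarrow>
     (\<forall>c\<in>charts M. open (fst c) \<and> open (chart_ran c) \<and>
        homeomorphism (fst c) (chart_ran c) (snd c) (chart_inv c)) \<and>
     (\<forall>x. chart_at M x \<in> charts M \<and> x \<in> fst (chart_at M x)) \<and>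
     (\<forall>c\<in>charts M. \<forall>c'\<in>charts M. smooth_on (snd c ` (fst c \<inter> fst c')) (snd c' \<circ> chart_inv c))"

definition riemannian :: "('a::topological_space, 'n::finite) riem \<Rightarrow> bool" where
  "riemannian M \<longleftrightarrow> smooth_manifold M \<and>
     (\<forall>x. bilinear (metric M x) \<and> (\<forall>u v. metric M x u v = metric M x v u) \<and>
          (\<forall>u. u \<noteq> 0 \<longrightarrow> metric M x u u > 0)) \<and>
     (\<forall>c\<in>charts M. \<forall>u v. smooth_on (chart_ran c) (\<lambda>p. gram M c p u v))"

text \<open>An orientation is given by an oriented atlas.\<close>

definition oriented :: "('a, 'n::finite) riem \<Rightarrow> bool" where
  "oriented M \<longleftrightarrow> (\<forall>c\<in>charts M. \<forall>c'\<in>charts M. \<forall>p\<in>snd c ` (fst c \<inter> fst c').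
     det (matrix (frechet_derivative (snd c' \<circ> chart_inv c) (at p))) > 0)"

definition tnorm :: "('a, 'n::finite) riem \<Rightarrow> 'a \<Rightarrow> real ^ 'n \<Rightarrow> real" where
  "tnorm M x v = sqrt (metric M x v v)"

definition pw_C1_curve :: "('a::topological_space, 'n::finite) riem \<Rightarrow> (real \<Rightarrow> 'a) \<Rightarrow> bool" where
  "pw_C1_curve M s \<longleftrightarrow> continuous_on {0..1} s \<and>
     (\<exists>S. finite S \<and> (\<forall>c\<in>charts M. (snd c \<circ> s) C1_differentiable_on {t \<in> {0..1} - S. s t \<in> fst c}))"

definition curve_length :: "('a, 'n::finite) riem \<Rightarrow> (real \<Rightarrow> 'a) \<Rightarrow> ennreal" where
  "curve_length M s = (\<integral>\<^sup>+t\<in>{0..1}.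
     ennreal (tnorm M (s t) (vector_derivative (snd (chart_at M (s t)) \<circ> s) (at t))) \<partial>lborel)"

definition riem_dist :: "('a::topological_space, 'n::finite) riem \<Rightarrow> 'a \<Rightarrow> 'a \<Rightarrow> ennreal" where
  "riem_dist M x y = (INF s\<in>{s. pw_C1_curve M s \<and> s 0 = x \<and> s 1 = y}. curve_length M s)"

definition riem_complete :: "('a::topological_space, 'n::finite) riem \<Rightarrow> bool" where
  "riem_complete M \<longleftrightarrow>
     (\<forall>x :: nat \<Rightarrow> 'a. (\<forall>e>0. \<exists>N. \<forall>i\<ge>N. \<forall>j\<ge>N. riem_dist M (x i) (x j) < e) \<longrightarrow>
        (\<exists>l. (\<lambda>i. riem_dist M (x i) l) \<longlonglongrightarrow> 0))"

text \<open>The Riemannian volume measure, determined by its densities in the charts.\<close>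

definition volume_measure :: "('a::topological_space, 'n::finite) riem \<Rightarrow> 'a measure \<Rightarrow> bool" where
  "volume_measure M m \<longleftrightarrow> sets m = sets borel \<and>
     (\<forall>c\<in>charts M. \<forall>A\<in>sets borel. A \<subseteq> fst c \<longrightarrow>
        emeasure m A =
          (\<integral>\<^sup>+p\<in>snd c ` A. ennreal (sqrt (det (\<chi> i j. gram M c p (axis i 1) (axis j 1)))) \<partial>lborel))"

text \<open>The Levi-Civita connection in the preferred chart at \<open>x\<close>: the covariant derivative at \<open>x\<close> in
  direction \<open>u\<close> of the vector field with constant coordinates \<open>v\<close> (Koszul formula).\<close>

definition christoffel :: "('a, 'n::finite) riem \<Rightarrow> 'a \<Rightarrow> real ^ 'n \<Rightarrow> real ^ 'n \<Rightarrow> real ^ 'n" where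
  "christoffel M x u v = (let c = chart_at M x; p = snd c x;
       D = (\<lambda>a b e. frechet_derivative (\<lambda>p. gram M c p a b) (at p) e)
     in THE w. \<forall>z. 2 * gram M c p w z = D v z u + D u z v - D u v z)"

definition smooth_fun :: "('a, 'n::finite) riem \<Rightarrow> ('a \<Rightarrow> real) \<Rightarrow> bool" where
  "smooth_fun M f \<longleftrightarrow> (\<forall>c\<in>charts M. smooth_on (chart_ran c) (f \<circ> chart_inv c))"

definition C0 :: "('a::topological_space \<Rightarrow> real) set" where
  "C0 = {f. continuous_on UNIV f \<and> compact (closure {x. f x \<noteq> 0})}"

definition test_fun :: "('a::topological_space, 'n::finite) riem \<Rightarrow> ('a \<Rightarrow> real) set" where
  "test_fun M = {f. smooth_fun M f \<and> compact (closure {x. f x \<noteq> 0})}"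

text \<open>\<open>V\<close> is a weak gradient of \<open>r\<close>: in every chart both are locally integrable, and
  \<open>g(V, v)\<close> is the distributional derivative of \<open>r\<close> in every coordinate direction \<open>v\<close>.\<close>

definition weak_gradient ::
  "('a::topological_space, 'n::finite) riem \<Rightarrow> ('a \<Rightarrow> real) \<Rightarrow> ('a \<Rightarrow> real ^ 'n) \<Rightarrow> bool" where
  "weak_gradient M r V \<longleftrightarrow> (\<forall>c\<in>charts M. \<forall>v.
     (let R = (\<lambda>p. r (chart_inv c p));
          H = (\<lambda>p. metric M (chart_inv c p) (V (chart_inv c p)) (to_tangent M c (chart_inv c p) v))
      in (\<forall>K. compact K \<and> K \<subseteq> chart_ran c \<longrightarrow>
            set_integrable lborel K R \<and> set_integrable lborel K H) \<and>
         (\<forall>f. smooth_on UNIV f \<and> compact (closure {p. f p \<noteq> 0}) \<and>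
              closure {p. f p \<noteq> 0} \<subseteq> chart_ran c \<longrightarrow>
            (LINT p:chart_ran c|lborel. R p * frechet_derivative f (at p) v) =
            - (LINT p:chart_ran c|lborel. H p * f p))))"

section \<open>Configuration space\<close>

definition Gamma :: "'a::topological_space set set" where
  "Gamma = {\<gamma>. \<forall>K. compact K \<longrightarrow> finite (\<gamma> \<inter> K)}"

definition pairing :: "('a \<Rightarrow> real) \<Rightarrow> 'a set \<Rightarrow> real" where
  "pairing f \<gamma> = (\<Sum>x\<in>{x\<in>\<gamma>. f x \<noteq> 0}. f x)"

definition vague :: "'a::topological_space set topology" where
  "vague = topology_generated_by {{\<gamma>\<in>Gamma. pairing f \<gamma> \<in> U} | f U. f \<in> C0 \<and> open U}"

definition GammaM :: "'a::topological_space set measure" where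
  "GammaM = sigma Gamma {U. openin vague U}"

text \<open>Standing assumptions on \<open>\<mu>\<close>, on \<open>\<sigma>(\<gamma>,dx)\<close>, on its density \<open>\<rho>(\<gamma>,x)\<close> with respect to
  the volume \<open>m\<close> and on the weak gradient \<open>d\<rho>(\<gamma>,x)\<close> of \<open>\<rho>(\<gamma>,\<cdot>)\<close>. The densities and gradients, which
  are only determined almost everywhere, are given by jointly measurable versions.\<close>

definition log_deriv ::
  "('a set \<Rightarrow> 'a \<Rightarrow> real) \<Rightarrow> ('a set \<Rightarrow> 'a \<Rightarrow> real ^ 'n) \<Rightarrow> 'a set \<Rightarrow> 'a \<Rightarrow> real ^ 'n" where
  "log_deriv \<rho> d\<rho> \<gamma> x = (1 / \<rho> (\<gamma> - {x}) x) *\<^sub>R d\<rho> (\<gamma> - {x}) x"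

definition admissible ::
  "('a::topological_space, 'n::finite) riem \<Rightarrow> 'a measure \<Rightarrow> 'a set measure \<Rightarrow> ('a set \<Rightarrow> 'a measure) \<Rightarrow>
   ('a set \<Rightarrow> 'a \<Rightarrow> real) \<Rightarrow> ('a set \<Rightarrow> 'a \<Rightarrow> real ^ 'n) \<Rightarrow> bool" where
  "admissible M m \<mu> \<sigma> \<rho> d\<rho> \<longleftrightarrow>
     prob_space \<mu> \<and> sets \<mu> = sets GammaM \<and>
     (\<forall>k. \<forall>\<phi>\<in>C0. (\<forall>x. 0 \<le> \<phi> x) \<longrightarrow> (\<integral>\<^sup>+\<gamma>. ennreal (pairing \<phi> \<gamma> ^ k) \<partial>\<mu>) < \<infinity>) \<and>
     \<comment> \<open>the kernel \<open>\<sigma>\<close> and the Campbell-Mecke (Georgii-Nguyen-Zessin) identity\<close>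
     (\<forall>\<gamma>\<in>Gamma. sets (\<sigma> \<gamma>) = sets borel) \<and>
     (\<forall>A\<in>sets borel. (\<lambda>\<gamma>. emeasure (\<sigma> \<gamma>) A) \<in> borel_measurable GammaM) \<and>
     (\<forall>F \<in> borel_measurable (GammaM \<Otimes>\<^sub>M borel). (\<forall>z. 0 \<le> (F z :: real)) \<longrightarrow>
        (\<integral>\<^sup>+\<gamma>. (\<integral>\<^sup>+x. ennreal (F (\<gamma>, x)) \<partial>count_space \<gamma>) \<partial>\<mu>) =
        (\<integral>\<^sup>+\<gamma>. (\<integral>\<^sup>+x. ennreal (F (insert x \<gamma>, x)) \<partial>\<sigma> \<gamma>) \<partial>\<mu>)) \<and>
     (AE \<gamma> in \<mu>. absolutely_continuous m (\<sigma> \<gamma>)) \<and>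
     \<comment> \<open>the density\<close>
     (\<lambda>(\<gamma>, x). \<rho> \<gamma> x) \<in> borel_measurable (GammaM \<Otimes>\<^sub>M borel) \<and>
     (AE \<gamma> in \<mu>. \<sigma> \<gamma> = density m (\<lambda>x. ennreal (\<rho> \<gamma> x))) \<and>
     (AE z in \<mu> \<Otimes>\<^sub>M m. \<rho> (fst z) (snd z) > 0) \<and>
     \<comment> \<open>its weak gradient\<close>
     (\<forall>c\<in>charts M. \<forall>v.
        (\<lambda>(\<gamma>, x). if x \<in> fst c then metric M x (d\<rho> \<gamma> x) (to_tangent M c x v) else 0)
          \<in> borel_measurable (GammaM \<Otimes>\<^sub>M borel)) \<and>
     (AE \<gamma> in \<mu>. weak_gradient M (\<rho> \<gamma>) (d\<rho> \<gamma>)) \<and>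
     (\<forall>\<Lambda>. open \<Lambda> \<and> compact (closure \<Lambda>) \<longrightarrow> (\<exists>\<epsilon>>0.
        (\<integral>\<^sup>+\<gamma>. ennreal ((\<Sum>x\<in>\<gamma> \<inter> \<Lambda>. tnorm M x (log_deriv \<rho> d\<rho> \<gamma> x)) powr (2 + \<epsilon>)) \<partial>\<mu>) < \<infinity>))"

text \<open>\<open>X\<^sup>k\<close> is \<open>PiE {..<k} (\<lambda>_. UNIV)\<close>. First the integral
  \<open>\<integral> f(x\<^sub>0,\<dots>) \<sigma>(\<gamma>,dx\<^sub>0) \<sigma>(\<gamma> + x\<^sub>0, dx\<^sub>1) \<dots>\<close> against \<open>\<sigma>\<^sup>(\<^sup>k\<^sup>)(\<gamma>,\<cdot>)\<close> (the last variable is integrated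
  first), then the measure \<open>\<mu>\<^sup>(\<^sup>k\<^sup>)\<close>.\<close>

primrec sigma_int ::
  "('a set \<Rightarrow> 'a measure) \<Rightarrow> nat \<Rightarrow> 'a set \<Rightarrow> ((nat \<Rightarrow> 'a) \<Rightarrow> ennreal) \<Rightarrow> ennreal" where
  "sigma_int \<sigma> 0 \<gamma> f = f (\<lambda>_. undefined)"
| "sigma_int \<sigma> (Suc k) \<gamma> f =
     sigma_int \<sigma> k \<gamma> (\<lambda>x. \<integral>\<^sup>+y. f (x(k := y)) \<partial>\<sigma> (\<gamma> \<union> x ` {..<k}))"

definition mu_k ::
  "'a::topological_space set measure \<Rightarrow> ('a set \<Rightarrow> 'a measure) \<Rightarrow> nat \<Rightarrow> ('a set \<times> (nat \<Rightarrow> 'a)) measure" where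
  "mu_k \<mu> \<sigma> k = measure_of
     (space (GammaM \<Otimes>\<^sub>M PiM {..<k} (\<lambda>_. borel)))
     (sets (GammaM \<Otimes>\<^sub>M PiM {..<k} (\<lambda>_. borel)))
     (\<lambda>A. \<integral>\<^sup>+\<gamma>. sigma_int \<sigma> k \<gamma> (\<lambda>x. indicator A (\<gamma>, x)) \<partial>\<mu>)"

section \<open>Tensors\<close>

text \<open>Let \<open>x : I \<rightarrow> X\<close> be a family of points and \<open>H\<close> the Hilbert direct sum of the tangent spaces
  at \<open>x i\<close>, \<open>i \<in> I\<close>. By means of the inner products, the \<open>n\<close>-th Hilbert tensor power of \<open>H\<close> is
  realised as the space of Hilbert-Schmidt \<open>n\<close>-linear functionals on \<open>H\<close>. Such a functional is
  given by its components: \<open>A is vs\<close> is the value at vectors \<open>vs ! j\<close> in the summand with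
  index \<open>is ! j\<close>. For a configuration \<open>\<gamma>\<close> the family is the identity on \<open>I = \<gamma>\<close>;
  for a point of \<open>X\<^sup>k\<close> it is the point itself and \<open>I = {..<k}\<close> (the coordinates may coincide).\<close>

type_synonym ('i, 'n) tensor = "'i list \<Rightarrow> (real ^ 'n) list \<Rightarrow> real"

definition tuples :: "'i set \<Rightarrow> nat \<Rightarrow> 'i list set" where
  "tuples I n = {is. length is = n \<and> set is \<subseteq> I}"

definition onb :: "('a, 'n::finite) riem \<Rightarrow> 'a \<Rightarrow> (real ^ 'n) set" where
  "onb M x = (SOME B. card B = CARD('n) \<and>
     (\<forall>u\<in>B. \<forall>v\<in>B. metric M x u v = (if u = v then 1 else 0)))"

definition comp_inner ::
  "('a, 'n::finite) riem \<Rightarrow> ('i \<Rightarrow> 'a) \<Rightarrow> ('i, 'n) tensor \<Rightarrow> ('i, 'n) tensor \<Rightarrow> 'i list \<Rightarrow> real" where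
  "comp_inner M x A B is = (\<Sum>vs\<in>listset (map (\<lambda>i. onb M (x i)) is). A is vs * B is vs)"

definition tinner ::
  "('a, 'n::finite) riem \<Rightarrow> ('i \<Rightarrow> 'a) \<Rightarrow> 'i set \<Rightarrow> nat \<Rightarrow> ('i, 'n) tensor \<Rightarrow> ('i, 'n) tensor \<Rightarrow> real" where
  "tinner M x I n A B = (\<Sum>\<^sub>\<infinity>is\<in>tuples I n. comp_inner M x A B is)"

definition wedge :: "('a, 'n::finite) riem \<Rightarrow> ('i \<Rightarrow> 'a) \<Rightarrow> 'i set \<Rightarrow> nat \<Rightarrow> ('i, 'n) tensor set" where
  "wedge M x I n = {A.
     (\<forall>is vs. is \<notin> tuples I n \<or> length vs \<noteq> n \<longrightarrow> A is vs = 0) \<and>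
     (\<forall>is vs j. is \<in> tuples I n \<and> length vs = n \<and> j < n \<longrightarrow> linear (\<lambda>v. A is (vs[j := v]))) \<and>
     (\<forall>is vs \<pi>. is \<in> tuples I n \<and> length vs = n \<and> \<pi> permutes {..<n} \<longrightarrow>
        A (permute_list \<pi> is) (permute_list \<pi> vs) = of_int (sign \<pi>) * A is vs) \<and>
     comp_inner M x A A summable_on tuples I n}"

text \<open>The index tuples in which every \<open>i < k\<close> occurs \<open>l\<^sub>i\<close> times with \<open>1 \<le> l\<^sub>i \<le> d\<close>; the elements of
  the exterior power which are supported by these tuples form the direct sum
  of the spaces \<open>(T\<^sub>0)\<^sup>\<and>\<^sup>l\<^sup>0 \<and> (T\<^sub>1)\<^sup>\<and>\<^sup>l\<^sup>1 \<and> \<dots>\<close>.\<close>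

definition T_tuples :: "'n itself \<Rightarrow> nat \<Rightarrow> nat \<Rightarrow> nat list set" where
  "T_tuples _ n k = {is \<in> tuples {..<k} n. \<forall>i<k. 1 \<le> count_list is i \<and> count_list is i \<le> CARD('n)}"

definition T_space :: "('a, 'n::finite) riem \<Rightarrow> nat \<Rightarrow> nat \<Rightarrow> (nat \<Rightarrow> 'a) \<Rightarrow> (nat, 'n) tensor set" where
  "T_space M n k x =
     {A \<in> wedge M x {..<k} n. \<forall>is vs. is \<notin> T_tuples TYPE('n) n k \<longrightarrow> A is vs = 0}"

section \<open>Covariant derivatives\<close>

text \<open>Let \<open>T y\<close>, for \<open>y\<close> near \<open>x\<close>, be a tensor in which the slots with index \<open>i\<close> belong to the tangent
  space at \<open>y\<close> while the other slots belong to fixed spaces. \<open>cov_rep\<close> expresses \<open>T\<close> in the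
  coordinates of \<open>chart_at x\<close>, and \<open>cov_deriv\<close> is the covariant derivative at \<open>x\<close> in direction \<open>u\<close>.\<close>

definition transport_slots ::
  "('a, 'n::finite) riem \<Rightarrow> ('i \<Rightarrow> ('a, 'n) chart option) \<Rightarrow> ('i \<Rightarrow> 'a) \<Rightarrow> 'i list \<Rightarrow>
   (real ^ 'n) list \<Rightarrow> (real ^ 'n) list" where
  "transport_slots M c y =
     map2 (\<lambda>i v. case c i of None \<Rightarrow> v | Some c' \<Rightarrow> to_tangent M c' (y i) v)"

definition cov_rep ::
  "('a, 'n::finite) riem \<Rightarrow> 'a \<Rightarrow> 'i \<Rightarrow> ('a \<Rightarrow> ('i, 'n) tensor) \<Rightarrow> 'i list \<Rightarrow> (real ^ 'n) list \<Rightarrow>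
   real ^ 'n \<Rightarrow> real" where
  "cov_rep M x i T is vs p = (let y = chart_inv (chart_at M x) p in
     T y is (transport_slots M [i \<mapsto> chart_at M x] (\<lambda>_. y) is vs))"

definition cov_deriv ::
  "('a, 'n::finite) riem \<Rightarrow> 'a \<Rightarrow> 'i \<Rightarrow> ('a \<Rightarrow> ('i, 'n) tensor) \<Rightarrow> real ^ 'n \<Rightarrow> ('i, 'n) tensor" where
  "cov_deriv M x i T u is vs =
     frechet_derivative (cov_rep M x i T is vs) (at (snd (chart_at M x) x)) u
     - (\<Sum>j<length is. if is ! j = i then T x is (vs[j := christoffel M x u (vs ! j)]) else 0)"

section \<open>Forms on the configuration space\<close>

type_synonym ('a, 'n) Gform = "'a set \<Rightarrow> ('a, 'n) tensor"

abbreviation Gwedge :: "('a, 'n::finite) riem \<Rightarrow> nat \<Rightarrow> 'a set \<Rightarrow> ('a, 'n) tensor set" where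
  "Gwedge M n \<gamma> \<equiv> wedge M (\<lambda>x. x) \<gamma> n"

abbreviation Ginner ::
  "('a, 'n::finite) riem \<Rightarrow> nat \<Rightarrow> 'a set \<Rightarrow> ('a, 'n) tensor \<Rightarrow> ('a, 'n) tensor \<Rightarrow> real" where
  "Ginner M n \<gamma> \<equiv> tinner M (\<lambda>x. x) \<gamma> n"

definition forms :: "('a::topological_space, 'n::finite) riem \<Rightarrow> nat \<Rightarrow> ('a, 'n) Gform set" where
  "forms M n = {W. (\<forall>\<gamma>\<in>Gamma. W \<gamma> \<in> Gwedge M n \<gamma>) \<and> (\<forall>\<gamma>. \<gamma> \<notin> Gamma \<longrightarrow> W \<gamma> = (\<lambda>_ _. 0))}"

definition lincomb :: "real \<Rightarrow> ('a, 'n) Gform \<Rightarrow> real \<Rightarrow> ('a, 'n) Gform \<Rightarrow> ('a, 'n) Gform" where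
  "lincomb a V b W = (\<lambda>\<gamma> xs vs. a * V \<gamma> xs vs + b * W \<gamma> xs vs)"

text \<open>The section \<open>y \<mapsto> W(\<gamma> - x + y)\<close>. The slots are labelled by the points of \<open>\<gamma>\<close>; those with label
  \<open>x\<close> belong to the tangent space at the moving point \<open>y\<close>.\<close>

definition move :: "('a, 'n::finite) Gform \<Rightarrow> 'a set \<Rightarrow> 'a \<Rightarrow> 'a \<Rightarrow> ('a, 'n) tensor" where
  "move W \<gamma> x y xs vs = W (insert y (\<gamma> - {x})) (map (\<lambda>z. if z = x then y else z) xs) vs"

text \<open>The gradient of a field of \<open>n\<close>-tensors is a field of \<open>(n+1)\<close>-tensors; the first slot is the
  direction of differentiation.\<close>

definition grad_Gamma :: "('a, 'n::finite) riem \<Rightarrow> ('a, 'n) Gform \<Rightarrow> ('a, 'n) Gform" where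
  "grad_Gamma M W \<gamma> xs vs =
     (if xs = [] \<or> vs = [] \<or> hd xs \<notin> \<gamma> then 0
      else cov_deriv M (hd xs) (hd xs) (move W \<gamma> (hd xs)) (hd vs) (tl xs) (tl vs))"

definition differentiable_Gamma :: "('a::topological_space, 'n::finite) riem \<Rightarrow> ('a, 'n) Gform \<Rightarrow> bool" where
  "differentiable_Gamma M W \<longleftrightarrow> (\<forall>\<gamma>\<in>Gamma. \<forall>x\<in>\<gamma>. \<forall>xs vs. set xs \<subseteq> \<gamma> \<and> length vs = length xs \<longrightarrow>
     cov_rep M x x (move W \<gamma> x) xs vs differentiable (at (snd (chart_at M x) x)))"

definition local_form :: "('a::topological_space, 'n) Gform \<Rightarrow> bool" where
  "local_form W \<longleftrightarrow> (\<exists>\<Lambda>. open \<Lambda> \<and> compact (closure \<Lambda>) \<and> (\<forall>\<gamma>\<in>Gamma. W \<gamma> = W (\<gamma> \<inter> \<Lambda>)))"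

definition FOmega :: "('a::topological_space, 'n::finite) riem \<Rightarrow> nat \<Rightarrow> ('a, 'n) Gform set" where
  "FOmega M n = {W \<in> forms M n. local_form W \<and>
     (\<forall>r. differentiable_Gamma M ((grad_Gamma M ^^ r) W)) \<and>
     (\<exists>\<phi>\<in>C0. (\<forall>x. 0 \<le> \<phi> x) \<and> (\<exists>l. \<forall>\<gamma>\<in>Gamma. Ginner M n \<gamma> (W \<gamma>) (W \<gamma>) \<le> pairing \<phi> \<gamma> ^ l))}"

text \<open>Elements of \<open>L\<^sup>2\<close> spaces are handled through representatives, two of them being identified when
  their distance is zero. \<open>L2_forms\<close> is the closure of \<open>FOmega\<close>, i.e. its completion.\<close>

definition L2_dist2 ::
  "('a, 'n::finite) riem \<Rightarrow> 'a set measure \<Rightarrow> nat \<Rightarrow> ('a, 'n) Gform \<Rightarrow> ('a, 'n) Gform \<Rightarrow> ennreal" where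
  "L2_dist2 M \<mu> n V W =
     (\<integral>\<^sup>+\<gamma>. ennreal (Ginner M n \<gamma> (lincomb 1 V (-1) W \<gamma>) (lincomb 1 V (-1) W \<gamma>)) \<partial>\<mu>)"

definition L2_forms :: "('a::topological_space, 'n::finite) riem \<Rightarrow> 'a set measure \<Rightarrow> nat \<Rightarrow> ('a, 'n) Gform set" where
  "L2_forms M \<mu> n = {W \<in> forms M n. \<exists>V. (\<forall>j. V j \<in> FOmega M n) \<and>
     (\<forall>j. (\<lambda>\<gamma>. Ginner M n \<gamma> (lincomb 1 W (-1) (V j) \<gamma>) (lincomb 1 W (-1) (V j) \<gamma>))
            \<in> borel_measurable (completion \<mu>)) \<and>
     (\<lambda>j. L2_dist2 M \<mu> n W (V j)) \<longlonglongrightarrow> 0}"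

section \<open>The space of test forms\<close>

definition cylinder_fun :: "('a::topological_space, 'n::finite) riem \<Rightarrow> ('a set \<Rightarrow> real) set" where
  "cylinder_fun M = {F. \<exists>N g \<phi>. (\<forall>i<N. \<phi> i \<in> test_fun M) \<and>
     smooth_on_prod N (PiE {..<N} (\<lambda>_. UNIV)) g \<and>
     (\<forall>ivs. fst ` set ivs \<subseteq> {..<N} \<longrightarrow> bounded (dpart ivs g ` PiE {..<N} (\<lambda>_. UNIV))) \<and>
     F = (\<lambda>\<gamma>. g (\<lambda>i\<in>{..<N}. pairing (\<phi> i) \<gamma>))}"

definition smooth_form_Xk ::
  "('a, 'n::finite) riem \<Rightarrow> nat \<Rightarrow> nat \<Rightarrow> ((nat \<Rightarrow> 'a) \<Rightarrow> (nat, 'n) tensor) \<Rightarrow> bool" where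
  "smooth_form_Xk M n k \<omega> \<longleftrightarrow>
     (\<forall>x\<in>PiE {..<k} (\<lambda>_. UNIV). \<omega> x \<in> wedge M x {..<k} n) \<and>
     (\<forall>c. (\<forall>i<k. c i \<in> charts M) \<longrightarrow> (\<forall>is\<in>tuples {..<k} n. \<forall>vs. length vs = n \<longrightarrow>
        smooth_on_prod k (PiE {..<k} (\<lambda>i. chart_ran (c i)))
          (\<lambda>q. let x = (\<lambda>i\<in>{..<k}. chart_inv (c i) (q i))
               in \<omega> x is (transport_slots M (Some \<circ> c) x is vs))))"

text \<open>A permutation of the coordinates relabels the slots: slot \<open>i\<close> of \<open>x \<circ> \<pi>\<close> is slot \<open>\<pi> i\<close> of \<open>x\<close>.\<close>

definition Psi_sym ::
  "('a::topological_space, 'n::finite) riem \<Rightarrow> nat \<Rightarrow> nat \<Rightarrow> ((nat \<Rightarrow> 'a) \<Rightarrow> (nat, 'n) tensor) set" where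
  "Psi_sym M n k = {\<omega>. smooth_form_Xk M n k \<omega> \<and>
     (\<exists>C. compactin (product_topology (\<lambda>_. euclidean) {..<k}) C \<and>
        (\<forall>x\<in>PiE {..<k} (\<lambda>_. UNIV) - C. \<omega> x = (\<lambda>_ _. 0))) \<and>
     (\<forall>x\<in>PiE {..<k} (\<lambda>_. UNIV). inj_on x {..<k} \<longrightarrow>
        \<omega> x \<in> T_space M n k x \<and>
        (\<forall>\<pi>. \<pi> permutes {..<k} \<longrightarrow> (\<forall>is\<in>tuples {..<k} n. \<forall>vs. \<omega> (x \<circ> \<pi>) is vs = \<omega> x (map \<pi> is) vs)))}"

text \<open>\<open>W\<^sub>k(\<gamma>, x\<^sub>0, \<dots>, x\<^sub>k\<^sub>-\<^sub>1)\<close> for distinct points of \<open>\<gamma>\<close>, the projection of \<open>W(\<gamma>)\<close> onto \<open>T_space\<close>, as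
  a tensor over the family \<open>x\<close>.\<close>

definition component ::
  "nat \<Rightarrow> nat \<Rightarrow> ('a, 'n::finite) Gform \<Rightarrow> 'a set \<Rightarrow> (nat \<Rightarrow> 'a) \<Rightarrow> (nat, 'n) tensor" where
  "component n k W \<gamma> x is vs = (if is \<in> T_tuples TYPE('n) n k then W \<gamma> (map x is) vs else 0)"

definition DOmega_gen :: "('a::topological_space, 'n::finite) riem \<Rightarrow> nat \<Rightarrow> ('a, 'n) Gform set" where
  "DOmega_gen M n = {W \<in> forms M n. \<exists>k\<in>{1..n}. \<exists>F\<in>cylinder_fun M. \<exists>\<omega>\<in>Psi_sym M n k.
     \<forall>\<gamma>\<in>Gamma. \<forall>l\<in>{1..n}. \<forall>x\<in>PiE {..<l} (\<lambda>_. \<gamma>). inj_on x {..<l} \<longrightarrow>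
       component n l W \<gamma> x =
         (if l = k then (\<lambda>is vs. sqrt (fact k) * F (\<gamma> - x ` {..<k}) * \<omega> x is vs) else (\<lambda>_ _. 0))}"

definition DOmega :: "('a::topological_space, 'n::finite) riem \<Rightarrow> nat \<Rightarrow> ('a, 'n) Gform set" where
  "DOmega M n = {W. \<exists>(J::nat) a G. (\<forall>j<J. G j \<in> DOmega_gen M n) \<and>
     W = (\<lambda>\<gamma> xs vs. \<Sum>j<J. a j * G j \<gamma> xs vs)}"

section \<open>The Dirichlet forms\<close>

definition energy ::
  "('a, 'n::finite) riem \<Rightarrow> 'a set measure \<Rightarrow> nat \<Rightarrow> ('a, 'n) Gform \<Rightarrow> ('a, 'n) Gform \<Rightarrow> real" where
  "energy M \<mu> n V W = (\<integral>\<gamma>. Ginner M (Suc n) \<gamma> (grad_Gamma M V \<gamma>) (grad_Gamma M W \<gamma>) \<partial>\<mu>)"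

text \<open>\<open>(E, DE)\<close> is the closure of \<open>(E0, D0)\<close> in \<open>L2_forms\<close>: a closed nonnegative symmetric bilinear form
  which extends \<open>(E0, D0)\<close> and has \<open>D0\<close> as a core. (Closedness, applied to constant sequences,
  makes \<open>E\<close> respect the identification of representatives.)\<close>

definition form_closure ::
  "('a::topological_space, 'n::finite) riem \<Rightarrow> 'a set measure \<Rightarrow> nat \<Rightarrow>
   ('a, 'n) Gform set \<Rightarrow> (('a, 'n) Gform \<Rightarrow> ('a, 'n) Gform \<Rightarrow> real) \<Rightarrow>
   ('a, 'n) Gform set \<Rightarrow> (('a, 'n) Gform \<Rightarrow> ('a, 'n) Gform \<Rightarrow> real) \<Rightarrow> bool" where
  "form_closure M \<mu> n D0 E0 DE E \<longleftrightarrow>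
     DE \<subseteq> L2_forms M \<mu> n \<and>
     (\<forall>U\<in>DE. \<forall>V\<in>DE. \<forall>a b. lincomb a U b V \<in> DE) \<and>
     (\<forall>U\<in>DE. \<forall>V\<in>DE. \<forall>W\<in>DE. \<forall>a b. E (lincomb a U b V) W = a * E U W + b * E V W) \<and>
     (\<forall>U\<in>DE. \<forall>V\<in>DE. E U V = E V U) \<and>
     (\<forall>U\<in>DE. 0 \<le> E U U) \<and>
     \<comment> \<open>closed\<close>
     (\<forall>V. \<forall>W\<in>L2_forms M \<mu> n. (\<forall>j. V j \<in> DE) \<and> (\<lambda>j. L2_dist2 M \<mu> n W (V j)) \<longlonglongrightarrow> 0 \<and>
        (\<forall>e>0. \<exists>N. \<forall>i\<ge>N. \<forall>j\<ge>N. E (lincomb 1 (V i) (-1) (V j)) (lincomb 1 (V i) (-1) (V j)) < e) \<longrightarrow>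
        W \<in> DE \<and> (\<lambda>j. E (lincomb 1 W (-1) (V j)) (lincomb 1 W (-1) (V j))) \<longlonglongrightarrow> 0) \<and>
     \<comment> \<open>extension\<close>
     D0 \<subseteq> DE \<and> (\<forall>U\<in>D0. \<forall>V\<in>D0. E U V = E0 U V) \<and>
     \<comment> \<open>core\<close>
     (\<forall>W\<in>DE. \<exists>V. (\<forall>j. V j \<in> D0) \<and> (\<lambda>j. L2_dist2 M \<mu> n W (V j)) \<longlonglongrightarrow> 0 \<and>
        (\<lambda>j. E (lincomb 1 W (-1) (V j)) (lincomb 1 W (-1) (V j))) \<longlonglongrightarrow> 0)"

text \<open>The unitary \<open>I\<^sup>n\<close> on representatives (injective on \<open>forms M n\<close>). The values where the \<open>x i\<close>
  are not distinct or meet \<open>\<gamma>\<close> are irrelevant, since these \<open>(\<gamma>, x)\<close> form a \<open>\<mu>\<^sup>(\<^sup>k\<^sup>)\<close>-null set.\<close>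

definition In_map ::
  "nat \<Rightarrow> ('a, 'n::finite) Gform \<Rightarrow> nat \<Rightarrow> 'a set \<Rightarrow> (nat \<Rightarrow> 'a) \<Rightarrow> (nat, 'n) tensor" where
  "In_map n W k \<gamma> x is vs = component n k W (\<gamma> \<union> x ` {..<k}) x is vs / sqrt (fact k)"

definition image_form ::
  "('a::topological_space, 'n::finite) riem \<Rightarrow> 'a set measure \<Rightarrow> nat \<Rightarrow>
   (('a, 'n) Gform \<Rightarrow> ('a, 'n) Gform \<Rightarrow> real) \<Rightarrow>
   (nat \<Rightarrow> 'a set \<Rightarrow> (nat \<Rightarrow> 'a) \<Rightarrow> (nat, 'n) tensor) \<Rightarrow>
   (nat \<Rightarrow> 'a set \<Rightarrow> (nat \<Rightarrow> 'a) \<Rightarrow> (nat, 'n) tensor) \<Rightarrow> real" where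
  "image_form M \<mu> n E V W =
     E (inv_into (L2_forms M \<mu> n) (In_map n) V) (inv_into (L2_forms M \<mu> n) (In_map n) W)"

section \<open>Gradients on \<open>\<Gamma> \<times> X\<^sup>k\<close>\<close>

text \<open>In both cases \<open>u\<close> is the direction, in the tangent space at \<open>z \<in> \<gamma>\<close> respectively at \<open>x i\<close>.
  For fixed \<open>x\<close> the values of \<open>\<gamma> \<mapsto> W(\<gamma>, x)\<close> lie in a fixed space, so that the gradient on
  \<open>\<Gamma>\<close> is that of a function: no slot is moved.\<close>

definition grad_conf ::
  "('a, 'n::finite) riem \<Rightarrow> ('a set \<Rightarrow> (nat \<Rightarrow> 'a) \<Rightarrow> (nat, 'n) tensor) \<Rightarrow>
   'a set \<Rightarrow> (nat \<Rightarrow> 'a) \<Rightarrow> 'a \<Rightarrow> real ^ 'n \<Rightarrow> (nat, 'n) tensor" where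
  "grad_conf M W \<gamma> x z u is vs =
     frechet_derivative (\<lambda>p. W (insert (chart_inv (chart_at M z) p) (\<gamma> - {z})) x is vs)
       (at (snd (chart_at M z) z)) u"

definition grad_Xk ::
  "('a, 'n::finite) riem \<Rightarrow> ((nat \<Rightarrow> 'a) \<Rightarrow> (nat, 'n) tensor) \<Rightarrow>
   (nat \<Rightarrow> 'a) \<Rightarrow> nat \<Rightarrow> real ^ 'n \<Rightarrow> (nat, 'n) tensor" where
  "grad_Xk M w x i u = cov_deriv M (x i) i (\<lambda>y. w (x(i := y))) u"

text \<open>The inner products of the gradients in the tensor products of the tangent space of \<open>\<Gamma>\<close> at \<open>\<gamma>\<close>,
  respectively of \<open>X\<^sup>k\<close> at \<open>x\<close>, with the space of \<open>n\<close>-tensors over \<open>x\<close>.\<close>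

definition inner_grad_conf ::
  "('a, 'n::finite) riem \<Rightarrow> nat \<Rightarrow> nat \<Rightarrow> ('a set \<Rightarrow> (nat \<Rightarrow> 'a) \<Rightarrow> (nat, 'n) tensor) \<Rightarrow>
   ('a set \<Rightarrow> (nat \<Rightarrow> 'a) \<Rightarrow> (nat, 'n) tensor) \<Rightarrow> 'a set \<Rightarrow> (nat \<Rightarrow> 'a) \<Rightarrow> real" where
  "inner_grad_conf M n k V W \<gamma> x =
     (\<Sum>\<^sub>\<infinity>z\<in>\<gamma>. \<Sum>u\<in>onb M z. tinner M x {..<k} n (grad_conf M V \<gamma> x z u) (grad_conf M W \<gamma> x z u))"

definition inner_grad_Xk ::
  "('a, 'n::finite) riem \<Rightarrow> nat \<Rightarrow> nat \<Rightarrow> ('a set \<Rightarrow> (nat \<Rightarrow> 'a) \<Rightarrow> (nat, 'n) tensor) \<Rightarrow>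
   ('a set \<Rightarrow> (nat \<Rightarrow> 'a) \<Rightarrow> (nat, 'n) tensor) \<Rightarrow> 'a set \<Rightarrow> (nat \<Rightarrow> 'a) \<Rightarrow> real" where
  "inner_grad_Xk M n k V W \<gamma> x =
     (\<Sum>i<k. \<Sum>u\<in>onb M (x i). tinner M x {..<k} n (grad_Xk M (V \<gamma>) x i u) (grad_Xk M (W \<gamma>) x i u))"

end

theory Submission
  imports Defs
begin

text \<open>
  Both sides are integrals of the same density. For \<open>\<gamma>\<close> fixed, expand \<open>\<langle>\<nabla>V\<^sub>1, \<nabla>V\<^sub>2\<rangle>\<close> in components:
  the slots of a component are points of \<open>\<gamma>\<close>, and if \<open>{x\<^sub>1,\<dots>,x\<^sub>k}\<close> is the set of points that occur among
  the slots of the form, the direction of differentiation \<open>z\<close> either lies in \<open>\<gamma> - {x\<^sub>1,\<dots>,x\<^sub>k}\<close>, where only the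
  cylinder function is differentiated, or is one of the \<open>x\<^sub>i\<close>, where only the form on \<open>X\<^sup>k\<close> is
  differentiated. Hence \<open>\<langle>\<nabla>V\<^sub>1, \<nabla>V\<^sub>2\<rangle>(\<gamma>)\<close> is the sum over \<open>k\<close> and over injective \<open>x\<close> with values in \<open>\<gamma>\<close> of
  \<open>G\<^sub>k(\<gamma> - {x\<^sub>1,\<dots>,x\<^sub>k}, x)\<close>, with \<open>G\<^sub>k\<close> the integrand on the right-hand side. The \<open>k\<close>-fold iterated
  Georgii-Nguyen-Zessin identity turns the \<open>\<mu>\<close>-integral of such a sum into the integral of \<open>G\<^sub>k\<close> against
  \<open>\<mu>\<^sup>(\<^sup>k\<^sup>)\<close>. The terms are integrable because all moments of \<open>\<mu>\<close> are finite.
\<close>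

section \<open>Measurability on configuration space\<close>

text \<open>What the computation hides is regularity. The sigma-algebra on configurations comes from
  the vague topology, and \<open>mu_k\<close> is the \<open>measure_of\<close> of an iterated
  integral whose kernel may fail to be locally finite on a null set of configurations. Neither the
  measurability of adding and removing points nor the countable additivity of that set function is
  evident. The former is reduced to the counting functions \<open>cnt A\<close> by a countable base
  of the vague topology; the latter is read off from a sum over injective tuples. The density on the
  right must be measurable in the points, yet its inner products use orthonormal bases and preferred
  charts selected pointwise, without continuity. Contractions are therefore rewritten in fixed
  charts with the inverse Gram matrix; this requires the covariant derivative to be chart
  independent, hence the transformation law of the Christoffel symbols. Normalisation: two factors
  \<open>sqrt (fact k)\<close> give k!, which is the number of enumerations of k distinct points.
  The explicit density agrees with the given integrand off a null set, whence the completed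
  measures.\<close>

lemma compact_closure_subset:
  fixes K :: "'a::t2_space set"
  assumes "compact K" "S \<subseteq> K"
  shows "compact (closure S)"
proof -
  have "closure S \<subseteq> K" using assms by (simp add: closure_minimal compact_imp_closed)
  then show ?thesis using assms(1) by (metis closed_closure compact_Int_closed inf.absorb_iff2)
qed

lemma C0I:
  fixes f :: "'a::t2_space \<Rightarrow> real"
  assumes "continuous_on UNIV f" "compact K" "{x. f x \<noteq> 0} \<subseteq> K"
  shows "f \<in> C0"
  using assms compact_closure_subset[OF assms(2,3)] by (simp add: C0_def)

lemma C0_cont: "f \<in> C0 \<Longrightarrow> continuous_on UNIV f"
  and C0_compact: "f \<in> C0 \<Longrightarrow> compact (closure {x. f x \<noteq> 0})"
  by (auto simp: C0_def)

lemma C0_measurable[measurable_dest]: "f \<in> C0 \<Longrightarrow> f \<in> borel_measurable borel"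
  by (simp add: C0_cont borel_measurable_continuous_onI)

lemma C0_sum:
  fixes f :: "'i \<Rightarrow> 'a::t2_space \<Rightarrow> real"
  assumes "finite I" "\<And>i. i \<in> I \<Longrightarrow> f i \<in> C0"
  shows "(\<lambda>x. \<Sum>i\<in>I. f i x) \<in> C0"
proof (rule C0I)
  show "continuous_on UNIV (\<lambda>x. \<Sum>i\<in>I. f i x)"
    using assms by (intro continuous_on_sum) (auto simp: C0_def)
  show "compact (\<Union>i\<in>I. closure {x. f i x \<noteq> 0})"
    using assms by (intro compact_UN) (auto simp: C0_def)
  show "{x. (\<Sum>i\<in>I. f i x) \<noteq> 0} \<subseteq> (\<Union>i\<in>I. closure {x. f i x \<noteq> 0})"
  proof safe
    fix x assume "(\<Sum>i\<in>I. f i x) \<noteq> 0"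
    then have "\<exists>i\<in>I. f i x \<noteq> 0" using sum.neutral[of I "\<lambda>i. f i x"] by blast
    then obtain i where "i \<in> I" "f i x \<noteq> 0" by blast
    then have "x \<in> closure {x. f i x \<noteq> 0}" using closure_subset[of "{x. f i x \<noteq> 0}"] by blast
    then show "x \<in> (\<Union>i\<in>I. closure {x. f i x \<noteq> 0})" using \<open>i \<in> I\<close> by blast
  qed
qed

lemma C0_comp:
  fixes f :: "'a::t2_space \<Rightarrow> real"
  assumes "f \<in> C0" "continuous_on UNIV h" "h 0 = (0::real)"
  shows "(\<lambda>x. h (f x)) \<in> C0"
proof (rule C0I)
  show "continuous_on UNIV (\<lambda>x. h (f x))"
    using continuous_on_compose2[OF assms(2) C0_cont[OF assms(1)]] by auto
  show "{x. h (f x) \<noteq> 0} \<subseteq> closure {x. f x \<noteq> 0}"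
    using assms(3) closure_subset by fastforce
qed (rule C0_compact[OF assms(1)])

lemma Gamma_finite: "\<gamma> \<in> Gamma \<Longrightarrow> compact K \<Longrightarrow> finite (\<gamma> \<inter> K)"
  by (simp add: Gamma_def)

lemma Gamma_finite_supp: "\<gamma> \<in> Gamma \<Longrightarrow> f \<in> C0 \<Longrightarrow> finite {x\<in>\<gamma>. f x \<noteq> 0}"
  by (rule finite_subset[OF _ Gamma_finite[OF _ C0_compact[of f]]]) (auto simp: closure_subset[THEN subsetD])

lemma Gamma_subset: "\<gamma> \<in> Gamma \<Longrightarrow> \<gamma>' \<subseteq> \<gamma> \<Longrightarrow> \<gamma>' \<in> Gamma"
  unfolding Gamma_def by (auto intro: finite_subset[OF Int_mono[OF _ order_refl]])

lemma Gamma_insert: "\<gamma> \<in> Gamma \<Longrightarrow> insert x \<gamma> \<in> Gamma"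
  by (auto simp: Gamma_def Int_insert_left)

lemma Gamma_union_finite: "\<gamma> \<in> Gamma \<Longrightarrow> finite S \<Longrightarrow> \<gamma> \<union> S \<in> Gamma"
  by (auto simp: Gamma_def Int_Un_distrib2)

lemma pairing_eq_sum:
  assumes "finite S" "S \<subseteq> \<gamma>" "\<And>x. x \<in> \<gamma> \<Longrightarrow> f x \<noteq> 0 \<Longrightarrow> x \<in> S"
  shows "pairing f \<gamma> = sum f S"
  unfolding pairing_def by (rule sum.mono_neutral_left) (use assms in auto)

lemma space_GammaM[simp]: "space GammaM = (Gamma :: 'a::topological_space set set)"
  and sets_GammaM: "sets GammaM = sigma_sets (Gamma :: 'a set set) {U. openin vague U}"
proof -
  have "topspace vague = (Gamma :: 'a set set)"
  proof -
    \<comment> \<open>With U = \<open>UNIV\<close>, the zero function makes \<open>Gamma\<close>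
      itself one of the generating sets.\<close>
    have "(\<lambda>_. 0) \<in> (C0 :: ('a \<Rightarrow> real) set)" by (auto simp: C0_def)
    then have "Gamma \<in> {{\<gamma> \<in> Gamma. pairing f \<gamma> \<in> U} |f U. f \<in> (C0 :: ('a \<Rightarrow> real) set) \<and> open U}"
      by (intro CollectI exI[of _ "\<lambda>_. 0"] exI[of _ UNIV]) auto
    then have "\<Union>{{\<gamma> \<in> Gamma. pairing f \<gamma> \<in> U} |f U. f \<in> (C0 :: ('a \<Rightarrow> real) set) \<and> open U} = Gamma"
      by (intro equalityI Union_least Union_upper) auto
    then show ?thesis unfolding vague_def by (simp add: topology_generated_by_topspace)
  qed
  then have "{U. openin vague U} \<subseteq> Pow (Gamma :: 'a set set)"
    using openin_subset by fastforce
  then show "space GammaM = (Gamma :: 'a set set)" "sets GammaM = sigma_sets (Gamma :: 'a set set) {U. openin vague U}"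
    by (auto simp: GammaM_def space_measure_of sets_measure_of)
qed

lemma vague_openin_sets: "openin vague U \<Longrightarrow> U \<in> sets GammaM"
  by (auto simp: sets_GammaM)

lemma pairing_measurable[measurable]:
  assumes "f \<in> C0" shows "pairing f \<in> borel_measurable GammaM"
proof (rule borel_measurableI)
  fix S :: "real set" assume "open S"
  then have "openin vague {\<gamma>\<in>Gamma. pairing f \<gamma> \<in> S}"
    unfolding vague_def using assms by (intro topology_generated_by_Basis) auto
  moreover have "pairing f -` S \<inter> space GammaM = {\<gamma>\<in>Gamma. pairing f \<gamma> \<in> S}" by auto
  ultimately show "pairing f -` S \<inter> space GammaM \<in> sets GammaM"
    by (simp add: vague_openin_sets)
qed

lemma nn_integral_count_pairing:
  assumes "\<gamma> \<in> Gamma" "f \<in> C0" "\<And>x. 0 \<le> f x"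
  shows "(\<integral>\<^sup>+x. ennreal (f x) \<partial>count_space \<gamma>) = ennreal (pairing f \<gamma>)"
proof -
  have *: "{x \<in> \<gamma>. ennreal (f x) \<noteq> 0} = {x\<in>\<gamma>. f x \<noteq> 0}"
    using assms(3) by (auto simp: ennreal_eq_0_iff order.antisym)
  have "(\<integral>\<^sup>+x. ennreal (f x) \<partial>count_space \<gamma>) = (\<Sum>x|x\<in>\<gamma> \<and> 0 < ennreal (f x). ennreal (f x))"
    using Gamma_finite_supp[OF assms(1,2)] * by (intro nn_integral_count_space) (auto simp: zero_less_iff_neq_zero)
  also have "\<dots> = ennreal (pairing f \<gamma>)"
    unfolding pairing_def using * assms(3)
    by (subst sum_ennreal) (auto simp: zero_less_iff_neq_zero)
  finally show ?thesis .
qed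

text \<open>The number of points of \<gamma> in A, possibly infinite. As an integral against
  counting measure it obeys monotone convergence, so A need not be relatively compact.\<close>

definition cnt :: "'a set \<Rightarrow> 'a set \<Rightarrow> ennreal" where
  "cnt A \<gamma> = (\<integral>\<^sup>+x. indicator A x \<partial>count_space \<gamma>)"

lemma cnt_eq: "cnt A \<gamma> = emeasure (count_space \<gamma>) (A \<inter> \<gamma>)"
proof -
  have "cnt A \<gamma> = (\<integral>\<^sup>+x. indicator (A \<inter> \<gamma>) x \<partial>count_space \<gamma>)"
    unfolding cnt_def by (rule nn_integral_cong) (auto simp: indicator_def)
  then show ?thesis by simp
qed

lemma cnt_card: "finite (A \<inter> \<gamma>) \<Longrightarrow> cnt A \<gamma> = of_nat (card (A \<inter> \<gamma>))"
  by (simp add: cnt_eq emeasure_count_space_finite)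

lemma cnt_0_iff: "cnt A \<gamma> = 0 \<longleftrightarrow> A \<inter> \<gamma> = {}"
  by (simp add: cnt_eq emeasure_count_space_eq_0)

lemma cnt_1_iff: "cnt A \<gamma> = 1 \<longleftrightarrow> (\<exists>x. A \<inter> \<gamma> = {x})"
proof (cases "finite (A \<inter> \<gamma>)")
  case True
  then have "cnt A \<gamma> = 1 \<longleftrightarrow> card (A \<inter> \<gamma>) = 1"
    by (simp add: cnt_card)
  then show ?thesis by (simp add: card_1_singleton_iff)
next
  case False
  then have "\<not> (\<exists>x. A \<inter> \<gamma> = {x})" by (metis finite.emptyI finite_insert)
  then show ?thesis using False by (simp add: cnt_eq emeasure_count_space_infinite)
qed

lemma cnt_union: "A \<inter> B = {} \<Longrightarrow> cnt (A \<union> B) \<gamma> = cnt A \<gamma> + cnt B \<gamma>"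
  unfolding cnt_def by (subst nn_integral_add[symmetric])
    (auto intro!: nn_integral_cong split: split_indicator)

lemma cnt_mono2: "\<gamma> \<subseteq> \<gamma>' \<Longrightarrow> cnt A \<gamma> \<le> cnt A \<gamma>'"
proof -
  assume "\<gamma> \<subseteq> \<gamma>'"
  then have sub: "A \<inter> \<gamma> \<subseteq> A \<inter> \<gamma>'" by auto
  show ?thesis
  proof (cases "finite (A \<inter> \<gamma>')")
    case True
    then have "finite (A \<inter> \<gamma>)" using sub finite_subset by blast
    then show ?thesis using True sub by (simp add: cnt_card card_mono)
  next
    case False
    then show ?thesis by (simp add: cnt_eq[of A "\<gamma>'"] emeasure_count_space_infinite)
  qed
qed

text \<open>Isolates the topological input of the measure theory on configurations: there are enough
  nonnegative functions in \<open>C0\<close>. It entails local compactness and holds on manifolds by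
  \<open>chart_bump\<close>. The parameter \<open>space_type\<close> only names the type.\<close>

locale bump_space =
  fixes space_type :: "'a::{t2_space, second_countable_topology} itself"
  assumes bump: "\<And>(x::'a) U. open U \<Longrightarrow> x \<in> U \<Longrightarrow>
    \<exists>f\<in>C0. (\<forall>y. 0 \<le> f y) \<and> f x > 0 \<and> {y. f y \<noteq> 0} \<subseteq> U"
begin

lemma nhd_compact:
  fixes x :: 'a assumes "open U" "x \<in> U"
  obtains V where "open V" "x \<in> V" "V \<subseteq> U" "compact (closure V)"
proof -
  obtain f where f: "f \<in> C0" "\<forall>y. 0 \<le> f y" "f x > 0" "{y. f y \<noteq> 0} \<subseteq> U"
    using bump[OF assms] by blast
  have "open (f -` {0<..})" using C0_cont[OF f(1)]
    by (simp add: continuous_on_eq_continuous_at open_vimage continuous_on_open_vimage)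
  moreover have "{y. f y \<noteq> 0} = f -` {0<..}" using f(2) by (auto simp: less_le)
  ultimately show ?thesis using that[of "{y. f y \<noteq> 0}"] f C0_compact[OF f(1)] by auto
qed

lemma C0_ge_1:
  fixes K :: "'a set" assumes "compact K"
  obtains f where "f \<in> C0" "\<And>x. 0 \<le> f x" "\<And>x. x \<in> K \<Longrightarrow> 1 \<le> f x"
proof -
  obtain b where b: "\<And>x::'a. b x \<in> C0 \<and> (\<forall>y. 0 \<le> b x y) \<and> b x x > 0"
    using bump[OF open_UNIV UNIV_I] by metis
  \<comment> \<open>The factor is chosen so that \<open>d x x\<close> = 2; hence \<open>d x\<close>
    exceeds 1 on a neighbourhood of x, and finitely many of these neighbourhoods cover K.\<close>
  define d where "d x y = (2 / b x x) * b x y" for x y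
  have "(\<lambda>y. (2 / b x x) * b x y) \<in> C0" for x
    by (rule C0_comp[where h="\<lambda>t. (2 / b x x) * t"]) (use b[of x] in \<open>auto intro!: continuous_intros\<close>)
  then have d: "d x \<in> C0" "0 \<le> d x y" "d x x > 1" for x y
    using b[of x] unfolding d_def[abs_def] by auto
  have o: "open (d x -` {1<..})" for x
    using C0_cont[OF d(1)[of x]] by (simp add: continuous_on_open_vimage)
  obtain T where T: "T \<subseteq> K" "finite T" "K \<subseteq> (\<Union>x\<in>T. d x -` {1<..})"
    using compactE_image[OF assms, of K "\<lambda>x. d x -` {1<..}"] o d(3) by (metis (no_types, lifting) UN_iff greaterThan_iff subsetI vimageI)
  show ?thesis
  proof (rule that[of "\<lambda>y. \<Sum>x\<in>T. d x y"])
    show "(\<lambda>y. \<Sum>x\<in>T. d x y) \<in> C0" using T d by (intro C0_sum) auto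
    show "0 \<le> (\<Sum>x\<in>T. d x y)" for y using d by (intro sum_nonneg) auto
    fix y assume "y \<in> K"
    then obtain x where "x \<in> T" "d x y > 1" using T by auto
    then show "1 \<le> (\<Sum>x\<in>T. d x y)" using T d member_le_sum[of x T "\<lambda>x. d x y"] by force
  qed
qed

lemma exhaustion:
  obtains U :: "nat \<Rightarrow> 'a set" where "\<And>i. open (U i)" "\<And>i. compact (closure (U i))" "incseq U"
    "(\<Union>i. U i) = UNIV"
proof -
  define F where "F = {V::'a set. open V \<and> compact (closure V)}"
  have "\<Union>F = UNIV" unfolding F_def using nhd_compact[OF open_UNIV UNIV_I] by (metis (mono_tags, lifting) UNIV_eq_I UnionI mem_Collect_eq)
  moreover obtain G where G: "G \<subseteq> F" "countable G" "\<Union>G = \<Union>F"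
    using Lindelof[of F] by (auto simp: F_def)
  ultimately have un: "\<Union>G = UNIV" by simp
  then have "G \<noteq> {}" by auto
  then obtain g where g: "G = range (g :: nat \<Rightarrow> _)" using G(2) by (metis range_from_nat_into)
  show ?thesis
  proof (rule that[of "\<lambda>i. \<Union>j\<le>i. g j"])
    have gF: "g j \<in> F" for j using G g by auto
    show "open (\<Union>j\<le>i. g j)" for i using gF by (auto simp: F_def)
    show "compact (closure (\<Union>j\<le>i. g j))" for i
    proof (rule compact_closure_subset)
      show "compact (\<Union>j\<le>i. closure (g j))" using gF by (intro compact_UN) (auto simp: F_def)
      show "(\<Union>j\<le>i. g j) \<subseteq> (\<Union>j\<le>i. closure (g j))" by (intro UN_mono closure_subset) simp
    qed
    show "incseq (\<lambda>i. \<Union>j\<le>i. g j)" by (auto simp: incseq_def intro: order_trans)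
    show "(\<Union>i. \<Union>j\<le>i. g j) = UNIV" using un g by auto
  qed
qed

lemma Gamma_countable: "\<gamma> \<in> Gamma \<Longrightarrow> countable (\<gamma> :: 'a set)"
proof -
  assume g: "\<gamma> \<in> Gamma"
  obtain U where U: "\<And>i. open (U i)" "\<And>i. compact (closure (U i))" "incseq U" "(\<Union>i::nat. U i) = (UNIV::'a set)"
    using exhaustion by blast
  have "\<gamma> = (\<Union>i. \<gamma> \<inter> closure (U i))" using U(4) closure_subset by blast
  moreover have "countable (\<Union>i. \<gamma> \<inter> closure (U i))"
    using Gamma_finite[OF g U(2)] by (intro countable_UN) (auto intro: countable_finite)
  ultimately show ?thesis by simp
qed

lemma Gamma_isolate:
  fixes x :: 'a
  assumes "\<gamma> \<in> Gamma" "open U" "x \<in> U"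
  obtains V where "open V" "x \<in> V" "V \<subseteq> U" "\<gamma> \<inter> V \<subseteq> {x}"
proof -
  obtain V where V: "open V" "x \<in> V" "V \<subseteq> U" "compact (closure V)"
    using nhd_compact[OF assms(2,3)] by blast
  have "finite (\<gamma> \<inter> closure V)" using Gamma_finite[OF assms(1) V(4)] .
  then have "open (V - (\<gamma> \<inter> closure V - {x}))"
    using V(1) by (intro open_Diff finite_imp_closed) auto
  moreover have "\<gamma> \<inter> (V - (\<gamma> \<inter> closure V - {x})) \<subseteq> {x}" using closure_subset[of V] by blast
  ultimately show ?thesis using that[of "V - (\<gamma> \<inter> closure V - {x})"] V by blast
qed

lemma Gamma_closed: "\<gamma> \<in> Gamma \<Longrightarrow> closed (\<gamma> :: 'a set)"
proof -
  assume g: "\<gamma> \<in> Gamma"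
  have "\<exists>T. open T \<and> x \<in> T \<and> T \<subseteq> - \<gamma>" if "x \<in> - \<gamma>" for x
    using Gamma_isolate[OF g open_UNIV UNIV_I[of x]] that by (metis Compl_iff disjoint_eq_subset_Compl inf_commute subset_singletonD Int_insert_right insertI1 Int_iff order_refl)
  then show "closed \<gamma>" unfolding closed_def by (subst open_subopen) blast
qed

text \<open>By the Lindelof property U is the union of the positivity sets of countably many bumps
  supported in U. The partial sums of these bumps increase and are eventually positive at each point
  of U; multiplying the n-th one by n and capping at 1 yields the indicator in the limit.\<close>

lemma indicator_C0_approx:
  fixes U :: "'a set" assumes "open U"
  obtains h where "\<And>n::nat. h n \<in> C0" "\<And>n x. 0 \<le> h n x" "\<And>x. incseq (\<lambda>n. h n x)"
    "\<And>x. (SUP n. ennreal (h n x)) = indicator U x"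
proof (cases "U = {}")
  case True
  show ?thesis
    by (rule that[of "\<lambda>_ _. 0"]) (use True in \<open>auto simp: C0_def incseq_def\<close>)
next
  case False
  obtain b where b: "\<And>x::'a. x \<in> U \<Longrightarrow> b x \<in> C0 \<and> (\<forall>y. 0 \<le> b x y) \<and> b x x > 0 \<and> {y. b x y \<noteq> 0} \<subseteq> U"
    using bump[OF assms] by metis
  define F where "F = (\<lambda>x. b x -` {0<..}) ` U"
  have "open S" if "S \<in> F" for S
  proof -
    from that obtain x where x: "x \<in> U" "S = b x -` {0<..}" unfolding F_def by blast
    have "continuous_on UNIV (b x)" using b[OF x(1)] C0_cont by blast
    then show ?thesis unfolding x(2) by (intro open_vimage) auto
  qed
  then obtain G where G: "G \<subseteq> F" "countable G" "\<Union>G = \<Union>F"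
    using Lindelof[of F] by auto
  have UF: "\<Union>F = U"
    unfolding F_def using b by force
  then have "G \<noteq> {}" using False G by auto
  then obtain g where g: "G = range (g :: nat \<Rightarrow> _)" using G(2) by (metis range_from_nat_into)
  have "\<forall>n. \<exists>x\<in>U. g n = b x -` {0<..}" using G(1) g unfolding F_def by blast
  then obtain p where p: "\<And>n. p n \<in> U" "\<And>n. g n = b (p n) -` {0<..}" by metis
  define s where "s n x = (\<Sum>j\<le>n. b (p j) x)" for n x
  define h where "h n x = min 1 (real n * s n x)" for n x
  have s0: "0 \<le> s n x" for n x unfolding s_def using b p by (intro sum_nonneg) auto
  have smono: "m \<le> n \<Longrightarrow> s m x \<le> s n x" for m n x
    unfolding s_def using b p by (intro sum_mono2) auto
  show ?thesis
  proof (rule that[of h])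
    show "h n \<in> C0" for n
      unfolding h_def s_def
      by (rule C0_comp[where h="\<lambda>t. min 1 (real n * t)"]) (use b p in \<open>auto intro!: C0_sum continuous_intros\<close>)
    show "0 \<le> h n x" for n x using s0 by (simp add: h_def)
    show "incseq (\<lambda>n. h n x)" for x
      unfolding incseq_def h_def using smono s0 by (intro allI impI min.mono mult_mono) auto
    fix x
    show "(SUP n. ennreal (h n x)) = indicator U x"
    proof (cases "x \<in> U")
      case True
      then have "x \<in> (\<Union>n. g n)" using UF G(3) g by auto
      then obtain j where j: "b (p j) x > 0" using p by auto
      have sj: "s j x > 0" unfolding s_def using b p j by (intro sum_pos2[of _ j]) auto
      obtain n where n: "real n * s j x > 1" using reals_Archimedean3[OF sj] by blast
      have "h (max n j) x = 1"
      proof -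
        have "1 \<le> real n * s j x" using n by simp
        also have "\<dots> \<le> real (max n j) * s (max n j) x" using s0 smono[of j "max n j" x] by (intro mult_mono) auto
        finally show ?thesis by (simp add: h_def)
      qed
      then have "ennreal (h (max n j) x) = 1" by simp
      then have "1 \<le> (SUP n. ennreal (h n x))" by (metis SUP_upper UNIV_I)
      moreover have "(SUP n. ennreal (h n x)) \<le> 1" by (rule SUP_least) (auto simp: h_def)
      ultimately show ?thesis using True by auto
    next
      case False
      then have "b (p j) x = 0" for j using b[OF p(1)[of j]] by auto
      then show ?thesis using False by (simp add: h_def s_def)
    qed
  qed
qed

lemma cnt_open_measurable: 
  assumes "open (U :: 'a set)" shows "cnt U \<in> borel_measurable GammaM"
proof -
  obtain h where h: "\<And>n::nat. h n \<in> C0" "\<And>n x. 0 \<le> h n x" "\<And>x. incseq (\<lambda>n. h n x)"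
    "\<And>x. (SUP n. ennreal (h n x)) = indicator U x"
    using indicator_C0_approx[OF assms] by blast
  have "cnt U \<gamma> = (SUP n. ennreal (pairing (h n) \<gamma>))" if "\<gamma> \<in> space GammaM" for \<gamma>
  proof -
    have "cnt U \<gamma> = (\<integral>\<^sup>+x. (SUP n. ennreal (h n x)) \<partial>count_space \<gamma>)"
      unfolding cnt_def h(4) ..
    also have "\<dots> = (SUP n. (\<integral>\<^sup>+x. ennreal (h n x) \<partial>count_space \<gamma>))"
      by (rule nn_integral_monotone_convergence_SUP) 
         (use h(3) in \<open>auto simp: incseq_def le_fun_def intro!: ennreal_leI\<close>)
    also have "\<dots> = (SUP n. ennreal (pairing (h n) \<gamma>))"
      using that h by (simp add: nn_integral_count_pairing)
    finally show ?thesis .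
  qed
  moreover have "(\<lambda>\<gamma>. (SUP n. ennreal (pairing (h n) \<gamma>))) \<in> borel_measurable GammaM"
    using h(1) by measurable
  ultimately show ?thesis by (subst measurable_cong) auto
qed

text \<open>Open sets are handled by approximation with \<open>C0\<close> functions, Borel sets by
  the pi-lambda argument. Intersecting with the relatively compact \<open>U i\<close> keeps the
  counts finite, so that the complement step may subtract; letting i grow removes the
  cut-off.\<close>

lemma cnt_measurable[measurable]:
  assumes "(A :: 'a set) \<in> sets borel" shows "cnt A \<in> borel_measurable GammaM"
proof -
  obtain U where U: "\<And>i. open (U i)" "\<And>i. compact (closure (U i))" "incseq U" "(\<Union>i::nat. U i) = (UNIV::'a set)"
    using exhaustion by blast
  have fin: "finite (B \<inter> U i \<inter> \<gamma>)" if "\<gamma> \<in> Gamma" for i \<gamma> B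
    by (rule finite_subset[OF _ Gamma_finite[OF that U(2)[of i]]]) (use closure_subset in auto)
  have m: "cnt (A \<inter> U i) \<in> borel_measurable GammaM" for i
  proof -
    have "Int_stable {S :: 'a set. open S}" "{S :: 'a set. open S} \<subseteq> Pow UNIV" "A \<in> sigma_sets UNIV {S. open S}"
      using assms by (auto simp: borel_def Int_stable_def)
    then show ?thesis
    proof (induction rule: sigma_sets_induct_disjoint)
      case (basic A) then show ?case using U(1) by (intro cnt_open_measurable) auto
    next
      case empty then show ?case by (simp add: cnt_def)
    next
      case (compl A)
      have "cnt ((UNIV - A) \<inter> U i) \<gamma> = cnt (U i) \<gamma> - cnt (A \<inter> U i) \<gamma>" if "\<gamma> \<in> space GammaM" for \<gamma>
      proof -
        have "cnt (U i) \<gamma> = cnt (A \<inter> U i \<union> (UNIV - A) \<inter> U i) \<gamma>"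
          by (rule arg_cong[where f="\<lambda>A. cnt A \<gamma>"]) auto
        also have "\<dots> = cnt (A \<inter> U i) \<gamma> + cnt ((UNIV - A) \<inter> U i) \<gamma>"
          by (rule cnt_union) auto
        finally have *: "cnt (U i) \<gamma> = cnt (A \<inter> U i) \<gamma> + cnt ((UNIV - A) \<inter> U i) \<gamma>" .
        have "cnt (A \<inter> U i) \<gamma> \<noteq> top" using fin[of \<gamma> A i] that by (simp add: cnt_card)
        then show ?thesis unfolding * by (metis ennreal_add_diff_cancel_left)
      qed
      moreover have "(\<lambda>\<gamma>. cnt (U i) \<gamma> - cnt (A \<inter> U i) \<gamma>) \<in> borel_measurable GammaM"
        using compl.IH cnt_open_measurable[OF U(1)[of i]] by measurable
      ultimately show ?case by (subst measurable_cong) auto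
    next
      case (union A)
      have "cnt ((\<Union>j. A j) \<inter> U i) \<gamma> = (\<Sum>j. cnt (A j \<inter> U i) \<gamma>)" for \<gamma>
      proof -
        have "(\<Sum>j. emeasure (count_space \<gamma>) (A j \<inter> U i \<inter> \<gamma>)) = emeasure (count_space \<gamma>) (\<Union>j. A j \<inter> U i \<inter> \<gamma>)"
          using union(1) by (intro suminf_emeasure) (auto simp: disjoint_family_on_def)
        then show ?thesis unfolding cnt_eq by (simp add: Int_UN_distrib2 Int_assoc)
      qed
      then show ?case using union.IH by (subst measurable_cong) auto
    qed
  qed
  have "cnt A \<gamma> = (SUP i. cnt (A \<inter> U i) \<gamma>)" for \<gamma>
  proof -
    have "(SUP i. emeasure (count_space \<gamma>) (A \<inter> U i \<inter> \<gamma>)) = emeasure (count_space \<gamma>) (\<Union>i. A \<inter> U i \<inter> \<gamma>)"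
      using U(3) by (intro SUP_emeasure_incseq) (auto simp: incseq_def)
    moreover have "(\<Union>i. A \<inter> U i \<inter> \<gamma>) = A \<inter> \<gamma>" using U(4) by auto
    ultimately show ?thesis unfolding cnt_eq by simp
  qed
  then have "cnt A = (\<lambda>\<gamma>. SUP i. cnt (A \<inter> U i) \<gamma>)" by auto
  then show ?thesis using m by simp
qed

text \<open>The vague topology is second countable: a basic neighbourhood of \<open>\<gamma>\<close> only prescribes that
  finitely many small sets contain exactly one point and finitely many others none.\<close>

lemma vague_countable_refinement:
  fixes B :: "'a set set"
  assumes B: "topological_basis B" and W: "openin vague W" "\<gamma>0 \<in> W"
  defines "C \<equiv> \<lambda>F1 F2. {\<gamma>\<in>Gamma. (\<forall>V\<in>F1. cnt V \<gamma> = 1) \<and> (\<forall>(V, V')\<in>F2. cnt (V \<inter> V') \<gamma> = 0)}"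
  shows "\<exists>F1 F2. finite F1 \<and> F1 \<subseteq> B \<and> finite F2 \<and> F2 \<subseteq> B \<times> B \<and> \<gamma>0 \<in> C F1 F2 \<and> C F1 F2 \<subseteq> W"
proof -
  have "generate_topology_on {{\<gamma> \<in> Gamma. pairing f \<gamma> \<in> U} |f U. f \<in> (C0 :: ('a \<Rightarrow> real) set) \<and> open U} W"
    using W(1) by (simp add: vague_def openin_topology_generated_by_iff)
  then show ?thesis using W(2)
  proof (induction arbitrary: \<gamma>0)
    case Empty then show ?case by simp
  next
    case (Int a b)
    from Int.IH(1)[of \<gamma>0] Int.prems obtain F1 F2 where F: "finite F1" "F1 \<subseteq> B" "finite F2" "F2 \<subseteq> B \<times> B" "\<gamma>0 \<in> C F1 F2" "C F1 F2 \<subseteq> a" by blast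
    from Int.IH(2)[of \<gamma>0] Int.prems obtain G1 G2 where G: "finite G1" "G1 \<subseteq> B" "finite G2" "G2 \<subseteq> B \<times> B" "\<gamma>0 \<in> C G1 G2" "C G1 G2 \<subseteq> b" by blast
    have CE: "C (F1 \<union> G1) (F2 \<union> G2) = C F1 F2 \<inter> C G1 G2" unfolding C_def by blast
    show ?case
      by (rule exI[of _ "F1 \<union> G1"], rule exI[of _ "F2 \<union> G2"]) (use F G in \<open>auto simp: CE\<close>)
  next
    case (UN K)
    then obtain k where "k \<in> K" "\<gamma>0 \<in> k" by blast
    with UN.IH[of k \<gamma>0] show ?case by (meson Sup_upper order_trans)
  next
    case (Basis s)
    then obtain f U where s: "s = {\<gamma> \<in> Gamma. pairing f \<gamma> \<in> U}" and f: "f \<in> C0" and U: "open U" by auto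
    have g0: "\<gamma>0 \<in> Gamma" "pairing f \<gamma>0 \<in> U" using Basis s by auto
    define K where "K = closure {x. f x \<noteq> 0}"
    have K: "compact K" unfolding K_def using C0_compact[OF f] .
    define P where "P = \<gamma>0 \<inter> K"
    have finP: "finite P" unfolding P_def using Gamma_finite[OF g0(1) K] .
    obtain e where e: "e > 0" "ball (pairing f \<gamma>0) e \<subseteq> U" using U g0(2) openE by blast
    \<comment> \<open>Each of the \<open>card P\<close> points may change the pairing by at most d,
      so the total change stays below e; the summand 1 makes this strict and covers empty P.\<close>
    define d where "d = e / (real (card P) + 1)"
    have d: "d > 0" using e by (simp add: d_def)
    have "\<exists>V\<in>B. x \<in> V \<and> V \<subseteq> f -` ball (f x) d \<and> V \<inter> \<gamma>0 = {x}" if "x \<in> P" for x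
    proof -
      have "open (f -` ball (f x) d)" using C0_cont[OF f] by (simp add: continuous_on_open_vimage)
      moreover have "x \<in> f -` ball (f x) d" using d by simp
      ultimately obtain V where V: "open V" "x \<in> V" "V \<subseteq> f -` ball (f x) d" "\<gamma>0 \<inter> V \<subseteq> {x}"
        by (rule Gamma_isolate[OF g0(1)])
      obtain V' where "V' \<in> B" "x \<in> V'" "V' \<subseteq> V" using topological_basisE[OF B V(1,2)] by blast
      then show ?thesis using V that P_def by (intro bexI[of _ V']) auto
    qed
    then obtain V where V: "\<And>x. x \<in> P \<Longrightarrow> V x \<in> B \<and> x \<in> V x \<and> V x \<subseteq> f -` ball (f x) d \<and> V x \<inter> \<gamma>0 = {x}" by metis
    \<comment> \<open>The part of the support outside the \<open>V x\<close> is compact and contains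
      no point of \<open>\<gamma>0\<close>; finitely many sets \<open>Y x\<close> free of
      \<open>\<gamma>0\<close> cover it.\<close>
    define L where "L = K - (\<Union>x\<in>P. V x)"
    have oV: "open (V x)" if "x \<in> P" for x using V[OF that] topological_basis_open[OF B] by auto
    have L: "compact L" unfolding L_def using K oV by (intro compact_diff) auto
    have "\<exists>Y\<in>B. x \<in> Y \<and> \<gamma>0 \<inter> Y = {}" if "x \<in> L" for x
    proof -
      have x: "x \<notin> \<gamma>0" using that V unfolding L_def P_def by blast
      obtain Y where Y: "open Y" "x \<in> Y" "\<gamma>0 \<inter> Y \<subseteq> {x}" using Gamma_isolate[OF g0(1) open_UNIV UNIV_I] by metis
      obtain Y' where "Y' \<in> B" "x \<in> Y'" "Y' \<subseteq> Y" using topological_basisE[OF B Y(1,2)] by blast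
      then show ?thesis using Y x by (intro bexI[of _ Y']) auto
    qed
    then obtain Y where Y: "\<And>x. x \<in> L \<Longrightarrow> Y x \<in> B \<and> x \<in> Y x \<and> \<gamma>0 \<inter> Y x = {}" by metis
    obtain T where T: "T \<subseteq> L" "finite T" "L \<subseteq> (\<Union>x\<in>T. Y x)"
      using compactE_image[OF L, of L Y] Y topological_basis_open[OF B] by (metis (no_types, lifting) UN_iff subsetI)
    define F1 where "F1 = V ` P"
    \<comment> \<open>A pair \<open>(Y x, Y x)\<close> demands that \<open>Y x\<close> be empty of
      points. A pair \<open>(V x, V y)\<close> with x and y different excludes a shared point, so
      the single points found in the \<open>V x\<close> are pairwise distinct.\<close>
    define F2 where "F2 = (\<lambda>x. (Y x, Y x)) ` T \<union> (\<lambda>(x, y). (V x, V y)) ` {(x, y)\<in>P \<times> P. x \<noteq> y}"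
    have "C F1 F2 \<subseteq> s"
    proof
      fix \<gamma> assume "\<gamma> \<in> C F1 F2"
      then have g: "\<gamma> \<in> Gamma" "\<And>x. x \<in> P \<Longrightarrow> cnt (V x) \<gamma> = 1" "\<And>x. x \<in> T \<Longrightarrow> Y x \<inter> \<gamma> = {}"
        "\<And>x y. x \<in> P \<Longrightarrow> y \<in> P \<Longrightarrow> x \<noteq> y \<Longrightarrow> V x \<inter> V y \<inter> \<gamma> = {}"
        unfolding C_def F1_def F2_def by (auto simp: cnt_0_iff ball_Un)
      then have "\<forall>x\<in>P. \<exists>y. V x \<inter> \<gamma> = {y}" by (simp add: cnt_1_iff)
      then obtain y where y: "\<And>x. x \<in> P \<Longrightarrow> V x \<inter> \<gamma> = {y x}" by metis
      have inj: "inj_on y P" using y g(4) by (intro inj_onI) blast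
      have "pairing f \<gamma> = sum f (y ` P)"
      proof (rule pairing_eq_sum)
        show "finite (y ` P)" using finP by simp
        show "y ` P \<subseteq> \<gamma>" using y by blast
        fix x assume x: "x \<in> \<gamma>" "f x \<noteq> 0"
        then have "x \<in> K" unfolding K_def using closure_subset by fastforce
        moreover have "x \<notin> L" using T(3) g(3) x by blast
        ultimately obtain z where "z \<in> P" "x \<in> V z" unfolding L_def by blast
        then show "x \<in> y ` P" using y x by blast
      qed
      also have "\<dots> = (\<Sum>x\<in>P. f (y x))" using inj by (simp add: sum.reindex)
      finally have 1: "pairing f \<gamma> = (\<Sum>x\<in>P. f (y x))" .
      have 2: "pairing f \<gamma>0 = sum f P"
        using finP closure_subset[of "{x. f x \<noteq> 0}"]
        by (intro pairing_eq_sum) (auto simp: P_def K_def)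
      have "\<bar>pairing f \<gamma> - pairing f \<gamma>0\<bar> \<le> (\<Sum>x\<in>P. \<bar>f (y x) - f x\<bar>)"
        unfolding 1 2 sum_subtractf[symmetric] by (rule sum_abs)
      also have "\<dots> \<le> (\<Sum>x\<in>P. d)"
      proof (rule sum_mono)
        fix x assume x: "x \<in> P"
        then have "y x \<in> f -` ball (f x) d" using V[OF x] y[OF x] by blast
        then show "\<bar>f (y x) - f x\<bar> \<le> d" by (simp add: dist_real_def)
      qed
      also have "\<dots> = real (card P) * d" by simp
      also have "\<dots> < e" unfolding d_def using e by (simp add: field_simps)
      finally have "pairing f \<gamma> \<in> U" using e by (auto simp: dist_real_def)
      then show "\<gamma> \<in> s" using g s by simp
    qed
    moreover have "\<gamma>0 \<in> C F1 F2"
    proof -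
      have "cnt (V x) \<gamma>0 = 1" if "x \<in> P" for x using V[OF that] by (auto simp: cnt_1_iff)
      moreover have "cnt (Y x) \<gamma>0 = 0" if "x \<in> T" for x
        using T(1) Y[of x] that by (auto simp: cnt_0_iff)
      moreover have "cnt (V x \<inter> V y) \<gamma>0 = 0" if "x \<in> P" "y \<in> P" "x \<noteq> y" for x y
        using V[OF that(1)] V[OF that(2)] that(3) by (auto simp: cnt_0_iff)
      ultimately show ?thesis unfolding C_def F1_def F2_def using g0 by auto
    qed
    moreover have "finite F1" "F1 \<subseteq> B" "finite F2" "F2 \<subseteq> B \<times> B"
      unfolding F1_def F2_def using finP T V Y
      by (auto intro: finite_subset[of _ "(\<lambda>(x, y). (V x, V y)) ` (P \<times> P)"])
    ultimately show ?case by blast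
  qed
qed

text \<open>A vaguely open set is the union of the sets \<open>C F1 F2\<close> it contains. These
  are indexed by finite subsets of a countable base and described by counts alone, so measurability
  of all counts is enough.\<close>

lemma measurable_GammaM:
  fixes f :: "'b \<Rightarrow> 'a set"
  assumes f: "\<And>w. w \<in> space N \<Longrightarrow> f w \<in> Gamma"
    and cnt: "\<And>A. A \<in> sets borel \<Longrightarrow> (\<lambda>w. cnt A (f w)) \<in> borel_measurable N"
  shows "f \<in> measurable N GammaM"
proof -
  obtain B :: "'a set set" where B: "countable B" "topological_basis B" using ex_countable_basis by blast
  define C where "C = (\<lambda>F1 F2. {\<gamma>\<in>(Gamma :: 'a set set). (\<forall>V\<in>F1. cnt V \<gamma> = 1) \<and> (\<forall>(V, V')\<in>F2. cnt (V \<inter> V') \<gamma> = 0)})"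
  define I where "I = {F1. finite F1 \<and> F1 \<subseteq> B} \<times> {F2. finite F2 \<and> F2 \<subseteq> B \<times> B}"
  have I: "countable I" unfolding I_def using B(1)
    by (intro countable_SIGMA countable_Collect_finite_subset) auto
  have meas: "f -` C F1 F2 \<inter> space N \<in> sets N" if "(F1, F2) \<in> I" for F1 F2
  proof -
    have [measurable]: "V \<in> F1 \<Longrightarrow> V \<in> sets borel" "p \<in> F2 \<Longrightarrow> fst p \<in> sets borel" "p \<in> F2 \<Longrightarrow> snd p \<in> sets borel" for V p
      using that topological_basis_open[OF B(2)] unfolding I_def
      by (auto intro!: sets.Int borel_open open_Int)
    have fin: "finite F1" "finite F2" using that by (auto simp: I_def)
    have "f -` C F1 F2 \<inter> space N = {w\<in>space N. (\<forall>V\<in>F1. cnt V (f w) = 1) \<and> (\<forall>p\<in>F2. cnt (fst p \<inter> snd p) (f w) = 0)}"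
      using f unfolding C_def by auto
    also have "\<dots> \<in> sets N"
    proof (intro sets.sets_Collect_conj sets.sets_Collect_finite_All fin)
      fix V assume "V \<in> F1"
      then have [measurable]: "(\<lambda>w. cnt V (f w)) \<in> borel_measurable N" by (intro cnt) measurable
      show "{w\<in>space N. cnt V (f w) = 1} \<in> sets N" by measurable
    next
      fix p assume "p \<in> F2"
      then have [measurable]: "(\<lambda>w. cnt (fst p \<inter> snd p) (f w)) \<in> borel_measurable N" by (intro cnt) measurable
      show "{w\<in>space N. cnt (fst p \<inter> snd p) (f w) = 0} \<in> sets N" by measurable
    qed
    finally show ?thesis .
  qed
  show ?thesis unfolding GammaM_def
  proof (rule measurable_measure_of)
    show "{U. openin vague U} \<subseteq> Pow (Gamma :: 'a set set)"
      using sets.space_closed[of GammaM] vague_openin_sets by (auto dest: vague_openin_sets[THEN sets.sets_into_space])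
    show "f \<in> space N \<rightarrow> Gamma" using f by auto
    fix W :: "'a set set" assume "W \<in> {U. openin vague U}"
    then have W: "openin vague W" by simp
    define J where "J = {p\<in>I. C (fst p) (snd p) \<subseteq> W}"
    have "W = (\<Union>p\<in>J. C (fst p) (snd p))"
    proof
      show "W \<subseteq> (\<Union>p\<in>J. C (fst p) (snd p))"
      proof
        fix g assume "g \<in> W"
        from vague_countable_refinement[OF B(2) W this]
        show "g \<in> (\<Union>p\<in>J. C (fst p) (snd p))" unfolding J_def I_def C_def by fastforce
      qed
    qed (auto simp: J_def)
    then have "f -` W \<inter> space N = (\<Union>p\<in>J. f -` C (fst p) (snd p) \<inter> space N)" by auto
    also have "\<dots> \<in> sets N"
      using I meas by (intro sets.countable_UN') (auto simp: J_def intro: countable_subset)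
    finally show "f -` W \<inter> space N \<in> sets N" .
  qed
qed

text \<open>A configuration is closed, so a point outside it has a basic neighbourhood containing
  none of its points. The complement is thus a countable union of measurable rectangles.\<close>

lemma mem_measurable: "{p \<in> space (GammaM \<Otimes>\<^sub>M borel). (snd p :: 'a) \<in> fst p} \<in> sets (GammaM \<Otimes>\<^sub>M borel)"
proof -
  obtain B :: "'a set set" where B: "countable B" "topological_basis B" using ex_countable_basis by blast
  have "{p \<in> space (GammaM \<Otimes>\<^sub>M borel). (snd p :: 'a) \<notin> fst p} = (\<Union>V\<in>B. {\<gamma>\<in>space GammaM. cnt V \<gamma> = 0} \<times> V)"
  proof (intro equalityI subsetI)
    fix p assume "p \<in> {p \<in> space (GammaM \<Otimes>\<^sub>M borel). (snd p::'a) \<notin> fst p}"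
    then have p: "fst p \<in> Gamma" "snd p \<notin> fst p" by (auto simp: space_pair_measure)
    have "open (- fst p)" using Gamma_closed[OF p(1)] by (simp add: open_closed)
    then obtain V where "V \<in> B" "snd p \<in> V" "V \<subseteq> - fst p" using topological_basisE[OF B(2)] p(2) by blast
    then show "p \<in> (\<Union>V\<in>B. {\<gamma>\<in>space GammaM. cnt V \<gamma> = 0} \<times> V)"
      using p by (auto simp: cnt_0_iff intro!: bexI[of _ V] mem_Times_iff[THEN iffD2])
  qed (auto simp: cnt_0_iff space_pair_measure)
  also have "\<dots> \<in> sets (GammaM \<Otimes>\<^sub>M borel)"
  proof (rule sets.countable_UN'[OF B(1)], safe)
    fix V assume "V \<in> B"
    then have [measurable]: "V \<in> sets borel" using topological_basis_open[OF B(2)] by auto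
    show "{\<gamma>\<in>space GammaM. cnt V \<gamma> = 0} \<times> V \<in> sets (GammaM \<Otimes>\<^sub>M borel)" by measurable
  qed
  finally have "space (GammaM \<Otimes>\<^sub>M borel) - {p \<in> space (GammaM \<Otimes>\<^sub>M borel). (snd p :: 'a) \<notin> fst p} \<in> sets (GammaM \<Otimes>\<^sub>M borel)"
    by (rule sets.compl_sets)
  also have "space (GammaM \<Otimes>\<^sub>M borel) - {p \<in> space (GammaM \<Otimes>\<^sub>M borel). (snd p :: 'a) \<notin> fst p} = {p \<in> space (GammaM \<Otimes>\<^sub>M borel). (snd p :: 'a) \<in> fst p}"
    by auto
  finally show ?thesis .
qed

lemma pred_mem[measurable]: "Measurable.pred (GammaM \<Otimes>\<^sub>M borel) (\<lambda>p. (snd p :: 'a) \<in> fst p)"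
  using mem_measurable by (simp add: pred_def)

lemma cnt_insert: "cnt A (insert y \<gamma>) = cnt A \<gamma> + (if y \<in> \<gamma> then 0 else indicator A y)"
proof (cases "y \<in> \<gamma>")
  case False
  show ?thesis
  proof (cases "finite (A \<inter> \<gamma>)")
    case True
    then show ?thesis using False by (cases "y \<in> A") (simp_all add: cnt_card add.commute)
  next
    case inf: False
    have "cnt A \<gamma> = \<top>" using inf by (simp add: cnt_eq emeasure_count_space)
    moreover from this have "cnt A (insert y \<gamma>) = \<top>"
      using cnt_mono2[of \<gamma> "insert y \<gamma>" A] by (auto simp: top_unique)
    ultimately show ?thesis by simp
  qed
qed (simp add: insert_absorb)

lemma measurable_insert_Gamma: "(\<lambda>p. insert (snd p :: 'a) (fst p)) \<in> measurable (GammaM \<Otimes>\<^sub>M borel) GammaM"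
proof (rule measurable_GammaM)
  fix A :: "'a set" assume [measurable]: "A \<in> sets borel"
  show "(\<lambda>p. cnt A (insert (snd p) (fst p))) \<in> borel_measurable (GammaM \<Otimes>\<^sub>M borel)"
    unfolding cnt_insert by measurable
qed (auto simp: space_pair_measure Gamma_insert)

lemma measurable_delete_Gamma: "(\<lambda>p. fst p - {snd p :: 'a}) \<in> measurable (GammaM \<Otimes>\<^sub>M borel) GammaM"
proof (rule measurable_GammaM)
  fix A :: "'a set" assume [measurable]: "A \<in> sets borel"
  have eq: "cnt A (fst p - {snd p}) = cnt (A) (fst p) - (if snd p \<in> fst p then indicator A (snd p) else 0)"
    for p :: "'a set \<times> 'a"
  proof (cases "snd p \<in> fst p")
    case True
    then have "cnt A (fst p) = cnt A (insert (snd p) (fst p - {snd p}))" by (simp add: insert_absorb)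
    also have "\<dots> = cnt A (fst p - {snd p}) + indicator A (snd p)" by (subst cnt_insert) simp
    finally show ?thesis using True by (simp add: indicator_def)
  qed simp
  show "(\<lambda>p. cnt A (fst p - {snd p})) \<in> borel_measurable (GammaM \<Otimes>\<^sub>M borel)"
    unfolding eq by measurable
qed (auto simp: space_pair_measure intro: Gamma_subset)

end

section \<open>Measurability of integrals against locally finite kernels\<close>

context bump_space begin

text \<open>The kernel is finite on compact sets but may have infinite total mass. The pi-lambda
  argument on rectangles is therefore run for the traces on the relatively compact
  \<open>U i\<close>, where differences of measures make sense, and the traces are then
  exhausted.\<close>

lemma kernel_measurable:
  fixes K :: "'w \<Rightarrow> 'a measure" and f :: "'w \<times> 'a \<Rightarrow> ennreal"
  assumes sets: "\<And>w. w \<in> space N \<Longrightarrow> sets (K w) = sets borel"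
    and em: "\<And>A. A \<in> sets borel \<Longrightarrow> (\<lambda>w. emeasure (K w) A) \<in> borel_measurable N"
    and fin: "\<And>w C. w \<in> space N \<Longrightarrow> compact C \<Longrightarrow> emeasure (K w) C < \<infinity>"
    and f: "f \<in> borel_measurable (N \<Otimes>\<^sub>M borel)"
  shows "(\<lambda>w. \<integral>\<^sup>+x. f (w, x) \<partial>K w) \<in> borel_measurable N"
proof -
  obtain U where U: "\<And>i. open (U i)" "\<And>i. compact (closure (U i))" "incseq U" "(\<Union>i::nat. U i) = (UNIV::'a set)"
    using exhaustion by blast
  have sect: "Pair w -` A \<in> sets (K w)" if "w \<in> space N" "A \<in> sets (N \<Otimes>\<^sub>M borel)" for w and A :: "('w \<times> 'a) set"
    using sets_Pair1[OF that(2)] sets[OF that(1)] by simp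
  have sectU: "Pair w -` A \<inter> U i \<in> sets (K w)" if "w \<in> space N" "A \<in> sets (N \<Otimes>\<^sub>M borel)" for w i and A :: "('w \<times> 'a) set"
    using sect[OF that] sets[OF that(1)] U(1)[of i] by auto
  have finU: "emeasure (K w) (B \<inter> U i) \<noteq> \<infinity>" if "w \<in> space N" for w B i
  proof -
    have "emeasure (K w) (B \<inter> U i) \<le> emeasure (K w) (closure (U i))"
      using closure_subset[of "U i"] sets[OF that] by (intro emeasure_mono) auto
    then show ?thesis using fin[OF that U(2)[of i]] by (auto simp: top_unique)
  qed
  have "(\<lambda>w. emeasure (K w) (Pair w -` A \<inter> U i)) \<in> borel_measurable N"
    if "A \<in> sets (N \<Otimes>\<^sub>M (borel :: 'a measure))" for A i
  proof -
    let ?G = "{a \<times> b |a b. a \<in> sets N \<and> b \<in> sets (borel :: 'a measure)}"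
    have "Int_stable ?G" "?G \<subseteq> Pow (space N \<times> space borel)" "A \<in> sigma_sets (space N \<times> space borel) ?G"
      using that Int_stable_pair_measure_generator[of N borel] pair_measure_closed[of N borel]
      by (auto simp: sets_pair_measure)
    then show ?thesis
    proof (induction rule: sigma_sets_induct_disjoint)
      case (basic A)
      then obtain a b where ab: "A = a \<times> b" "a \<in> sets N" "b \<in> sets borel" by auto
      have "emeasure (K w) (Pair w -` A \<inter> U i) = indicator a w * emeasure (K w) (b \<inter> U i)" for w
        using ab(1) by (simp add: indicator_def)
      moreover have "(\<lambda>w. indicator a w * emeasure (K w) (b \<inter> U i)) \<in> borel_measurable N"
        using ab U(1)[of i] by (intro borel_measurable_times_ennreal borel_measurable_indicator em) auto
      ultimately show ?case by simp
    next
      case empty show ?case by simp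
    next
      case (compl A)
      then have A: "A \<in> sets (N \<Otimes>\<^sub>M borel)" by (simp add: sets_pair_measure)
      have "emeasure (K w) (Pair w -` (space N \<times> space borel - A) \<inter> U i)
          = emeasure (K w) (U i) - emeasure (K w) (Pair w -` A \<inter> U i)" if "w \<in> space N" for w
      proof -
        have "Pair w -` (space N \<times> space borel - A) \<inter> U i = U i - (Pair w -` A \<inter> U i)"
          using that by auto
        then show ?thesis
          using emeasure_Diff[OF finU[OF that] , of "U i" "Pair w -` A" i] sectU[OF that A, of i] U(1)[of i] sets[OF that]
          by simp
      qed
      moreover have "(\<lambda>w. emeasure (K w) (U i) - emeasure (K w) (Pair w -` A \<inter> U i)) \<in> borel_measurable N"
        using compl.IH em[of "U i"] U(1)[of i] by (intro borel_measurable_minus_ennreal) auto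
      ultimately show ?case by (subst measurable_cong) auto
    next
      case (union A)
      then have A: "A j \<in> sets (N \<Otimes>\<^sub>M borel)" for j by (auto simp: sets_pair_measure)
      have "emeasure (K w) (Pair w -` (\<Union>j. A j) \<inter> U i) = (\<Sum>j. emeasure (K w) (Pair w -` A j \<inter> U i))"
        if "w \<in> space N" for w
      proof -
        have "(\<Sum>j. emeasure (K w) (Pair w -` A j \<inter> U i)) = emeasure (K w) (\<Union>j. Pair w -` A j \<inter> U i)"
          using sectU[OF that A] union(1) by (intro suminf_emeasure) (auto simp: disjoint_family_on_def disjoint_iff)
        moreover have "(\<Union>j. Pair w -` A j \<inter> U i) = Pair w -` (\<Union>j. A j) \<inter> U i" by auto
        ultimately show ?thesis by simp
      qed
      moreover have "(\<lambda>w. \<Sum>j. emeasure (K w) (Pair w -` A j \<inter> U i)) \<in> borel_measurable N"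
        using union.IH by measurable
      ultimately show ?case by (subst measurable_cong) auto
    qed
  qed
  then have emU: "(\<lambda>w. SUP i. emeasure (K w) (Pair w -` A \<inter> U i)) \<in> borel_measurable N"
    if "A \<in> sets (N \<Otimes>\<^sub>M (borel :: 'a measure))" for A
    using that by (intro borel_measurable_SUP) auto
  have emA: "(\<lambda>w. emeasure (K w) (Pair w -` A)) \<in> borel_measurable N"
    if A: "A \<in> sets (N \<Otimes>\<^sub>M (borel :: 'a measure))" for A
  proof -
    have "emeasure (K w) (Pair w -` A) = (SUP i. emeasure (K w) (Pair w -` A \<inter> U i))" if "w \<in> space N" for w
    proof -
      have "(SUP i. emeasure (K w) (Pair w -` A \<inter> U i)) = emeasure (K w) (\<Union>i. Pair w -` A \<inter> U i)"
        using sectU[OF that A] U(3) by (intro SUP_emeasure_incseq) (auto simp: incseq_def)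
      moreover have "(\<Union>i. Pair w -` A \<inter> U i) = Pair w -` A" using U(4) by auto
      ultimately show ?thesis by simp
    qed
    then show ?thesis using emU[OF A] by (subst measurable_cong) auto
  qed
  have msect: "(\<lambda>x. g (w, x)) \<in> borel_measurable (K w)"
    if "g \<in> borel_measurable (N \<Otimes>\<^sub>M borel)" "w \<in> space N" for g :: "'w \<times> 'a \<Rightarrow> ennreal" and w
    using measurable_Pair2[OF that] sets[OF that(2)] by (simp cong: measurable_cong_sets)
  show ?thesis using f
  proof (induction rule: borel_measurable_induct)
    case (cong f g)
    have "(\<integral>\<^sup>+x. f (w, x) \<partial>K w) = (\<integral>\<^sup>+x. g (w, x) \<partial>K w)" if "w \<in> space N" for w
      using cong(3) that by (intro nn_integral_cong) (auto simp: space_pair_measure)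
    then show ?case using cong(4) by (subst (asm) measurable_cong) auto
  next
    case (set A)
    have "(\<integral>\<^sup>+x. indicator A (w, x) \<partial>K w) = emeasure (K w) (Pair w -` A)" if "w \<in> space N" for w
    proof -
      have "(\<integral>\<^sup>+x. indicator A (w, x) \<partial>K w) = (\<integral>\<^sup>+x. indicator (Pair w -` A) x \<partial>K w)"
        by (simp add: indicator_def)
      then show ?thesis using sect[OF that set] by simp
    qed
    then show ?case using emA[OF set] by (subst measurable_cong) auto
  next
    case (mult u c)
    have "(\<integral>\<^sup>+x. c * u (w, x) \<partial>K w) = c * (\<integral>\<^sup>+x. u (w, x) \<partial>K w)" if "w \<in> space N" for w
      using msect[OF mult(2) that] by (rule nn_integral_cmult)
    moreover have "(\<lambda>w. c * (\<integral>\<^sup>+x. u (w, x) \<partial>K w)) \<in> borel_measurable N" using mult.IH by measurable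
    ultimately show ?case by (subst measurable_cong) auto
  next
    case (add u v)
    have "(\<integral>\<^sup>+x. v (w, x) + u (w, x) \<partial>K w) = (\<integral>\<^sup>+x. v (w, x) \<partial>K w) + (\<integral>\<^sup>+x. u (w, x) \<partial>K w)" if "w \<in> space N" for w
      using msect[of u, OF _ that] msect[of v, OF _ that] add by (intro nn_integral_add) auto
    moreover have "(\<lambda>w. (\<integral>\<^sup>+x. v (w, x) \<partial>K w) + (\<integral>\<^sup>+x. u (w, x) \<partial>K w)) \<in> borel_measurable N"
      using add.IH by measurable
    ultimately show ?case by (subst measurable_cong) auto
  next
    case (seq V)
    have "(\<integral>\<^sup>+x. (SUP i. V i) (w, x) \<partial>K w) = (SUP i. (\<integral>\<^sup>+x. V i (w, x) \<partial>K w))" if "w \<in> space N" for w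
    proof -
      have "(\<integral>\<^sup>+x. (SUP i. V i) (w, x) \<partial>K w) = (\<integral>\<^sup>+x. (SUP i. V i (w, x)) \<partial>K w)" by (simp add: image_comp)
      also have "\<dots> = (SUP i. (\<integral>\<^sup>+x. V i (w, x) \<partial>K w))"
        using seq(3) msect[OF seq(1) that]
        by (intro nn_integral_monotone_convergence_SUP) (auto simp: incseq_def le_fun_def)
      finally show ?thesis .
    qed
    moreover have "(\<lambda>w. SUP i. (\<integral>\<^sup>+x. V i (w, x) \<partial>K w)) \<in> borel_measurable N" using seq.IH by measurable
    ultimately show ?case by (subst measurable_cong) auto
  qed
qed

lemma count_integral_measurable:
  fixes f :: "'w \<times> 'a \<Rightarrow> ennreal"
  assumes g: "g \<in> measurable N GammaM" and f: "f \<in> borel_measurable (N \<Otimes>\<^sub>M borel)"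
  shows "(\<lambda>w. \<integral>\<^sup>+x. f (w, x) \<partial>count_space (g w)) \<in> borel_measurable N"
proof -
  \<comment> \<open>Counting measure lives on the power set of \<open>g w\<close>; its image on the
    Borel sets is a kernel in the sense of \<open>kernel_measurable\<close>, finite on compact sets
    because \<open>g w\<close> is locally finite.\<close>
  define K where "K w = distr (count_space (g w)) borel (\<lambda>x. x)" for w
  have G: "g w \<in> Gamma" if "w \<in> space N" for w using measurable_space[OF g that] by simp
  have em: "emeasure (K w) A = cnt A (g w)" if "A \<in> sets borel" for w A
    using that unfolding K_def cnt_eq by (subst emeasure_distr) auto
  have "(\<lambda>w. \<integral>\<^sup>+x. f (w, x) \<partial>K w) \<in> borel_measurable N"
  proof (rule kernel_measurable[OF _ _ _ f])
    show "sets (K w) = sets borel" for w by (simp add: K_def)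
    show "(\<lambda>w. emeasure (K w) A) \<in> borel_measurable N" if "A \<in> sets borel" for A
      unfolding em[OF that] using measurable_compose[OF g cnt_measurable[OF that]] by simp
    fix w and C :: "'a set" assume "w \<in> space N" "compact C"
    then show "emeasure (K w) C < \<infinity>"
      using Gamma_finite[OF G, of w C] by (simp add: em borel_compact cnt_card Int_commute of_nat_less_top)
  qed
  moreover have "(\<integral>\<^sup>+x. f (w, x) \<partial>K w) = (\<integral>\<^sup>+x. f (w, x) \<partial>count_space (g w))" if "w \<in> space N" for w
    using measurable_Pair2[OF f that] unfolding K_def by (intro nn_integral_distr) auto
  ultimately show ?thesis by (subst (asm) measurable_cong) auto
qed

end

section \<open>The iterated Georgii-Nguyen-Zessin identity\<close>

definition Inj :: "nat \<Rightarrow> 'a set \<Rightarrow> (nat \<Rightarrow> 'a) set" where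
  "Inj k \<gamma> = {x \<in> PiE {..<k} (\<lambda>_. \<gamma>). inj_on x {..<k}}"

text \<open>The reduced Campbell sum: ordered tuples of distinct points of \<gamma>, with these
  points taken out of the configuration handed to f. It is the counterpart of
  \<open>sigma_int\<close>, which adds points to the configuration instead.\<close>

definition camp :: "nat \<Rightarrow> 'a set \<Rightarrow> ('a set \<Rightarrow> (nat \<Rightarrow> 'a) \<Rightarrow> ennreal) \<Rightarrow> ennreal" where
  "camp k \<gamma> f = (\<integral>\<^sup>+x. f (\<gamma> - x ` {..<k}) x \<partial>count_space (Inj k \<gamma>))"

lemma Inj_0: "Inj 0 \<gamma> = {\<lambda>_. undefined}"
  by (auto simp: Inj_def)

lemma camp_0: "camp 0 \<gamma> f = f \<gamma> (\<lambda>_. undefined)"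
  by (simp add: camp_def Inj_0 nn_integral_count_space_finite)

lemma Inj_upd_range: "x \<in> Inj k \<gamma> \<Longrightarrow> (x(k := y)) ` {..<Suc k} = insert y (x ` {..<k})"
  by (auto simp: lessThan_Suc)

lemma Inj_Suc_iff:
  "x(k := y) \<in> Inj (Suc k) \<gamma> \<longleftrightarrow> x(k := undefined) \<in> Inj k \<gamma> \<and> y \<in> \<gamma> - x ` {..<k}"
  unfolding Inj_def lessThan_Suc
  by (auto simp: PiE_def extensional_def inj_on_def image_iff Pi_def)

lemma bij_Inj_Suc:
  "bij_betw (\<lambda>(x, y). x(k := y)) {(x, y). x \<in> Inj k \<gamma> \<and> y \<in> \<gamma> - x ` {..<k}} (Inj (Suc k) \<gamma>)"
proof -
  \<comment> \<open>Tuples are extensional: a k-tuple has the value \<open>undefined\<close> at k,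
    so resetting that entry inverts the appending of a point.\<close>
  have und: "x k = undefined" if "x \<in> Inj k \<gamma>" for x using that by (auto simp: Inj_def PiE_def extensional_def)
  show ?thesis
  proof (rule bij_betwI[where g="\<lambda>x. (x(k := undefined), x k)"])
    show "(\<lambda>(x, y). x(k := y)) \<in> {(x, y). x \<in> Inj k \<gamma> \<and> y \<in> \<gamma> - x ` {..<k}} \<rightarrow> Inj (Suc k) \<gamma>"
    proof safe
      fix x y assume "x \<in> Inj k \<gamma>" "y \<in> \<gamma>" "y \<notin> x ` {..<k}"
      moreover from this und[of x] have "x(k := undefined) = x" by auto
      ultimately show "x(k := y) \<in> Inj (Suc k) \<gamma>" by (simp add: Inj_Suc_iff)
    qed
    show "(\<lambda>x. (x(k := undefined), x k)) \<in> Inj (Suc k) \<gamma> \<rightarrow> {(x, y). x \<in> Inj k \<gamma> \<and> y \<in> \<gamma> - x ` {..<k}}"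
    proof safe
      fix x assume "x \<in> Inj (Suc k) \<gamma>"
      then have x: "x(k := x k) \<in> Inj (Suc k) \<gamma>" by simp
      show "x(k := undefined) \<in> Inj k \<gamma>" "x k \<in> \<gamma>"
        using x unfolding Inj_Suc_iff by auto
      fix i assume "x k = (x(k := undefined)) i" "i < k"
      then show False using x unfolding Inj_Suc_iff by auto
    qed
  qed (use und in \<open>auto simp: fun_upd_idem\<close>)
qed

lemma camp_Suc_pairs:
  "camp (Suc k) \<gamma> f = (\<integral>\<^sup>+p. f (\<gamma> - fst p ` {..<k} - {snd p}) ((fst p)(k := snd p))
      \<partial>count_space {(x, y). x \<in> Inj k \<gamma> \<and> y \<in> \<gamma> - x ` {..<k}})"
  unfolding camp_def
proof (subst nn_integral_bij_count_space[OF bij_Inj_Suc, symmetric], intro nn_integral_cong)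
  fix p assume p: "p \<in> space (count_space {(x, y). x \<in> Inj k \<gamma> \<and> y \<in> \<gamma> - x ` {..<k}})"
  obtain x y where xy: "p = (x, y)" by (cases p)
  have "insert y (x ` {..<k}) = (x(k := y)) ` {..<Suc k}" using p xy by (intro Inj_upd_range[symmetric, of x k \<gamma>]) auto
  then have "\<gamma> - (x(k := y)) ` {..<Suc k} = \<gamma> - x ` {..<k} - {y}" by auto
  then show "f (\<gamma> - (case p of (x, y) \<Rightarrow> x(k := y)) ` {..<Suc k}) (case p of (x, y) \<Rightarrow> x(k := y)) =
    f (\<gamma> - fst p ` {..<k} - {snd p}) ((fst p)(k := snd p))" by (simp add: xy)
qed

lemma nn_integral_count_space_UNIV:
  "(\<integral>\<^sup>+x. f x \<partial>count_space A) = (\<integral>\<^sup>+x. f x * indicator A x \<partial>count_space UNIV)"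
  by (simp add: nn_integral_restrict_space[symmetric] restrict_count_space)

lemma camp_Suc:
  "camp (Suc k) \<gamma> f = camp k \<gamma> (\<lambda>\<gamma>' x. \<integral>\<^sup>+y. f (\<gamma>' - {y}) (x(k := y)) \<partial>count_space \<gamma>')"
proof -
  let ?S = "{(x, y). x \<in> Inj k \<gamma> \<and> y \<in> \<gamma> - x ` {..<k}}"
  have "camp (Suc k) \<gamma> f = (\<integral>\<^sup>+x. \<integral>\<^sup>+y. f (\<gamma> - x ` {..<k} - {y}) (x(k := y)) * indicator ?S (x, y)
      \<partial>count_space UNIV \<partial>count_space UNIV)"
    unfolding camp_Suc_pairs
    by (subst nn_integral_count_space_UNIV, subst nn_integral_fst_count_space[symmetric]) simp
  also have "\<dots> = (\<integral>\<^sup>+x. (\<integral>\<^sup>+y. f (\<gamma> - x ` {..<k} - {y}) (x(k := y)) \<partial>count_space (\<gamma> - x ` {..<k})) * indicator (Inj k \<gamma>) x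
      \<partial>count_space UNIV)"
    by (rule nn_integral_cong, subst nn_integral_count_space_UNIV)
       (auto simp: indicator_def intro!: nn_integral_cong)
  finally show ?thesis unfolding camp_def by (subst nn_integral_count_space_UNIV)
qed

text \<open>The same double sum as \<open>camp_Suc\<close> with the last point chosen first. The
  version with the last point innermost serves measurability by induction on k; this one has the
  outer single sum to which the Georgii-Nguyen-Zessin identity applies.\<close>

lemma camp_Suc':
  "camp (Suc k) \<gamma> f = (\<integral>\<^sup>+y. camp k (\<gamma> - {y}) (\<lambda>\<gamma>' x. f \<gamma>' (x(k := y))) \<partial>count_space \<gamma>)"
proof -
  let ?S = "{(x, y). x \<in> Inj k \<gamma> \<and> y \<in> \<gamma> - x ` {..<k}}"
  have eq: "\<gamma> - {y} - x ` {..<k} = \<gamma> - x ` {..<k} - {y}" for x y by auto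
  have "camp (Suc k) \<gamma> f = (\<integral>\<^sup>+y. \<integral>\<^sup>+x. f (\<gamma> - x ` {..<k} - {y}) (x(k := y)) * indicator ?S (x, y)
      \<partial>count_space UNIV \<partial>count_space UNIV)"
    unfolding camp_Suc_pairs
    by (subst nn_integral_count_space_UNIV, subst nn_integral_snd_count_space[symmetric]) simp
  also have "\<dots> = (\<integral>\<^sup>+y. camp k (\<gamma> - {y}) (\<lambda>\<gamma>' x. f \<gamma>' (x(k := y))) * indicator \<gamma> y \<partial>count_space UNIV)"
  proof (rule nn_integral_cong)
    fix y
    have I: "Inj k (\<gamma> - {y}) = {x\<in>Inj k \<gamma>. y \<notin> x ` {..<k}}" by (auto simp: Inj_def PiE_def Pi_def)
    show "(\<integral>\<^sup>+x. f (\<gamma> - x ` {..<k} - {y}) (x(k := y)) * indicator ?S (x, y) \<partial>count_space UNIV)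
      = camp k (\<gamma> - {y}) (\<lambda>\<gamma>' x. f \<gamma>' (x(k := y))) * indicator \<gamma> y"
      unfolding camp_def I eq
      by (subst nn_integral_count_space_UNIV[where A="{x\<in>Inj k \<gamma>. y \<notin> x ` {..<k}}"])
         (auto simp: indicator_def intro!: nn_integral_cong)
  qed
  finally show ?thesis by (subst nn_integral_count_space_UNIV)
qed

lemma camp_cong:
  "(\<And>x. x \<in> Inj k \<gamma> \<Longrightarrow> f (\<gamma> - x ` {..<k}) x = g (\<gamma> - x ` {..<k}) x) \<Longrightarrow> camp k \<gamma> f = camp k \<gamma> g"
  unfolding camp_def by (rule nn_integral_cong) simp

lemma camp_mono:
  "(\<And>x. x \<in> Inj k \<gamma> \<Longrightarrow> f (\<gamma> - x ` {..<k}) x \<le> g (\<gamma> - x ` {..<k}) x) \<Longrightarrow> camp k \<gamma> f \<le> camp k \<gamma> g"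
  unfolding camp_def by (rule nn_integral_mono) simp

lemma camp_add: "camp k \<gamma> (\<lambda>\<gamma> x. f \<gamma> x + g \<gamma> x) = camp k \<gamma> f + camp k \<gamma> g"
  unfolding camp_def by (rule nn_integral_add) auto

lemma camp_cmult: "camp k \<gamma> (\<lambda>\<gamma> x. c * f \<gamma> x) = c * camp k \<gamma> f"
  unfolding camp_def by (rule nn_integral_cmult) auto

lemma camp_finite_sum:
  assumes "finite S" "S \<subseteq> \<gamma>" "\<And>x. x \<in> Inj k \<gamma> \<Longrightarrow> x \<notin> Inj k S \<Longrightarrow> f (\<gamma> - x ` {..<k}) x = 0"
  shows "camp k \<gamma> f = (\<Sum>x\<in>Inj k S. f (\<gamma> - x ` {..<k}) x)"
proof -
  have fin: "finite (Inj k S)"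
    unfolding Inj_def using finite_PiE[of "{..<k}" "\<lambda>_. S"] assms(1) by (auto intro: finite_subset[rotated])
  have sub: "Inj k S \<subseteq> Inj k \<gamma>" using assms(2) by (auto simp: Inj_def PiE_def Pi_def)
  have "camp k \<gamma> f = (\<integral>\<^sup>+x. f (\<gamma> - x ` {..<k}) x \<partial>count_space (Inj k S))"
    unfolding camp_def using assms(3) sub by (intro nn_integral_count_space_eq) auto
  then show ?thesis using fin by (simp add: nn_integral_count_space_finite)
qed

lemma measurable_upd[measurable]:
  "(\<lambda>p. (fst p)(k := snd p)) \<in> measurable (PiM {..<k} (\<lambda>_. N) \<Otimes>\<^sub>M N) (PiM {..<Suc k} (\<lambda>_. N))"
  using measurable_add_dim[of k "{..<k}" "\<lambda>_. N"] by (simp add: lessThan_Suc split_beta')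

context bump_space begin

lemma count_step_measurable:
  fixes f :: "'w \<times> 'a set \<times> (nat \<Rightarrow> 'a) \<Rightarrow> ennreal"
  assumes f: "f \<in> borel_measurable (N \<Otimes>\<^sub>M (GammaM \<Otimes>\<^sub>M PiM {..<Suc k} (\<lambda>_. borel)))"
  shows "(\<lambda>p. \<integral>\<^sup>+y. f (fst p, fst (snd p) - {y}, (snd (snd p))(k := y)) \<partial>count_space (fst (snd p)))
    \<in> borel_measurable (N \<Otimes>\<^sub>M (GammaM \<Otimes>\<^sub>M PiM {..<k} (\<lambda>_. borel)))"
proof -
  let ?N = "N \<Otimes>\<^sub>M (GammaM \<Otimes>\<^sub>M PiM {..<k} (\<lambda>_. borel :: 'a measure))"
  have "(\<lambda>p. (fst (snd (fst p)), snd p)) \<in> measurable (?N \<Otimes>\<^sub>M (borel :: 'a measure)) (GammaM \<Otimes>\<^sub>M borel)" by measurable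
  from measurable_compose[OF this measurable_delete_Gamma]
  have 1: "(\<lambda>p. fst (snd (fst p)) - {snd p}) \<in> measurable (?N \<Otimes>\<^sub>M (borel :: 'a measure)) GammaM" by simp
  have "(\<lambda>p. (snd (snd (fst p)), snd p)) \<in> measurable (?N \<Otimes>\<^sub>M (borel :: 'a measure)) (PiM {..<k} (\<lambda>_. borel) \<Otimes>\<^sub>M borel)" by measurable
  from measurable_compose[OF this measurable_upd]
  have 2: "(\<lambda>p. (snd (snd (fst p)))(k := snd p)) \<in> measurable (?N \<Otimes>\<^sub>M (borel :: 'a measure)) (PiM {..<Suc k} (\<lambda>_. borel))" by simp
  have "(\<lambda>p. (fst (fst p), fst (snd (fst p)) - {snd p}, (snd (snd (fst p)))(k := snd p)))
    \<in> measurable (?N \<Otimes>\<^sub>M (borel :: 'a measure)) (N \<Otimes>\<^sub>M (GammaM \<Otimes>\<^sub>M PiM {..<Suc k} (\<lambda>_. borel)))"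
    by (intro measurable_Pair 1 2) measurable
  from measurable_compose[OF this f]
  have "(\<lambda>p. f (fst (fst p), fst (snd (fst p)) - {snd p}, (snd (snd (fst p)))(k := snd p))) \<in> borel_measurable (?N \<Otimes>\<^sub>M (borel :: 'a measure))" .
  moreover have "(\<lambda>p. fst (snd p)) \<in> measurable ?N GammaM" by measurable
  ultimately show ?thesis using count_integral_measurable[of "\<lambda>p. fst (snd p)" ?N "\<lambda>p. f (fst (fst p), fst (snd (fst p)) - {snd p}, (snd (snd (fst p)))(k := snd p))"]
    by simp
qed

text \<open>The parameter w lets both the configuration and the summand depend on further variables.
  The iteration uses it with w a configuration together with one of its points and \<open>g\<close>
  the removal of that point.\<close>

lemma camp_measurable_param:
  fixes f :: "'w \<times> 'a set \<times> (nat \<Rightarrow> 'a) \<Rightarrow> ennreal"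
  assumes g: "g \<in> measurable N GammaM"
    and "f \<in> borel_measurable (N \<Otimes>\<^sub>M (GammaM \<Otimes>\<^sub>M PiM {..<k} (\<lambda>_. borel)))"
  shows "(\<lambda>w. camp k (g w) (\<lambda>\<gamma> x. f (w, \<gamma>, x))) \<in> borel_measurable N"
  using assms(2)
proof (induction k arbitrary: f)
  case 0
  have "(\<lambda>_. undefined) \<in> space (PiM {..<0} (\<lambda>_. borel :: 'a measure))" by (simp add: space_PiM PiE_def extensional_def)
  then have "(\<lambda>w. (\<lambda>_. undefined)) \<in> measurable N (PiM {..<0} (\<lambda>_. borel :: 'a measure))"
    by (rule measurable_const)
  then have "(\<lambda>w. (w, g w, (\<lambda>_. undefined))) \<in> measurable N (N \<Otimes>\<^sub>M (GammaM \<Otimes>\<^sub>M PiM {..<0} (\<lambda>_. borel :: 'a measure)))"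
    using g by (intro measurable_Pair) auto
  from measurable_compose[OF this 0] show ?case unfolding camp_0 by simp
next
  case (Suc k)
  show ?case
    unfolding camp_Suc using Suc.IH[OF count_step_measurable[OF Suc.prems]] by simp
qed

lemma camp_measurable:
  fixes f :: "'a set \<times> (nat \<Rightarrow> 'a) \<Rightarrow> ennreal"
  assumes "f \<in> borel_measurable (GammaM \<Otimes>\<^sub>M PiM {..<k} (\<lambda>_. borel))"
  shows "(\<lambda>\<gamma>. camp k \<gamma> (\<lambda>\<gamma> x. f (\<gamma>, x))) \<in> borel_measurable GammaM"
proof -
  have "(\<lambda>p. f (snd p)) \<in> borel_measurable (GammaM \<Otimes>\<^sub>M (GammaM \<Otimes>\<^sub>M PiM {..<k} (\<lambda>_. borel)))"
    using measurable_compose[OF measurable_snd assms] .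
  from camp_measurable_param[OF measurable_ident_sets[OF refl] this] show ?thesis by simp
qed

lemma Inj_countable: "\<gamma> \<in> Gamma \<Longrightarrow> countable (Inj k (\<gamma> :: 'a set))"
  unfolding Inj_def using Gamma_countable[of \<gamma>]
  by (intro countable_subset[OF _ countable_PiE[of "{..<k}" "\<lambda>_. \<gamma>"]]) auto

end

section \<open>Consequences of the Georgii-Nguyen-Zessin identity\<close>

locale gnz_space = bump_space space_type
  for space_type :: "'a::{t2_space, second_countable_topology} itself" +
  fixes m :: "'a measure" and \<mu> :: "'a set measure" and \<sigma> :: "'a set \<Rightarrow> 'a measure"
  assumes prob: "prob_space \<mu>"
    and sets_mu[measurable_cong]: "sets \<mu> = sets GammaM"
    and moments: "\<And>k \<phi>. \<phi> \<in> C0 \<Longrightarrow> (\<And>x. 0 \<le> \<phi> x) \<Longrightarrow> (\<integral>\<^sup>+\<gamma>. ennreal (pairing \<phi> \<gamma> ^ k) \<partial>\<mu>) < \<infinity>"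
    and sets_sigma: "\<And>\<gamma>. \<gamma> \<in> Gamma \<Longrightarrow> sets (\<sigma> \<gamma>) = sets borel"
    and sigma_measurable: "\<And>A. A \<in> sets borel \<Longrightarrow> (\<lambda>\<gamma>. emeasure (\<sigma> \<gamma>) A) \<in> borel_measurable GammaM"
    and gnz: "\<And>F. F \<in> borel_measurable (GammaM \<Otimes>\<^sub>M borel) \<Longrightarrow> (\<And>z. 0 \<le> F z) \<Longrightarrow>
        (\<integral>\<^sup>+\<gamma>. (\<integral>\<^sup>+x. ennreal (F (\<gamma>, x)) \<partial>count_space \<gamma>) \<partial>\<mu>) =
        (\<integral>\<^sup>+\<gamma>. (\<integral>\<^sup>+x. ennreal (F (insert x \<gamma>, x)) \<partial>\<sigma> \<gamma>) \<partial>\<mu>)"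
    and abs_cont: "AE \<gamma> in \<mu>. absolutely_continuous m (\<sigma> \<gamma>)"
    and sets_m: "sets m = sets borel"
    and m_singleton: "\<And>x. emeasure m {x} = 0"
begin

lemma space_mu: "space \<mu> = Gamma"
  using sets_eq_imp_space_eq[OF sets_mu] by simp

definition good :: "'a set \<Rightarrow> bool" where
  "good \<gamma> \<longleftrightarrow> (\<forall>C. compact C \<longrightarrow> emeasure (\<sigma> \<gamma>) C < \<infinity>)"

text \<open>A version of \<sigma> that is locally finite for every configuration. It differs from
  \<sigma> only where \<open>good\<close> fails, a null set by \<open>AE_good\<close>, and it
  satisfies the hypotheses of \<open>kernel_measurable\<close> without exception.\<close>

definition sg :: "'a set \<Rightarrow> 'a measure" where
  "sg \<gamma> = (if good \<gamma> then \<sigma> \<gamma> else null_measure borel)"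

lemma good_exhaustion:
  obtains U :: "nat \<Rightarrow> 'a set" where "\<And>i. compact (U i)"
    "\<And>\<gamma>. \<gamma> \<in> Gamma \<Longrightarrow> good \<gamma> \<longleftrightarrow> (\<forall>i. emeasure (\<sigma> \<gamma>) (U i) < \<infinity>)"
proof -
  obtain U where U: "\<And>i. open (U i)" "\<And>i. compact (closure (U i))" "incseq U" "(\<Union>i::nat. U i) = (UNIV::'a set)"
    using exhaustion by blast
  show ?thesis
  proof (rule that[of "\<lambda>i. closure (U i)", OF U(2)])
    fix \<gamma> :: "'a set" assume g: "\<gamma> \<in> Gamma"
    have "emeasure (\<sigma> \<gamma>) C < \<infinity>" if fin: "\<forall>i. emeasure (\<sigma> \<gamma>) (closure (U i)) < \<infinity>" and C: "compact C" for C
    proof -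
      have "C \<subseteq> \<Union>(range U)" using U(4) by simp
      then obtain D where D: "D \<subseteq> range U" "finite D" "C \<subseteq> \<Union>D"
        using compactE[OF C, of "range U"] U(1) by (metis imageE)
      then obtain I where I: "finite I" "D = U ` I" by (meson finite_subset_image)
      obtain n where n: "\<forall>i\<in>I. i \<le> n" using I(1) by (meson finite_nat_set_iff_bounded_le)
      have "\<Union>D \<subseteq> U n" using I n U(3) by (auto simp: incseq_def)
      then have "C \<subseteq> closure (U n)" using D(3) closure_subset[of "U n"] by blast
      then have "emeasure (\<sigma> \<gamma>) C \<le> emeasure (\<sigma> \<gamma>) (closure (U n))"
        using sets_sigma[OF g] by (intro emeasure_mono) auto
      then show ?thesis using fin by (meson le_less_trans)
    qed
    then show "good \<gamma> \<longleftrightarrow> (\<forall>i. emeasure (\<sigma> \<gamma>) (closure (U i)) < \<infinity>)"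
      unfolding good_def using U(2) by blast
  qed
qed

lemma good_measurable[measurable]: "Measurable.pred GammaM good"
proof -
  obtain U :: "nat \<Rightarrow> 'a set" where U: "\<And>i. compact (U i)"
    "\<And>\<gamma>. \<gamma> \<in> Gamma \<Longrightarrow> good \<gamma> \<longleftrightarrow> (\<forall>i. emeasure (\<sigma> \<gamma>) (U i) < \<infinity>)"
    using good_exhaustion by blast
  have [measurable]: "(\<lambda>\<gamma>. emeasure (\<sigma> \<gamma>) (U i)) \<in> borel_measurable GammaM" for i
    using sigma_measurable U(1) by (auto simp: borel_compact)
  have "Measurable.pred GammaM (\<lambda>\<gamma>. \<forall>i. emeasure (\<sigma> \<gamma>) (U i) < \<infinity>)" by measurable
  moreover have "good \<gamma> = (\<forall>i. emeasure (\<sigma> \<gamma>) (U i) < \<infinity>)" if "\<gamma> \<in> space GammaM" for \<gamma>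
    using U(2) that by simp
  ultimately show ?thesis by (subst measurable_cong)
qed

lemma sets_sg: "\<gamma> \<in> Gamma \<Longrightarrow> sets (sg \<gamma>) = sets borel"
  by (simp add: sg_def sets_sigma)

lemma sg_kernel_measurable:
  fixes f :: "'w \<times> 'a \<Rightarrow> ennreal"
  assumes g: "g \<in> measurable N GammaM" and f: "f \<in> borel_measurable (N \<Otimes>\<^sub>M borel)"
  shows "(\<lambda>w. \<integral>\<^sup>+x. f (w, x) \<partial>sg (g w)) \<in> borel_measurable N"
proof (rule kernel_measurable[OF _ _ _ f])
  have G: "g w \<in> Gamma" if "w \<in> space N" for w using measurable_space[OF g that] by simp
  show "sets (sg (g w)) = sets borel" if "w \<in> space N" for w using sets_sg[OF G[OF that]] .
  show "emeasure (sg (g w)) C < \<infinity>" if "w \<in> space N" "compact C" for w C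
    using that by (simp add: sg_def good_def)
  fix A :: "'a set" assume "A \<in> sets borel"
  then have [measurable]: "(\<lambda>\<gamma>. emeasure (\<sigma> \<gamma>) A) \<in> borel_measurable GammaM" by (rule sigma_measurable)
  have "(\<lambda>\<gamma>. if good \<gamma> then emeasure (\<sigma> \<gamma>) A else 0) \<in> borel_measurable GammaM" by measurable
  moreover have "emeasure (sg \<gamma>) A = (if good \<gamma> then emeasure (\<sigma> \<gamma>) A else 0)" for \<gamma> by (simp add: sg_def)
  ultimately have "(\<lambda>\<gamma>. emeasure (sg \<gamma>) A) \<in> borel_measurable GammaM" by simp
  then show "(\<lambda>w. emeasure (sg (g w)) A) \<in> borel_measurable N" using g by simp
qed

text \<open>For compact U the identity equates the mean of \<open>\<sigma> \<gamma> U\<close> with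
  the mean number of points in U. The latter is at most the first moment of a \<open>C0\<close>
  function that is at least 1 on U. So \<open>\<sigma> \<gamma> U\<close> is almost surely finite,
  and countably many U suffice.\<close>

lemma AE_good: "AE \<gamma> in \<mu>. good \<gamma>"
proof -
  obtain U :: "nat \<Rightarrow> 'a set" where U: "\<And>i. compact (U i)"
    "\<And>\<gamma>. \<gamma> \<in> Gamma \<Longrightarrow> good \<gamma> \<longleftrightarrow> (\<forall>i. emeasure (\<sigma> \<gamma>) (U i) < \<infinity>)"
    using good_exhaustion by blast
  have "AE \<gamma> in \<mu>. emeasure (\<sigma> \<gamma>) (U i) < \<infinity>" for i
  proof -
    have [measurable]: "U i \<in> sets borel" using U(1) by (auto simp: borel_compact)
    obtain \<phi> where \<phi>: "\<phi> \<in> C0" "\<And>x. 0 \<le> \<phi> x" "\<And>x. x \<in> U i \<Longrightarrow> 1 \<le> \<phi> x" using C0_ge_1[OF U(1)] by blast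
    have "(\<lambda>z. indicator (U i) (snd z)) \<in> borel_measurable (GammaM \<Otimes>\<^sub>M (borel :: 'a measure))" by measurable
    have "(\<integral>\<^sup>+\<gamma>. emeasure (\<sigma> \<gamma>) (U i) \<partial>\<mu>) = (\<integral>\<^sup>+\<gamma>. (\<integral>\<^sup>+x. indicator (U i) x \<partial>\<sigma> \<gamma>) \<partial>\<mu>)"
      by (intro nn_integral_cong) (simp add: space_mu sets_sigma)
    also have "\<dots> = (\<integral>\<^sup>+\<gamma>. cnt (U i) \<gamma> \<partial>\<mu>)"
      using gnz[OF \<open>_ \<in> borel_measurable (GammaM \<Otimes>\<^sub>M (borel :: 'a measure))\<close>]
      unfolding cnt_def by (simp add: ennreal_indicator)
    also have "\<dots> \<le> (\<integral>\<^sup>+\<gamma>. ennreal (pairing \<phi> \<gamma> ^ 1) \<partial>\<mu>)"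
    proof (rule nn_integral_mono)
      fix \<gamma> assume "\<gamma> \<in> space \<mu>"
      then have g: "\<gamma> \<in> Gamma" by (simp add: space_mu)
      have "cnt (U i) \<gamma> \<le> (\<integral>\<^sup>+x. ennreal (\<phi> x) \<partial>count_space \<gamma>)"
        unfolding cnt_def using \<phi> by (intro nn_integral_mono) (auto simp: indicator_def)
      then show "cnt (U i) \<gamma> \<le> ennreal (pairing \<phi> \<gamma> ^ 1)"
        using nn_integral_count_pairing[OF g \<phi>(1,2)] by simp
    qed
    also have "\<dots> < \<infinity>" by (rule moments[OF \<phi>(1,2)])
    finally have fin: "(\<integral>\<^sup>+\<gamma>. emeasure (\<sigma> \<gamma>) (U i) \<partial>\<mu>) \<noteq> \<infinity>" by simp
    have [measurable]: "(\<lambda>\<gamma>. emeasure (\<sigma> \<gamma>) (U i)) \<in> borel_measurable \<mu>"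
      using sigma_measurable[of "U i"] by measurable
    show ?thesis using nn_integral_PInf_AE[OF _ fin] by (auto simp: less_top)
  qed
  then have *: "AE \<gamma> in \<mu>. \<forall>i. emeasure (\<sigma> \<gamma>) (U i) < \<infinity>" by (simp add: AE_all_countable)
  show ?thesis by (rule AE_mp[OF *], rule AE_I2) (use U(2) in \<open>auto simp: space_mu\<close>)
qed

lemma AE_sg: "AE \<gamma> in \<mu>. sg \<gamma> = \<sigma> \<gamma>"
  using AE_good by eventually_elim (simp add: sg_def)

lemma gnz_ennreal:
  fixes F :: "'a set \<times> 'a \<Rightarrow> ennreal"
  assumes F[measurable]: "F \<in> borel_measurable (GammaM \<Otimes>\<^sub>M borel)"
  shows "(\<integral>\<^sup>+\<gamma>. (\<integral>\<^sup>+x. F (\<gamma>, x) \<partial>count_space \<gamma>) \<partial>\<mu>) = (\<integral>\<^sup>+\<gamma>. (\<integral>\<^sup>+x. F (insert x \<gamma>, x) \<partial>sg \<gamma>) \<partial>\<mu>)"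
proof -
  \<comment> \<open>The assumed identity concerns real-valued integrands. Truncation at n makes F
    real-valued, and monotone convergence on both sides removes it.\<close>
  define G where "G n z = enn2real (min (F z) (of_nat n))" for n z
  have Gm[measurable]: "G n \<in> borel_measurable (GammaM \<Otimes>\<^sub>M borel)" for n unfolding G_def by measurable
  have G: "ennreal (G n z) = min (F z) (of_nat n)" for n z
    unfolding G_def by (intro ennreal_enn2real) (simp add: min_less_iff_disj of_nat_less_top)
  have sup: "F z = (SUP n. ennreal (G n z))" for z
    unfolding G using ennreal_SUP_of_nat_eq_top
    by (simp only: inf_min[symmetric] inf_SUP[symmetric] inf_top_right)
  have inc: "incseq (\<lambda>n. ennreal (G n z))" for z
    unfolding G incseq_def by (intro allI impI min.mono) (auto simp: of_nat_mono)
  have ins: "(\<lambda>p. (insert (snd p) (fst p), snd p)) \<in> measurable (GammaM \<Otimes>\<^sub>M borel) (GammaM \<Otimes>\<^sub>M (borel :: 'a measure))"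
    using measurable_insert_Gamma by measurable
  have Gins: "(\<lambda>p. ennreal (G n (insert (snd p) (fst p), snd p))) \<in> borel_measurable (GammaM \<Otimes>\<^sub>M (borel :: 'a measure))" for n
    using measurable_compose[OF ins, of "\<lambda>z. ennreal (G n z)"] by simp
  have c: "(\<integral>\<^sup>+x. F (\<gamma>, x) \<partial>count_space \<gamma>) = (SUP n. \<integral>\<^sup>+x. ennreal (G n (\<gamma>, x)) \<partial>count_space \<gamma>)" for \<gamma>
    unfolding sup using inc by (intro nn_integral_monotone_convergence_SUP) (auto simp: incseq_def le_fun_def)
  have s: "(\<integral>\<^sup>+x. F (insert x \<gamma>, x) \<partial>sg \<gamma>) = (SUP n. \<integral>\<^sup>+x. ennreal (G n (insert x \<gamma>, x)) \<partial>sg \<gamma>)" if "\<gamma> \<in> Gamma" for \<gamma>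
    unfolding sup
  proof (rule nn_integral_monotone_convergence_SUP)
    show "incseq (\<lambda>n x. ennreal (G n (insert x \<gamma>, x)))" using inc by (auto simp: incseq_def le_fun_def)
    show "(\<lambda>x. ennreal (G n (insert x \<gamma>, x))) \<in> borel_measurable (sg \<gamma>)" for n
      using measurable_Pair2[OF Gins[of n], of \<gamma>] that sets_sg[OF that] by (simp cong: measurable_cong_sets)
  qed
  have "(\<integral>\<^sup>+\<gamma>. (\<integral>\<^sup>+x. F (\<gamma>, x) \<partial>count_space \<gamma>) \<partial>\<mu>) = (SUP n. \<integral>\<^sup>+\<gamma>. (\<integral>\<^sup>+x. ennreal (G n (\<gamma>, x)) \<partial>count_space \<gamma>) \<partial>\<mu>)"
    unfolding c
  proof (rule nn_integral_monotone_convergence_SUP)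
    show "incseq (\<lambda>n \<gamma>. \<integral>\<^sup>+x. ennreal (G n (\<gamma>, x)) \<partial>count_space \<gamma>)"
      using inc by (auto simp: incseq_def le_fun_def intro!: nn_integral_mono)
    show "(\<lambda>\<gamma>. \<integral>\<^sup>+x. ennreal (G n (\<gamma>, x)) \<partial>count_space \<gamma>) \<in> borel_measurable \<mu>" for n
      using count_integral_measurable[of "\<lambda>\<gamma>. \<gamma>" GammaM "\<lambda>z. ennreal (G n z)"] sets_mu by (simp cong: measurable_cong_sets)
  qed
  also have "\<dots> = (SUP n. \<integral>\<^sup>+\<gamma>. (\<integral>\<^sup>+x. ennreal (G n (insert x \<gamma>, x)) \<partial>\<sigma> \<gamma>) \<partial>\<mu>)"
    by (subst gnz) (auto simp: G_def)
  also have "\<dots> = (SUP n. \<integral>\<^sup>+\<gamma>. (\<integral>\<^sup>+x. ennreal (G n (insert x \<gamma>, x)) \<partial>sg \<gamma>) \<partial>\<mu>)"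
    using AE_sg by (intro SUP_cong refl nn_integral_cong_AE) (auto elim!: eventually_mono)
  also have "\<dots> = (\<integral>\<^sup>+\<gamma>. (SUP n. \<integral>\<^sup>+x. ennreal (G n (insert x \<gamma>, x)) \<partial>sg \<gamma>) \<partial>\<mu>)"
  proof (rule nn_integral_monotone_convergence_SUP[symmetric])
    show "incseq (\<lambda>n \<gamma>. \<integral>\<^sup>+x. ennreal (G n (insert x \<gamma>, x)) \<partial>sg \<gamma>)"
      using inc by (auto simp: incseq_def le_fun_def intro!: nn_integral_mono)
    show "(\<lambda>\<gamma>. \<integral>\<^sup>+x. ennreal (G n (insert x \<gamma>, x)) \<partial>sg \<gamma>) \<in> borel_measurable \<mu>" for n
      using sg_kernel_measurable[of "\<lambda>\<gamma>. \<gamma>" GammaM, OF _ Gins[of n]] sets_mu by (simp cong: measurable_cong_sets)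
  qed
  also have "\<dots> = (\<integral>\<^sup>+\<gamma>. (\<integral>\<^sup>+x. F (insert x \<gamma>, x) \<partial>sg \<gamma>) \<partial>\<mu>)"
    by (intro nn_integral_cong) (simp add: s space_mu)
  finally show ?thesis .
qed

text \<open>A configuration is countable and single points are null for the volume, so \<gamma> is a
  null set for m and, by absolute continuity, for \<open>\<sigma> \<gamma>\<close>.\<close>

lemma AE_not_mem: "AE \<gamma> in \<mu>. AE x in sg \<gamma>. x \<notin> \<gamma>"
proof -
  have *: "AE \<gamma> in \<mu>. absolutely_continuous m (\<sigma> \<gamma>) \<and> sg \<gamma> = \<sigma> \<gamma>" using abs_cont AE_sg by eventually_elim simp
  show ?thesis
  proof (rule AE_mp[OF *], rule AE_I2, rule impI)
    fix \<gamma> assume g: "\<gamma> \<in> space \<mu>" "absolutely_continuous m (\<sigma> \<gamma>) \<and> sg \<gamma> = \<sigma> \<gamma>"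
    then have G: "\<gamma> \<in> Gamma" by (simp add: space_mu)
    have "{x} \<in> null_sets m" for x using m_singleton sets_m by (auto simp: null_sets_def)
    then have "(\<Union>x\<in>\<gamma>. {x}) \<in> null_sets m" using Gamma_countable[OF G] by (intro null_sets_UN') auto
    then have "\<gamma> \<in> null_sets (sg \<gamma>)" using g by (auto simp: absolutely_continuous_def)
    then show "AE x in sg \<gamma>. x \<notin> \<gamma>" by (rule AE_not_in)
  qed
qed

lemma sigma_int_mono: "(\<And>x. f x \<le> g x) \<Longrightarrow> sigma_int \<sigma> k \<gamma> f \<le> sigma_int \<sigma> k \<gamma> g"
proof (induction k arbitrary: f g)
  case (Suc k)
  show ?case unfolding sigma_int.simps by (intro Suc.IH nn_integral_mono Suc.prems)
qed simp

lemma union_measurable: "(\<lambda>p. fst p \<union> snd p ` {..<k::nat}) \<in> measurable (GammaM \<Otimes>\<^sub>M PiM {..<k} (\<lambda>_. borel :: 'a measure)) GammaM"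
proof -
  have "i \<le> k \<Longrightarrow> (\<lambda>p. fst p \<union> snd p ` {..<i}) \<in> measurable (GammaM \<Otimes>\<^sub>M PiM {..<k} (\<lambda>_. borel :: 'a measure)) GammaM" for i
  proof (induction i)
    case 0 show ?case by simp
  next
    case (Suc i)
    have "(\<lambda>p. (fst p \<union> snd p ` {..<i}, snd p i)) \<in> measurable (GammaM \<Otimes>\<^sub>M PiM {..<k} (\<lambda>_. borel :: 'a measure)) (GammaM \<Otimes>\<^sub>M borel)"
      using Suc by (intro measurable_Pair) (auto intro!: measurable_compose[OF measurable_snd measurable_component_singleton])
    from measurable_compose[OF this measurable_insert_Gamma] show ?case by (simp add: lessThan_Suc)
  qed
  then show ?thesis by simp
qed

text \<open>The induction step squeezes the possibly non-measurable integral against \<open>\<sigma>\<close> between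
  measurable ones that only differ on the null set of configurations that are not \<open>good\<close>.\<close>

lemma sigma_int_camp:
  fixes f :: "'a set \<times> (nat \<Rightarrow> 'a) \<Rightarrow> ennreal"
  assumes "f \<in> borel_measurable (GammaM \<Otimes>\<^sub>M PiM {..<k} (\<lambda>_. borel))"
  shows "(\<integral>\<^sup>+\<gamma>. sigma_int \<sigma> k \<gamma> (\<lambda>x. f (\<gamma>, x)) \<partial>\<mu>) = (\<integral>\<^sup>+\<gamma>. camp k \<gamma> (\<lambda>\<gamma> x. f (\<gamma>, x)) \<partial>\<mu>)"
  using assms
proof (induction k arbitrary: f)
  case 0 show ?case by (simp add: camp_0)
next
  case (Suc k)
  note f[measurable] = Suc.prems
  let ?P = "GammaM \<Otimes>\<^sub>M PiM {..<k} (\<lambda>_. borel :: 'a measure)"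
  let ?u = "\<lambda>p :: 'a set \<times> (nat \<Rightarrow> 'a). fst p \<union> snd p ` {..<k}"
  define h where "h p = (\<integral>\<^sup>+y. f (fst p, (snd p)(k := y)) \<partial>\<sigma> (?u p))" for p
  define h' where "h' p = (\<integral>\<^sup>+y. f (fst p, (snd p)(k := y)) \<partial>sg (?u p))" for p
  define h'' where "h'' p = h' p + (if good (?u p) then 0 else \<infinity>)" for p
  have "(\<lambda>p. (fst (fst p), (snd (fst p), snd p))) \<in> measurable (?P \<Otimes>\<^sub>M (borel :: 'a measure)) (GammaM \<Otimes>\<^sub>M (PiM {..<k} (\<lambda>_. borel) \<Otimes>\<^sub>M borel))"
    by measurable
  then have "(\<lambda>p. (fst (fst p), (snd (fst p))(k := snd p))) \<in> measurable (?P \<Otimes>\<^sub>M (borel :: 'a measure)) (GammaM \<Otimes>\<^sub>M PiM {..<Suc k} (\<lambda>_. borel))"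
    by (intro measurable_Pair measurable_compose[OF _ measurable_upd, of "\<lambda>p. (snd (fst p), snd p)", simplified]) measurable
  from measurable_compose[OF this f]
  have fm: "(\<lambda>p. f (fst (fst p), (snd (fst p))(k := snd p))) \<in> borel_measurable (?P \<Otimes>\<^sub>M (borel :: 'a measure))" by simp
  have h'm[measurable]: "h' \<in> borel_measurable ?P"
    unfolding h'_def[abs_def] using sg_kernel_measurable[OF union_measurable fm] by simp
  have [measurable]: "Measurable.pred ?P (\<lambda>p. good (?u p))"
    using measurable_compose[OF union_measurable good_measurable] .
  have h''m[measurable]: "h'' \<in> borel_measurable ?P" unfolding h''_def by measurable
  have le: "h' p \<le> h p" "h p \<le> h'' p" for p
    unfolding h_def h'_def h''_def by (auto simp: sg_def)
  \<comment> \<open>In \<open>camp\<close> the points of x are first removed from \<gamma> and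
    \<open>?u\<close> puts them back, so the infinite penalty in \<open>h''\<close> tests whether
    \<gamma> itself is good.\<close>
  have camp_eq: "AE \<gamma> in \<mu>. camp k \<gamma> (\<lambda>\<gamma> x. h'' (\<gamma>, x)) = camp k \<gamma> (\<lambda>\<gamma> x. h' (\<gamma>, x))"
  proof (rule AE_mp[OF AE_good], intro AE_I2 impI camp_cong)
    fix \<gamma> x assume "good \<gamma>" "x \<in> Inj k \<gamma>"
    then have "\<gamma> - x ` {..<k} \<union> x ` {..<k} = \<gamma>" by (auto simp: Inj_def)
    then show "h'' (\<gamma> - x ` {..<k}, x) = h' (\<gamma> - x ` {..<k}, x)" using \<open>good \<gamma>\<close> by (simp add: h''_def)
  qed
  have "(\<integral>\<^sup>+\<gamma>. sigma_int \<sigma> k \<gamma> (\<lambda>x. h (\<gamma>, x)) \<partial>\<mu>) = (\<integral>\<^sup>+\<gamma>. camp k \<gamma> (\<lambda>\<gamma> x. h' (\<gamma>, x)) \<partial>\<mu>)"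
  proof (rule antisym)
    have "(\<integral>\<^sup>+\<gamma>. sigma_int \<sigma> k \<gamma> (\<lambda>x. h (\<gamma>, x)) \<partial>\<mu>) \<le> (\<integral>\<^sup>+\<gamma>. sigma_int \<sigma> k \<gamma> (\<lambda>x. h'' (\<gamma>, x)) \<partial>\<mu>)"
      by (intro nn_integral_mono sigma_int_mono le)
    also have "\<dots> = (\<integral>\<^sup>+\<gamma>. camp k \<gamma> (\<lambda>\<gamma> x. h'' (\<gamma>, x)) \<partial>\<mu>)" by (rule Suc.IH) measurable
    also have "\<dots> = (\<integral>\<^sup>+\<gamma>. camp k \<gamma> (\<lambda>\<gamma> x. h' (\<gamma>, x)) \<partial>\<mu>)" by (rule nn_integral_cong_AE[OF camp_eq])
    finally show "(\<integral>\<^sup>+\<gamma>. sigma_int \<sigma> k \<gamma> (\<lambda>x. h (\<gamma>, x)) \<partial>\<mu>) \<le> \<dots>" .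
    have "(\<integral>\<^sup>+\<gamma>. camp k \<gamma> (\<lambda>\<gamma> x. h' (\<gamma>, x)) \<partial>\<mu>) = (\<integral>\<^sup>+\<gamma>. sigma_int \<sigma> k \<gamma> (\<lambda>x. h' (\<gamma>, x)) \<partial>\<mu>)"
      by (rule Suc.IH[symmetric]) measurable
    also have "\<dots> \<le> (\<integral>\<^sup>+\<gamma>. sigma_int \<sigma> k \<gamma> (\<lambda>x. h (\<gamma>, x)) \<partial>\<mu>)"
      by (intro nn_integral_mono sigma_int_mono le)
    finally show "(\<integral>\<^sup>+\<gamma>. camp k \<gamma> (\<lambda>\<gamma> x. h' (\<gamma>, x)) \<partial>\<mu>) \<le> \<dots>" .
  qed
  then have "(\<integral>\<^sup>+\<gamma>. sigma_int \<sigma> (Suc k) \<gamma> (\<lambda>x. f (\<gamma>, x)) \<partial>\<mu>) = (\<integral>\<^sup>+\<gamma>. camp k \<gamma> (\<lambda>\<gamma> x. h' (\<gamma>, x)) \<partial>\<mu>)"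
    by (simp add: h_def)
  also have "\<dots> = (\<integral>\<^sup>+\<gamma>. (\<integral>\<^sup>+y. camp k \<gamma> (\<lambda>\<gamma>' x. f (\<gamma>', x(k := y))) \<partial>sg \<gamma>) \<partial>\<mu>)"
  proof (rule nn_integral_cong)
    fix \<gamma> assume "\<gamma> \<in> space \<mu>"
    then have G: "\<gamma> \<in> Gamma" by (simp add: space_mu)
    have "camp k \<gamma> (\<lambda>\<gamma> x. h' (\<gamma>, x)) = (\<integral>\<^sup>+x. \<integral>\<^sup>+y. f (\<gamma> - x ` {..<k}, x(k := y)) \<partial>sg \<gamma> \<partial>count_space (Inj k \<gamma>))"
      unfolding camp_def h'_def
    proof (rule nn_integral_cong)
      fix x assume "x \<in> space (count_space (Inj k \<gamma>))"
      then have "\<gamma> - x ` {..<k} \<union> x ` {..<k} = \<gamma>" by (auto simp: Inj_def)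
      then show "(\<integral>\<^sup>+y. f (fst (\<gamma> - x ` {..<k}, x), (snd (\<gamma> - x ` {..<k}, x))(k := y)) \<partial>sg (fst (\<gamma> - x ` {..<k}, x) \<union> snd (\<gamma> - x ` {..<k}, x) ` {..<k}))
        = (\<integral>\<^sup>+y. f (\<gamma> - x ` {..<k}, x(k := y)) \<partial>sg \<gamma>)" by simp
    qed
    \<comment> \<open>The tuples form a countable set, so this exchanges a series with an integral
      of nonnegative functions.\<close>
    also have "\<dots> = (\<integral>\<^sup>+y. \<integral>\<^sup>+x. f (\<gamma> - x ` {..<k}, x(k := y)) \<partial>count_space (Inj k \<gamma>) \<partial>sg \<gamma>)"
    proof (rule nn_integral_count_space_nn_integral[symmetric, OF Inj_countable[OF G]])
      fix x assume "x \<in> Inj k \<gamma>"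
      then have "(\<gamma> - x ` {..<k}, x) \<in> space ?P"
        using Gamma_subset[OF G] by (auto simp: space_pair_measure space_PiM Inj_def PiE_def)
      from measurable_Pair2[OF fm this] show "(\<lambda>y. f (\<gamma> - x ` {..<k}, x(k := y))) \<in> borel_measurable (sg \<gamma>)"
        using sets_sg[OF G] by (simp cong: measurable_cong_sets)
    qed
    finally show "camp k \<gamma> (\<lambda>\<gamma> x. h' (\<gamma>, x)) = (\<integral>\<^sup>+y. camp k \<gamma> (\<lambda>\<gamma>' x. f (\<gamma>', x(k := y))) \<partial>sg \<gamma>)"
      unfolding camp_def .
  qed
  \<comment> \<open>Almost surely y is no point of \<gamma>. Writing \<gamma> as
    \<open>insert y \<gamma> - {y}\<close> exhibits the integrand as a function of
    \<open>insert y \<gamma>\<close> and y, the shape required by the identity.\<close>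
  also have "\<dots> = (\<integral>\<^sup>+\<gamma>. (\<integral>\<^sup>+y. camp k (insert y \<gamma> - {y}) (\<lambda>\<gamma>' x. f (\<gamma>', x(k := y))) \<partial>sg \<gamma>) \<partial>\<mu>)"
  proof (rule nn_integral_cong_AE, rule AE_mp[OF AE_not_mem], rule AE_I2, rule impI)
    fix \<gamma> assume "AE x in sg \<gamma>. x \<notin> \<gamma>"
    then show "(\<integral>\<^sup>+y. camp k \<gamma> (\<lambda>\<gamma>' x. f (\<gamma>', x(k := y))) \<partial>sg \<gamma>) =
      (\<integral>\<^sup>+y. camp k (insert y \<gamma> - {y}) (\<lambda>\<gamma>' x. f (\<gamma>', x(k := y))) \<partial>sg \<gamma>)"
      by (intro nn_integral_cong_AE) (auto elim!: eventually_mono)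
  qed
  also have "\<dots> = (\<integral>\<^sup>+\<gamma>. (\<integral>\<^sup>+y. camp k (\<gamma> - {y}) (\<lambda>\<gamma>' x. f (\<gamma>', x(k := y))) \<partial>count_space \<gamma>) \<partial>\<mu>)"
  proof -
    have "(\<lambda>p. (fst (snd p), (snd (snd p), snd (fst p)))) \<in> measurable ((GammaM \<Otimes>\<^sub>M (borel :: 'a measure)) \<Otimes>\<^sub>M ?P) (GammaM \<Otimes>\<^sub>M (PiM {..<k} (\<lambda>_. borel) \<Otimes>\<^sub>M borel))"
      by measurable
    then have "(\<lambda>p. (fst (snd p), (snd (snd p))(k := snd (fst p)))) \<in> measurable ((GammaM \<Otimes>\<^sub>M (borel :: 'a measure)) \<Otimes>\<^sub>M ?P) (GammaM \<Otimes>\<^sub>M PiM {..<Suc k} (\<lambda>_. borel))"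
      by (intro measurable_Pair measurable_compose[OF _ measurable_upd, of "\<lambda>p. (snd (snd p), snd (fst p))", simplified]) measurable
    from measurable_compose[OF this f]
    have "(\<lambda>z. camp k (fst z - {snd z}) (\<lambda>\<gamma>' x. f (\<gamma>', x(k := snd z)))) \<in> borel_measurable (GammaM \<Otimes>\<^sub>M borel)"
      using camp_measurable_param[OF measurable_delete_Gamma, of "\<lambda>p. f (fst (snd p), (snd (snd p))(k := snd (fst p)))" k] by simp
    from gnz_ennreal[OF this] show ?thesis by simp
  qed
  also have "\<dots> = (\<integral>\<^sup>+\<gamma>. camp (Suc k) \<gamma> (\<lambda>\<gamma> x. f (\<gamma>, x)) \<partial>\<mu>)" by (simp add: camp_Suc')
  finally show ?case .
qed

section \<open>The measure \<open>mu_k\<close>\<close>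

lemma sets_mu_k[measurable_cong]: "sets (mu_k \<mu> \<sigma> k) = sets (GammaM \<Otimes>\<^sub>M PiM {..<k} (\<lambda>_. borel))"
  and space_mu_k: "space (mu_k \<mu> \<sigma> k) = Gamma \<times> PiE {..<k} (\<lambda>_. UNIV)"
  unfolding mu_k_def
  by (simp_all add: sets.sets_measure_of_eq sets.space_measure_of_eq, simp add: space_pair_measure space_PiM)

text \<open>\<open>measure_of\<close> returns the prescribed set function only if this is countably
  additive. For the iterated \<sigma>-integral that is obscured by possibly non-measurable inner
  integrals; for the equal Campbell sum it is the exchange of series with integrals.\<close>

lemma emeasure_mu_k:
  assumes "A \<in> sets (GammaM \<Otimes>\<^sub>M PiM {..<k} (\<lambda>_. borel))"
  shows "emeasure (mu_k \<mu> \<sigma> k) A = (\<integral>\<^sup>+\<gamma>. camp k \<gamma> (\<lambda>\<gamma> x. indicator A (\<gamma>, x)) \<partial>\<mu>)"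
proof -
  let ?P = "GammaM \<Otimes>\<^sub>M PiM {..<k} (\<lambda>_. borel :: 'a measure)"
  let ?f = "\<lambda>A. \<integral>\<^sup>+\<gamma>. sigma_int \<sigma> k \<gamma> (\<lambda>x. indicator A (\<gamma>, x)) \<partial>\<mu>"
  have eq: "?f A = (\<integral>\<^sup>+\<gamma>. camp k \<gamma> (\<lambda>\<gamma> x. indicator A (\<gamma>, x)) \<partial>\<mu>)" if "A \<in> sets ?P" for A
    using that by (intro sigma_int_camp) auto
  have m: "(\<lambda>\<gamma>. camp k \<gamma> (\<lambda>\<gamma> x. indicator A (\<gamma>, x))) \<in> borel_measurable \<mu>" if "A \<in> sets ?P" for A
    using camp_measurable[of "indicator A" k] that sets_mu by (simp cong: measurable_cong_sets)
  have "countably_additive (sets ?P) ?f"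
  proof (rule countably_additiveI)
    fix A :: "nat \<Rightarrow> ('a set \<times> (nat \<Rightarrow> 'a)) set" assume A: "range A \<subseteq> sets ?P" "disjoint_family A" "(\<Union>i. A i) \<in> sets ?P"
    have "(\<Sum>i. ?f (A i)) = (\<Sum>i. \<integral>\<^sup>+\<gamma>. camp k \<gamma> (\<lambda>\<gamma> x. indicator (A i) (\<gamma>, x)) \<partial>\<mu>)"
      using A(1) by (intro suminf_cong eq) auto
    also have "\<dots> = (\<integral>\<^sup>+\<gamma>. (\<Sum>i. camp k \<gamma> (\<lambda>\<gamma> x. indicator (A i) (\<gamma>, x))) \<partial>\<mu>)"
      using A(1) by (intro nn_integral_suminf[symmetric] m) auto
    also have "\<dots> = (\<integral>\<^sup>+\<gamma>. camp k \<gamma> (\<lambda>\<gamma> x. (\<Sum>i. indicator (A i) (\<gamma>, x))) \<partial>\<mu>)"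
      unfolding camp_def by (intro nn_integral_cong nn_integral_suminf[symmetric]) simp
    also have "\<dots> = (\<integral>\<^sup>+\<gamma>. camp k \<gamma> (\<lambda>\<gamma> x. indicator (\<Union>i. A i) (\<gamma>, x)) \<partial>\<mu>)"
      using suminf_indicator[OF A(2)] by simp
    also have "\<dots> = ?f (\<Union>i. A i)" using eq[OF A(3)] by simp
    finally show "(\<Sum>i. ?f (A i)) = ?f (\<Union>i. A i)" .
  qed
  moreover have "positive (sets ?P) ?f"
    using eq[of "{}"] by (simp add: positive_def camp_def)
  ultimately have "emeasure (mu_k \<mu> \<sigma> k) A = ?f A"
    using assms unfolding mu_k_def
    by (intro emeasure_measure_of_sigma sets.sigma_algebra_axioms) auto
  then show ?thesis using eq[OF assms] by simp
qed

lemma nn_integral_mu_k: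
  fixes f :: "'a set \<times> (nat \<Rightarrow> 'a) \<Rightarrow> ennreal"
  assumes "f \<in> borel_measurable (GammaM \<Otimes>\<^sub>M PiM {..<k} (\<lambda>_. borel))"
  shows "(\<integral>\<^sup>+p. f p \<partial>mu_k \<mu> \<sigma> k) = (\<integral>\<^sup>+\<gamma>. camp k \<gamma> (\<lambda>\<gamma> x. f (\<gamma>, x)) \<partial>\<mu>)"
  using assms
proof (induction rule: borel_measurable_induct)
  let ?P = "GammaM \<Otimes>\<^sub>M PiM {..<k} (\<lambda>_. borel :: 'a measure)"
  have m: "(\<lambda>\<gamma>. camp k \<gamma> (\<lambda>\<gamma> x. f (\<gamma>, x))) \<in> borel_measurable \<mu>" if "f \<in> borel_measurable ?P" for f
    using camp_measurable[of f k] that sets_mu by (simp cong: measurable_cong_sets)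
  have mk: "f \<in> borel_measurable (mu_k \<mu> \<sigma> k)" if "f \<in> borel_measurable ?P" for f :: "_ \<Rightarrow> ennreal"
    using that by (simp cong: measurable_cong_sets add: sets_mu_k)
  have sp: "(\<gamma> - x ` {..<k}, x) \<in> space ?P" if "\<gamma> \<in> space \<mu>" "x \<in> Inj k \<gamma>" for \<gamma> x
    using that Gamma_subset[of \<gamma>] by (auto simp: space_pair_measure space_PiM Inj_def PiE_def space_mu)
  {
    case (cong f g)
    have "(\<integral>\<^sup>+p. f p \<partial>mu_k \<mu> \<sigma> k) = (\<integral>\<^sup>+p. g p \<partial>mu_k \<mu> \<sigma> k)"
      using cong(3) by (intro nn_integral_cong) (simp add: space_mu_k space_pair_measure space_PiM)
    moreover have "(\<integral>\<^sup>+\<gamma>. camp k \<gamma> (\<lambda>\<gamma> x. f (\<gamma>, x)) \<partial>\<mu>) = (\<integral>\<^sup>+\<gamma>. camp k \<gamma> (\<lambda>\<gamma> x. g (\<gamma>, x)) \<partial>\<mu>)"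
      using cong(3) sp by (intro nn_integral_cong camp_cong) auto
    ultimately show ?case using cong(4) by simp
  next
    case (set A)
    then show ?case by (simp add: emeasure_mu_k sets_mu_k)
  next
    case (mult u c)
    then show ?case by (simp add: nn_integral_cmult mk m camp_cmult)
  next
    case (add u v)
    then show ?case by (simp add: nn_integral_add mk m camp_add)
  next
    case (seq U)
    have "(\<integral>\<^sup>+p. (SUP i. U i) p \<partial>mu_k \<mu> \<sigma> k) = (SUP i. \<integral>\<^sup>+p. U i p \<partial>mu_k \<mu> \<sigma> k)"
      using nn_integral_monotone_convergence_SUP[OF seq(3) mk[OF seq(1)]] by (simp add: image_comp)
    also have "\<dots> = (SUP i. \<integral>\<^sup>+\<gamma>. camp k \<gamma> (\<lambda>\<gamma> x. U i (\<gamma>, x)) \<partial>\<mu>)" using seq.IH by simp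
    also have "\<dots> = (\<integral>\<^sup>+\<gamma>. (SUP i. camp k \<gamma> (\<lambda>\<gamma> x. U i (\<gamma>, x))) \<partial>\<mu>)"
      using seq(3) by (intro nn_integral_monotone_convergence_SUP[symmetric] m seq(1))
        (auto simp: incseq_def le_fun_def intro!: camp_mono)
    also have "\<dots> = (\<integral>\<^sup>+\<gamma>. camp k \<gamma> (\<lambda>\<gamma> x. (SUP i. U i) (\<gamma>, x)) \<partial>\<mu>)"
      unfolding camp_def using seq(3)
      by (subst nn_integral_monotone_convergence_SUP[symmetric]) (auto simp: incseq_def le_fun_def image_comp)
    finally show ?case .
  }
qed

end

section \<open>Multilinear forms and symmetry of second derivatives\<close>

definition mlin :: "nat \<Rightarrow> ((real ^ 'n::finite) list \<Rightarrow> real) \<Rightarrow> bool" where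
  "mlin n A \<longleftrightarrow> (\<forall>vs j. length vs = n \<and> j < n \<longrightarrow> linear (\<lambda>v. A (vs[j := v])))"

lemma mlinD: "mlin n A \<Longrightarrow> length vs = n \<Longrightarrow> j < n \<Longrightarrow> linear (\<lambda>v. A (vs[j := v]))"
  by (simp add: mlin_def)

lemma mlin_Cons_linear:
  assumes "mlin (Suc n) A" "length vs = n" shows "linear (\<lambda>v. A (v # vs))"
  using mlinD[OF assms(1), of "undefined # vs" 0] assms(2) by simp

lemma mlin_Cons:
  fixes A :: "(real ^ 'n::finite) list \<Rightarrow> real"
  shows "mlin (Suc n) A \<Longrightarrow> mlin n (\<lambda>vs. A (v # vs))"
  unfolding mlin_def
proof (intro allI impI)
  fix vs :: "(real ^ 'n) list" and j
  assume *: "\<forall>vs j. length vs = Suc n \<and> j < Suc n \<longrightarrow> linear (\<lambda>v. A (vs[j := v]))" and "length vs = n \<and> j < n"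
  then show "linear (\<lambda>va. A (v # vs[j := va]))" using *[rule_format, of "v # vs" "Suc j"] by simp
qed

lemma linear_axis_expansion:
  fixes f :: "real ^ 'n::finite \<Rightarrow> 'b::real_vector"
  assumes "linear f" shows "f v = (\<Sum>a\<in>UNIV. v $ a *\<^sub>R f (axis a 1))"
proof -
  have "v = (\<Sum>a\<in>UNIV. v $ a *\<^sub>R axis a 1)"
    using basis_expansion[of v] by (simp add: scalar_mult_eq_scaleR)
  then have "f v = f (\<Sum>a\<in>UNIV. v $ a *\<^sub>R axis a 1)" by simp
  also have "\<dots> = (\<Sum>a\<in>UNIV. v $ a *\<^sub>R f (axis a 1))"
    using assms by (simp add: linear_sum linear_cmul)
  finally show ?thesis .
qed

lemma linear_axis_expansion_real:
  fixes f :: "real ^ 'n::finite \<Rightarrow> real"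
  assumes "linear f" shows "f v = (\<Sum>a\<in>UNIV. v $ a * f (axis a 1))"
  using linear_axis_expansion[OF assms, of v] by simp

lemma vec_nth_has_derivative:
  "(f has_derivative f') F \<Longrightarrow> ((\<lambda>x. f x $ i) has_derivative (\<lambda>u. f' u $ i)) F"
  by (rule bounded_linear.has_derivative[OF bounded_linear_vec_nth])

text \<open>The product rule for a multilinear form whose coefficients and arguments both move.
  Expanding the first argument in the standard basis reduces it to a finite sum of scalars times
  forms with one slot fewer, hence induction on the number of slots.\<close>

lemma mlin_has_derivative:
  fixes S :: "'p::real_normed_vector \<Rightarrow> (real ^ 'n::finite) list \<Rightarrow> real"
  assumes "open P" "p0 \<in> P" "\<And>p. p \<in> P \<Longrightarrow> mlin n (S p)"
    and "\<And>vs. length vs = n \<Longrightarrow> ((\<lambda>p. S p vs) has_derivative S' vs) (at p0)"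
    and "length fs = n" "length fs' = n" "\<And>j. j < n \<Longrightarrow> ((fs ! j) has_derivative (fs' ! j)) (at p0)"
  shows "((\<lambda>p. S p (map (\<lambda>f. f p) fs)) has_derivative
    (\<lambda>u. S' (map (\<lambda>f. f p0) fs) u + (\<Sum>j<n. S p0 ((map (\<lambda>f. f p0) fs)[j := (fs' ! j) u])))) (at p0)"
  using assms
proof (induction n arbitrary: S S' fs fs')
  case 0 then show ?case by simp
next
  case (Suc n)
  obtain f gs f' gs' where fs: "fs = f # gs" "fs' = f' # gs'" "length gs = n" "length gs' = n"
    using Suc.prems(5,6) by (metis length_Suc_conv)
  let ?r = "\<lambda>p. map (\<lambda>f. f p) gs"
  have f: "(f has_derivative f') (at p0)" using Suc.prems(7)[of 0] fs by simp
  have gs: "((gs ! j) has_derivative (gs' ! j)) (at p0)" if "j < n" for j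
    using Suc.prems(7)[of "Suc j"] that fs by simp
  let ?e = "\<lambda>a :: 'n. axis a (1::real)"
  define D where "D a u = S' (?e a # ?r p0) u + (\<Sum>j<n. S p0 (?e a # (?r p0)[j := (gs' ! j) u]))" for a u
  have IH: "((\<lambda>p. S p (?e a # ?r p)) has_derivative D a) (at p0)" for a
    unfolding D_def
    by (rule Suc.IH[where S="\<lambda>p vs. S p (?e a # vs)" and S'="\<lambda>vs. S' (?e a # vs)"])
       (use Suc.prems fs gs in \<open>auto intro: mlin_Cons\<close>)
  have "((\<lambda>p. \<Sum>a\<in>UNIV. f p $ a * S p (?e a # ?r p)) has_derivative
      (\<lambda>u. \<Sum>a\<in>UNIV. f p0 $ a * D a u + f' u $ a * S p0 (?e a # ?r p0))) (at p0)"
    by (intro has_derivative_sum has_derivative_mult vec_nth_has_derivative f IH)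
  moreover have "(\<Sum>a\<in>UNIV. f p $ a * S p (?e a # ?r p)) = S p (f p # ?r p)" if "p \<in> P" for p
    using linear_axis_expansion_real[OF mlin_Cons_linear[OF Suc.prems(3)[OF that]], of "?r p" "f p"] fs by simp
  ultimately have 1: "((\<lambda>p. S p (f p # ?r p)) has_derivative
      (\<lambda>u. \<Sum>a\<in>UNIV. f p0 $ a * D a u + f' u $ a * S p0 (?e a # ?r p0))) (at p0)"
    by (rule has_derivative_transform_within_open[OF _ Suc.prems(1,2)])
  have S'_exp: "S' (f p0 # ?r p0) u = (\<Sum>a\<in>UNIV. f p0 $ a * S' (?e a # ?r p0) u)" for u
  proof -
    have "((\<lambda>p. \<Sum>a\<in>UNIV. f p0 $ a * S p (?e a # ?r p0)) has_derivative
      (\<lambda>u. \<Sum>a\<in>UNIV. f p0 $ a * S' (?e a # ?r p0) u)) (at p0)"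
      using Suc.prems(4) fs by (intro has_derivative_sum has_derivative_mult_right) auto
    moreover have "(\<Sum>a\<in>UNIV. f p0 $ a * S p (?e a # ?r p0)) = S p (f p0 # ?r p0)" if "p \<in> P" for p
      using linear_axis_expansion_real[OF mlin_Cons_linear[OF Suc.prems(3)[OF that]], of "?r p0" "f p0"] fs by simp
    ultimately have "((\<lambda>p. S p (f p0 # ?r p0)) has_derivative
      (\<lambda>u. \<Sum>a\<in>UNIV. f p0 $ a * S' (?e a # ?r p0) u)) (at p0)"
      by (rule has_derivative_transform_within_open[OF _ Suc.prems(1,2)])
    from has_derivative_unique[OF Suc.prems(4)[of "f p0 # ?r p0"] this] fs show ?thesis by (auto dest: fun_cong)
  qed
  have S0: "mlin (Suc n) (S p0)" using Suc.prems(2,3) by blast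
  have exp0: "S p0 (v # vs) = (\<Sum>a\<in>UNIV. v $ a * S p0 (?e a # vs))" if "length vs = n" for v vs
    using linear_axis_expansion_real[OF mlin_Cons_linear[OF S0 that], of v] by simp
  have "(\<Sum>a\<in>UNIV. f p0 $ a * D a u + f' u $ a * S p0 (?e a # ?r p0)) =
      S' (f p0 # ?r p0) u + (\<Sum>j<Suc n. S p0 ((f p0 # ?r p0)[j := (fs' ! j) u]))" for u
  proof -
    have "(\<Sum>j<Suc n. S p0 ((f p0 # ?r p0)[j := (fs' ! j) u])) = S p0 (f' u # ?r p0) + (\<Sum>j<n. S p0 (f p0 # (?r p0)[j := (gs' ! j) u]))"
      unfolding sum.lessThan_Suc_shift fs by simp
    also have "(\<Sum>j<n. S p0 (f p0 # (?r p0)[j := (gs' ! j) u])) = (\<Sum>j<n. \<Sum>a\<in>UNIV. f p0 $ a * S p0 (?e a # (?r p0)[j := (gs' ! j) u]))"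
      using fs by (intro sum.cong refl exp0) simp
    also have "\<dots> = (\<Sum>a\<in>UNIV. f p0 $ a * (\<Sum>j<n. S p0 (?e a # (?r p0)[j := (gs' ! j) u])))"
      by (subst sum.swap) (simp add: sum_distrib_left)
    finally show ?thesis
      using exp0[of "?r p0" "f' u"] fs
      by (simp add: S'_exp D_def distrib_left sum.distrib)
  qed
  then have "(\<lambda>u. \<Sum>a\<in>UNIV. f p0 $ a * D a u + f' u $ a * S p0 (?e a # ?r p0)) =
      (\<lambda>u. S' (f p0 # ?r p0) u + (\<Sum>j<Suc n. S p0 ((f p0 # ?r p0)[j := (fs' ! j) u])))"
    by (rule ext)
  then show ?case unfolding fs(1) list.map using has_derivative_eq_rhs[OF 1] by blast
qed

text \<open>Additivity and homogeneity in a slot hold at every p near \<open>p0\<close>, and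
  differentiating these identities at \<open>p0\<close> preserves them.\<close>

lemma mlin_frechet_derivative:
  fixes S :: "'p::real_normed_vector \<Rightarrow> (real ^ 'n::finite) list \<Rightarrow> real"
  assumes "open P" "p0 \<in> P" "\<And>p. p \<in> P \<Longrightarrow> mlin n (S p)"
    and d: "\<And>vs. length vs = n \<Longrightarrow> (\<lambda>p. S p vs) differentiable (at p0)"
  shows "mlin n (\<lambda>vs. frechet_derivative (\<lambda>p. S p vs) (at p0) u)"
  unfolding mlin_def
proof (intro allI impI)
  fix vs :: "(real ^ 'n) list" and j
  assume vj: "length vs = n \<and> j < n"
  let ?D = "\<lambda>vs. frechet_derivative (\<lambda>p. S p vs) (at p0)"
  have D: "((\<lambda>p. S p (vs[j := v])) has_derivative ?D (vs[j := v])) (at p0)" for v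
    using d[of "vs[j := v]"] vj by (simp add: frechet_derivative_works)
  have lin: "linear (\<lambda>v. S p (vs[j := v]))" if "p \<in> P" for p using mlinD[OF assms(3)[OF that]] vj by blast
  show "linear (\<lambda>v. frechet_derivative (\<lambda>p. S p (vs[j := v])) (at p0) u)"
  proof (rule linearI)
  fix x y and r :: real
  have "((\<lambda>p. S p (vs[j := x]) + S p (vs[j := y])) has_derivative (\<lambda>u. ?D (vs[j := x]) u + ?D (vs[j := y]) u)) (at p0)"
    by (intro has_derivative_add D)
  then have "((\<lambda>p. S p (vs[j := x + y])) has_derivative (\<lambda>u. ?D (vs[j := x]) u + ?D (vs[j := y]) u)) (at p0)"
    by (rule has_derivative_transform_within_open[OF _ assms(1,2)]) (simp add: linear_add[OF lin])
  from has_derivative_unique[OF D this]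
  show "?D (vs[j := x + y]) u = ?D (vs[j := x]) u + ?D (vs[j := y]) u" by (auto dest: fun_cong)
  have "((\<lambda>p. r *\<^sub>R S p (vs[j := x])) has_derivative (\<lambda>u. r *\<^sub>R ?D (vs[j := x]) u)) (at p0)"
    by (intro has_derivative_scaleR_right D)
  then have "((\<lambda>p. S p (vs[j := r *\<^sub>R x])) has_derivative (\<lambda>u. r *\<^sub>R ?D (vs[j := x]) u)) (at p0)"
    by (rule has_derivative_transform_within_open[OF _ assms(1,2)]) (simp add: linear_cmul[OF lin])
  from has_derivative_unique[OF D this]
  show "?D (vs[j := r *\<^sub>R x]) u = r *\<^sub>R ?D (vs[j := x]) u" by (auto dest: fun_cong)
  qed
qed

text \<open>Schwarz's theorem: the second difference quotient is symmetric in the two directions.\<close>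

lemma second_difference_tendsto:
  fixes f :: "'v::real_normed_vector \<Rightarrow> real"
  assumes "open S" "x \<in> S" and f: "\<And>y. y \<in> S \<Longrightarrow> f differentiable (at y)"
    and g: "(\<lambda>y. frechet_derivative f (at y) v) differentiable (at x)"
  shows "((\<lambda>t. (f (x + t *\<^sub>R u + t *\<^sub>R v) - f (x + t *\<^sub>R u) - f (x + t *\<^sub>R v) + f x) / t\<^sup>2)
    \<longlongrightarrow> frechet_derivative (\<lambda>y. frechet_derivative f (at y) v) (at x) u) (at_right 0)"
proof (rule tendstoI)
  let ?g = "\<lambda>y. frechet_derivative f (at y) v"
  let ?L = "frechet_derivative ?g (at x)"
  fix e :: real assume "e > 0"
  have L: "(?g has_derivative ?L) (at x)" using g by (simp add: frechet_derivative_works)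
  interpret L: bounded_linear ?L using L by (rule has_derivative_bounded_linear)
  \<comment> \<open>C bounds the sum of the norms of the two displacements \<open>w1\<close> and
    \<open>w2\<close> per unit of t; the summand 1 keeps it positive. The choice of
    \<open>e'\<close> below then leaves a total error of half of e.\<close>
  define C where "C = norm u + 2 * norm v + 1"
  have C: "C > 0" unfolding C_def by (smt (verit) norm_ge_zero)
  define e' where "e' = e / (2 * C)"
  have e': "e' > 0" using C \<open>e > 0\<close> by (simp add: e'_def)
  obtain d where d: "d > 0" "\<And>w. norm w < d \<Longrightarrow> \<bar>?g (x + w) - ?g x - ?L w\<bar> \<le> e' * norm w"
    using has_derivative_at_alt[THEN iffD1, OF L] e' 
    by (metis add_diff_cancel_left' real_norm_def)
  obtain r where r: "r > 0" "ball x r \<subseteq> S" using assms(1,2) openE by blast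
  define t0 where "t0 = min d r / C"
  have t0: "t0 > 0" using d r C by (simp add: t0_def)
  have small: "norm (t *\<^sub>R u + (s * t) *\<^sub>R v) < min d r" "norm ((s * t) *\<^sub>R v) < min d r"
    if t: "0 < t" "t < t0" and s: "0 \<le> s" "s \<le> 1" for t s
  proof -
    have "t * (norm u + norm v) \<le> t * C" using t unfolding C_def by (intro mult_left_mono) auto
    also have "\<dots> < t0 * C" using t C by simp
    also have "\<dots> = min d r" using C by (simp add: t0_def)
    finally have *: "t * (norm u + norm v) < min d r" .
    have sv: "norm ((s * t) *\<^sub>R v) \<le> t * norm v" using s t by (simp add: mult_left_le_one_le mult_mono)
    have "norm (t *\<^sub>R u + (s * t) *\<^sub>R v) \<le> norm (t *\<^sub>R u) + norm ((s * t) *\<^sub>R v)" by (rule norm_triangle_ineq)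
    also have "\<dots> \<le> t * norm u + t * norm v" using sv t by simp
    finally show "norm (t *\<^sub>R u + (s * t) *\<^sub>R v) < min d r" using * by (simp add: distrib_left)
    have "0 \<le> t * norm u" using t by simp
    then show "norm ((s * t) *\<^sub>R v) < min d r" using sv * by (simp add: distrib_left)
  qed
  have main: "\<bar>(f (x + t *\<^sub>R u + t *\<^sub>R v) - f (x + t *\<^sub>R u) - f (x + t *\<^sub>R v) + f x) / t\<^sup>2 - ?L u\<bar> < e"
    if t: "0 < t" "t < t0" for t
  proof -
    \<comment> \<open>The second difference is \<open>h 1 - h 0\<close>: the increment in direction
      u, followed along the segment in direction v. The mean value theorem turns it into a
      difference of two values of the v-derivative.\<close>
    define h where "h s = f (x + (t *\<^sub>R u + (s * t) *\<^sub>R v)) - f (x + (s * t) *\<^sub>R v)" for s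
    have dh: "(h has_real_derivative t * (?g (x + (t *\<^sub>R u + (s * t) *\<^sub>R v)) - ?g (x + (s * t) *\<^sub>R v))) (at s)"
      if s: "0 \<le> s" "s \<le> 1" for s
    proof -
      have *: "(f has_derivative frechet_derivative f (at (x + w))) (at (x + w))" if "norm w < min d r" for w
        using f[of "x + w"] r that by (auto simp: dist_norm frechet_derivative_works subset_iff)
      have bl: "frechet_derivative f (at (x + w)) (c *\<^sub>R v) = c * frechet_derivative f (at (x + w)) v" if "norm w < min d r" for w c
        using has_derivative_linear[OF *[OF that]] by (simp add: linear_cmul)
      have A: "((\<lambda>s. x + (t *\<^sub>R u + (s * t) *\<^sub>R v)) has_derivative (\<lambda>k. (k * t) *\<^sub>R v)) (at s)"
        "((\<lambda>s. x + (s * t) *\<^sub>R v) has_derivative (\<lambda>k. (k * t) *\<^sub>R v)) (at s)"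
        by (auto intro!: derivative_eq_intros)
      have 1: "((\<lambda>s. f (x + (t *\<^sub>R u + (s * t) *\<^sub>R v))) has_derivative (\<lambda>k. frechet_derivative f (at (x + (t *\<^sub>R u + (s * t) *\<^sub>R v))) ((k * t) *\<^sub>R v))) (at s)"
        by (rule has_derivative_compose[of "\<lambda>s. x + (t *\<^sub>R u + (s * t) *\<^sub>R v)" "\<lambda>k. (k * t) *\<^sub>R v" s UNIV f, OF A(1) *[OF small(1)[OF t s]]])
      have 2: "((\<lambda>s. f (x + (s * t) *\<^sub>R v)) has_derivative (\<lambda>k. frechet_derivative f (at (x + (s * t) *\<^sub>R v)) ((k * t) *\<^sub>R v))) (at s)"
        by (rule has_derivative_compose[of "\<lambda>s. x + (s * t) *\<^sub>R v" "\<lambda>k. (k * t) *\<^sub>R v" s UNIV f, OF A(2) *[OF small(2)[OF t s]]])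
      show ?thesis unfolding has_field_derivative_def h_def[abs_def]
        by (rule has_derivative_eq_rhs[OF has_derivative_diff[OF 1 2]])
           (simp add: bl[OF small(1)[OF t s]] bl[OF small(2)[OF t s]] fun_eq_iff algebra_simps)
    qed
    obtain s where s: "0 < s" "s < 1" "h 1 - h 0 = (1 - 0) * (t * (?g (x + (t *\<^sub>R u + (s * t) *\<^sub>R v)) - ?g (x + (s * t) *\<^sub>R v)))"
      using MVT2[of 0 1 h "\<lambda>s. t * (?g (x + (t *\<^sub>R u + (s * t) *\<^sub>R v)) - ?g (x + (s * t) *\<^sub>R v))", OF zero_less_one dh]
      by blast
    define w1 where "w1 = t *\<^sub>R u + (s * t) *\<^sub>R v"
    define w2 where "w2 = (s * t) *\<^sub>R v"
    have nw: "norm w1 < d" "norm w2 < d" using small[OF t, of s] s by (auto simp: w1_def w2_def)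
    have Lw: "?L w1 - ?L w2 = t * ?L u" unfolding w1_def w2_def by (simp add: L.add L.scaleR)
    have "f (x + t *\<^sub>R u + t *\<^sub>R v) - f (x + t *\<^sub>R u) - f (x + t *\<^sub>R v) + f x = h 1 - h 0"
      by (simp add: h_def add.assoc)
    also have "\<dots> = t * (?g (x + w1) - ?g (x + w2))" using s(3) by (simp add: w1_def w2_def)
    finally have fe: "f (x + t *\<^sub>R u + t *\<^sub>R v) - f (x + t *\<^sub>R u) - f (x + t *\<^sub>R v) + f x = t * (?g (x + w1) - ?g (x + w2))" .
    have eq: "(f (x + t *\<^sub>R u + t *\<^sub>R v) - f (x + t *\<^sub>R u) - f (x + t *\<^sub>R v) + f x) / t\<^sup>2 - ?L u
        = (?g (x + w1) - ?g (x + w2) - t * ?L u) / t"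
      unfolding fe using t by (simp add: power2_eq_square field_simps)
    have "\<bar>?g (x + w1) - ?g (x + w2) - t * ?L u\<bar> \<le> e' * norm w1 + e' * norm w2"
      using d(2)[OF nw(1)] d(2)[OF nw(2)] unfolding Lw[symmetric] by linarith
    also have "\<dots> \<le> e' * (t * C)"
    proof -
      have sv: "norm ((s * t) *\<^sub>R v) \<le> t * norm v" using s t by (simp add: mult_left_le_one_le mult_mono)
      have "norm w1 \<le> norm (t *\<^sub>R u) + norm ((s * t) *\<^sub>R v)" unfolding w1_def by (rule norm_triangle_ineq)
      then have "norm w1 + norm w2 \<le> t * norm u + 2 * (t * norm v)" using sv t unfolding w2_def by simp
      also have "\<dots> \<le> t * C" unfolding C_def using t by (simp add: algebra_simps)
      finally show ?thesis using e' by (simp add: distrib_left[symmetric])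
    qed
    also have "\<dots> = t * (e / 2)" using C by (simp add: e'_def field_simps)
    also have "\<dots> < t * e" using t \<open>e > 0\<close> by simp
    finally show ?thesis unfolding eq using t by (simp add: abs_divide field_simps)
  qed
  show "\<forall>\<^sub>F t in at_right 0. dist ((f (x + t *\<^sub>R u + t *\<^sub>R v) - f (x + t *\<^sub>R u) - f (x + t *\<^sub>R v) + f x) / t\<^sup>2) (?L u) < e"
    using t0 main by (intro eventually_at_rightI[of 0 t0]) (auto simp: dist_real_def)
qed

lemma frechet_derivative_symmetric:
  fixes f :: "'v::real_normed_vector \<Rightarrow> real ^ 'n::finite"
  assumes "open S" "x \<in> S" "smooth_on S f"
  shows "frechet_derivative (\<lambda>y. frechet_derivative f (at y) v) (at x) u
    = frechet_derivative (\<lambda>y. frechet_derivative f (at y) u) (at x) v"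
proof -
  have d: "f differentiable (at y)" if "y \<in> S" for y
    using assms(3)[unfolded smooth_on_def, rule_format, of y "[]"] that by simp
  have dd: "(\<lambda>y. frechet_derivative f (at y) v) differentiable (at x)" for v
    using assms(3)[unfolded smooth_on_def, rule_format, of x "[v]"] assms(2) by simp
  have "frechet_derivative (\<lambda>y. frechet_derivative f (at y) v) (at x) u $ i
    = frechet_derivative (\<lambda>y. frechet_derivative f (at y) u) (at x) v $ i" for i
  proof -
    let ?f = "\<lambda>y. f y $ i"
    have fi: "(?f has_derivative (\<lambda>v. frechet_derivative f (at y) v $ i)) (at y)" if "y \<in> S" for y
      using d[OF that] by (intro vec_nth_has_derivative) (simp add: frechet_derivative_works)
    have di: "?f differentiable (at y)" if "y \<in> S" for y using fi[OF that] by (auto simp: differentiable_def)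
    have fr: "frechet_derivative ?f (at y) v = frechet_derivative f (at y) v $ i" if "y \<in> S" for y v
      using frechet_derivative_at[OF fi[OF that]] by metis
    have gi: "((\<lambda>y. frechet_derivative ?f (at y) v) has_derivative
       (\<lambda>u. frechet_derivative (\<lambda>y. frechet_derivative f (at y) v) (at x) u $ i)) (at x)" for v
      by (rule has_derivative_transform_within_open[OF vec_nth_has_derivative[OF dd[unfolded frechet_derivative_works]] assms(1,2)])
         (simp add: fr)
    have gd: "(\<lambda>y. frechet_derivative ?f (at y) v) differentiable (at x)" for v
      using gi by (auto simp: differentiable_def)
    have g: "frechet_derivative (\<lambda>y. frechet_derivative ?f (at y) v) (at x) u = frechet_derivative (\<lambda>y. frechet_derivative f (at y) v) (at x) u $ i" for u v
      using frechet_derivative_at[OF gi[of v]] by metis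
    have "frechet_derivative (\<lambda>y. frechet_derivative ?f (at y) v) (at x) u = frechet_derivative (\<lambda>y. frechet_derivative ?f (at y) u) (at x) v"
    proof (rule tendsto_unique[OF _ second_difference_tendsto[OF assms(1,2) di gd]])
      show "((\<lambda>t. (?f (x + t *\<^sub>R u + t *\<^sub>R v) - ?f (x + t *\<^sub>R u) - ?f (x + t *\<^sub>R v) + ?f x) / t\<^sup>2)
        \<longlongrightarrow> frechet_derivative (\<lambda>y. frechet_derivative ?f (at y) u) (at x) v) (at_right 0)"
        using second_difference_tendsto[OF assms(1,2) di gd, where u=v and v=u]
        by (simp add: add.commute add.left_commute algebra_simps)
    qed simp
    then show ?thesis by (simp add: g)
  qed
  then show ?thesis by (simp add: vec_eq_iff)
qed

text \<open>Finite-dimensional Riesz representation. Positivity makes the map from w to the values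
  of \<open>b w\<close> on the standard basis injective, hence onto.\<close>

lemma bilinear_riesz:
  fixes b :: "real ^ 'n::finite \<Rightarrow> real ^ 'n \<Rightarrow> real"
  assumes b: "bilinear b" and pos: "\<And>u. u \<noteq> 0 \<Longrightarrow> b u u > 0" and K: "linear K"
  shows "\<exists>!w. \<forall>z. b w z = K z"
proof -
  have bl: "linear (\<lambda>w. b w z)" "linear (b w)" for w z using b by (auto simp: bilinear_def)
  define T where "T w = (\<chi> a. b w (axis a 1))" for w
  have T: "linear T" unfolding T_def by (rule linearI) (simp_all add: vec_eq_iff linear_add[OF bl(1)] linear_cmul[OF bl(1)])
  have ext: "b w = K'" if "T w = (\<chi> a. K' (axis a 1))" "linear K'" for w K'
  proof
    fix z
    have "b w (axis a 1) = K' (axis a 1)" for a using that(1) by (simp add: T_def vec_eq_iff)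
    then show "b w z = K' z"
      using linear_axis_expansion_real[OF bl(2), of w z] linear_axis_expansion_real[OF that(2), of z] by simp
  qed
  have "inj T"
  proof (rule linear_injective_0[OF T, THEN iffD2], intro allI impI)
    fix w assume "T w = 0"
    then have "b w = (\<lambda>_. 0)" by (intro ext) (auto simp: vec_eq_iff linear_zero)
    then show "w = 0" using pos[of w] by auto
  qed
  then have "surj T" using T linear_injective_imp_surjective by blast
  then obtain w where w: "T w = (\<chi> a. K (axis a 1))" by (metis surjD)
  have "b w z = K z" for z using ext[OF w K] by simp
  moreover have "w' = w" if "\<forall>z. b w' z = K z" for w'
  proof -
    have "T w' = T w" using that calculation by (simp add: T_def)
    then show ?thesis using \<open>inj T\<close> by (auto dest: injD)
  qed
  ultimately show ?thesis by blast
qed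

section \<open>Covariant derivatives in arbitrary charts\<close>

definition Dt :: "('a, 'n::finite) chart \<Rightarrow> ('a, 'n) chart \<Rightarrow> real ^ 'n \<Rightarrow> real ^ 'n \<Rightarrow> real ^ 'n" where
  "Dt c c' p = frechet_derivative (snd c' \<circ> chart_inv c) (at p)"

locale riem_mfd =
  fixes M :: "('a::{t2_space, second_countable_topology}, 'n::finite) riem"
  assumes riemannian: "riemannian M"
begin

lemma smooth_mfd: "smooth_manifold M"
  using riemannian by (simp add: riemannian_def)

lemma chart_open: "c \<in> charts M \<Longrightarrow> open (fst c)"
  and chart_ran_open: "c \<in> charts M \<Longrightarrow> open (chart_ran c)"
  and chart_homeo: "c \<in> charts M \<Longrightarrow> homeomorphism (fst c) (chart_ran c) (snd c) (chart_inv c)"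
  and chart_at_charts[simp]: "chart_at M x \<in> charts M"
  and chart_at_mem[simp]: "x \<in> fst (chart_at M x)"
  and trans_smooth: "c \<in> charts M \<Longrightarrow> c' \<in> charts M \<Longrightarrow>
    smooth_on (snd c ` (fst c \<inter> fst c')) (snd c' \<circ> chart_inv c)"
  using smooth_mfd by (auto simp: smooth_manifold_def)

lemma chart_inv_left: "c \<in> charts M \<Longrightarrow> y \<in> fst c \<Longrightarrow> chart_inv c (snd c y) = y"
  and chart_inv_right: "c \<in> charts M \<Longrightarrow> p \<in> chart_ran c \<Longrightarrow> snd c (chart_inv c p) = p"
  and chart_ran_mem: "c \<in> charts M \<Longrightarrow> y \<in> fst c \<Longrightarrow> snd c y \<in> chart_ran c"
  and chart_inv_mem: "c \<in> charts M \<Longrightarrow> p \<in> chart_ran c \<Longrightarrow> chart_inv c p \<in> fst c"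
  and chart_cont: "c \<in> charts M \<Longrightarrow> continuous_on (fst c) (snd c)"
  and chart_inv_cont: "c \<in> charts M \<Longrightarrow> continuous_on (chart_ran c) (chart_inv c)"
  using chart_homeo[of c] by (auto simp: homeomorphism_def)

lemma chart_vimage_open:
  assumes "c \<in> charts M" "open U"
  shows "open {p \<in> chart_ran c. chart_inv c p \<in> U}"
proof -
  have "{p \<in> chart_ran c. chart_inv c p \<in> U} = chart_ran c \<inter> chart_inv c -` U" by auto
  then show ?thesis using chart_inv_cont[OF assms(1)] chart_ran_open[OF assms(1)] assms(2)
    by (simp add: continuous_on_open_vimage Int_commute)
qed

lemma chart_image_open:
  assumes "c \<in> charts M" "c' \<in> charts M"
  shows "open (snd c ` (fst c \<inter> fst c'))"
proof -
  have "snd c ` (fst c \<inter> fst c') = {p \<in> chart_ran c. chart_inv c p \<in> fst c'}"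
    using chart_inv_left[OF assms(1)] chart_inv_right[OF assms(1)] chart_ran_mem[OF assms(1)] chart_inv_mem[OF assms(1)]
    by force
  then show ?thesis using chart_vimage_open[OF assms(1) chart_open[OF assms(2)]] by simp
qed

lemma trans_has_derivative:
  assumes "c \<in> charts M" "c' \<in> charts M" "y \<in> fst c" "y \<in> fst c'"
  shows "((snd c' \<circ> chart_inv c) has_derivative Dt c c' (snd c y)) (at (snd c y))"
proof -
  have "snd c y \<in> snd c ` (fst c \<inter> fst c')" using assms by auto
  from trans_smooth[OF assms(1,2), unfolded smooth_on_def, rule_format, OF this, of "[]"]
  show ?thesis by (simp add: frechet_derivative_works Dt_def)
qed

lemma Dt_linear:
  assumes "c \<in> charts M" "c' \<in> charts M" "y \<in> fst c" "y \<in> fst c'"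
  shows "linear (Dt c c' (snd c y))"
  using trans_has_derivative[OF assms] by (rule has_derivative_linear)

lemma Dt_id: "c \<in> charts M \<Longrightarrow> y \<in> fst c \<Longrightarrow> Dt c c (snd c y) = (\<lambda>v. v)"
proof -
  assume c: "c \<in> charts M" "y \<in> fst c"
  have "((\<lambda>p. p) has_derivative (\<lambda>v. v)) (at (snd c y))" by (rule has_derivative_ident)
  then have "((snd c \<circ> chart_inv c) has_derivative (\<lambda>v. v)) (at (snd c y))"
    by (rule has_derivative_transform_within_open[OF _ chart_ran_open[OF c(1)] chart_ran_mem[OF c]])
       (simp add: chart_inv_right[OF c(1)])
  then show ?thesis using has_derivative_unique[OF trans_has_derivative[OF c(1) c(1) c(2) c(2)]] by simp
qed

lemma Dt_chain:
  assumes c: "c \<in> charts M" "c' \<in> charts M" "c'' \<in> charts M" and y: "y \<in> fst c" "y \<in> fst c'" "y \<in> fst c''"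
  shows "Dt c c'' (snd c y) v = Dt c' c'' (snd c' y) (Dt c c' (snd c y) v)"
proof -
  have e: "(snd c' \<circ> chart_inv c) (snd c y) = snd c' y" using chart_inv_left[OF c(1) y(1)] by simp
  have "((snd c'' \<circ> chart_inv c') \<circ> (snd c' \<circ> chart_inv c) has_derivative (Dt c' c'' (snd c' y) \<circ> Dt c c' (snd c y))) (at (snd c y))"
    by (rule diff_chain_at[OF trans_has_derivative[OF c(1,2) y(1,2)]])
       (unfold e, rule trans_has_derivative[OF c(2,3) y(2,3)])
  then have "((snd c'' \<circ> chart_inv c) has_derivative (Dt c' c'' (snd c' y) \<circ> Dt c c' (snd c y))) (at (snd c y))"
  proof (rule has_derivative_transform_within_open[OF _ chart_image_open[OF c(1,2)]])
    show "snd c y \<in> snd c ` (fst c \<inter> fst c')" using y by auto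
    show "(snd c'' \<circ> chart_inv c' \<circ> (snd c' \<circ> chart_inv c)) x = (snd c'' \<circ> chart_inv c) x" if "x \<in> snd c ` (fst c \<inter> fst c')" for x
      using that chart_inv_left[OF c(1)] chart_inv_left[OF c(2)] by auto
  qed
  from has_derivative_unique[OF trans_has_derivative[OF c(1,3) y(1,3)] this] show ?thesis by simp
qed

lemma Dt_inverse:
  assumes c: "c \<in> charts M" "c' \<in> charts M" and y: "y \<in> fst c" "y \<in> fst c'"
  shows "Dt c' c (snd c' y) (Dt c c' (snd c y) v) = v"
  using Dt_chain[OF c(1,2,1) y(1,2,1), of v] Dt_id[OF c(1) y(1)] by simp

lemma to_tangent_Dt: "to_tangent M c y v = Dt c (chart_at M y) (snd c y) v"
  by (simp add: to_tangent_def Dt_def)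

lemma tt_chain:
  assumes "c \<in> charts M" "c' \<in> charts M" "y \<in> fst c" "y \<in> fst c'"
  shows "to_tangent M c y v = to_tangent M c' y (Dt c c' (snd c y) v)"
  unfolding to_tangent_Dt using assms by (intro Dt_chain) auto

lemma tt_id[simp]: "to_tangent M (chart_at M y) y v = v"
  unfolding to_tangent_Dt using Dt_id[of "chart_at M y" y] by simp

lemma tt_linear: "c \<in> charts M \<Longrightarrow> y \<in> fst c \<Longrightarrow> linear (to_tangent M c y)"
  using Dt_linear[of c "chart_at M y" y] by (simp add: to_tangent_Dt[abs_def])

lemma tt_Dt: "c \<in> charts M \<Longrightarrow> y \<in> fst c \<Longrightarrow> to_tangent M c y (Dt (chart_at M y) c (snd (chart_at M y) y) v) = v"
  unfolding to_tangent_Dt by (rule Dt_inverse) auto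

lemma metric_bilinear: "bilinear (metric M x)"
  and metric_sym: "metric M x u v = metric M x v u"
  and metric_pos: "u \<noteq> 0 \<Longrightarrow> metric M x u u > 0"
  using riemannian by (auto simp: riemannian_def)

lemma metric_linear: "linear (metric M x u)" "linear (\<lambda>u. metric M x u v)"
  using metric_bilinear by (auto simp: bilinear_def)

lemma gram_at: "c \<in> charts M \<Longrightarrow> y \<in> fst c \<Longrightarrow>
  gram M c (snd c y) u v = metric M y (to_tangent M c y u) (to_tangent M c y v)"
  by (simp add: gram_def chart_inv_left)

lemma gram_change:
  assumes "c \<in> charts M" "c' \<in> charts M" "y \<in> fst c" "y \<in> fst c'"
  shows "gram M c (snd c y) u v = gram M c' (snd c' y) (Dt c c' (snd c y) u) (Dt c c' (snd c y) v)"
  using assms by (simp add: gram_at tt_chain[OF assms])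

lemma gram_linear:
  assumes "c \<in> charts M" "p \<in> chart_ran c"
  shows "linear (gram M c p u)" "linear (\<lambda>u. gram M c p u v)"
proof -
  have "linear (to_tangent M c (chart_inv c p))" using tt_linear[OF assms(1) chart_inv_mem[OF assms]] .
  from linear_compose[OF this metric_linear(1)] linear_compose[OF this metric_linear(2)]
  show "linear (gram M c p u)" "linear (\<lambda>u. gram M c p u v)" by (simp_all add: gram_def[abs_def] o_def)
qed

lemma gram_sym: "gram M c p u v = gram M c p v u"
  by (simp add: gram_def metric_sym)

lemma gram_pos:
  assumes "c \<in> charts M" "p \<in> chart_ran c" "u \<noteq> 0"
  shows "gram M c p u u > 0"
proof -
  let ?y = "chart_inv c p"
  have y: "?y \<in> fst c" using chart_inv_mem[OF assms(1,2)] .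
  have "to_tangent M c ?y u \<noteq> 0"
  proof
    assume 0: "to_tangent M c ?y u = 0"
    have "Dt (chart_at M ?y) c (snd (chart_at M ?y) ?y) (to_tangent M c ?y u) = u"
      unfolding to_tangent_Dt by (rule Dt_inverse) (use assms y in auto)
    moreover have "linear (Dt (chart_at M ?y) c (snd (chart_at M ?y) ?y))" by (rule Dt_linear) (use assms y in auto)
    ultimately show False using 0 assms(3) by (simp add: linear_0)
  qed
  then show ?thesis by (simp add: gram_def metric_pos)
qed

lemma gram_smooth: "c \<in> charts M \<Longrightarrow> smooth_on (chart_ran c) (\<lambda>p. gram M c p u v)"
  using riemannian by (simp add: riemannian_def)

lemma gram_differentiable: "c \<in> charts M \<Longrightarrow> p \<in> chart_ran c \<Longrightarrow> (\<lambda>p. gram M c p u v) differentiable (at p)"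
  using gram_smooth[of c u v, unfolded smooth_on_def, rule_format, of p "[]"] by simp

lemma gram_continuous: "c \<in> charts M \<Longrightarrow> continuous_on (chart_ran c) (\<lambda>p. gram M c p u v)"
  using gram_differentiable by (intro continuous_at_imp_continuous_on ballI differentiable_imp_continuous_within) auto

lemma Dgram_continuous:
  "c \<in> charts M \<Longrightarrow> continuous_on (chart_ran c) (\<lambda>p. frechet_derivative (\<lambda>p. gram M c p u v) (at p) w)"
  using gram_smooth[of c u v, unfolded smooth_on_def, rule_format, of _ "[w]"]
  by (intro continuous_at_imp_continuous_on ballI differentiable_imp_continuous_within) auto

lemma gram_mlin: "c \<in> charts M \<Longrightarrow> p \<in> chart_ran c \<Longrightarrow> mlin 2 (\<lambda>vs. gram M c p (vs ! 0) (vs ! 1))"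
  unfolding mlin_def using gram_linear[of c p] by (auto simp: less_2_cases_iff)

section \<open>Christoffel symbols in an arbitrary chart\<close>

abbreviation Dgram :: "('a, 'n) chart \<Rightarrow> real ^ 'n \<Rightarrow> real ^ 'n \<Rightarrow> real ^ 'n \<Rightarrow> real ^ 'n \<Rightarrow> real" where
  "Dgram c p a b e \<equiv> frechet_derivative (\<lambda>p. gram M c p a b) (at p) e"

definition koszul :: "('a, 'n) chart \<Rightarrow> real ^ 'n \<Rightarrow> real ^ 'n \<Rightarrow> real ^ 'n \<Rightarrow> real ^ 'n \<Rightarrow> real" where
  "koszul c p u v z = Dgram c p v z u + Dgram c p u z v - Dgram c p u v z"

text \<open>\<open>christoffel\<close> is tied to the preferred chart at its point, which may jump
  from point to point. Here chart and point are independent, so the symbols can be compared between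
  charts and studied as functions of p.\<close>

definition chr :: "('a, 'n) chart \<Rightarrow> real ^ 'n \<Rightarrow> real ^ 'n \<Rightarrow> real ^ 'n \<Rightarrow> real ^ 'n" where
  "chr c p u v = (THE w. \<forall>z. 2 * gram M c p w z = koszul c p u v z)"

lemma christoffel_chr: "christoffel M x = chr (chart_at M x) (snd (chart_at M x) x)"
  by (simp add: fun_eq_iff christoffel_def chr_def koszul_def Let_def)

lemma Dgram_linear:
  assumes "c \<in> charts M" "p \<in> chart_ran c"
  shows "linear (Dgram c p a b)" "linear (\<lambda>a. Dgram c p a b e)" "linear (\<lambda>b. Dgram c p a b e)"
proof -
  show "linear (Dgram c p a b)"
    using gram_differentiable[OF assms] by (auto simp: frechet_derivative_works intro: has_derivative_linear)
  have "mlin 2 (\<lambda>vs. frechet_derivative (\<lambda>p. gram M c p (vs ! 0) (vs ! 1)) (at p) e)"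
    by (rule mlin_frechet_derivative[OF chart_ran_open[OF assms(1)] assms(2) gram_mlin[OF assms(1)]])
       (auto intro: gram_differentiable[OF assms])
  from mlinD[OF this, of "[a, b]" 0] mlinD[OF this, of "[a, b]" 1]
  show "linear (\<lambda>a. Dgram c p a b e)" "linear (\<lambda>b. Dgram c p a b e)" by simp_all
qed

lemma chr_unique:
  assumes "c \<in> charts M" "p \<in> chart_ran c"
  shows "\<exists>!w. \<forall>z. 2 * gram M c p w z = koszul c p u v z"
proof (rule bilinear_riesz)
  show "bilinear (\<lambda>a b. 2 * gram M c p a b)"
    using linear_compose_scale_right[OF gram_linear(1)[OF assms], of 2]
      linear_compose_scale_right[OF gram_linear(2)[OF assms], of 2]
    unfolding bilinear_def by simp
  show "linear (koszul c p u v)" unfolding koszul_def[abs_def]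
    using Dgram_linear[OF assms] by (intro linear_compose_sub linear_compose_add) auto
qed (use gram_pos[OF assms] in auto)

lemma chr_koszul:
  assumes "c \<in> charts M" "p \<in> chart_ran c"
  shows "2 * gram M c p (chr c p u v) z = koszul c p u v z"
  using theI'[OF chr_unique[OF assms, of u v]] unfolding chr_def by blast

lemma chr_eqI:
  assumes "c \<in> charts M" "p \<in> chart_ran c" "\<And>z. 2 * gram M c p w z = koszul c p u v z"
  shows "chr c p u v = w"
  using chr_unique[OF assms(1,2), of u v] chr_koszul[OF assms(1,2), of u v] assms(3) by blast

lemma chr_linear:
  assumes "c \<in> charts M" "p \<in> chart_ran c"
  shows "linear (chr c p u)" "linear (\<lambda>u. chr c p u v)"
proof -
  note g = gram_linear(2)[OF assms]
  note D = Dgram_linear[OF assms]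
  show "linear (chr c p u)"
  proof (rule linearI)
    fix v v' r
    show "chr c p u (v + v') = chr c p u v + chr c p u v'"
      by (rule chr_eqI[OF assms])
         (simp add: linear_add[OF g] distrib_left chr_koszul[OF assms], simp add: koszul_def linear_add[OF D(1)] linear_add[OF D(2)] linear_add[OF D(3)])
    show "chr c p u (r *\<^sub>R v) = r *\<^sub>R chr c p u v"
      by (rule chr_eqI[OF assms])
         (simp add: linear_cmul[OF g] mult.left_commute[of 2 r] chr_koszul[OF assms], simp add: koszul_def linear_cmul[OF D(1)] linear_cmul[OF D(2)] linear_cmul[OF D(3)] algebra_simps)
  qed
  show "linear (\<lambda>u. chr c p u v)"
  proof (rule linearI)
    fix u u' r
    show "chr c p (u + u') v = chr c p u v + chr c p u' v"
      by (rule chr_eqI[OF assms])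
         (simp add: linear_add[OF g] distrib_left chr_koszul[OF assms], simp add: koszul_def linear_add[OF D(1)] linear_add[OF D(2)] linear_add[OF D(3)])
    show "chr c p (r *\<^sub>R u) v = r *\<^sub>R chr c p u v"
      by (rule chr_eqI[OF assms])
         (simp add: linear_cmul[OF g] mult.left_commute[of 2 r] chr_koszul[OF assms], simp add: koszul_def linear_cmul[OF D(1)] linear_cmul[OF D(2)] linear_cmul[OF D(3)] algebra_simps)
  qed
qed

definition D2t :: "('a, 'n) chart \<Rightarrow> ('a, 'n) chart \<Rightarrow> real ^ 'n \<Rightarrow> real ^ 'n \<Rightarrow> real ^ 'n \<Rightarrow> real ^ 'n" where
  "D2t c c' p u v = frechet_derivative (\<lambda>p. Dt c c' p v) (at p) u"

lemma Dt_has_derivative: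
  assumes "c \<in> charts M" "c' \<in> charts M" "y \<in> fst c" "y \<in> fst c'"
  shows "((\<lambda>p. Dt c c' p v) has_derivative (\<lambda>u. D2t c c' (snd c y) u v)) (at (snd c y))"
proof -
  have "snd c y \<in> snd c ` (fst c \<inter> fst c')" using assms by auto
  from trans_smooth[OF assms(1,2), unfolded smooth_on_def, rule_format, OF this, of "[v]"]
  show ?thesis by (simp add: frechet_derivative_works Dt_def D2t_def)
qed

lemma D2t_sym:
  assumes "c \<in> charts M" "c' \<in> charts M" "y \<in> fst c" "y \<in> fst c'"
  shows "D2t c c' (snd c y) u v = D2t c c' (snd c y) v u"
  unfolding D2t_def Dt_def
  by (rule frechet_derivative_symmetric[OF chart_image_open[OF assms(1,2)] _ trans_smooth[OF assms(1,2)]])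
     (use assms in auto)

text \<open>S holds coefficients in the chart \<open>c'\<close>. The list b marks the slots that are
  converted from c by the Jacobian of the transition map. Differentiating in the coordinates of c
  produces the derivative of S and, for every marked slot, a term with the Hessian
  \<open>D2t\<close> of the transition map.\<close>

lemma mlin_change_derivative:
  fixes S :: "real ^ 'n \<Rightarrow> (real ^ 'n) list \<Rightarrow> real" and b :: "bool list"
  assumes c: "c \<in> charts M" "c' \<in> charts M" and y: "y \<in> fst c" "y \<in> fst c'"
    and U: "open U" "snd c' y \<in> U" "\<And>p. p \<in> U \<Longrightarrow> mlin n (S p)"
    and d: "\<And>vs. length vs = n \<Longrightarrow> (\<lambda>p. S p vs) differentiable (at (snd c' y))"
    and len: "length vs = n" "length b = n"
  defines "A \<equiv> \<lambda>p v. Dt c c' p v" and "p0 \<equiv> snd c y"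
  defines "tr \<equiv> \<lambda>p. map2 (\<lambda>k v. if k then A p v else v) b vs"
  shows "((\<lambda>p. S (snd c' (chart_inv c p)) (tr p)) has_derivative
    (\<lambda>u. frechet_derivative (\<lambda>p. S p (tr p0)) (at (snd c' y)) (A p0 u)
       + (\<Sum>j<n. if b ! j then S (snd c' y) ((tr p0)[j := D2t c c' p0 u (vs ! j)]) else 0))) (at p0)"
proof -
  let ?phi = "snd c' \<circ> chart_inv c"
  have phi: "(?phi has_derivative A p0) (at p0)" unfolding A_def p0_def by (rule trans_has_derivative[OF c y])
  have phi0: "?phi p0 = snd c' y" unfolding p0_def using chart_inv_left[OF c(1) y(1)] by simp
  define P where "P = {p \<in> snd c ` (fst c \<inter> fst c'). ?phi p \<in> U}"
  have "continuous_on (snd c ` (fst c \<inter> fst c')) ?phi"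
    using trans_smooth[OF c, unfolded smooth_on_def, rule_format, of _ "[]"]
    by (intro continuous_at_imp_continuous_on ballI differentiable_imp_continuous_within) auto
  then have "open (?phi -` U \<inter> snd c ` (fst c \<inter> fst c'))"
    using continuous_on_open_vimage[OF chart_image_open[OF c]] U(1) by blast
  moreover have "?phi -` U \<inter> snd c ` (fst c \<inter> fst c') = P" unfolding P_def by blast
  ultimately have "open P" by simp
  moreover have "p0 \<in> P" using phi0 U(2) y unfolding P_def p0_def by auto
  moreover have "mlin n (S (?phi p))" if "p \<in> P" for p using U(3) that unfolding P_def by auto
  moreover have "((\<lambda>p. S (?phi p) vs) has_derivative (\<lambda>u. frechet_derivative (\<lambda>p. S p vs) (at (snd c' y)) (A p0 u))) (at p0)"
    if "length vs = n" for vs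
  proof -
    have "((\<lambda>p. S p vs) has_derivative frechet_derivative (\<lambda>p. S p vs) (at (snd c' y))) (at (?phi p0))"
      unfolding phi0 using d[OF that] by (simp add: frechet_derivative_works)
    from diff_chain_at[OF phi this] show ?thesis by (simp add: o_def)
  qed
  ultimately have "((\<lambda>p. S (?phi p) (map (\<lambda>f. f p) (map2 (\<lambda>k v p. if k then A p v else v) b vs))) has_derivative
    (\<lambda>u. frechet_derivative (\<lambda>p. S p (map (\<lambda>f. f p0) (map2 (\<lambda>k v p. if k then A p v else v) b vs))) (at (snd c' y)) (A p0 u)
       + (\<Sum>j<n. S (?phi p0) ((map (\<lambda>f. f p0) (map2 (\<lambda>k v p. if k then A p v else v) b vs))
            [j := ((map2 (\<lambda>k v u. if k then D2t c c' p0 u v else 0) b vs) ! j) u])))) (at p0)"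
  proof (rule mlin_has_derivative)
    fix j assume "j < n"
    then show "(map2 (\<lambda>k v p. if k then A p v else v) b vs ! j has_derivative
        map2 (\<lambda>k v u. if k then D2t c c' p0 u v else 0) b vs ! j) (at p0)"
      using len Dt_has_derivative[OF c y, of "vs ! j"] by (cases "b ! j") (auto simp: A_def p0_def)
  qed (use len in auto)
  moreover have "map (\<lambda>f. f p) (map2 (\<lambda>k v p. if k then A p v else v) b vs) = tr p" for p
    unfolding tr_def by (simp add: case_prod_beta cong: if_cong)
  \<comment> \<open>An unmarked slot does not depend on p; its derivative 0 is inserted into a
    linear slot and the term vanishes.\<close>
  moreover have "S (?phi p0) ((tr p0)[j := ((map2 (\<lambda>k v u. if k then D2t c c' p0 u v else 0) b vs) ! j) u])
     = (if b ! j then S (snd c' y) ((tr p0)[j := D2t c c' p0 u (vs ! j)]) else 0)" if "j < n" for j u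
  proof (cases "b ! j")
    case False
    have "linear (\<lambda>v. S (snd c' y) ((tr p0)[j := v]))"
      using mlinD[OF U(3)[OF U(2)] _ that, of "tr p0"] len by (simp add: tr_def)
    from linear_0[OF this] show ?thesis using False that len phi0 by simp
  qed (use that len phi0 in simp)
  ultimately show ?thesis by simp
qed

lemma Dgram_change:
  assumes c: "c \<in> charts M" "c' \<in> charts M" and y: "y \<in> fst c" "y \<in> fst c'"
  defines "A \<equiv> Dt c c' (snd c y)" and "B \<equiv> D2t c c' (snd c y)" and "G \<equiv> gram M c' (snd c' y)"
  shows "Dgram c (snd c y) a b e = Dgram c' (snd c' y) (A a) (A b) (A e) + G (B e a) (A b) + G (A a) (B e b)"
proof -
  note p' = chart_ran_mem[OF c(2) y(2)]
  have "((\<lambda>p. gram M c' (snd c' (chart_inv c p)) (Dt c c' p a) (Dt c c' p b)) has_derivative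
     (\<lambda>e. Dgram c' (snd c' y) (A a) (A b) (A e) + (G (B e a) (A b) + G (A a) (B e b)))) (at (snd c y))"
    using mlin_change_derivative[where S="\<lambda>p vs. gram M c' p (vs ! 0) (vs ! 1)" and n=2, OF c y chart_ran_open[OF c(2)] p' gram_mlin[OF c(2)],
        where vs="[a, b]" and b="[True, True]"]
      gram_differentiable[OF c(2) p']
    by (simp add: numeral_2_eq_2 lessThan_Suc A_def B_def G_def add_ac)
  then have "((\<lambda>p. gram M c p a b) has_derivative
     (\<lambda>e. Dgram c' (snd c' y) (A a) (A b) (A e) + (G (B e a) (A b) + G (A a) (B e b)))) (at (snd c y))"
  proof (rule has_derivative_transform_within_open[OF _ chart_image_open[OF c]])
    show "snd c y \<in> snd c ` (fst c \<inter> fst c')" using y by auto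
    fix p assume "p \<in> snd c ` (fst c \<inter> fst c')"
    then obtain z where z: "p = snd c z" "z \<in> fst c" "z \<in> fst c'" by auto
    show "gram M c' (snd c' (chart_inv c p)) (Dt c c' p a) (Dt c c' p b) = gram M c p a b"
      unfolding z(1) using gram_change[OF c z(2,3), of a b] chart_inv_left[OF c(1) z(2)] by simp
  qed
  from frechet_derivative_at[OF this, symmetric] show ?thesis by simp
qed

text \<open>The inhomogeneous transformation law. Changing charts in the Koszul formula produces six
  Hessian terms; by symmetry of the Hessian four of them cancel and the other two combine to twice
  \<open>?G (B u v) (A z)\<close>.\<close>

lemma chr_change:
  assumes c: "c \<in> charts M" "c' \<in> charts M" and y: "y \<in> fst c" "y \<in> fst c'"
  defines "A \<equiv> Dt c c' (snd c y)" and "B \<equiv> D2t c c' (snd c y)"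
  shows "A (chr c (snd c y) u v) = chr c' (snd c' y) (A u) (A v) + B u v"
proof -
  note p = chart_ran_mem[OF c(1) y(1)] and p' = chart_ran_mem[OF c(2) y(2)]
  let ?G = "gram M c' (snd c' y)"
  note g1 = gram_linear(2)[OF c(2) p']
  have "chr c' (snd c' y) (A u) (A v) = A (chr c (snd c y) u v) - B u v"
  proof (rule chr_eqI[OF c(2) p'])
    fix z'
    define z where "z = Dt c' c (snd c' y) z'"
    have z: "A z = z'" unfolding z_def A_def by (rule Dt_inverse[OF c(2,1) y(2,1)])
    have sym: "B u v = B v u" for u v unfolding B_def by (rule D2t_sym[OF c y])
    have "2 * ?G (A (chr c (snd c y) u v)) (A z) = koszul c (snd c y) u v z"
      unfolding A_def gram_change[OF c y, symmetric] by (rule chr_koszul[OF c(1) p])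
    also have "\<dots> = koszul c' (snd c' y) (A u) (A v) (A z) + 2 * ?G (B u v) (A z)"
      unfolding koszul_def Dgram_change[OF c y, folded A_def B_def]
      using sym[of z u] sym[of z v] sym[of v u] by (simp add: gram_sym[of c' "snd c' y" "A u"] gram_sym[of c' "snd c' y" "A v"])
    finally show "2 * ?G (A (chr c (snd c y) u v) - B u v) z' = koszul c' (snd c' y) (A u) (A v) z'"
      unfolding z linear_diff[OF g1] by simp
  qed
  then show ?thesis by simp
qed

section \<open>The covariant derivative in an arbitrary chart\<close>

definition tsl :: "('a, 'n) chart \<Rightarrow> 'a \<Rightarrow> 'i \<Rightarrow> 'i list \<Rightarrow> (real ^ 'n) list \<Rightarrow> (real ^ 'n) list" where
  "tsl c y i is vs = map2 (\<lambda>k v. if k = i then to_tangent M c y v else v) is vs"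

lemma transport_slots_single: "transport_slots M [i \<mapsto> c] (\<lambda>_. y) is vs = tsl c y i is vs"
  unfolding transport_slots_def tsl_def by (auto intro!: map_cong)

lemma length_tsl[simp]: "length (tsl c y i is vs) = min (length is) (length vs)"
  by (simp add: tsl_def)

lemma nth_tsl: "j < length is \<Longrightarrow> j < length vs \<Longrightarrow>
  tsl c y i is vs ! j = (if is ! j = i then to_tangent M c y (vs ! j) else vs ! j)"
  by (simp add: tsl_def)

lemma tsl_update: "length is = length vs \<Longrightarrow> j < length vs \<Longrightarrow>
  tsl c y i is (vs[j := v]) = (tsl c y i is vs)[j := if is ! j = i then to_tangent M c y v else v]"
  by (rule nth_equalityI) (auto simp: nth_tsl nth_list_update)

lemma tsl_at: "length is = length vs \<Longrightarrow> tsl (chart_at M y) y i is vs = vs"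
  by (rule nth_equalityI) (auto simp: nth_tsl)

lemma mlin_tsl:
  assumes "c \<in> charts M" "y \<in> fst c" "mlin n A" "length is = n"
  shows "mlin n (\<lambda>vs. A (tsl c y i is vs))"
  unfolding mlin_def
proof (intro allI impI)
  fix vs :: "(real ^ 'n) list" and j assume vj: "length vs = n \<and> j < n"
  have l: "linear (\<lambda>v. A ((tsl c y i is vs)[j := v]))" by (rule mlinD[OF assms(3)]) (use vj assms in auto)
  have l': "linear (\<lambda>v. if is ! j = i then to_tangent M c y v else v)"
    using tt_linear[OF assms(1,2)] linear_id by (cases "is ! j = i") (auto simp: id_def)
  show "linear (\<lambda>v. A (tsl c y i is (vs[j := v])))"
    using linear_compose[OF l' l] vj assms(4) by (simp add: tsl_update o_def)
qed

text \<open>The counterpart of \<open>cov_deriv\<close> in a chart c of choice: the direction u and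
  the slots labelled i are given in coordinates of c, while the remaining slots keep their own fixed
  spaces. In the preferred chart the two agree.\<close>

definition cdc :: "('a, 'n) chart \<Rightarrow> 'a \<Rightarrow> 'i \<Rightarrow> ('a \<Rightarrow> ('i, 'n) tensor) \<Rightarrow> real ^ 'n \<Rightarrow> ('i, 'n) tensor" where
  "cdc c y i T u is vs =
     frechet_derivative (\<lambda>p. T (chart_inv c p) is (tsl c (chart_inv c p) i is vs)) (at (snd c y)) u
     - (\<Sum>j<length is. if is ! j = i
          then T y is ((tsl c y i is vs)[j := to_tangent M c y (chr c (snd c y) u (vs ! j))]) else 0)"

lemma cov_rep_eq: "cov_rep M x i T is vs =
  (\<lambda>p. T (chart_inv (chart_at M x) p) is (tsl (chart_at M x) (chart_inv (chart_at M x) p) i is vs))"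
  by (rule ext) (simp add: cov_rep_def Let_def transport_slots_single)

lemma cov_deriv_cdc: "length vs = length is \<Longrightarrow> cov_deriv M x i T u is vs = cdc (chart_at M x) x i T u is vs"
  unfolding cov_deriv_def cdc_def cov_rep_eq christoffel_chr by (simp add: tsl_at cong: if_cong)

text \<open>The covariant derivative is a tensor. Differentiating the Jacobians in the moving slots
  yields one Hessian term per slot, and these are exactly the inhomogeneous terms by which the
  Christoffel symbols change.\<close>

lemma cdc_change:
  assumes c: "c \<in> charts M" "c' \<in> charts M" and y: "y \<in> fst c" "y \<in> fst c'"
    and N: "open N" "y \<in> N" "\<And>z. z \<in> N \<Longrightarrow> mlin n (T z is)"
    and d: "\<And>vs. length vs = n \<Longrightarrow> (\<lambda>p. T (chart_inv c' p) is (tsl c' (chart_inv c' p) i is vs)) differentiable (at (snd c' y))"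
    and len: "length is = n" "length vs = n"
  defines "A \<equiv> Dt c c' (snd c y)"
  shows "cdc c y i T u is vs = cdc c' y i T (A u) is (map2 (\<lambda>k v. if k = i then A v else v) is vs)"
proof -
  define S where "S p vs = T (chart_inv c' p) is (tsl c' (chart_inv c' p) i is vs)" for p vs
  define U where "U = {p \<in> chart_ran c'. chart_inv c' p \<in> N}"
  have U: "open U" "snd c' y \<in> U"
    unfolding U_def using chart_vimage_open[OF c(2) N(1)] chart_ran_mem[OF c(2) y(2)] chart_inv_left[OF c(2) y(2)] N(2) by auto
  have SU: "mlin n (S p)" if "p \<in> U" for p
    using that N(3) chart_inv_mem[OF c(2)] unfolding U_def S_def by (intro mlin_tsl[OF c(2) _ _ len(1)]) auto
  have Sd: "(\<lambda>p. S p vs) differentiable (at (snd c' y))" if "length vs = n" for vs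
    unfolding S_def using d[OF that] .
  let ?tr = "\<lambda>p. map2 (\<lambda>k v. if k = i then Dt c c' p v else v) is vs"
  let ?b = "map (\<lambda>k. k = i) is"
  have m2: "map2 (\<lambda>k v. if k then Dt c c' p v else v) ?b vs = ?tr p" for p
    by (rule nth_equalityI) auto
  have tsl_eq: "tsl c z i is vs = tsl c' z i is (?tr (snd c z))" if "z \<in> fst c" "z \<in> fst c'" for z
    by (rule nth_equalityI) (use len in \<open>auto simp: nth_tsl tt_chain[OF c that]\<close>)
  let ?p = "snd c y"
  let ?D = "\<lambda>u. frechet_derivative (\<lambda>p. S p (?tr ?p)) (at (snd c' y)) (A u)
       + (\<Sum>j<n. if is ! j = i then S (snd c' y) ((?tr ?p)[j := D2t c c' ?p u (vs ! j)]) else 0)"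
  have "((\<lambda>p. S (snd c' (chart_inv c p)) (?tr p)) has_derivative ?D) (at ?p)"
  proof (rule has_derivative_eq_rhs)
    show "((\<lambda>p. S (snd c' (chart_inv c p)) (?tr p)) has_derivative (\<lambda>u. frechet_derivative (\<lambda>p. S p (?tr ?p)) (at (snd c' y)) (Dt c c' ?p u)
       + (\<Sum>j<n. if ?b ! j then S (snd c' y) ((?tr ?p)[j := D2t c c' ?p u (vs ! j)]) else 0))) (at ?p)"
      using mlin_change_derivative[OF c y U SU Sd len(2), of ?b, unfolded m2] len by simp
    show "(\<lambda>u. frechet_derivative (\<lambda>p. S p (?tr ?p)) (at (snd c' y)) (Dt c c' ?p u)
       + (\<Sum>j<n. if ?b ! j then S (snd c' y) ((?tr ?p)[j := D2t c c' ?p u (vs ! j)]) else 0)) = ?D"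
      using len by (intro ext arg_cong2[where f="(+)"] sum.cong) (auto simp: A_def)
  qed
  then have "((\<lambda>p. T (chart_inv c p) is (tsl c (chart_inv c p) i is vs)) has_derivative ?D) (at ?p)"
  proof (rule has_derivative_transform_within_open[OF _ chart_image_open[OF c]])
    show "snd c y \<in> snd c ` (fst c \<inter> fst c')" using y by auto
    fix p assume "p \<in> snd c ` (fst c \<inter> fst c')"
    then obtain z where z: "p = snd c z" "z \<in> fst c" "z \<in> fst c'" by auto
    show "S (snd c' (chart_inv c p)) (?tr p) = T (chart_inv c p) is (tsl c (chart_inv c p) i is vs)"
      unfolding z(1) S_def using chart_inv_left[OF c(1) z(2)] chart_inv_left[OF c(2) z(3)] tsl_eq[OF z(2,3)] by simp
  qed
  note D = frechet_derivative_at[OF this, symmetric]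
  have Sy: "S (snd c' y) vs = T y is (tsl c' y i is vs)" for vs
    unfolding S_def using chart_inv_left[OF c(2) y(2)] by simp
  have key: "T y is ((tsl c y i is vs)[j := to_tangent M c y (chr c ?p u (vs ! j))])
      = T y is ((tsl c' y i is (?tr ?p))[j := to_tangent M c' y (chr c' (snd c' y) (A u) (?tr ?p ! j))])
       + S (snd c' y) ((?tr ?p)[j := D2t c c' ?p u (vs ! j)])" if j: "j < n" "is ! j = i" for j
  proof -
    have l: "linear (\<lambda>v. T y is ((tsl c' y i is (?tr ?p))[j := v]))"
      by (rule mlinD[OF N(3)[OF N(2)]]) (use j len in auto)
    have "to_tangent M c y (chr c ?p u (vs ! j))
      = to_tangent M c' y (chr c' (snd c' y) (A u) (A (vs ! j))) + to_tangent M c' y (D2t c c' ?p u (vs ! j))"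
      unfolding tt_chain[OF c y] chr_change[OF c y, folded A_def] A_def[symmetric]
      using tt_linear[OF c(2) y(2)] by (simp add: linear_add)
    moreover have "?tr ?p ! j = A (vs ! j)" using j len by (simp add: A_def)
    moreover have "S (snd c' y) ((?tr ?p)[j := D2t c c' ?p u (vs ! j)])
      = T y is ((tsl c' y i is (?tr ?p))[j := to_tangent M c' y (D2t c c' ?p u (vs ! j))])"
      unfolding Sy using j len by (subst tsl_update) auto
    ultimately show ?thesis using linear_add[OF l] tsl_eq[OF y] by simp
  qed
  have "cdc c y i T u is vs = ?D u - (\<Sum>j<n. if is ! j = i
          then T y is ((tsl c y i is vs)[j := to_tangent M c y (chr c ?p u (vs ! j))]) else 0)"
    unfolding cdc_def D len(1) ..
  also have "\<dots> = frechet_derivative (\<lambda>p. S p (?tr ?p)) (at (snd c' y)) (A u)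
      - (\<Sum>j<n. if is ! j = i then T y is ((tsl c' y i is (?tr ?p))[j := to_tangent M c' y (chr c' (snd c' y) (A u) (?tr ?p ! j))]) else 0)"
  proof -
    have "(\<Sum>j<n. if is ! j = i then T y is ((tsl c y i is vs)[j := to_tangent M c y (chr c ?p u (vs ! j))]) else 0)
      = (\<Sum>j<n. (if is ! j = i then T y is ((tsl c' y i is (?tr ?p))[j := to_tangent M c' y (chr c' (snd c' y) (A u) (?tr ?p ! j))]) else 0)
        + (if is ! j = i then S (snd c' y) ((?tr ?p)[j := D2t c c' ?p u (vs ! j)]) else 0))"
      using key by (intro sum.cong) auto
    then show ?thesis by (simp add: sum.distrib)
  qed
  also have "\<dots> = cdc c' y i T (A u) is (?tr ?p)"
    unfolding cdc_def S_def len(1) ..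
  finally show ?thesis unfolding A_def .
qed

text \<open>Allows the derivative at varying points y to be computed in one fixed chart; the
  definition would use a different preferred chart at each y, for which nothing is
  continuous.\<close>

lemma cov_deriv_chart:
  assumes c: "c \<in> charts M" "y \<in> fst c"
    and N: "open N" "y \<in> N" "\<And>z. z \<in> N \<Longrightarrow> mlin n (T z is)"
    and d: "\<And>vs. length vs = n \<Longrightarrow> cov_rep M y i T is vs differentiable (at (snd (chart_at M y) y))"
    and len: "length is = n" "length vs = n"
  shows "cov_deriv M y i T (to_tangent M c y u) is (tsl c y i is vs) = cdc c y i T u is vs"
proof -
  have "cdc c y i T u is vs = cdc (chart_at M y) y i T (Dt c (chart_at M y) (snd c y) u) is
      (map2 (\<lambda>k v. if k = i then Dt c (chart_at M y) (snd c y) v else v) is vs)"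
    by (rule cdc_change[where y=y and c'="chart_at M y" and T=T and n=n and N=N])
       (use c N d[unfolded cov_rep_eq] len in auto)
  then show ?thesis using len by (simp add: cov_deriv_cdc tsl_def to_tangent_Dt cong: if_cong)
qed

lemma christoffel_linear: "linear (christoffel M x u)" "linear (\<lambda>u. christoffel M x u v)"
  unfolding christoffel_chr using chr_linear[of "chart_at M x" "snd (chart_at M x) x"] chart_ran_mem[of "chart_at M x" x] by auto

lemma cov_deriv_linear:
  assumes N: "open N" "y \<in> N" "\<And>z. z \<in> N \<Longrightarrow> mlin n (T z is)"
    and d: "\<And>vs. length vs = n \<Longrightarrow> cov_rep M y i T is vs differentiable (at (snd (chart_at M y) y))"
    and len: "length is = n" 
  shows "length vs = n \<Longrightarrow> linear (\<lambda>u. cov_deriv M y i T u is vs)" "mlin n (cov_deriv M y i T u is)"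
proof -
  note mT = N(3)[OF N(2)]
  { assume vs: "length vs = n"
    have "linear (frechet_derivative (cov_rep M y i T is vs) (at (snd (chart_at M y) y)))"
      using d[OF vs] by (auto simp: frechet_derivative_works intro: has_derivative_linear)
    moreover have "linear (\<lambda>u. if is ! j = i then T y is (vs[j := christoffel M y u (vs ! j)]) else 0)" if "j < n" for j
    proof (cases "is ! j = i")
      case True
      have "linear (\<lambda>v. T y is (vs[j := v]))" by (rule mlinD[OF mT vs that])
      from linear_compose[OF christoffel_linear(2) this] True show ?thesis by (simp add: o_def)
    qed (simp add: linear_zero)
    ultimately show "linear (\<lambda>u. cov_deriv M y i T u is vs)"
      unfolding cov_deriv_def len by (intro linear_compose_sub linear_compose_sum) auto }
  define U where "U = {p \<in> chart_ran (chart_at M y). chart_inv (chart_at M y) p \<in> N}"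
  have U: "open U" "snd (chart_at M y) y \<in> U"
    unfolding U_def using chart_vimage_open[OF _ N(1), of "chart_at M y"] chart_ran_mem[of "chart_at M y" y] chart_inv_left[of "chart_at M y" y] N(2) by auto
  have "mlin n (\<lambda>vs. cov_rep M y i T is vs p)" if "p \<in> U" for p
    using that N(3) chart_inv_mem[of "chart_at M y" p] unfolding U_def cov_rep_eq by (intro mlin_tsl[OF _ _ _ len]) auto
  from mlin_frechet_derivative[OF U this d]
  have mD: "mlin n (\<lambda>vs. frechet_derivative (cov_rep M y i T is vs) (at (snd (chart_at M y) y)) u)" by simp
  show "mlin n (cov_deriv M y i T u is)"
    unfolding mlin_def
  proof (intro allI impI)
    fix vs :: "(real ^ 'n) list" and k assume vk: "length vs = n \<and> k < n"
    have "linear (\<lambda>v. if is ! j = i then T y is (vs[k := v, j := christoffel M y u (vs[k := v] ! j)]) else 0)" if j: "j < n" for j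
    proof (cases "is ! j = i")
      case True
      show ?thesis
      proof (cases "j = k")
        case eq: True
        have "linear (\<lambda>v. T y is (vs[j := v]))" by (rule mlinD[OF mT _ j]) (use vk in auto)
        from linear_compose[OF christoffel_linear(1) this] True eq vk show ?thesis by (simp add: o_def)
      next
        case False
        have "linear (\<lambda>v. T y is (vs[j := christoffel M y u (vs ! j), k := v]))" by (rule mlinD[OF mT]) (use vk in auto)
        then show ?thesis using True False by (simp add: list_update_swap)
      qed
    qed (simp add: linear_zero)
    moreover have "linear (\<lambda>v. frechet_derivative (cov_rep M y i T is (vs[k := v])) (at (snd (chart_at M y) y)) u)"
      using mlinD[OF mD] vk by blast
    ultimately show "linear (\<lambda>v. cov_deriv M y i T u is (vs[k := v]))"
      unfolding cov_deriv_def len by (intro linear_compose_sub linear_compose_sum) auto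
  qed
qed

end

section \<open>Orthonormal frames\<close>

lemma continuous_on_det:
  fixes A :: "'z::topological_space \<Rightarrow> real ^ 'n::finite ^ 'n"
  assumes "\<And>i j. continuous_on S (\<lambda>z. A z $ i $ j)"
  shows "continuous_on S (\<lambda>z. det (A z))"
  unfolding det_def by (intro continuous_on_sum continuous_on_mult continuous_on_const continuous_on_prod assms)

lemma listset_length: "vs \<in> listset As \<Longrightarrow> length vs = length As"
  by (induction As arbitrary: vs) (auto simp: set_Cons_def)

lemma sum_listset_Cons:
  assumes "finite A" "\<And>A. A \<in> set As \<Longrightarrow> finite A"
  shows "(\<Sum>vs\<in>listset (A # As). f vs) = (\<Sum>v\<in>A. \<Sum>vs\<in>listset As. f (v # vs))"
proof -
  have "listset (A # As) = (\<lambda>p. fst p # snd p) ` (A \<times> listset As)" by (force simp: set_Cons_def)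
  moreover have "inj_on (\<lambda>p. fst p # snd p) (A \<times> listset As)" by (auto simp: inj_on_def)
  ultimately have "(\<Sum>vs\<in>listset (A # As). f vs) = (\<Sum>p\<in>A \<times> listset As. f (fst p # snd p))"
    by (simp add: sum.reindex)
  then show ?thesis by (simp add: sum.cartesian_product case_prod_beta)
qed

context riem_mfd begin

definition orthonormal :: "'a \<Rightarrow> (real ^ 'n) set \<Rightarrow> bool" where
  "orthonormal x B \<longleftrightarrow> (\<forall>u\<in>B. \<forall>v\<in>B. metric M x u v = (if u = v then 1 else 0))"

lemma metric_sum_orthonormal:
  assumes "orthonormal x B" "finite B" "v \<in> B"
  shows "metric M x (\<Sum>u\<in>B. r u *\<^sub>R u) v = r v"
proof -
  have "metric M x (\<Sum>u\<in>B. r u *\<^sub>R u) v = (\<Sum>u\<in>B. r u * metric M x u v)"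
    by (simp add: linear_sum[OF metric_linear(2)] linear_cmul[OF metric_linear(2)])
  also have "\<dots> = (\<Sum>u\<in>B. if u = v then r u else 0)"
    using assms(1,3) by (intro sum.cong) (auto simp: orthonormal_def)
  finally show ?thesis using assms(2,3) by simp
qed

lemma orthonormal_card_le:
  assumes "orthonormal x B" "finite B" shows "card B \<le> CARD('n)"
proof -
  have "independent B"
    unfolding real_vector.independent_explicit_module
  proof (intro allI impI)
    fix t and r :: "real ^ 'n \<Rightarrow> real" and v
    assume t: "finite t" "t \<subseteq> B" "(\<Sum>v\<in>t. r v *\<^sub>R v) = 0" "v \<in> t"
    have "orthonormal x t" using assms(1) t(2) unfolding orthonormal_def by (simp add: subset_eq)
    from metric_sum_orthonormal[OF this t(1,4), of r] t(3) show "r v = 0"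
      using linear_0[OF metric_linear(2)] by simp
  qed
  then show ?thesis using independent_bound[of B] by simp
qed

text \<open>One Gram-Schmidt step. It serves twice: to build an orthonormal set of full size, and,
  against the bound \<open>orthonormal_card_le\<close>, to show that such a set spans.\<close>

lemma orthonormal_extend:
  assumes B: "orthonormal x B" "finite B" and w: "w \<noteq> (\<Sum>u\<in>B. metric M x w u *\<^sub>R u)"
  shows "\<exists>e. e \<notin> B \<and> orthonormal x (insert e B)"
proof -
  define w' where "w' = w - (\<Sum>u\<in>B. metric M x w u *\<^sub>R u)"
  have 0: "metric M x w' v = 0" if "v \<in> B" for v
    unfolding w'_def using metric_sum_orthonormal[OF B that] by (simp add: linear_diff[OF metric_linear(2)])
  have pos: "metric M x w' w' > 0" using w by (intro metric_pos) (simp add: w'_def)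
  define r where "r = 1 / sqrt (metric M x w' w')"
  define e where "e = r *\<^sub>R w'"
  have ee: "metric M x e e = 1"
    unfolding e_def using pos by (simp add: linear_cmul[OF metric_linear(1)] linear_cmul[OF metric_linear(2)] r_def flip: power2_eq_square)
  have ev: "metric M x e v = 0" if "v \<in> B" for v
    unfolding e_def using 0[OF that] by (simp add: linear_cmul[OF metric_linear(2)])
  have "e \<notin> B" using ev[of e] ee by auto
  moreover have "orthonormal x (insert e B)"
    unfolding orthonormal_def
  proof (intro ballI)
    fix u v assume "u \<in> insert e B" "v \<in> insert e B"
    then consider "u = e" "v = e" | "u = e" "v \<in> B" | "u \<in> B" "v = e" | "u \<in> B" "v \<in> B" by blast
    then show "metric M x u v = (if u = v then 1 else 0)"
    proof cases
      case 1 then show ?thesis using ee by simp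
    next
      case 2 then show ?thesis using ev[OF 2(2)] \<open>e \<notin> B\<close> by auto
    next
      case 3 then show ?thesis using ev[OF 3(1)] metric_sym[of x u e] \<open>e \<notin> B\<close> by auto
    next
      case 4 then show ?thesis using B(1) by (simp add: orthonormal_def)
    qed
  qed
  ultimately show ?thesis by blast
qed

lemma onb_exists: "\<exists>B. card B = CARD('n) \<and> orthonormal x B"
proof -
  have "k \<le> CARD('n) \<Longrightarrow> \<exists>B. finite B \<and> card B = k \<and> orthonormal x B" for k
  proof (induction k)
    case 0 show ?case by (intro exI[of _ "{}"]) (auto simp: orthonormal_def)
  next
    case (Suc k)
    then obtain B where B: "finite B" "card B = k" "orthonormal x B" by auto
    have "\<exists>w. w \<noteq> (\<Sum>u\<in>B. metric M x w u *\<^sub>R u)"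
    proof (rule ccontr)
      assume "\<not> ?thesis"
      moreover have "(\<Sum>u\<in>B. metric M x w u *\<^sub>R u) \<in> span B" for w
        by (intro span_sum span_scale span_base)
      ultimately have "w \<in> span B" for w by metis
      then have "(UNIV :: (real ^ 'n) set) \<subseteq> span B" by auto
      from dim_le_card[OF this B(1)] B(2) Suc.prems show False by simp
    qed
    then obtain e where "e \<notin> B" "orthonormal x (insert e B)" using orthonormal_extend[OF B(3,1)] by blast
    then show ?case using B by (intro exI[of _ "insert e B"]) auto
  qed
  from this[of "CARD('n)"] show ?thesis by auto
qed

lemma onb_card: "card (onb M x) = CARD('n)" and onb_orthonormal: "orthonormal x (onb M x)"
  using someI_ex[OF onb_exists[of x]] unfolding onb_def orthonormal_def by blast+

lemma onb_finite[simp]: "finite (onb M x)"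
  using onb_card[of x] by (metis card.infinite card_gt_0_iff finite_UNIV_card_ge_0 finite_class.finite_UNIV less_irrefl)

lemma onb_expansion: "w = (\<Sum>u\<in>onb M x. metric M x w u *\<^sub>R u)"
proof (rule ccontr)
  assume "w \<noteq> (\<Sum>u\<in>onb M x. metric M x w u *\<^sub>R u)"
  then obtain e where e: "e \<notin> onb M x" "orthonormal x (insert e (onb M x))"
    using orthonormal_extend[OF onb_orthonormal onb_finite] by blast
  from orthonormal_card_le[OF e(2)] e(1) onb_card[of x] show False by simp
qed

text \<open>The inverse of the Gram matrix in the chart c, by \<open>gmat_ginv\<close>; hence it
  does not depend on the orthonormal basis by which it is written here.\<close>

definition ginv :: "('a, 'n) chart \<Rightarrow> 'a \<Rightarrow> 'n \<Rightarrow> 'n \<Rightarrow> real" where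
  "ginv c y a b = (\<Sum>u\<in>onb M y. Dt (chart_at M y) c (snd (chart_at M y) y) u $ a *
     Dt (chart_at M y) c (snd (chart_at M y) y) u $ b)"

text \<open>\<open>onb\<close> is an arbitrary choice at every point, so sums over it are not
  visibly continuous. In coordinate frames the same contraction has coefficients that are continuous
  in the point.\<close>

lemma frame_sum:
  assumes c: "c \<in> charts M" "y \<in> fst c" and lin: "linear f" "linear g"
  shows "(\<Sum>u\<in>onb M y. f u * g u) = (\<Sum>a\<in>UNIV. \<Sum>b\<in>UNIV. ginv c y a b *
    (f (to_tangent M c y (axis a 1)) * (g (to_tangent M c y (axis b 1)) :: real)))"
proof -
  let ?L = "to_tangent M c y" and ?L' = "Dt (chart_at M y) c (snd (chart_at M y) y)"
  have e: "h u = (\<Sum>a\<in>UNIV. ?L' u $ a * h (?L (axis a 1)))" if "linear h" for h :: "real ^ 'n \<Rightarrow> real" and u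
    using linear_axis_expansion_real[OF linear_compose[OF tt_linear[OF c] that], of "?L' u"] tt_Dt[OF c, of u]
    by simp
  have "(\<Sum>u\<in>onb M y. f u * g u) = (\<Sum>u\<in>onb M y. \<Sum>a\<in>UNIV. \<Sum>b\<in>UNIV. (?L' u $ a * f (?L (axis a 1))) * (?L' u $ b * g (?L (axis b 1))))"
    by (intro sum.cong refl, subst e[OF lin(1)], subst e[OF lin(2)]) (simp add: sum_product)
  also have "\<dots> = (\<Sum>a\<in>UNIV. \<Sum>b\<in>UNIV. \<Sum>u\<in>onb M y. (?L' u $ a * f (?L (axis a 1))) * (?L' u $ b * g (?L (axis b 1))))"
    by (subst sum.swap, intro sum.cong refl, subst sum.swap) simp
  also have "\<dots> = (\<Sum>a\<in>UNIV. \<Sum>b\<in>UNIV. ginv c y a b * (f (?L (axis a 1)) * g (?L (axis b 1))))"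
    unfolding ginv_def by (intro sum.cong refl) (simp add: sum_distrib_left mult_ac)
  finally show ?thesis .
qed

definition gmat :: "('a, 'n) chart \<Rightarrow> real ^ 'n \<Rightarrow> real ^ 'n ^ 'n" where
  "gmat c p = (\<chi> a b. gram M c p (axis a 1) (axis b 1))"

lemma gmat_ginv:
  assumes c: "c \<in> charts M" "y \<in> fst c"
  shows "gmat c (snd c y) ** (\<chi> a b. ginv c y a b) = mat 1"
proof -
  let ?L = "to_tangent M c y" and ?L' = "Dt (chart_at M y) c (snd (chart_at M y) y)"
  have lL': "linear (\<lambda>u. ?L' u $ k)" for k
    using linear_compose[OF Dt_linear[of "chart_at M y" c y] bounded_linear.linear[OF bounded_linear_vec_nth]] c
    by (simp add: o_def)
  have "(\<Sum>b\<in>UNIV. gram M c (snd c y) (axis a 1) (axis b 1) * ginv c y b k) = (if a = k then 1 else 0)" for a k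
  proof -
    have "(\<Sum>b\<in>UNIV. gram M c (snd c y) (axis a 1) (axis b 1) * ginv c y b k)
       = (\<Sum>u\<in>onb M y. (\<Sum>b\<in>UNIV. ?L' u $ b * metric M y (?L (axis a 1)) (?L (axis b 1))) * ?L' u $ k)"
      unfolding ginv_def by (simp add: gram_at[OF c] sum_distrib_left sum_distrib_right mult_ac) (subst sum.swap, simp)
    also have "\<dots> = (\<Sum>u\<in>onb M y. metric M y (?L (axis a 1)) u * ?L' u $ k)"
    proof (intro sum.cong refl arg_cong2[where f=times])
      fix u
      have "linear (metric M y (?L (axis a 1)) \<circ> ?L)" by (rule linear_compose[OF tt_linear[OF c] metric_linear(1)])
      from linear_axis_expansion_real[OF this, of "?L' u"]
      show "(\<Sum>b\<in>UNIV. ?L' u $ b * metric M y (?L (axis a 1)) (?L (axis b 1))) = metric M y (?L (axis a 1)) u"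
        by (simp add: tt_Dt[OF c])
    qed
    also have "\<dots> = ?L' (\<Sum>u\<in>onb M y. metric M y (?L (axis a 1)) u *\<^sub>R u) $ k"
      by (simp add: linear_sum[OF lL'[of k]] linear_cmul[OF lL'[of k]])
    also have "\<dots> = ?L' (?L (axis a 1)) $ k" using onb_expansion[of "?L (axis a 1)" y] by simp
    also have "\<dots> = axis a 1 $ k"
      using Dt_inverse[of c "chart_at M y" y "axis a 1"] c by (simp add: to_tangent_Dt)
    finally show ?thesis by (simp add: axis_def)
  qed
  then show ?thesis by (simp add: matrix_matrix_mult_def gmat_def mat_def vec_eq_iff)
qed

lemma gmat_det: "c \<in> charts M \<Longrightarrow> p \<in> chart_ran c \<Longrightarrow> det (gmat c p) \<noteq> 0"
  using gmat_ginv[of c "chart_inv c p"] chart_inv_mem[of c p] chart_inv_right[of c p]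
  by (metis invertible_det_nz invertible_right_inverse)

lemma gmat_continuous: "c \<in> charts M \<Longrightarrow> continuous_on (chart_ran c) (\<lambda>p. gmat c p $ i $ j)"
  unfolding gmat_def by (simp add: gram_continuous)

text \<open>Column b of \<open>ginv\<close> solves a linear system with the Gram matrix and
  right-hand side \<open>axis b 1\<close>. Cramer's rule gives its entries as quotients of
  determinants with continuous entries.\<close>

lemma ginv_continuous:
  assumes c: "c \<in> charts M"
  shows "continuous_on (chart_ran c) (\<lambda>p. ginv c (chart_inv c p) a b)"
proof -
  have "ginv c (chart_inv c p) a b = det (\<chi> i j. if j = a then axis b 1 $ i else gmat c p $ i $ j) / det (gmat c p)"
    if p: "p \<in> chart_ran c" for p
  proof -
    have "gmat c p *v (\<chi> a. ginv c (chart_inv c p) a b) = axis b 1"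
    proof -
      have "gmat c p ** (\<chi> a b. ginv c (chart_inv c p) a b) = mat 1"
        using gmat_ginv[OF c chart_inv_mem[OF c p]] chart_inv_right[OF c p] by simp
      then have "(gmat c p ** (\<chi> a b. ginv c (chart_inv c p) a b)) $ i $ b = mat 1 $ i $ b" for i by simp
      then show ?thesis by (simp add: vec_eq_iff matrix_vector_mult_def matrix_matrix_mult_def mat_def axis_def)
    qed
    then have "(\<chi> a. ginv c (chart_inv c p) a b) = (\<chi> k. det (\<chi> i j. if j = k then axis b 1 $ i else gmat c p $ i $ j) / det (gmat c p))"
      using cramer[OF gmat_det[OF c p]] by blast
    then show ?thesis by (simp add: vec_eq_iff)
  qed
  moreover have "continuous_on (chart_ran c) (\<lambda>p. det (\<chi> i j. if j = a then axis b 1 $ i else gmat c p $ i $ j) / det (gmat c p))"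
  proof (intro continuous_on_divide continuous_on_det gmat_continuous c ballI gmat_det)
    fix i j show "continuous_on (chart_ran c) (\<lambda>p. (\<chi> i j. if j = a then axis b 1 $ i else gmat c p $ i $ j) $ i $ j)"
      by (cases "j = a") (auto intro: gmat_continuous[OF c])
  qed
  ultimately show ?thesis by (simp cong: continuous_on_cong)
qed

text \<open>The Koszul formula is a linear system for the coordinates of \<open>chr\<close>;
  inverting the Gram matrix expresses them by \<open>ginv\<close> and first derivatives of the
  metric.\<close>

lemma chr_continuous:
  assumes c: "c \<in> charts M"
  shows "continuous_on (chart_ran c) (\<lambda>p. chr c p u v $ b)"
proof -
  have "chr c p u v $ b = (\<Sum>a\<in>UNIV. ginv c (chart_inv c p) b a * (koszul c p u v (axis a 1) / 2))"
    if p: "p \<in> chart_ran c" for p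
  proof -
    let ?H = "\<chi> a b. ginv c (chart_inv c p) a b"
    have "gmat c p ** ?H = mat 1"
      using gmat_ginv[OF c chart_inv_mem[OF c p]] chart_inv_right[OF c p] by simp
    then have H: "?H ** gmat c p = mat 1" by (simp add: matrix_left_right_inverse)
    have "gmat c p *v chr c p u v = (\<chi> a. koszul c p u v (axis a 1) / 2)"
    proof -
      have "(\<Sum>b\<in>UNIV. gram M c p (axis a 1) (axis b 1) * chr c p u v $ b) = koszul c p u v (axis a 1) / 2" for a
      proof -
        have "(\<Sum>b\<in>UNIV. gram M c p (axis a 1) (axis b 1) * chr c p u v $ b) = gram M c p (axis a 1) (chr c p u v)"
          using linear_axis_expansion_real[OF gram_linear(1)[OF c p], of "axis a 1" "chr c p u v"] by (simp add: mult.commute)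
        then show ?thesis using chr_koszul[OF c p, of u v "axis a 1"] by (simp add: gram_sym)
      qed
      then show ?thesis by (simp add: gmat_def matrix_vector_mult_def vec_eq_iff)
    qed
    then have "?H *v (\<chi> a. koszul c p u v (axis a 1) / 2) = chr c p u v"
      using H by (metis matrix_vector_mul_assoc matrix_vector_mul_lid)
    then have "(?H *v (\<chi> a. koszul c p u v (axis a 1) / 2)) $ b = chr c p u v $ b" by simp
    then show ?thesis by (simp add: matrix_vector_mult_def)
  qed
  moreover have "continuous_on (chart_ran c) (\<lambda>p. \<Sum>a\<in>UNIV. ginv c (chart_inv c p) b a * (koszul c p u v (axis a 1) / 2))"
    unfolding koszul_def
    by (intro continuous_on_sum continuous_on_mult continuous_on_divide continuous_on_add continuous_on_diff
        continuous_on_const Dgram_continuous ginv_continuous c) simp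
  ultimately show ?thesis by (simp cong: continuous_on_cong)
qed

lemma ginv_continuous_comp:
  assumes "c \<in> charts M" "continuous_on S x" "\<And>z. z \<in> S \<Longrightarrow> x z \<in> fst c"
  shows "continuous_on S (\<lambda>z. ginv c (x z) a b)"
proof -
  have "continuous_on S (\<lambda>z. snd c (x z))"
    using continuous_on_compose2[OF chart_cont[OF assms(1)] assms(2)] assms(3) by auto
  then have "continuous_on S (\<lambda>z. ginv c (chart_inv c (snd c (x z))) a b)"
    by (rule continuous_on_compose2[OF ginv_continuous[OF assms(1)]]) (use assms chart_ran_mem[OF assms(1)] in auto)
  then show ?thesis using assms(3) chart_inv_left[OF assms(1)] by (simp cong: continuous_on_cong)
qed

text \<open>Induction on the slots: \<open>frame_sum\<close> replaces the orthonormal basis in the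
  first slot by the coordinate frame of its chart, and the remaining sum is the same statement with
  that frame vector inserted. In the end only values on coordinate vectors must be
  continuous.\<close>

lemma comp_sum_continuous:
  fixes A B :: "'z::topological_space \<Rightarrow> (real ^ 'n) list \<Rightarrow> real" and x :: "'z \<Rightarrow> 'i \<Rightarrow> 'a"
  assumes "\<And>i. i \<in> set is \<Longrightarrow> c i \<in> charts M" "\<And>i. i \<in> set is \<Longrightarrow> continuous_on S (\<lambda>z. x z i)"
    "\<And>i z. i \<in> set is \<Longrightarrow> z \<in> S \<Longrightarrow> x z i \<in> fst (c i)"
    "\<And>z. z \<in> S \<Longrightarrow> mlin (length is) (A z)" "\<And>z. z \<in> S \<Longrightarrow> mlin (length is) (B z)"
    "\<And>vs. length vs = length is \<Longrightarrow> continuous_on S (\<lambda>z. A z (map2 (\<lambda>i v. to_tangent M (c i) (x z i) v) is vs))"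
    "\<And>vs. length vs = length is \<Longrightarrow> continuous_on S (\<lambda>z. B z (map2 (\<lambda>i v. to_tangent M (c i) (x z i) v) is vs))"
  shows "continuous_on S (\<lambda>z. \<Sum>ws\<in>listset (map (\<lambda>i. onb M (x z i)) is). A z ws * B z ws)"
  using assms
proof (induction "is" arbitrary: A B)
  case Nil
  show ?case using Nil(6)[of "[]"] Nil(7)[of "[]"] by (simp add: continuous_on_mult)
next
  case (Cons i "is")
  let ?e = "\<lambda>z a. to_tangent M (c i) (x z i) (axis a 1)"
  let ?I = "\<lambda>a b z. \<Sum>ws\<in>listset (map (\<lambda>i. onb M (x z i)) is). A z (?e z a # ws) * B z (?e z b # ws)"
  have IH: "continuous_on S (?I a b)" for a b
  proof (rule Cons.IH)
    fix vs :: "(real ^ 'n) list" assume vs: "length vs = length is"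
    show "continuous_on S (\<lambda>z. A z (?e z a # map2 (\<lambda>i v. to_tangent M (c i) (x z i) v) is vs))"
      using Cons.prems(6)[of "axis a 1 # vs"] vs by simp
    show "continuous_on S (\<lambda>z. B z (?e z b # map2 (\<lambda>i v. to_tangent M (c i) (x z i) v) is vs))"
      using Cons.prems(7)[of "axis b 1 # vs"] vs by simp
  next
    fix z assume "z \<in> S"
    then show "mlin (length is) (\<lambda>ws. A z (?e z a # ws))" "mlin (length is) (\<lambda>ws. B z (?e z b # ws))"
      using Cons.prems(4,5) by (auto intro!: mlin_Cons)
  qed (use Cons.prems(1-3) in auto)
  have "(\<Sum>ws\<in>listset (map (\<lambda>i. onb M (x z i)) (i # is)). A z ws * B z ws)
      = (\<Sum>a\<in>UNIV. \<Sum>b\<in>UNIV. ginv (c i) (x z i) a b * ?I a b z)" if z: "z \<in> S" for z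
  proof -
    let ?Ls = "listset (map (\<lambda>i. onb M (x z i)) is)"
    have "(\<Sum>ws\<in>listset (map (\<lambda>i. onb M (x z i)) (i # is)). A z ws * B z ws) = (\<Sum>ws\<in>?Ls. \<Sum>u\<in>onb M (x z i). A z (u # ws) * B z (u # ws))"
      unfolding list.map by (subst sum_listset_Cons) (auto intro: sum.swap)
    also have "\<dots> = (\<Sum>ws\<in>?Ls. \<Sum>a\<in>UNIV. \<Sum>b\<in>UNIV. ginv (c i) (x z i) a b * (A z (?e z a # ws) * B z (?e z b # ws)))"
    proof (intro sum.cong refl frame_sum)
      fix ws assume "ws \<in> ?Ls"
      then have l: "length ws = length is" using listset_length by fastforce
      show "linear (\<lambda>u. A z (u # ws))" "linear (\<lambda>u. B z (u # ws))"
        using Cons.prems(4,5)[OF z] l by (auto intro!: mlin_Cons_linear)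
    qed (use Cons.prems z in auto)
    also have "\<dots> = (\<Sum>a\<in>UNIV. \<Sum>b\<in>UNIV. ginv (c i) (x z i) a b * ?I a b z)"
      by (subst sum.swap, intro sum.cong refl, subst sum.swap) (simp add: sum_distrib_left)
    finally show ?thesis .
  qed
  moreover have "continuous_on S (\<lambda>z. \<Sum>a\<in>UNIV. \<Sum>b\<in>UNIV. ginv (c i) (x z i) a b * ?I a b z)"
    by (intro continuous_on_sum continuous_on_mult IH ginv_continuous_comp) (use Cons.prems in auto)
  ultimately show ?case by (simp cong: continuous_on_cong)
qed

end

section \<open>Smooth forms on powers of the manifold\<close>

lemma continuous_on_relatively_open_cover:
  assumes "\<And>x. x \<in> X \<Longrightarrow> \<exists>U. open U \<and> x \<in> U \<and> continuous_on (X \<inter> U) f"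
  shows "continuous_on X f"
  unfolding continuous_on_topological
proof (intro ballI allI impI)
  fix x B assume x: "x \<in> X" and B: "open B" "f x \<in> B"
  obtain U where U: "open U" "x \<in> U" "continuous_on (X \<inter> U) f" using assms[OF x] by blast
  obtain A where "open A" "x \<in> A" "\<forall>y\<in>X \<inter> U. y \<in> A \<longrightarrow> f y \<in> B"
    using U(3)[unfolded continuous_on_topological, rule_format, of x B] x U(2) B by blast
  then show "\<exists>A. open A \<and> x \<in> A \<and> (\<forall>y\<in>X. y \<in> A \<longrightarrow> f y \<in> B)"
    using U by (intro exI[of _ "A \<inter> U"]) auto
qed

text \<open>Composition with restriction to the first k coordinates makes f continuous on the full
  countable product. There second countability makes the Borel sets equal to the product
  sigma-algebra.\<close>

lemma continuous_on_extensional_measurable: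
  fixes f :: "(nat \<Rightarrow> 'b::second_countable_topology) \<Rightarrow> 'c::topological_space"
  assumes "continuous_on (PiE {..<k} (\<lambda>_. UNIV)) f"
  shows "f \<in> borel_measurable (PiM {..<k} (\<lambda>_. borel))"
proof -
  have "continuous_on UNIV (\<lambda>x :: nat \<Rightarrow> 'b. restrict x {..<k})"
  proof (rule continuous_on_coordinatewise_then_product)
    fix i :: nat show "continuous_on UNIV (\<lambda>x :: nat \<Rightarrow> 'b. restrict x {..<k} i)"
      by (cases "i < k") (simp_all add: continuous_on_product_coordinates)
  qed
  then have "continuous_on UNIV (\<lambda>x. f (restrict x {..<k}))"
    by (rule continuous_on_compose2[OF assms]) (auto split: if_splits)
  then have "(\<lambda>x. f (restrict x {..<k})) \<in> borel_measurable borel" by (rule borel_measurable_continuous_onI)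
  then have 1: "(\<lambda>x. f (restrict x {..<k})) \<in> borel_measurable (PiM UNIV (\<lambda>_. borel))"
    using sets_PiM_equal_borel measurable_cong_sets by blast
  have "(\<lambda>x. x) \<in> measurable (PiM {..<k} (\<lambda>_. borel :: 'b measure)) (PiM UNIV (\<lambda>_. borel))"
  proof (rule measurable_PiM_single')
    fix i :: nat
    show "(\<lambda>x. x i) \<in> borel_measurable (PiM {..<k} (\<lambda>_. borel :: 'b measure))"
    proof (cases "i < k")
      case False
      have "(\<lambda>x. undefined) \<in> borel_measurable (PiM {..<k} (\<lambda>_. borel :: 'b measure))" by simp
      then show ?thesis using False by (subst measurable_cong[of _ _ "\<lambda>x. undefined"]) (auto simp: space_PiM PiE_def extensional_def)
    qed simp
  qed auto
  from measurable_compose[OF this 1] show ?thesis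
    by (rule measurable_cong[THEN iffD1, rotated]) (auto simp: space_PiM PiE_restrict)
qed

lemma finite_tuples[simp]: "finite I \<Longrightarrow> finite (tuples I n)"
  unfolding tuples_def using finite_lists_length_eq[of I n] by (simp add: conj_commute)

context riem_mfd begin

lemma continuous_on_charts:
  assumes "\<And>c. c \<in> charts M \<Longrightarrow> continuous_on (fst c) f"
  shows "continuous_on UNIV f"
proof (rule continuous_on_relatively_open_cover)
  fix x show "\<exists>U. open U \<and> x \<in> U \<and> continuous_on (UNIV \<inter> U) f"
    using assms[of "chart_at M x"] chart_open[of "chart_at M x"] by (intro exI[of _ "fst (chart_at M x)"]) auto
qed

text \<open>A tent function in chart coordinates, extended by zero. It is continuous on the chart
  domain and vanishes off the compact set K, the inverse image of a closed ball; since the space is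
  Hausdorff, the complement of K is open and the two pieces glue.\<close>

lemma chart_bump:
  fixes x :: 'a assumes U: "open U" "x \<in> U"
  shows "\<exists>f\<in>C0. (\<forall>y. 0 \<le> f y) \<and> f x > 0 \<and> {y. f y \<noteq> 0} \<subseteq> U"
proof -
  define c where "c = chart_at M x"
  have c: "c \<in> charts M" "x \<in> fst c" by (auto simp: c_def)
  let ?p = "snd c x"
  have "open {p \<in> chart_ran c. chart_inv c p \<in> U}" by (rule chart_vimage_open[OF c(1) U(1)])
  moreover have "?p \<in> {p \<in> chart_ran c. chart_inv c p \<in> U}"
    using chart_ran_mem[OF c] chart_inv_left[OF c] U(2) by simp
  ultimately obtain r where r: "r > 0" "cball ?p r \<subseteq> {p \<in> chart_ran c. chart_inv c p \<in> U}"
    using open_contains_cball by blast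
  define K where "K = chart_inv c ` cball ?p r"
  have "continuous_on (cball ?p r) (chart_inv c)"
    by (rule continuous_on_subset[OF chart_inv_cont[OF c(1)]]) (use r in auto)
  then have K: "compact K" unfolding K_def by (intro compact_continuous_image compact_cball)
  define f where "f y = (if y \<in> fst c then max 0 (r - dist (snd c y) ?p) else 0)" for y
  have fK: "f y = 0" if "y \<notin> K" for y
  proof (cases "y \<in> fst c")
    case True
    then have "snd c y \<notin> cball ?p r" using that chart_inv_left[OF c(1) True] unfolding K_def by force
    then show ?thesis by (simp add: f_def dist_commute)
  qed (simp add: f_def)
  have "continuous_on (fst c) (\<lambda>y. max 0 (r - dist (snd c y) ?p))"
    by (intro continuous_intros chart_cont[OF c(1)])
  then have 1: "continuous_on (fst c) f" by (rule continuous_on_eq) (simp add: f_def)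
  have "continuous_on (-K) (\<lambda>_. 0 :: real)" by (rule continuous_on_const)
  then have 2: "continuous_on (-K) f" by (rule continuous_on_eq) (simp add: fK)
  have "continuous_on (fst c \<union> -K) f"
    using 1 2 chart_open[OF c(1)] compact_imp_closed[OF K] by (intro continuous_on_open_Un) auto
  moreover have "K \<subseteq> fst c" unfolding K_def using r(2) chart_inv_mem[OF c(1)] by auto
  then have "fst c \<union> -K = UNIV" by auto
  ultimately have "continuous_on UNIV f" by simp
  then have "f \<in> C0" using C0I[OF _ K, of f] fK by blast
  moreover have "f x > 0" using r c by (simp add: f_def)
  moreover have "K \<subseteq> U" unfolding K_def using r(2) by auto
  then have "{y. f y \<noteq> 0} \<subseteq> U" using fK by blast
  ultimately show ?thesis by (intro bexI[of _ f]) (auto simp: f_def)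
qed

sublocale bump_space "TYPE('a)"
  by unfold_locales (rule chart_bump)

lemma transport_Some: "transport_slots M (Some \<circ> c) x is vs = map2 (\<lambda>i v. to_tangent M (c i) (x i) v) is vs"
  by (simp add: transport_slots_def)

section \<open>Coordinates for forms on powers of the manifold\<close>

definition coord :: "(nat \<Rightarrow> ('a, 'n) chart) \<Rightarrow> nat \<Rightarrow> (nat \<Rightarrow> 'a) \<Rightarrow> nat \<Rightarrow> real ^ 'n" where
  "coord c k x = (\<lambda>j\<in>{..<k}. snd (c j) (x j))"

text \<open>The coefficient functions of \<omega> in a product chart, with vectors given in chart
  coordinates in every slot. \<open>smooth_form_Xk\<close> demands smoothness of precisely these
  functions.\<close>

definition frep :: "(nat \<Rightarrow> ('a, 'n) chart) \<Rightarrow> nat \<Rightarrow> ((nat \<Rightarrow> 'a) \<Rightarrow> (nat, 'n) tensor) \<Rightarrow> nat list \<Rightarrow> (real ^ 'n) list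
    \<Rightarrow> (nat \<Rightarrow> real ^ 'n) \<Rightarrow> real" where
  "frep c k \<omega> is vs q = (let x = (\<lambda>i\<in>{..<k}. chart_inv (c i) (q i))
               in \<omega> x is (transport_slots M (Some \<circ> c) x is vs))"

definition cdom :: "(nat \<Rightarrow> ('a, 'n) chart) \<Rightarrow> nat \<Rightarrow> (nat \<Rightarrow> 'a) set" where
  "cdom c k = {x \<in> PiE {..<k} (\<lambda>_. UNIV). \<forall>j<k. x j \<in> fst (c j)}"

lemma frep_smooth:
  assumes "smooth_form_Xk M n k \<omega>" "\<And>j. j < k \<Longrightarrow> c j \<in> charts M" "is \<in> tuples {..<k} n" "length vs = n"
  shows "smooth_on_prod k (PiE {..<k} (\<lambda>i. chart_ran (c i))) (frep c k \<omega> is vs)"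
  using assms unfolding smooth_form_Xk_def frep_def[abs_def] by blast

lemma coord_mem: "(\<And>j. j < k \<Longrightarrow> c j \<in> charts M) \<Longrightarrow> x \<in> cdom c k \<Longrightarrow> coord c k x \<in> PiE {..<k} (\<lambda>i. chart_ran (c i))"
  using chart_ran_mem by (auto simp: coord_def cdom_def)

lemma frep_coord_upd:
  assumes c: "\<And>j. j < k \<Longrightarrow> c j \<in> charts M" and x: "x \<in> cdom c k" and i: "i < k"
  shows "frep c k \<omega> is vs ((coord c k x)(i := p)) =
    \<omega> (x(i := chart_inv (c i) p)) is (map2 (\<lambda>j v. to_tangent M (c j) ((x(i := chart_inv (c i) p)) j) v) is vs)"
proof -
  have "(\<lambda>j\<in>{..<k}. chart_inv (c j) (((coord c k x)(i := p)) j)) = x(i := chart_inv (c i) p)"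
    using x i chart_inv_left[OF c] by (auto simp: fun_eq_iff coord_def cdom_def PiE_def extensional_def)
  then show ?thesis by (simp add: frep_def Let_def transport_Some)
qed

lemma frep_coord:
  assumes c: "\<And>j. j < k \<Longrightarrow> c j \<in> charts M" and x: "x \<in> cdom c k"
  shows "frep c k \<omega> is vs (coord c k x) = \<omega> x is (map2 (\<lambda>j v. to_tangent M (c j) (x j) v) is vs)"
proof -
  have "(\<lambda>j\<in>{..<k}. chart_inv (c j) (coord c k x j)) = x"
    using x chart_inv_left[OF c] by (auto simp: fun_eq_iff coord_def cdom_def PiE_def extensional_def)
  then show ?thesis by (simp add: frep_def Let_def transport_Some)
qed

lemma coord_continuous:
  assumes "\<And>j. j < k \<Longrightarrow> c j \<in> charts M" shows "continuous_on (cdom c k) (coord c k)"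
proof (rule continuous_on_coordinatewise_then_product)
  fix i show "continuous_on (cdom c k) (\<lambda>x. coord c k x i)"
  proof (cases "i < k")
    case True
    have "continuous_on (cdom c k) (\<lambda>x. snd (c i) (x i))"
      by (rule continuous_on_compose2[OF chart_cont[OF assms[OF True]]])
         (auto intro: continuous_on_product_coordinates[THEN continuous_on_subset] simp: cdom_def True)
    then show ?thesis using True by (simp add: coord_def)
  qed (simp add: coord_def)
qed

lemma form_mlin:
  assumes "smooth_form_Xk M n k \<omega>" "x \<in> PiE {..<k} (\<lambda>_. UNIV)" "is \<in> tuples {..<k} n"
  shows "mlin n (\<omega> x is)"
  using assms unfolding smooth_form_Xk_def wedge_def mlin_def by blast

text \<open>In \<open>vs'\<close> all slots except those labelled i are already transported at x.
  Transporting the latter at the moving point completes the list, so moving the i-th point is moving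
  the i-th block of coordinates in \<open>frep\<close>.\<close>

lemma form_slots:
  assumes c: "\<And>j. j < k \<Longrightarrow> c j \<in> charts M" and x: "x \<in> cdom c k" and i: "i < k"
    and len: "length vs = length is"
  defines "vs' \<equiv> map2 (\<lambda>j v. if j = i then v else to_tangent M (c j) (x j) v) is vs"
  shows "\<omega> (x(i := chart_inv (c i) p)) is (tsl (c i) (chart_inv (c i) p) i is vs') = frep c k \<omega> is vs ((coord c k x)(i := p))"
proof -
  have "tsl (c i) (chart_inv (c i) p) i is vs' = map2 (\<lambda>j v. to_tangent M (c j) ((x(i := chart_inv (c i) p)) j) v) is vs"
    by (rule nth_equalityI) (use len in \<open>auto simp: vs'_def nth_tsl\<close>)
  then show ?thesis by (simp add: frep_coord_upd[OF c x i])
qed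

lemma frep_differentiable:
  assumes "smooth_form_Xk M n k \<omega>" "\<And>j. j < k \<Longrightarrow> c j \<in> charts M" "is \<in> tuples {..<k} n" "length vs = n"
    "x \<in> cdom c k" "i < k"
  shows "(\<lambda>p. frep c k \<omega> is vs ((coord c k x)(i := p))) differentiable (at (snd (c i) (x i)))"
proof -
  have "(\<lambda>p. dpart [] (frep c k \<omega> is vs) ((coord c k x)(i := p))) differentiable (at (coord c k x i))"
  proof -
    have "smooth_on_prod k (PiE {..<k} (\<lambda>i. chart_ran (c i))) (frep c k \<omega> is vs)"
      by (rule frep_smooth[OF assms(1-4)])
    from this[unfolded smooth_on_prod_def, THEN spec[of _ "[]"]] assms(6) coord_mem[OF assms(2,5)]
    show ?thesis by simp
  qed
  then show ?thesis using assms(6) by (simp add: coord_def)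
qed

text \<open>With the preferred chart at every coordinate, the slots that do not move are transported
  by the identity at x; the local representation is then \<open>frep\<close> along one block of
  variables.\<close>

lemma form_cov_rep_differentiable:
  assumes \<omega>: "smooth_form_Xk M n k \<omega>" and x: "x \<in> PiE {..<k} (\<lambda>_. UNIV)" and i: "i < k"
    and "is": "is \<in> tuples {..<k} n" and vs: "length vs = n"
  shows "cov_rep M (x i) i (\<lambda>y. \<omega> (x(i := y))) is vs differentiable (at (snd (chart_at M (x i)) (x i)))"
proof -
  define c where "c j = chart_at M (x j)" for j
  have c: "\<And>j. j < k \<Longrightarrow> c j \<in> charts M" by (simp add: c_def)
  have xd: "x \<in> cdom c k" using x by (simp add: cdom_def c_def)
  have len: "length vs = length is" using "is" vs by (simp add: tuples_def)
  have "map2 (\<lambda>j v. if j = i then v else to_tangent M (c j) (x j) v) is vs = vs"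
    by (rule nth_equalityI) (use len in \<open>auto simp: c_def\<close>)
  with form_slots[OF c xd i len, of \<omega>]
  have "cov_rep M (x i) i (\<lambda>y. \<omega> (x(i := y))) is vs = (\<lambda>p. frep c k \<omega> is vs ((coord c k x)(i := p)))"
    unfolding cov_rep_eq by (simp add: c_def)
  then show ?thesis using frep_differentiable[OF \<omega> c "is" vs xd i] by (simp add: c_def)
qed

lemma form_upd_mlin:
  assumes "smooth_form_Xk M n k \<omega>" "x \<in> PiE {..<k} (\<lambda>_. UNIV)" "i < k" "is \<in> tuples {..<k} n"
  shows "mlin n (\<omega> (x(i := y)) is)"
  by (rule form_mlin[OF assms(1) _ assms(4)]) (use assms(2,3) in \<open>auto simp: PiE_def extensional_def\<close>)

text \<open>The textbook formula: a partial derivative of the coefficients minus Christoffel terms,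
  in charts that stay fixed while x varies. From it joint continuity of the gradient in all points
  can be read off.\<close>

lemma grad_Xk_chart:
  assumes \<omega>: "smooth_form_Xk M n k \<omega>" and c: "\<And>j. j < k \<Longrightarrow> c j \<in> charts M"
    and x: "x \<in> cdom c k" and i: "i < k" and "is": "is \<in> tuples {..<k} n" and vs: "length vs = n"
  shows "grad_Xk M \<omega> x i (to_tangent M (c i) (x i) u) is (map2 (\<lambda>j v. to_tangent M (c j) (x j) v) is vs) =
    dpart [(i, u)] (frep c k \<omega> is vs) (coord c k x)
    - (\<Sum>j<n. if is ! j = i then \<Sum>a\<in>UNIV. chr (c i) (coord c k x i) u (vs ! j) $ a
         * frep c k \<omega> is (vs[j := axis a 1]) (coord c k x) else 0)"
proof -
  have len: "length is = n" "length vs = length is" using "is" vs by (auto simp: tuples_def)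
  have xP: "x \<in> PiE {..<k} (\<lambda>_. UNIV)" and xi: "x i \<in> fst (c i)" using x i by (auto simp: cdom_def)
  have ci: "coord c k x i = snd (c i) (x i)" using i by (simp add: coord_def)
  let ?T = "\<lambda>y. \<omega> (x(i := y))"
  define vs' where "vs' = map2 (\<lambda>j v. if j = i then v else to_tangent M (c j) (x j) v) is vs"
  have len': "length vs' = n" using len by (simp add: vs'_def)
  let ?t = "\<lambda>vs. map2 (\<lambda>j v. to_tangent M (c j) (x j) v) is vs"
  have tsl: "tsl (c i) (x i) i is vs' = ?t vs"
    by (rule nth_equalityI) (use len in \<open>auto simp: vs'_def nth_tsl\<close>)
  have "grad_Xk M \<omega> x i (to_tangent M (c i) (x i) u) is (?t vs) = cdc (c i) (x i) i ?T u is vs'"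
    unfolding grad_Xk_def tsl[symmetric]
    by (rule cov_deriv_chart[where N=UNIV and n=n])
       (use c i xi len len' form_upd_mlin[OF \<omega> xP i "is"] form_cov_rep_differentiable[OF \<omega> xP i "is"] in auto)
  also have "\<dots> = frechet_derivative (\<lambda>p. frep c k \<omega> is vs ((coord c k x)(i := p))) (at (snd (c i) (x i))) u
     - (\<Sum>j<n. if is ! j = i
          then \<omega> x is ((?t vs)[j := to_tangent M (c i) (x i) (chr (c i) (snd (c i) (x i)) u (vs' ! j))]) else 0)"
    unfolding cdc_def tsl len fun_upd_triv using form_slots[OF c x i len(2), of \<omega>] by (simp add: vs'_def)
  also have "(\<Sum>j<n. if is ! j = i
          then \<omega> x is ((?t vs)[j := to_tangent M (c i) (x i) (chr (c i) (snd (c i) (x i)) u (vs' ! j))]) else 0)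
    = (\<Sum>j<n. if is ! j = i then \<Sum>a\<in>UNIV. chr (c i) (coord c k x i) u (vs ! j) $ a
         * frep c k \<omega> is (vs[j := axis a 1]) (coord c k x) else 0)"
  proof (intro sum.cong refl if_cong)
    fix j assume j: "j \<in> {..<n}" "is ! j = i"
    have l: "linear (\<lambda>v. \<omega> x is ((?t vs)[j := v]))"
      by (rule mlinD[OF form_mlin[OF \<omega> xP "is"]]) (use len j in auto)
    have "linear ((\<lambda>v. \<omega> x is ((?t vs)[j := v])) \<circ> to_tangent M (c i) (x i))"
      by (rule linear_compose[OF tt_linear[OF c[OF i] xi] l])
    from linear_axis_expansion_real[OF this, of "chr (c i) (snd (c i) (x i)) u (vs ! j)"]
    have "\<omega> x is ((?t vs)[j := to_tangent M (c i) (x i) (chr (c i) (snd (c i) (x i)) u (vs ! j))])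
      = (\<Sum>a\<in>UNIV. chr (c i) (snd (c i) (x i)) u (vs ! j) $ a * \<omega> x is ((?t vs)[j := to_tangent M (c i) (x i) (axis a 1)]))"
      by simp
    moreover have "(?t vs)[j := to_tangent M (c i) (x i) v] = ?t (vs[j := v])" for v
      by (rule nth_equalityI) (use len j in \<open>auto simp: nth_list_update\<close>)
    moreover have "vs' ! j = vs ! j" using j len by (simp add: vs'_def)
    ultimately show "\<omega> x is ((?t vs)[j := to_tangent M (c i) (x i) (chr (c i) (snd (c i) (x i)) u (vs' ! j))])
      = (\<Sum>a\<in>UNIV. chr (c i) (coord c k x i) u (vs ! j) $ a * frep c k \<omega> is (vs[j := axis a 1]) (coord c k x))"
      by (simp add: ci frep_coord[OF c x])
  qed
  finally show ?thesis unfolding dpart.simps fst_conv snd_conv ci .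
qed

lemma dpart_frep_continuous:
  assumes "smooth_form_Xk M n k \<omega>" "\<And>j. j < k \<Longrightarrow> c j \<in> charts M" "is \<in> tuples {..<k} n" "length vs = n"
    "fst ` set ivs \<subseteq> {..<k}"
  shows "continuous_on (cdom c k) (\<lambda>x. dpart ivs (frep c k \<omega> is vs) (coord c k x))"
proof (rule continuous_on_compose2[OF _ coord_continuous[OF assms(2)]])
  have "smooth_on_prod k (PiE {..<k} (\<lambda>i. chart_ran (c i))) (frep c k \<omega> is vs)"
    by (rule frep_smooth[OF assms(1-4)])
  from this[unfolded smooth_on_prod_def, THEN spec[of _ ivs]] assms(5)
  show "continuous_on (PiE {..<k} (\<lambda>i. chart_ran (c i))) (dpart ivs (frep c k \<omega> is vs))" by simp
  show "coord c k ` cdom c k \<subseteq> PiE {..<k} (\<lambda>i. chart_ran (c i))"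
    by (rule image_subsetI) (rule coord_mem[OF assms(2)])
qed

lemma grad_frame_continuous:
  assumes \<omega>: "smooth_form_Xk M n k \<omega>" and c: "\<And>j. j < k \<Longrightarrow> c j \<in> charts M"
    and i: "i < k" and "is": "is \<in> tuples {..<k} n" and vs: "length vs = n"
  shows "continuous_on (cdom c k) (\<lambda>x. grad_Xk M \<omega> x i (to_tangent M (c i) (x i) u) is (map2 (\<lambda>j v. to_tangent M (c j) (x j) v) is vs))"
proof -
  have ch: "continuous_on (cdom c k) (\<lambda>x. chr (c i) (coord c k x i) u v $ a)" for v a
  proof (rule continuous_on_compose2[OF chr_continuous[OF c[OF i]]])
    show "continuous_on (cdom c k) (\<lambda>x. coord c k x i)"
      using continuous_on_compose2[OF continuous_on_product_coordinates coord_continuous[OF c]] by auto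
    show "(\<lambda>x. coord c k x i) ` cdom c k \<subseteq> chart_ran (c i)" using coord_mem[of k c] c i by (fastforce dest: PiE_mem)
  qed
  have f: "continuous_on (cdom c k) (\<lambda>x. frep c k \<omega> is vs (coord c k x))" if "length vs = n" for vs
    using dpart_frep_continuous[OF \<omega> c "is" that, where ivs="[]"] by simp
  have "continuous_on (cdom c k) (\<lambda>x. dpart [(i, u)] (frep c k \<omega> is vs) (coord c k x)
    - (\<Sum>j<n. if is ! j = i then \<Sum>a\<in>UNIV. chr (c i) (coord c k x i) u (vs ! j) $ a
         * frep c k \<omega> is (vs[j := axis a 1]) (coord c k x) else 0))"
  proof (intro continuous_on_diff continuous_on_sum)
    show "continuous_on (cdom c k) (\<lambda>x. dpart [(i, u)] (frep c k \<omega> is vs) (coord c k x))"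
      by (rule dpart_frep_continuous[OF \<omega> c "is" vs]) (use i in auto)
    fix j show "continuous_on (cdom c k) (\<lambda>x. if is ! j = i then \<Sum>a\<in>UNIV. chr (c i) (coord c k x i) u (vs ! j) $ a
         * frep c k \<omega> is (vs[j := axis a 1]) (coord c k x) else 0)"
    proof (cases "is ! j = i")
      case True
      have "continuous_on (cdom c k) (\<lambda>x. \<Sum>a\<in>UNIV. chr (c i) (coord c k x i) u (vs ! j) $ a
         * frep c k \<omega> is (vs[j := axis a 1]) (coord c k x))"
        by (intro continuous_on_sum continuous_on_mult ch f) (use vs in simp)
      then show ?thesis by (simp only: True if_True simp_thms)
    qed simp
  qed
  then show ?thesis
    by (rule continuous_on_eq) (rule grad_Xk_chart[OF \<omega> c _ i "is" vs, symmetric])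
qed

text \<open>The direction of differentiation is treated as an additional first slot at the point
  \<open>x i\<close>, so that \<open>comp_sum_continuous\<close> for the index list
  \<open>i # is\<close> also takes care of the sum over directions.\<close>

lemma grad_Xk_mlin:
  assumes \<omega>: "smooth_form_Xk M n k \<omega>" and x: "x \<in> PiE {..<k} (\<lambda>_. UNIV)" and i: "i < k" and "is": "is \<in> tuples {..<k} n"
  shows "mlin (Suc n) (\<lambda>us. grad_Xk M \<omega> x i (hd us) is (tl us))"
proof -
  note a = form_upd_mlin[OF \<omega> x i "is"] form_cov_rep_differentiable[OF \<omega> x i "is"]
  have len: "length is = n" using "is" by (simp add: tuples_def)
  have 1: "linear (\<lambda>u. grad_Xk M \<omega> x i u is vs)" if "length vs = n" for vs
    unfolding grad_Xk_def by (rule cov_deriv_linear(1)[where N=UNIV and n=n]) (use a len that in auto)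
  have 2: "mlin n (grad_Xk M \<omega> x i u is)" for u
    unfolding grad_Xk_def by (rule cov_deriv_linear(2)[where N=UNIV and n=n]) (use a len in auto)
  show ?thesis unfolding mlin_def
  proof (intro allI impI)
    fix us :: "(real ^ 'n) list" and j assume us: "length us = Suc n \<and> j < Suc n"
    then obtain u vs where uv: "us = u # vs" "length vs = n" by (cases us) auto
    show "linear (\<lambda>v. grad_Xk M \<omega> x i (hd (us[j := v])) is (tl (us[j := v])))"
      using uv us 1[OF uv(2)] mlinD[OF 2 uv(2)] by (cases j) auto
  qed
qed

section \<open>Continuity of inner products of forms and of their gradients\<close>

lemma tinner_finite: "finite I \<Longrightarrow> tinner M x I n A B = (\<Sum>is\<in>tuples I n. comp_inner M x A B is)"
  by (simp add: tinner_def)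

definition iprod :: "nat \<Rightarrow> nat \<Rightarrow> ((nat \<Rightarrow> 'a) \<Rightarrow> (nat, 'n) tensor) \<Rightarrow> ((nat \<Rightarrow> 'a) \<Rightarrow> (nat, 'n) tensor) \<Rightarrow> (nat \<Rightarrow> 'a) \<Rightarrow> real" where
  "iprod n k \<omega> \<omega>' x = tinner M x {..<k} n (\<omega> x) (\<omega>' x)"

definition gprod :: "nat \<Rightarrow> nat \<Rightarrow> ((nat \<Rightarrow> 'a) \<Rightarrow> (nat, 'n) tensor) \<Rightarrow> ((nat \<Rightarrow> 'a) \<Rightarrow> (nat, 'n) tensor) \<Rightarrow> (nat \<Rightarrow> 'a) \<Rightarrow> real" where
  "gprod n k \<omega> \<omega>' x = (\<Sum>i<k. \<Sum>u\<in>onb M (x i). tinner M x {..<k} n (grad_Xk M \<omega> x i u) (grad_Xk M \<omega>' x i u))"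

lemma continuous_on_cdomI:
  assumes "\<And>c. (\<And>j. j < k \<Longrightarrow> c j \<in> charts M) \<Longrightarrow> continuous_on (cdom c k) f"
  shows "continuous_on (PiE {..<k} (\<lambda>_. UNIV)) f"
proof (rule continuous_on_relatively_open_cover)
  fix x :: "nat \<Rightarrow> 'a" assume x: "x \<in> PiE {..<k} (\<lambda>_. UNIV)"
  let ?c = "\<lambda>j. chart_at M (x j)"
  let ?U = "\<Inter>j\<in>{..<k}. (\<lambda>y. y j) -` fst (?c j)"
  have "open ?U"
    by (intro open_INT finite_lessThan ballI open_vimage chart_open continuous_on_product_coordinates) simp
  moreover have "x \<in> ?U" by simp
  moreover have "PiE {..<k} (\<lambda>_. UNIV) \<inter> ?U = cdom ?c k" by (auto simp: cdom_def)
  then have "continuous_on (PiE {..<k} (\<lambda>_. UNIV) \<inter> ?U) f" using assms[of ?c] by simp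
  ultimately show "\<exists>U. open U \<and> x \<in> U \<and> continuous_on (PiE {..<k} (\<lambda>_. UNIV) \<inter> U) f" by blast
qed

lemma iprod_continuous:
  assumes "smooth_form_Xk M n k \<omega>" "smooth_form_Xk M n k \<omega>'"
  shows "continuous_on (PiE {..<k} (\<lambda>_. UNIV)) (iprod n k \<omega> \<omega>')"
proof (rule continuous_on_cdomI)
  fix c assume c: "\<And>j. j < k \<Longrightarrow> c j \<in> charts M"
  show "continuous_on (cdom c k) (iprod n k \<omega> \<omega>')"
    unfolding iprod_def[abs_def] tinner_finite[OF finite_lessThan] comp_inner_def
  proof (intro continuous_on_sum comp_sum_continuous)
    fix "is" assume "is": "is \<in> tuples {..<k} n"
    then have len: "length is = n" and set: "set is \<subseteq> {..<k}" by (auto simp: tuples_def)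
    show "c i \<in> charts M" if "i \<in> set is" for i using that set c by auto
    show "continuous_on (cdom c k) (\<lambda>z. z i)" for i by (rule continuous_on_subset[OF continuous_on_product_coordinates]) simp
    show "z i \<in> fst (c i)" if "i \<in> set is" "z \<in> cdom c k" for i z using that set by (auto simp: cdom_def)
    show "mlin (length is) (\<omega> z is)" "mlin (length is) (\<omega>' z is)" if "z \<in> cdom c k" for z
      using that form_mlin[OF assms(1) _ "is"] form_mlin[OF assms(2) _ "is"] len by (auto simp: cdom_def)
    fix vs :: "(real ^ 'n) list" assume "length vs = length is"
    then have vs: "length vs = n" using len by simp
    show "continuous_on (cdom c k) (\<lambda>z. \<omega> z is (map2 (\<lambda>i. to_tangent M (c i) (z i)) is vs))"
      using dpart_frep_continuous[OF assms(1) c "is" vs, where ivs="[]"] by (rule continuous_on_eq) (auto simp: frep_coord[OF c])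
    show "continuous_on (cdom c k) (\<lambda>z. \<omega>' z is (map2 (\<lambda>i. to_tangent M (c i) (z i)) is vs))"
      using dpart_frep_continuous[OF assms(2) c "is" vs, where ivs="[]"] by (rule continuous_on_eq) (auto simp: frep_coord[OF c])
  qed
qed

lemma gprod_expand:
  "gprod n k \<omega> \<omega>' x = (\<Sum>i<k. \<Sum>is\<in>tuples {..<k} n. \<Sum>us\<in>listset (map (\<lambda>i. onb M (x i)) (i # is)).
     grad_Xk M \<omega> x i (hd us) is (tl us) * grad_Xk M \<omega>' x i (hd us) is (tl us))"
  unfolding gprod_def tinner_finite[OF finite_lessThan] comp_inner_def
proof (intro sum.cong refl)
  fix i
  show "(\<Sum>u\<in>onb M (x i). \<Sum>is\<in>tuples {..<k} n. \<Sum>vs\<in>listset (map (\<lambda>i. onb M (x i)) is). grad_Xk M \<omega> x i u is vs * grad_Xk M \<omega>' x i u is vs)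
    = (\<Sum>is\<in>tuples {..<k} n. \<Sum>us\<in>listset (map (\<lambda>i. onb M (x i)) (i # is)).
     grad_Xk M \<omega> x i (hd us) is (tl us) * grad_Xk M \<omega>' x i (hd us) is (tl us))"
  proof (subst sum.swap, intro sum.cong refl)
    fix "is" :: "nat list"
    show "(\<Sum>u\<in>onb M (x i). \<Sum>vs\<in>listset (map (\<lambda>i. onb M (x i)) is). grad_Xk M \<omega> x i u is vs * grad_Xk M \<omega>' x i u is vs)
      = (\<Sum>us\<in>listset (map (\<lambda>i. onb M (x i)) (i # is)). grad_Xk M \<omega> x i (hd us) is (tl us) * grad_Xk M \<omega>' x i (hd us) is (tl us))"
      unfolding list.map by (subst sum_listset_Cons) auto
  qed
qed

lemma gprod_continuous:
  assumes "smooth_form_Xk M n k \<omega>" "smooth_form_Xk M n k \<omega>'"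
  shows "continuous_on (PiE {..<k} (\<lambda>_. UNIV)) (gprod n k \<omega> \<omega>')"
proof (rule continuous_on_cdomI)
  fix c assume c: "\<And>j. j < k \<Longrightarrow> c j \<in> charts M"
  show "continuous_on (cdom c k) (gprod n k \<omega> \<omega>')"
    unfolding gprod_expand[abs_def]
  proof (rule continuous_on_sum, rule continuous_on_sum)
    fix i "is" assume i: "i \<in> {..<k}" and "is": "is \<in> tuples {..<k} n"
    then have len: "length (i # is) = Suc n" and set: "set (i # is) \<subseteq> {..<k}" by (auto simp: tuples_def)
    show "continuous_on (cdom c k) (\<lambda>x. \<Sum>us\<in>listset (map (\<lambda>i. onb M (x i)) (i # is)).
     grad_Xk M \<omega> x i (hd us) is (tl us) * grad_Xk M \<omega>' x i (hd us) is (tl us))"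
    proof (rule comp_sum_continuous[where A="\<lambda>x us. grad_Xk M \<omega> x i (hd us) is (tl us)" and B="\<lambda>x us. grad_Xk M \<omega>' x i (hd us) is (tl us)" and c=c])
    show "c j \<in> charts M" if "j \<in> set (i # is)" for j using that set c by auto
    show "continuous_on (cdom c k) (\<lambda>z. z i)" for i by (rule continuous_on_subset[OF continuous_on_product_coordinates]) simp
    show "z j \<in> fst (c j)" if "j \<in> set (i # is)" "z \<in> cdom c k" for j z using that set by (auto simp: cdom_def)
    show "mlin (length (i # is)) (\<lambda>us. grad_Xk M \<omega> z i (hd us) is (tl us))" "mlin (length (i # is)) (\<lambda>us. grad_Xk M \<omega>' z i (hd us) is (tl us))"
      if "z \<in> cdom c k" for z
      using that grad_Xk_mlin[OF assms(1) _ _ "is"] grad_Xk_mlin[OF assms(2) _ _ "is"] len i by (auto simp: cdom_def)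
    fix us :: "(real ^ 'n) list" assume "length us = length (i # is)"
    then obtain u vs where us: "us = u # vs" "length vs = n" using len by (cases us) auto
    show "continuous_on (cdom c k) (\<lambda>z. grad_Xk M \<omega> z i (hd (map2 (\<lambda>i. to_tangent M (c i) (z i)) (i # is) us)) is (tl (map2 (\<lambda>i. to_tangent M (c i) (z i)) (i # is) us)))"
      using grad_frame_continuous[OF assms(1) c _ "is" us(2), where i=i and u=u] i us by simp
    show "continuous_on (cdom c k) (\<lambda>z. grad_Xk M \<omega>' z i (hd (map2 (\<lambda>i. to_tangent M (c i) (z i)) (i # is) us)) is (tl (map2 (\<lambda>i. to_tangent M (c i) (z i)) (i # is) us)))"
      using grad_frame_continuous[OF assms(2) c _ "is" us(2), where i=i and u=u] i us by simp
    qed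
  qed
qed

end

section \<open>Cylinder functions\<close>

lemma tendsto_funI:
  fixes f :: "'z \<Rightarrow> 'i \<Rightarrow> 'b::topological_space"
  assumes "\<And>i. ((\<lambda>z. f z i) \<longlongrightarrow> l i) F" shows "(f \<longlongrightarrow> l) F"
proof -
  have "limitin (product_topology (\<lambda>_. euclidean) UNIV) f l F"
    using assms by (simp add: limitin_componentwise)
  then show ?thesis by (simp add: euclidean_product_topology)
qed

lemma compact_PiE_lessThan:
  fixes K :: "'b::topological_space set"
  assumes "compact K" shows "compact (PiE {..<k::nat} (\<lambda>_. K))"
proof -
  have eq: "PiE {..<k} (\<lambda>_. K) = PiE UNIV (\<lambda>i. if i < k then K else {undefined})"
    by (auto simp: PiE_def extensional_def Pi_def split: if_splits)
  \<comment> \<open>Outside \<open>{..<k}\<close> an extensional function has the value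
    \<open>undefined\<close>, so the remaining factors are compact singletons and Tychonoff's
    theorem applies.\<close>
  have "compactin (product_topology (\<lambda>_. euclidean) UNIV) (PiE UNIV (\<lambda>i. if i < k then K else {undefined}))"
    unfolding compactin_PiE using assms by auto
  then show ?thesis unfolding eq by (simp add: euclidean_product_topology)
qed

lemma bounded_on_compact_support:
  fixes h :: "(nat \<Rightarrow> 'b::topological_space) \<Rightarrow> real"
  assumes h: "continuous_on (PiE {..<k} (\<lambda>_. UNIV)) h" and K: "compact K"
    and 0: "\<And>x i. x \<in> PiE {..<k} (\<lambda>_. UNIV) \<Longrightarrow> i < k \<Longrightarrow> x i \<notin> K \<Longrightarrow> h x = 0"
  shows "\<exists>C\<ge>0. \<forall>x\<in>PiE {..<k} (\<lambda>_. UNIV). \<bar>h x\<bar> \<le> C"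
proof -
  have sub: "PiE {..<k} (\<lambda>_. K) \<subseteq> PiE {..<k} (\<lambda>_. UNIV)" by (auto simp: PiE_def)
  have "compact (h ` PiE {..<k} (\<lambda>_. K))"
    by (rule compact_continuous_image[OF continuous_on_subset[OF h sub] compact_PiE_lessThan[OF K]])
  then have "bounded (h ` PiE {..<k} (\<lambda>_. K))" by (rule compact_imp_bounded)
  then obtain C where C: "\<And>x. x \<in> PiE {..<k} (\<lambda>_. K) \<Longrightarrow> \<bar>h x\<bar> \<le> C"
    unfolding bounded_iff by auto
  have "\<bar>h x\<bar> \<le> max C 0" if x: "x \<in> PiE {..<k} (\<lambda>_. UNIV)" for x
  proof (cases "\<forall>i<k. x i \<in> K")
    case True
    then have "x \<in> PiE {..<k} (\<lambda>_. K)" using x by (auto simp: PiE_def Pi_def)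
    then show ?thesis using C[of x] by simp
  next
    case False
    then show ?thesis using 0[OF x] by auto
  qed
  then show ?thesis by (intro exI[of _ "max C 0"]) auto
qed

text \<open>The chain rule from continuous partial derivatives, for a number of variables that is
  not a type. Variables are released one at a time from their value at \<open>p0\<close>; each
  release is a two-variable chain rule with a partial derivative continuous at the base
  point.\<close>

lemma smooth_on_prod_chain:
  fixes g :: "(nat \<Rightarrow> real) \<Rightarrow> real" and h :: "nat \<Rightarrow> 'p::real_normed_vector \<Rightarrow> real"
  assumes g: "smooth_on_prod N (PiE {..<N} (\<lambda>_. UNIV)) g"
    and h: "\<And>i. i < N \<Longrightarrow> (h i has_derivative h' i) (at p0)"
  shows "((\<lambda>p. g (\<lambda>i\<in>{..<N}. h i p)) has_derivative
    (\<lambda>u. \<Sum>i<N. dpart [(i, 1)] g (\<lambda>i\<in>{..<N}. h i p0) * h' i u)) (at p0)"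
proof -
  let ?q0 = "\<lambda>i\<in>{..<N}. h i p0"
  let ?Q = "PiE {..<N} (\<lambda>_. UNIV :: real set)"
  have gd: "(\<lambda>w. g (q(i := w))) differentiable (at (q i))" if "i < N" "q \<in> ?Q" for i q
    using g[unfolded smooth_on_prod_def, THEN spec[of _ "[]"]] that by simp
  have gc: "continuous_on ?Q (dpart [(i, 1)] g)" if "i < N" for i
    using g[unfolded smooth_on_prod_def, THEN spec[of _ "[(i, 1)]"]] that by simp
  \<comment> \<open>Arguments below m already move with p, the m-th is the free variable y, and
    those above m are still frozen at \<open>p0\<close>.\<close>
  define q where "q m p y = (\<lambda>i\<in>{..<N}. if i < m then h i p else if i = m then y else h i p0)" for m p y
  have qQ: "q m p y \<in> ?Q" for m p y by (auto simp: q_def)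
  have "m \<le> N \<Longrightarrow> ((\<lambda>p. g (\<lambda>i\<in>{..<N}. if i < m then h i p else h i p0)) has_derivative
    (\<lambda>u. \<Sum>i<m. dpart [(i, 1)] g ?q0 * h' i u)) (at p0)" for m
  proof (induction m)
    case 0 show ?case by simp
  next
    case (Suc m)
    then have m: "m < N" by simp
    have q0: "q m p0 (h m p0) = ?q0" by (auto simp: q_def)
    define Phi where "Phi p y = g (q m p y)" for p y
    define fy where "fy p y = blinfun_mult_right (dpart [(m, 1)] g (q m p y))" for p y
    have "((\<lambda>(p, y). Phi p y) has_derivative (\<lambda>(tx, ty). (\<Sum>i<m. dpart [(i, 1)] g ?q0 * h' i tx) + fy p0 (h m p0) ty))
      (at (p0, h m p0) within UNIV \<times> UNIV)"
    proof (rule has_derivative_partialsI)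
      have q1: "q m p (h m p0) = (\<lambda>i\<in>{..<N}. if i < m then h i p else h i p0)" for p by (auto simp: q_def)
      show "((\<lambda>p. Phi p (h m p0)) has_derivative (\<lambda>tx. \<Sum>i<m. dpart [(i, 1)] g ?q0 * h' i tx)) (at p0)"
        unfolding Phi_def q1 by (rule Suc.IH) (use Suc.prems in simp)
      fix p y
      have upd: "(q m p y)(m := w) = q m p w" for w using m by (auto simp: q_def)
      have qm: "q m p y m = y" using m by (simp add: q_def)
      let ?D = "frechet_derivative (\<lambda>w. g (q m p w)) (at y)"
      have D: "((\<lambda>y. Phi p y) has_derivative ?D) (at y)"
        using gd[OF m qQ[of m p y]] unfolding upd qm Phi_def by (simp add: frechet_derivative_works)
      have "?D 1 = dpart [(m, 1)] g (q m p y)" by (simp add: upd qm)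
      then have "?D = (\<lambda>t. dpart [(m, 1)] g (q m p y) * t)"
        using linear_cmul[OF has_derivative_linear[OF D], of _ 1] by (auto simp: fun_eq_iff mult.commute)
      then show "((\<lambda>y. Phi p y) has_derivative blinfun_apply (fy p y)) (at y within UNIV)"
        using D by (simp add: fy_def)
    next
      let ?F = "at (p0, h m p0) within UNIV \<times> UNIV"
      have "((\<lambda>z. q m (fst z) (snd z)) \<longlongrightarrow> q m p0 (h m p0)) ?F"
      proof (rule tendsto_funI)
        fix i
        consider "i < N" "i < m" | "i < N" "i = m" | "i < N" "i > m" | "i \<ge> N" by linarith
        then show "((\<lambda>z. q m (fst z) (snd z) i) \<longlongrightarrow> q m p0 (h m p0) i) ?F"
        proof cases
          case 1
          have "isCont (h i) p0" using has_derivative_continuous[OF h[OF 1(1)]] .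
          moreover have "((\<lambda>z. fst z) \<longlongrightarrow> p0) ?F" by (auto intro!: tendsto_eq_intros)
          ultimately have "((\<lambda>z. h i (fst z)) \<longlongrightarrow> h i p0) ?F" by (rule isCont_tendsto_compose)
          then show ?thesis using 1 by (simp add: q_def)
        next
          case 2
          have "((\<lambda>z. snd z) \<longlongrightarrow> h m p0) ?F" by (auto intro!: tendsto_eq_intros)
          then show ?thesis using 2 by (simp add: q_def)
        qed (simp_all add: q_def)
      qed
      from continuous_on_tendsto_compose[OF gc[OF m] this qQ]
      have "((\<lambda>z. dpart [(m, 1)] g (q m (fst z) (snd z))) \<longlongrightarrow> dpart [(m, 1)] g (q m p0 (h m p0))) ?F"
        using qQ by (simp del: dpart.simps)
      then have "((\<lambda>z. fy (fst z) (snd z)) \<longlongrightarrow> fy p0 (h m p0)) ?F"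
        unfolding fy_def by (rule bounded_linear.tendsto[OF bounded_linear_blinfun_mult_right])
      then show "continuous ?F (\<lambda>(p, y). fy p y)"
        unfolding continuous_within case_prod_unfold by simp
    qed auto
    then have P: "((\<lambda>(p, y). Phi p y) has_derivative (\<lambda>(tx, ty). (\<Sum>i<m. dpart [(i, 1)] g ?q0 * h' i tx) + fy p0 (h m p0) ty))
      (at (p0, h m p0))" by simp
    have "((\<lambda>p. (p, h m p)) has_derivative (\<lambda>u. (u, h' m u))) (at p0)"
      by (intro has_derivative_Pair has_derivative_ident h m)
    from has_derivative_compose[OF this P]
    have PD: "((\<lambda>p. Phi p (h m p)) has_derivative (\<lambda>u. (\<Sum>i<m. dpart [(i, 1)] g ?q0 * h' i u) + dpart [(m, 1)] g ?q0 * h' m u)) (at p0)"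
      by (simp add: fy_def q0 del: dpart.simps)
    have q2: "q m p (h m p) = (\<lambda>i\<in>{..<N}. if i < Suc m then h i p else h i p0)" for p
      by (auto simp: q_def less_Suc_eq)
    show ?case unfolding sum.lessThan_Suc using PD unfolding Phi_def q2 .
  qed
  from this[of N] show ?thesis by (simp del: dpart.simps cong: restrict_cong)
qed

context riem_mfd begin

section \<open>Supports of test forms\<close>

lemma Psi_smooth: "\<omega> \<in> Psi_sym M n k \<Longrightarrow> smooth_form_Xk M n k \<omega>"
  by (simp add: Psi_sym_def)

text \<open>The compact support in the k-th power is replaced by the union of its projections: one
  compact subset of X that controls every coordinate.\<close>

lemma Psi_support:
  assumes "\<omega> \<in> Psi_sym M n k"
  obtains K where "compact K" "\<And>x i. x \<in> PiE {..<k} (\<lambda>_. UNIV) \<Longrightarrow> i < k \<Longrightarrow> x i \<notin> K \<Longrightarrow> \<omega> x = (\<lambda>_ _. 0)"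
proof -
  obtain C where C: "compactin (product_topology (\<lambda>_. euclidean) {..<k}) C"
      "\<forall>x\<in>PiE {..<k} (\<lambda>_. UNIV) - C. \<omega> x = (\<lambda>_ _. 0)"
    using assms unfolding Psi_sym_def by blast
  have "compactin euclidean ((\<lambda>x. x i) ` C)" if "i < k" for i
    by (rule image_compactin[OF C(1)]) (use that in \<open>auto intro!: continuous_map_product_projection\<close>)
  then have "compact (\<Union>i\<in>{..<k}. (\<lambda>x. x i) ` C)" by (intro compact_UN) auto
  then show ?thesis using C(2) by (intro that[of "\<Union>i\<in>{..<k}. (\<lambda>x. x i) ` C"]) auto
qed

lemma grad_Xk_eq_0:
  assumes K: "compact K" "\<And>x i. x \<in> PiE {..<k} (\<lambda>_. UNIV) \<Longrightarrow> i < k \<Longrightarrow> x i \<notin> K \<Longrightarrow> \<omega> x = (\<lambda>_ _. 0)"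
    and x: "x \<in> PiE {..<k} (\<lambda>_. UNIV)" and j: "j < k" "x j \<notin> K" and i: "i < k"
  shows "grad_Xk M \<omega> x i u is vs = 0"
proof -
  have xu: "x(i := y) \<in> PiE {..<k} (\<lambda>_. UNIV)" for y using x i by (auto simp: PiE_def extensional_def)
  have x0: "\<omega> x = (\<lambda>_ _. 0)" using K(2)[OF x j] .
  define c where "c = chart_at M (x i)"
  have c: "c \<in> charts M" "x i \<in> fst c" by (auto simp: c_def)
  \<comment> \<open>If the moving coordinate is the one outside K, it stays outside on this
    neighbourhood since K is closed; otherwise the coordinate j is fixed outside K. In both cases
    the form vanishes along the motion.\<close>
  define V where "V = (if i = j then {p \<in> chart_ran c. chart_inv c p \<in> - K} else UNIV)"
  have V: "open V" "snd c (x i) \<in> V"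
    unfolding V_def using chart_vimage_open[OF c(1), of "- K"] compact_imp_closed[OF K(1)] chart_ran_mem[OF c] chart_inv_left[OF c] j
    by auto
  have "\<omega> (x(i := chart_inv c p)) = (\<lambda>_ _. 0)" if "p \<in> V" for p
    using K(2)[OF xu j(1)] that j unfolding V_def by (auto split: if_splits)
  then have "(cov_rep M (x i) i (\<lambda>y. \<omega> (x(i := y))) is vs has_derivative (\<lambda>_. 0)) (at (snd c (x i)))"
    by (intro has_derivative_transform_within_open[OF has_derivative_const V]) (simp add: cov_rep_def Let_def c_def)
  from frechet_derivative_at[OF this] have "frechet_derivative (cov_rep M (x i) i (\<lambda>y. \<omega> (x(i := y))) is vs) (at (snd c (x i))) u = 0"
    by metis
  then show ?thesis unfolding grad_Xk_def cov_deriv_def by (simp add: x0 c_def cong: if_cong)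
qed

section \<open>Gradients of test functions\<close>

definition dfun :: "('a \<Rightarrow> real) \<Rightarrow> 'a \<Rightarrow> real ^ 'n \<Rightarrow> real" where
  "dfun \<phi> z u = frechet_derivative (\<lambda>p. \<phi> (chart_inv (chart_at M z) p)) (at (snd (chart_at M z) z)) u"

definition dprod :: "('a \<Rightarrow> real) \<Rightarrow> ('a \<Rightarrow> real) \<Rightarrow> 'a \<Rightarrow> real" where
  "dprod \<phi> \<psi> z = (\<Sum>u\<in>onb M z. dfun \<phi> z u * dfun \<psi> z u)"

lemma smooth_fun_derivative:
  assumes "smooth_fun M \<phi>" "c \<in> charts M" "p \<in> chart_ran c"
  shows "((\<lambda>p. \<phi> (chart_inv c p)) has_derivative frechet_derivative (\<lambda>p. \<phi> (chart_inv c p)) (at p)) (at p)"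
  using assms(1)[unfolded smooth_fun_def, rule_format, OF assms(2), unfolded smooth_on_def, rule_format, OF assms(3), of "[]"]
  by (simp add: frechet_derivative_works o_def)

lemma smooth_fun_Dcont:
  assumes "smooth_fun M \<phi>" "c \<in> charts M"
  shows "continuous_on (chart_ran c) (\<lambda>p. frechet_derivative (\<lambda>p. \<phi> (chart_inv c p)) (at p) u)"
  using assms(1)[unfolded smooth_fun_def, rule_format, OF assms(2), unfolded smooth_on_def, rule_format, of _ "[u]"]
  by (intro continuous_at_imp_continuous_on ballI differentiable_imp_continuous_within) (auto simp: o_def)

lemma smooth_fun_continuous:
  assumes "smooth_fun M \<phi>" shows "continuous_on UNIV \<phi>"
proof (rule continuous_on_charts)
  fix c assume c: "c \<in> charts M"
  have "continuous_on (chart_ran c) (\<lambda>p. \<phi> (chart_inv c p))"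
    using smooth_fun_derivative[OF assms c] by (intro continuous_at_imp_continuous_on ballI has_derivative_continuous) blast
  then have "continuous_on (fst c) (\<lambda>y. \<phi> (chart_inv c (snd c y)))"
    by (rule continuous_on_compose2[OF _ chart_cont[OF c]]) (use chart_ran_mem[OF c] in auto)
  then show "continuous_on (fst c) \<phi>" by (rule continuous_on_eq) (simp add: chart_inv_left[OF c])
qed

lemma test_fun_C0: "\<phi> \<in> test_fun M \<Longrightarrow> \<phi> \<in> C0"
  by (simp add: test_fun_def C0_def smooth_fun_continuous)

lemma dfun_linear: "smooth_fun M \<phi> \<Longrightarrow> linear (dfun \<phi> z)"
  unfolding dfun_def[abs_def]
  by (rule has_derivative_linear[OF smooth_fun_derivative]) (auto intro: chart_ran_mem)

lemma dfun_chart: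
  assumes "smooth_fun M \<phi>" and c: "c \<in> charts M" "z \<in> fst c"
  shows "dfun \<phi> z (to_tangent M c z u) = frechet_derivative (\<lambda>p. \<phi> (chart_inv c p)) (at (snd c z)) u"
proof -
  let ?a = "chart_at M z"
  have e: "(snd ?a \<circ> chart_inv c) (snd c z) = snd ?a z" using chart_inv_left[OF c] by simp
  have "(dfun \<phi> z = frechet_derivative (\<lambda>p. \<phi> (chart_inv ?a p)) (at (snd ?a z)))" by (simp add: dfun_def fun_eq_iff)
  then have "((\<lambda>p. \<phi> (chart_inv ?a p)) has_derivative dfun \<phi> z) (at ((snd ?a \<circ> chart_inv c) (snd c z)))"
    unfolding e using smooth_fun_derivative[OF assms(1), of ?a] by (simp add: chart_ran_mem)
  from diff_chain_at[OF trans_has_derivative[OF c(1) chart_at_charts c(2) chart_at_mem] this]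
  have "((\<lambda>p. \<phi> (chart_inv ?a p)) \<circ> (snd ?a \<circ> chart_inv c) has_derivative dfun \<phi> z \<circ> Dt c ?a (snd c z)) (at (snd c z))" .
  then have "((\<lambda>p. \<phi> (chart_inv c p)) has_derivative dfun \<phi> z \<circ> Dt c ?a (snd c z)) (at (snd c z))"
  proof (rule has_derivative_transform_within_open[OF _ chart_image_open[OF c(1), of ?a]])
    show "snd c z \<in> snd c ` (fst c \<inter> fst ?a)" using c by auto
    fix p assume "p \<in> snd c ` (fst c \<inter> fst ?a)"
    then show "((\<lambda>p. \<phi> (chart_inv ?a p)) \<circ> (snd ?a \<circ> chart_inv c)) p = \<phi> (chart_inv c p)"
      using chart_inv_left[OF c(1)] chart_inv_left[of ?a] by auto
  qed simp
  from fun_cong[OF frechet_derivative_at[OF this], of u] show ?thesis by (simp add: to_tangent_Dt)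
qed

lemma dfun_eq_0:
  assumes "z \<notin> closure {x. \<phi> x \<noteq> 0}" shows "dfun \<phi> z u = 0"
proof -
  let ?a = "chart_at M z"
  let ?V = "{p \<in> chart_ran ?a. chart_inv ?a p \<in> - closure {x. \<phi> x \<noteq> 0}}"
  have "open ?V" by (rule chart_vimage_open) auto
  moreover have "snd ?a z \<in> ?V" using assms chart_ran_mem[of ?a z] chart_inv_left[of ?a z] by simp
  moreover have "0 = \<phi> (chart_inv ?a p)" if "p \<in> ?V" for p using that closure_subset[of "{x. \<phi> x \<noteq> 0}"] by auto
  ultimately have "((\<lambda>p. \<phi> (chart_inv ?a p)) has_derivative (\<lambda>_. 0)) (at (snd ?a z))"
    by (rule has_derivative_transform_within_open[OF has_derivative_const])
  from frechet_derivative_at[OF this] show ?thesis unfolding dfun_def by metis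
qed

text \<open>Continuity comes from \<open>frame_sum\<close>, which trades the arbitrary bases for the
  inverse Gram matrix. Membership in \<open>C0\<close> makes the pairing with this function
  measurable and controlled by the moments.\<close>

lemma dprod_C0:
  assumes "\<phi> \<in> test_fun M" "\<psi> \<in> test_fun M" shows "dprod \<phi> \<psi> \<in> C0"
proof (rule C0I)
  have s: "smooth_fun M \<phi>" "smooth_fun M \<psi>" using assms by (auto simp: test_fun_def)
  show "compact (closure {x. \<phi> x \<noteq> 0})" using assms by (simp add: test_fun_def)
  have "dprod \<phi> \<psi> x = 0" if "x \<notin> closure {x. \<phi> x \<noteq> 0}" for x
    by (simp add: dprod_def dfun_eq_0[OF that])
  then show "{x. dprod \<phi> \<psi> x \<noteq> 0} \<subseteq> closure {x. \<phi> x \<noteq> 0}" by blast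
  show "continuous_on UNIV (dprod \<phi> \<psi>)"
  proof (rule continuous_on_charts)
    fix c assume c: "c \<in> charts M"
    have D: "continuous_on (fst c) (\<lambda>z. frechet_derivative (\<lambda>p. f (chart_inv c p)) (at (snd c z)) u)" if "smooth_fun M f" for f u
      by (rule continuous_on_compose2[OF smooth_fun_Dcont[OF that c] chart_cont[OF c]]) (use chart_ran_mem[OF c] in auto)
    have "continuous_on (fst c) (\<lambda>z. \<Sum>a\<in>UNIV. \<Sum>b\<in>UNIV. ginv c z a b *
      (frechet_derivative (\<lambda>p. \<phi> (chart_inv c p)) (at (snd c z)) (axis a 1) * frechet_derivative (\<lambda>p. \<psi> (chart_inv c p)) (at (snd c z)) (axis b 1)))"
      by (intro continuous_on_sum continuous_on_mult D s ginv_continuous_comp c continuous_on_id)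
    then show "continuous_on (fst c) (dprod \<phi> \<psi>)"
      by (rule continuous_on_eq) (simp add: dprod_def frame_sum[OF c _ dfun_linear[OF s(1)] dfun_linear[OF s(2)]] dfun_chart[OF s(1) c] dfun_chart[OF s(2) c])
  qed
qed

section \<open>Gradients of cylinder functions\<close>

definition dG :: "('a set \<Rightarrow> real) \<Rightarrow> 'a set \<Rightarrow> 'a \<Rightarrow> real ^ 'n \<Rightarrow> real" where
  "dG F \<gamma> z u = frechet_derivative (\<lambda>p. F (insert (chart_inv (chart_at M z) p) (\<gamma> - {z}))) (at (snd (chart_at M z) z)) u"

text \<open>The inner product of two gradients on \<open>Gamma\<close>, a carre du champ. For
  cylinder functions only finitely many terms of the sum are nonzero.\<close>

definition cprod :: "('a set \<Rightarrow> real) \<Rightarrow> ('a set \<Rightarrow> real) \<Rightarrow> 'a set \<Rightarrow> real" where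
  "cprod F F' \<gamma> = (\<Sum>\<^sub>\<infinity>z\<in>\<gamma>. \<Sum>u\<in>onb M z. dG F \<gamma> z u * dG F' \<gamma> z u)"

lemma pairing_insert:
  assumes "\<gamma> \<in> Gamma" "y \<notin> \<gamma>" "f \<in> C0" shows "pairing f (insert y \<gamma>) = f y + pairing f \<gamma>"
proof -
  have fin: "finite {x\<in>\<gamma>. f x \<noteq> 0}" by (rule Gamma_finite_supp[OF assms(1,3)])
  have "pairing f (insert y \<gamma>) = sum f (insert y {x\<in>\<gamma>. f x \<noteq> 0})"
    by (rule pairing_eq_sum) (use fin in auto)
  then show ?thesis using fin assms(2) by (simp add: pairing_def)
qed

text \<open>A configuration is a set, so a point moved onto another one would disappear. Since the
  other points form a closed set, small motions avoid such a merger.\<close>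

lemma moving_nhd:
  assumes "\<gamma> \<in> Gamma"
  obtains V where "open V" "snd (chart_at M z) z \<in> V" "V \<subseteq> chart_ran (chart_at M z)"
    "\<And>p. p \<in> V \<Longrightarrow> chart_inv (chart_at M z) p \<notin> \<gamma> - {z}"
proof -
  have "closed (\<gamma> - {z})" by (rule Gamma_closed[OF Gamma_subset[OF assms]]) auto
  then have "open {p \<in> chart_ran (chart_at M z). chart_inv (chart_at M z) p \<in> - (\<gamma> - {z})}"
    by (intro chart_vimage_open chart_at_charts open_Compl)
  then show ?thesis
    by (rule that) (auto simp: chart_ran_mem chart_inv_left)
qed

text \<open>Near z, moving the point changes each pairing by adding \<open>\<phi> i\<close> at the
  new position to a constant, the pairing with the other points; the rest is the chain rule.\<close>

lemma cylinder_derivative: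
  assumes \<phi>: "\<And>i. i < N \<Longrightarrow> \<phi> i \<in> test_fun M"
    and g: "smooth_on_prod N (PiE {..<N} (\<lambda>_. UNIV)) g" and F: "F = (\<lambda>\<gamma>. g (\<lambda>i\<in>{..<N}. pairing (\<phi> i) \<gamma>))"
    and \<gamma>: "\<gamma> \<in> Gamma" "z \<in> \<gamma>"
  shows "((\<lambda>p. F (insert (chart_inv (chart_at M z) p) (\<gamma> - {z}))) has_derivative
    (\<lambda>u. \<Sum>i<N. dpart [(i, 1)] g (\<lambda>i\<in>{..<N}. pairing (\<phi> i) \<gamma>) * dfun (\<phi> i) z u)) (at (snd (chart_at M z) z))"
proof -
  let ?a = "chart_at M z"
  have G: "\<gamma> - {z} \<in> Gamma" using Gamma_subset[OF \<gamma>(1)] by auto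
  obtain V where V: "open V" "snd ?a z \<in> V" "V \<subseteq> chart_ran ?a" "\<And>p. p \<in> V \<Longrightarrow> chart_inv ?a p \<notin> \<gamma> - {z}"
    using moving_nhd[OF \<gamma>(1), of z] by blast
  let ?h = "\<lambda>i p. \<phi> i (chart_inv ?a p) + pairing (\<phi> i) (\<gamma> - {z})"
  have p: "pairing (\<phi> i) \<gamma> = ?h i (snd ?a z)" if "i < N" for i
    using pairing_insert[OF G _ test_fun_C0[OF \<phi>[OF that]], of z] \<gamma>(2) by (simp add: chart_inv_left insert_absorb)
  have hd: "(?h i has_derivative dfun (\<phi> i) z) (at (snd ?a z))" if "i < N" for i
  proof -
    have "((\<lambda>p. \<phi> i (chart_inv ?a p)) has_derivative dfun (\<phi> i) z) (at (snd ?a z))"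
      using smooth_fun_derivative[of "\<phi> i" ?a "snd ?a z"] \<phi>[OF that] chart_ran_mem[of ?a z]
      by (simp add: test_fun_def dfun_def[abs_def])
    then show ?thesis by (rule has_derivative_add_const)
  qed
  from smooth_on_prod_chain[OF g, where h="?h" and h'="\<lambda>i. dfun (\<phi> i) z", OF hd]
  have "((\<lambda>p. g (\<lambda>i\<in>{..<N}. ?h i p)) has_derivative (\<lambda>u. \<Sum>i<N. dpart [(i, 1)] g (\<lambda>i\<in>{..<N}. ?h i (snd ?a z)) * dfun (\<phi> i) z u)) (at (snd ?a z))"
    .
  moreover have "(\<lambda>i\<in>{..<N}. ?h i (snd ?a z)) = (\<lambda>i\<in>{..<N}. pairing (\<phi> i) \<gamma>)" using p by (auto simp: restrict_def)
  ultimately have "((\<lambda>p. g (\<lambda>i\<in>{..<N}. ?h i p)) has_derivative (\<lambda>u. \<Sum>i<N. dpart [(i, 1)] g (\<lambda>i\<in>{..<N}. pairing (\<phi> i) \<gamma>) * dfun (\<phi> i) z u)) (at (snd ?a z))"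
    by metis
  then show ?thesis
  proof (rule has_derivative_transform_within_open[OF _ V(1,2)])
    fix q assume "q \<in> V"
    then have "pairing (\<phi> i) (insert (chart_inv ?a q) (\<gamma> - {z})) = ?h i q" if "i < N" for i
      using pairing_insert[OF G V(4) test_fun_C0[OF \<phi>[OF that]]] by simp
    then have "(\<lambda>i\<in>{..<N}. ?h i q) = (\<lambda>i\<in>{..<N}. pairing (\<phi> i) (insert (chart_inv ?a q) (\<gamma> - {z})))" by (auto simp: restrict_def)
    then show "g (\<lambda>i\<in>{..<N}. ?h i q) = F (insert (chart_inv ?a q) (\<gamma> - {z}))" unfolding F by metis
  qed
qed

lemma cylinderE:
  assumes "F \<in> cylinder_fun M"
  obtains N g \<phi> C where "\<And>i. i < N \<Longrightarrow> \<phi> i \<in> test_fun M" "smooth_on_prod N (PiE {..<N} (\<lambda>_. UNIV)) g"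
    "F = (\<lambda>\<gamma>. g (\<lambda>i\<in>{..<N}. pairing (\<phi> i) \<gamma>))"
    "\<And>q. q \<in> PiE {..<N} (\<lambda>_. UNIV) \<Longrightarrow> \<bar>g q\<bar> \<le> C"
    "\<And>q i. q \<in> PiE {..<N} (\<lambda>_. UNIV) \<Longrightarrow> i < N \<Longrightarrow> \<bar>dpart [(i, 1)] g q\<bar> \<le> C" "C \<ge> 0"
proof -
  obtain N g \<phi> where F: "\<forall>i<N. \<phi> i \<in> test_fun M" "smooth_on_prod N (PiE {..<N} (\<lambda>_. UNIV)) g"
    "\<forall>ivs. fst ` set ivs \<subseteq> {..<N} \<longrightarrow> bounded (dpart ivs g ` PiE {..<N} (\<lambda>_. UNIV))"
    "F = (\<lambda>\<gamma>. g (\<lambda>i\<in>{..<N}. pairing (\<phi> i) \<gamma>))"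
    using assms unfolding cylinder_fun_def by blast
  let ?Q = "PiE {..<N} (\<lambda>_. UNIV :: real set)"
  have "bounded (g ` ?Q)" using F(3)[rule_format, of "[]"] by simp
  then obtain C0 where C0: "\<And>q. q \<in> ?Q \<Longrightarrow> \<bar>g q\<bar> \<le> C0" unfolding bounded_iff by auto
  have "\<exists>C. \<forall>q\<in>?Q. \<bar>dpart [(i, 1)] g q\<bar> \<le> C" if "i < N" for i
    using F(3)[rule_format, of "[(i, 1)]"] that unfolding bounded_iff by (auto simp del: dpart.simps)
  then obtain C1 where C1: "\<And>i q. i < N \<Longrightarrow> q \<in> ?Q \<Longrightarrow> \<bar>dpart [(i, 1)] g q\<bar> \<le> C1 i" by metis
  define C where "C = \<bar>C0\<bar> + (\<Sum>i<N. \<bar>C1 i\<bar>)"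
  have "C1 i \<le> C" if "i < N" for i
  proof -
    have "\<bar>C1 i\<bar> \<le> (\<Sum>i<N. \<bar>C1 i\<bar>)" using that by (intro member_le_sum) auto
    then show ?thesis unfolding C_def by linarith
  qed
  moreover have "C0 \<le> C" "C \<ge> 0" unfolding C_def using sum_nonneg[of "{..<N}" "\<lambda>i. \<bar>C1 i\<bar>"] by (auto intro: order_trans[of _ "\<bar>C0\<bar>"])
  ultimately show ?thesis using F C0 C1 by (intro that[of N \<phi> g C]) (blast intro: order_trans)+
qed

lemma pairings_mem: "(\<lambda>i\<in>{..<N}. pairing (\<phi> i) \<gamma>) \<in> PiE {..<N} (\<lambda>_. UNIV)" by simp

lemma pairings_measurable:
  fixes N :: nat and g :: "(nat \<Rightarrow> real) \<Rightarrow> real"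
  assumes "\<And>i. i < N \<Longrightarrow> \<phi> i \<in> C0" and g: "continuous_on (PiE {..<N} (\<lambda>_. UNIV)) g"
  shows "(\<lambda>\<gamma>. g (\<lambda>i\<in>{..<N}. pairing (\<phi> i) \<gamma>) :: real) \<in> borel_measurable (GammaM :: 'a set measure)"
proof -
  have "(\<lambda>\<gamma>. \<lambda>i\<in>{..<N}. pairing (\<phi> i) \<gamma>) \<in> measurable (GammaM :: 'a set measure) (PiM {..<N} (\<lambda>_. borel))"
    by (rule measurable_restrict) (use assms(1) in auto)
  from measurable_compose[OF this continuous_on_extensional_measurable[OF g]] show ?thesis .
qed

lemma cylinder_measurable:
  assumes "F \<in> cylinder_fun M" shows "F \<in> borel_measurable GammaM"
  using assms
proof (rule cylinderE)
  fix N g \<phi> C assume A: "\<And>i. i < N \<Longrightarrow> \<phi> i \<in> test_fun M" "smooth_on_prod N (PiE {..<N} (\<lambda>_. UNIV)) g"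
    "F = (\<lambda>\<gamma>. g (\<lambda>i\<in>{..<N}. pairing (\<phi> i) \<gamma>))"
  have "continuous_on (PiE {..<N} (\<lambda>_. UNIV)) g"
    using A(2)[unfolded smooth_on_prod_def, THEN spec[of _ "[]"]] by simp
  moreover have "\<phi> i \<in> C0" if "i < N" for i using test_fun_C0[OF A(1)[OF that]] .
  ultimately show ?thesis unfolding A(3) using pairings_measurable[of N \<phi> g] by blast
qed

lemma cylinder_bounded:
  assumes "F \<in> cylinder_fun M" shows "\<exists>C\<ge>0. \<forall>\<gamma>. \<bar>F \<gamma>\<bar> \<le> C"
  using assms by (rule cylinderE) (metis pairings_mem)

lemma cylinder_differentiable:
  assumes "F \<in> cylinder_fun M" "\<gamma> \<in> Gamma" "z \<in> \<gamma>"
  shows "(\<lambda>p. F (insert (chart_inv (chart_at M z) p) (\<gamma> - {z}))) differentiable (at (snd (chart_at M z) z))"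
  using assms(1)
proof (rule cylinderE)
  fix N g \<phi> C assume A: "\<And>i. i < N \<Longrightarrow> \<phi> i \<in> test_fun M" "smooth_on_prod N (PiE {..<N} (\<lambda>_. UNIV)) g"
    "F = (\<lambda>\<gamma>. g (\<lambda>i\<in>{..<N}. pairing (\<phi> i) \<gamma>))"
  from cylinder_derivative[OF A assms(2,3)] show ?thesis unfolding differentiable_def by blast
qed

lemma dG_eq:
  assumes A: "\<And>i. i < N \<Longrightarrow> \<phi> i \<in> test_fun M" "smooth_on_prod N (PiE {..<N} (\<lambda>_. UNIV)) g"
    "F = (\<lambda>\<gamma>. g (\<lambda>i\<in>{..<N}. pairing (\<phi> i) \<gamma>))" and "\<gamma> \<in> Gamma" "z \<in> \<gamma>"
  shows "dG F \<gamma> z u = (\<Sum>i<N. dpart [(i, 1)] g (\<lambda>i\<in>{..<N}. pairing (\<phi> i) \<gamma>) * dfun (\<phi> i) z u)"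
proof -
  have "((\<lambda>p. F (insert (chart_inv (chart_at M z) p) (\<gamma> - {z}))) has_derivative
    (\<lambda>u. \<Sum>i<N. dpart [(i, 1)] g (\<lambda>i\<in>{..<N}. pairing (\<phi> i) \<gamma>) * dfun (\<phi> i) z u)) (at (snd (chart_at M z) z))"
    by (rule cylinder_derivative[OF _ A(2,3) assms(4,5)]) (rule A(1))
  from fun_cong[OF frechet_derivative_at[OF this], of u] show ?thesis unfolding dG_def by (rule sym)
qed

lemma cylinder_support:
  assumes "F \<in> cylinder_fun M"
  shows "\<exists>K. compact K \<and> (\<forall>\<gamma>\<in>Gamma. \<forall>z\<in>\<gamma> - K. \<forall>u. dG F \<gamma> z u = 0)"
  using assms
proof (rule cylinderE)
  fix N g \<phi> C assume A: "\<And>i. i < N \<Longrightarrow> \<phi> i \<in> test_fun M" "smooth_on_prod N (PiE {..<N} (\<lambda>_. UNIV)) g"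
    "F = (\<lambda>\<gamma>. g (\<lambda>i\<in>{..<N}. pairing (\<phi> i) \<gamma>))"
  let ?K = "\<Union>i\<in>{..<N}. closure {x. \<phi> i x \<noteq> 0}"
  have "compact ?K" using A(1) by (intro compact_UN) (auto simp: test_fun_def)
  moreover have "dG F \<gamma> z u = 0" if "\<gamma> \<in> Gamma" "z \<in> \<gamma> - ?K" for \<gamma> z u
    using dG_eq[OF A that(1), of z u] that(2) dfun_eq_0[of z "\<phi> _"] by (auto intro!: sum.neutral)
  ultimately show ?thesis by blast
qed

text \<open>The sum over the points of \<gamma> is absorbed into pairings with the functions
  \<open>dprod\<close>, the other factors being bounded functions of pairings. Measurability and
  growth of \<open>cprod\<close> both follow from this form.\<close>

lemma cprod_formula:
  assumes A: "\<And>i. i < N \<Longrightarrow> \<phi> i \<in> test_fun M" "smooth_on_prod N (PiE {..<N} (\<lambda>_. UNIV)) g"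
    "F = (\<lambda>\<gamma>. g (\<lambda>i\<in>{..<N}. pairing (\<phi> i) \<gamma>))"
    and A': "\<And>i. i < N' \<Longrightarrow> \<phi>' i \<in> test_fun M" "smooth_on_prod N' (PiE {..<N'} (\<lambda>_. UNIV)) g'"
    "F' = (\<lambda>\<gamma>. g' (\<lambda>i\<in>{..<N'}. pairing (\<phi>' i) \<gamma>))"
    and \<gamma>: "\<gamma> \<in> Gamma"
  shows "cprod F F' \<gamma> = (\<Sum>i<N. \<Sum>j<N'. dpart [(i, 1)] g (\<lambda>i\<in>{..<N}. pairing (\<phi> i) \<gamma>) *
     dpart [(j, 1)] g' (\<lambda>i\<in>{..<N'}. pairing (\<phi>' i) \<gamma>) * pairing (dprod (\<phi> i) (\<phi>' j)) \<gamma>)"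
proof -
  let ?K = "\<Union>i\<in>{..<N}. closure {x. \<phi> i x \<noteq> 0}"
  have "compact ?K" using A(1) by (intro compact_UN) (auto simp: test_fun_def)
  then have fin: "finite (\<gamma> \<inter> ?K)" by (rule Gamma_finite[OF \<gamma>])
  let ?d = "\<lambda>i. dpart [(i, 1)] g (\<lambda>i\<in>{..<N}. pairing (\<phi> i) \<gamma>)" and ?d' = "\<lambda>j. dpart [(j, 1)] g' (\<lambda>i\<in>{..<N'}. pairing (\<phi>' i) \<gamma>)"
  have z: "(\<Sum>u\<in>onb M z. dG F \<gamma> z u * dG F' \<gamma> z u) = (\<Sum>i<N. \<Sum>j<N'. ?d i * ?d' j * dprod (\<phi> i) (\<phi>' j) z)" if "z \<in> \<gamma>" for z
  proof -
    have "(\<Sum>u\<in>onb M z. dG F \<gamma> z u * dG F' \<gamma> z u) = (\<Sum>u\<in>onb M z. \<Sum>i<N. \<Sum>j<N'. (?d i * dfun (\<phi> i) z u) * (?d' j * dfun (\<phi>' j) z u))"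
      by (simp only: dG_eq[OF A \<gamma> that] dG_eq[OF A' \<gamma> that] sum_product)
    also have "\<dots> = (\<Sum>i<N. \<Sum>j<N'. \<Sum>u\<in>onb M z. (?d i * dfun (\<phi> i) z u) * (?d' j * dfun (\<phi>' j) z u))"
      by (subst sum.swap, intro sum.cong refl, subst sum.swap) simp
    also have "\<dots> = (\<Sum>i<N. \<Sum>j<N'. ?d i * ?d' j * dprod (\<phi> i) (\<phi>' j) z)"
      unfolding dprod_def by (intro sum.cong refl) (simp add: sum_distrib_left mult_ac del: dpart.simps)
    finally show ?thesis .
  qed
  have d0: "dprod (\<phi> i) (\<phi>' j) z = 0" if "i < N" "z \<notin> ?K" for i j z
    using that dfun_eq_0[of z "\<phi> i"] by (auto simp: dprod_def)
  have "cprod F F' \<gamma> = (\<Sum>\<^sub>\<infinity>z\<in>\<gamma>. \<Sum>i<N. \<Sum>j<N'. ?d i * ?d' j * dprod (\<phi> i) (\<phi>' j) z)"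
    unfolding cprod_def by (intro infsum_cong z)
  also have "\<dots> = (\<Sum>\<^sub>\<infinity>z\<in>\<gamma> \<inter> ?K. \<Sum>i<N. \<Sum>j<N'. ?d i * ?d' j * dprod (\<phi> i) (\<phi>' j) z)"
    using d0 by (intro infsum_cong_neutral) (auto intro!: sum.neutral simp del: dpart.simps)
  also have "\<dots> = (\<Sum>z\<in>\<gamma> \<inter> ?K. \<Sum>i<N. \<Sum>j<N'. ?d i * ?d' j * dprod (\<phi> i) (\<phi>' j) z)"
    using fin by simp
  also have "\<dots> = (\<Sum>i<N. \<Sum>j<N'. \<Sum>z\<in>\<gamma> \<inter> ?K. ?d i * ?d' j * dprod (\<phi> i) (\<phi>' j) z)"
    by (subst sum.swap, intro sum.cong refl, subst sum.swap) simp
  also have "\<dots> = (\<Sum>i<N. \<Sum>j<N'. ?d i * ?d' j * pairing (dprod (\<phi> i) (\<phi>' j)) \<gamma>)"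
  proof (intro sum.cong refl)
    fix i j assume "i \<in> {..<N}" "j \<in> {..<N'}"
    then have "pairing (dprod (\<phi> i) (\<phi>' j)) \<gamma> = sum (dprod (\<phi> i) (\<phi>' j)) (\<gamma> \<inter> ?K)"
    proof (intro pairing_eq_sum fin)
      show "x \<in> \<gamma> \<inter> ?K" if "x \<in> \<gamma>" "dprod (\<phi> i) (\<phi>' j) x \<noteq> 0" for x
        using d0[of i x j] that \<open>i \<in> {..<N}\<close> by blast
    qed simp
    then show "(\<Sum>z\<in>\<gamma> \<inter> ?K. ?d i * ?d' j * dprod (\<phi> i) (\<phi>' j) z) = ?d i * ?d' j * pairing (dprod (\<phi> i) (\<phi>' j)) \<gamma>"
      by (simp only: sum_distrib_left)
  qed
  finally show ?thesis .
qed

lemma pairing_abs_le: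
  assumes "\<gamma> \<in> Gamma" "f \<in> C0" shows "\<bar>pairing f \<gamma>\<bar> \<le> pairing (\<lambda>x. \<bar>f x\<bar>) \<gamma>"
  unfolding pairing_def using sum_abs[of f "{x \<in> \<gamma>. f x \<noteq> 0}"] by simp

lemma pairing_sum:
  assumes "finite I" "\<And>i. i \<in> I \<Longrightarrow> f i \<in> C0" "\<gamma> \<in> Gamma"
  shows "pairing (\<lambda>x. \<Sum>i\<in>I. f i x) \<gamma> = (\<Sum>i\<in>I. pairing (f i) \<gamma>)"
proof -
  let ?S = "\<Union>i\<in>I. {x\<in>\<gamma>. f i x \<noteq> 0}"
  have fin: "finite ?S" using assms Gamma_finite_supp by blast
  have "pairing (\<lambda>x. \<Sum>i\<in>I. f i x) \<gamma> = (\<Sum>x\<in>?S. \<Sum>i\<in>I. f i x)"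
  proof (rule pairing_eq_sum[OF fin])
    fix x assume "x \<in> \<gamma>" "(\<Sum>i\<in>I. f i x) \<noteq> 0"
    then have "\<exists>i\<in>I. f i x \<noteq> 0" using sum.neutral[of I "\<lambda>i. f i x"] by blast
    then show "x \<in> ?S" using \<open>x \<in> \<gamma>\<close> by blast
  qed auto
  also have "\<dots> = (\<Sum>i\<in>I. \<Sum>x\<in>?S. f i x)" by (rule sum.swap)
  also have "\<dots> = (\<Sum>i\<in>I. pairing (f i) \<gamma>)"
    using fin by (intro sum.cong refl pairing_eq_sum[symmetric]) auto
  finally show ?thesis .
qed

lemma cprod_measurable_bounded:
  assumes "F \<in> cylinder_fun M" "F' \<in> cylinder_fun M"
  shows "cprod F F' \<in> borel_measurable GammaM"
    and "\<exists>f\<in>C0. \<exists>D\<ge>0. (\<forall>x. 0 \<le> f x) \<and> (\<forall>\<gamma>\<in>Gamma. \<bar>cprod F F' \<gamma>\<bar> \<le> D * pairing f \<gamma>)"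
proof -
  obtain N g \<phi> C where A: "\<And>i. i < N \<Longrightarrow> \<phi> i \<in> test_fun M" "smooth_on_prod N (PiE {..<N} (\<lambda>_. UNIV)) g"
    "F = (\<lambda>\<gamma>. g (\<lambda>i\<in>{..<N}. pairing (\<phi> i) \<gamma>))"
    and C: "\<And>q i. q \<in> PiE {..<N} (\<lambda>_. UNIV) \<Longrightarrow> i < N \<Longrightarrow> \<bar>dpart [(i, 1)] g q\<bar> \<le> C" "C \<ge> 0"
    using cylinderE[OF assms(1)] by metis
  obtain N' g' \<phi>' C' where A': "\<And>i. i < N' \<Longrightarrow> \<phi>' i \<in> test_fun M" "smooth_on_prod N' (PiE {..<N'} (\<lambda>_. UNIV)) g'"
    "F' = (\<lambda>\<gamma>. g' (\<lambda>i\<in>{..<N'}. pairing (\<phi>' i) \<gamma>))"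
    and C': "\<And>q i. q \<in> PiE {..<N'} (\<lambda>_. UNIV) \<Longrightarrow> i < N' \<Longrightarrow> \<bar>dpart [(i, 1)] g' q\<bar> \<le> C'" "C' \<ge> 0"
    using cylinderE[OF assms(2)] by metis
  let ?d = "\<lambda>i \<gamma>. dpart [(i, 1)] g (\<lambda>i\<in>{..<N}. pairing (\<phi> i) \<gamma>)" and ?d' = "\<lambda>j \<gamma>. dpart [(j, 1)] g' (\<lambda>i\<in>{..<N'}. pairing (\<phi>' i) \<gamma>)"
  let ?f = "\<lambda>\<gamma>. \<Sum>i<N. \<Sum>j<N'. ?d i \<gamma> * ?d' j \<gamma> * pairing (dprod (\<phi> i) (\<phi>' j)) \<gamma>"
  have formula: "cprod F F' \<gamma> = ?f \<gamma>" if "\<gamma> \<in> Gamma" for \<gamma>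
    by (rule cprod_formula[OF _ A(2,3) _ A'(2,3) that]) (use A(1) A'(1) in auto)
  have gm: "?d i \<in> borel_measurable GammaM" if "i < N" for i
    using A(2)[unfolded smooth_on_prod_def, THEN spec[of _ "[(i, 1)]"]] that
    by (intro pairings_measurable test_fun_C0 A(1)) (auto simp del: dpart.simps)
  have gm': "?d' j \<in> borel_measurable GammaM" if "j < N'" for j
    using A'(2)[unfolded smooth_on_prod_def, THEN spec[of _ "[(j, 1)]"]] that
    by (intro pairings_measurable test_fun_C0 A'(1)) (auto simp del: dpart.simps)
  have "?f \<in> borel_measurable GammaM"
    by (intro borel_measurable_sum borel_measurable_times gm gm' pairing_measurable dprod_C0 A(1) A'(1)) auto
  then show "cprod F F' \<in> borel_measurable GammaM"
    by (rule measurable_cong[THEN iffD1, rotated]) (simp add: formula del: dpart.simps)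
  let ?h = "\<lambda>i j x. \<bar>dprod (\<phi> i) (\<phi>' j) x\<bar>"
  have hC: "?h i j \<in> C0" if "i < N" "j < N'" for i j
    by (rule C0_comp[OF dprod_C0[OF A(1)[OF that(1)] A'(1)[OF that(2)]], where h=abs]) (auto intro: continuous_intros)
  let ?chi = "\<lambda>x. \<Sum>p\<in>{..<N} \<times> {..<N'}. ?h (fst p) (snd p) x"
  have chi: "?chi \<in> C0" using hC by (intro C0_sum) auto
  have bd: "\<bar>cprod F F' \<gamma>\<bar> \<le> (C * C') * pairing ?chi \<gamma>" if \<gamma>: "\<gamma> \<in> Gamma" for \<gamma>
  proof -
    have "\<bar>?f \<gamma>\<bar> \<le> (\<Sum>i<N. \<Sum>j<N'. \<bar>?d i \<gamma> * ?d' j \<gamma> * pairing (dprod (\<phi> i) (\<phi>' j)) \<gamma>\<bar>)"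
      by (rule order_trans[OF sum_abs sum_mono[OF sum_abs]])
    also have "\<dots> \<le> (\<Sum>i<N. \<Sum>j<N'. (C * C') * pairing (?h i j) \<gamma>)"
    proof (intro sum_mono)
      fix i j assume "i \<in> {..<N}" "j \<in> {..<N'}"
      then have ij: "i < N" "j < N'" by auto
      have "\<bar>?d i \<gamma>\<bar> * \<bar>?d' j \<gamma>\<bar> \<le> C * C'"
        by (rule mult_mono[OF C(1)[OF pairings_mem ij(1)] C'(1)[OF pairings_mem ij(2)] C(2) abs_ge_zero])
      moreover have "\<bar>pairing (dprod (\<phi> i) (\<phi>' j)) \<gamma>\<bar> \<le> pairing (?h i j) \<gamma>"
        by (rule pairing_abs_le[OF \<gamma> dprod_C0[OF A(1)[OF ij(1)] A'(1)[OF ij(2)]]])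
      ultimately show "\<bar>?d i \<gamma> * ?d' j \<gamma> * pairing (dprod (\<phi> i) (\<phi>' j)) \<gamma>\<bar> \<le> (C * C') * pairing (?h i j) \<gamma>"
        unfolding abs_mult by (rule mult_mono) (use C(2) C'(2) in \<open>simp_all del: dpart.simps\<close>)
    qed
    also have "\<dots> = (C * C') * (\<Sum>p\<in>{..<N} \<times> {..<N'}. pairing (?h (fst p) (snd p)) \<gamma>)"
      by (simp add: sum_distrib_left sum.cartesian_product case_prod_beta)
    also have "(\<Sum>p\<in>{..<N} \<times> {..<N'}. pairing (?h (fst p) (snd p)) \<gamma>) = pairing ?chi \<gamma>"
      using hC \<gamma> by (intro pairing_sum[symmetric]) auto
    finally show ?thesis unfolding formula[OF \<gamma>] .
  qed
  have nn: "0 \<le> ?chi x" for x by (intro sum_nonneg) auto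
  have CC: "0 \<le> C * C'" using C(2) C'(2) by simp
  show "\<exists>f\<in>C0. \<exists>D\<ge>0. (\<forall>x. 0 \<le> f x) \<and> (\<forall>\<gamma>\<in>Gamma. \<bar>cprod F F' \<gamma>\<bar> \<le> D * pairing f \<gamma>)"
    by (rule bexI[OF _ chi], rule exI[of _ "C * C'"], intro conjI allI ballI CC nn bd)
qed

end

section \<open>Gradients of test forms\<close>

lemma count_list_card: "count_list xs y = card {j. j < length xs \<and> xs ! j = y}"
proof -
  have "{j. j < length xs \<and> y = xs ! j} = {j. j < length xs \<and> xs ! j = y}" by auto
  then show ?thesis by (simp add: count_list_eq_length_filter length_filter_conv_card)
qed

lemma map_permute_transpose:
  assumes "j1 < length xs" "j2 < length xs" "xs ! j1 = xs ! j2"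
  shows "permute_list (Transposition.transpose j1 j2) xs = xs"
proof (rule nth_equalityI)
  fix j assume "j < length (permute_list (Transposition.transpose j1 j2) xs)"
  then show "permute_list (Transposition.transpose j1 j2) xs ! j = xs ! j"
    using assms by (simp add: permute_list_def) (simp add: Transposition.transpose_def)
qed (simp add: permute_list_def)

lemma wedge_mlin: "A \<in> wedge M x I n \<Longrightarrow> is \<in> tuples I n \<Longrightarrow> mlin n (A is)"
  unfolding wedge_def mlin_def by blast

text \<open>Induction over the positions labelled i at which the vector is not yet known to be a
  standard basis vector, expanding one such slot at a time. Once all are basis vectors, two of the
  more than d positions carry the same one; their transposition fixes both lists but has sign
  -1.\<close>

lemma wedge_alternating:
  fixes A :: "('i, 'n::finite) tensor"
  assumes A: "A \<in> wedge M x I n" and "is": "is \<in> tuples I n"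
    and cnt: "count_list is i > CARD('n)" and vs: "length vs = n"
  shows "A is vs = 0"
proof -
  have len: "length is = n" using "is" by (simp add: tuples_def)
  define P where "P = {j. j < n \<and> is ! j = i}"
  have P: "finite P" "card P > CARD('n)" using cnt count_list_card[of "is" i] len by (auto simp: P_def)
  have "\<lbrakk>finite Q; Q \<subseteq> P; length vs = n; \<And>j. j \<in> P - Q \<Longrightarrow> \<exists>a. vs ! j = axis a 1\<rbrakk> \<Longrightarrow> A is vs = 0" for Q and vs :: "(real ^ 'n) list"
  proof (induction Q arbitrary: vs rule: finite_induct)
    case empty
    then obtain a where a: "\<And>j. j \<in> P \<Longrightarrow> vs ! j = axis (a j) 1" by (metis Diff_empty)
    have "\<not> inj_on a P" using P card_inj_on_le[of a P UNIV] by auto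
    then obtain j1 j2 where j: "j1 \<in> P" "j2 \<in> P" "a j1 = a j2" "j1 \<noteq> j2" by (auto simp: inj_on_def)
    have jn: "j1 < n" "j2 < n" "is ! j1 = is ! j2" using j by (auto simp: P_def)
    have "Transposition.transpose j1 j2 permutes {..<n}" using jn by (intro permutes_swap_id) auto
    then have "A (permute_list (Transposition.transpose j1 j2) is) (permute_list (Transposition.transpose j1 j2) vs) = of_int (sign (Transposition.transpose j1 j2)) * A is vs"
      using A "is" empty.prems(2) unfolding wedge_def by blast
    moreover have "permute_list (Transposition.transpose j1 j2) is = is" using jn len by (intro map_permute_transpose) auto
    moreover have "permute_list (Transposition.transpose j1 j2) vs = vs"
      using jn j a empty.prems(2) by (intro map_permute_transpose) auto
    ultimately show ?case using j(4) by (simp add: sign_swap_id)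
  next
    case (insert q Q)
    have q: "q < n" using insert.prems(1) by (auto simp: P_def)
    have "A is (vs[q := axis a 1]) = 0" for a
      using insert.prems q by (intro insert.IH) (auto simp: nth_list_update)
    moreover have "linear (\<lambda>v. A is (vs[q := v]))"
      by (rule mlinD[OF wedge_mlin[OF A "is"] insert.prems(2) q])
    ultimately have "A is (vs[q := vs ! q]) = 0"
      using linear_axis_expansion_real[of "\<lambda>v. A is (vs[q := v])" "vs ! q"] by simp
    then show ?case by simp
  qed
  from this[of P vs] show ?thesis using P(1) vs by simp
qed

text \<open>Factors a list of slots into the set of points that occur, enumerated injectively by x,
  and the pattern in which they occur. This links components over a configuration with components
  over a tuple.\<close>

lemma list_enumeration:
  obtains l x "is" where "x \<in> Inj l (set xs)" "xs = map x is" "set is = {..<l::nat}" "length is = length xs" "l \<le> length xs"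
proof -
  define l where "l = card (set xs)"
  obtain h where h: "bij_betw h {0..<l} (set xs)"
    using ex_bij_betw_nat_finite[of "set xs"] by (auto simp: l_def)
  define x where "x = restrict h {..<l}"
  have x: "bij_betw x {..<l} (set xs)"
    using h unfolding x_def by (subst bij_betw_cong[of _ _ h]) (auto simp: atLeast0LessThan)
  define g where "g = inv_into {..<l} x"
  have g: "x (g y) = y" "g y < l" if "y \<in> set xs" for y
    using that x inv_into_into[of y x "{..<l}"] unfolding g_def by (auto simp: bij_betw_def f_inv_into_f)
  have "x \<in> Inj l (set xs)" using x by (auto simp: Inj_def x_def bij_betw_def)
  moreover have "xs = map x (map g xs)" using g by (simp add: map_idI)
  moreover have "set (map g xs) = {..<l}"
  proof -
    have "g ` set xs = {..<l}" using bij_betw_inv_into[OF x] by (simp add: g_def bij_betw_def)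
    then show ?thesis by simp
  qed
  moreover have "l \<le> length xs" by (simp add: l_def card_length)
  ultimately show ?thesis using that[of x l "map g xs"] by simp
qed

lemma Inj_mono: "S \<subseteq> T \<Longrightarrow> Inj l S \<subseteq> Inj l T"
  by (auto simp: Inj_def PiE_def Pi_def)

lemma not_T_tuples_count:
  assumes "is \<in> tuples {..<l} n" "set is = {..<l}" "is \<notin> T_tuples TYPE('n::finite) n l"
  obtains i where "i < l" "count_list is i > CARD('n)"
proof -
  have "1 \<le> count_list is i" if "i < l" for i
    using assms(2) that count_list_0_iff[of "is" i] by (metis One_nat_def Suc_leI lessThan_iff neq0_conv)
  then show ?thesis using assms that unfolding T_tuples_def by (auto simp: not_le)
qed

context riem_mfd begin

text \<open>\<open>component\<close> retains only the patterns in \<open>T_tuples\<close>. A pattern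
  that uses every index but lies outside repeats some point more than d times, where an alternating
  tensor vanishes; hence no information is lost.\<close>

lemma forms_alternating:
  assumes W: "W \<in> forms M n" and \<gamma>: "\<gamma> \<in> Gamma" and x: "x \<in> Inj l \<gamma>"
    and "is": "is \<in> tuples {..<l} n" "set is = {..<l}" "is \<notin> T_tuples TYPE('n) n l" and vs: "length vs = n"
  shows "W \<gamma> (map x is) vs = 0"
proof -
  obtain i where i: "i < l" "count_list is i > CARD('n)" using not_T_tuples_count[OF "is"] by blast
  have "count_list (map x is) (x i) = count_list is i"
    by (rule count_list_inj_map) (use x "is"(2) i in \<open>auto simp: Inj_def\<close>)
  moreover have "map x is \<in> tuples \<gamma> n" using x "is" by (auto simp: tuples_def Inj_def)
  moreover have "W \<gamma> \<in> Gwedge M n \<gamma>" using W \<gamma> by (simp add: forms_def)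
  ultimately show ?thesis using wedge_alternating[of "W \<gamma>" M "\<lambda>x. x" \<gamma> n "map x is" "x i" vs] i vs by simp
qed

text \<open>Injectivity is literal, not modulo null sets. For x with values in \<gamma> the union of
  \<gamma> with these points is \<gamma>, so values of \<open>In_map\<close> at such overlapping
  arguments recover the components with patterns in \<open>T_tuples\<close>; the others vanish for
  every form.\<close>

lemma In_map_inj: "inj_on (In_map n) (forms M n)"
proof (rule inj_onI)
  fix V W assume V: "V \<in> forms M n" and W: "W \<in> forms M n" and eq: "In_map n V = In_map n W"
  have "V \<gamma> xs vs = W \<gamma> xs vs" for \<gamma> xs vs
  proof (cases "\<gamma> \<in> Gamma \<and> xs \<in> tuples \<gamma> n \<and> length vs = n")
    case False
    then show ?thesis using V W by (cases "\<gamma> \<in> Gamma") (auto simp: forms_def wedge_def)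
  next
    case True
    then have len: "length xs = n" and sub: "set xs \<subseteq> \<gamma>" by (auto simp: tuples_def)
    obtain l x "is" where x: "x \<in> Inj l (set xs)" "xs = map x is" "set is = {..<l}" "length is = length xs"
      using list_enumeration[of xs] by metis
    have x\<gamma>: "x \<in> Inj l \<gamma>" using x(1) Inj_mono[OF sub] by blast
    have ist: "is \<in> tuples {..<l} n" using x len by (simp add: tuples_def)
    show ?thesis
    proof (cases "is \<in> T_tuples TYPE('n) n l")
      case T: True
      have "\<gamma> \<union> x ` {..<l} = \<gamma>" using x\<gamma> by (auto simp: Inj_def)
      moreover have "In_map n V l \<gamma> x is vs = In_map n W l \<gamma> x is vs" by (simp add: eq)
      ultimately show ?thesis using T x(2) by (simp add: In_map_def component_def)
    next
      case False
      then show ?thesis using forms_alternating[OF V _ x\<gamma> ist x(3) False] forms_alternating[OF W _ x\<gamma> ist x(3) False] True x(2)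
        by simp
    qed
  qed
  then show "V = W" by blast
qed

section \<open>Test forms as finite families of cylinder functions and forms on powers\<close>

definition Jl :: "nat \<Rightarrow> (nat \<Rightarrow> nat) \<Rightarrow> nat \<Rightarrow> nat set" where
  "Jl J k l = {j. j < J \<and> k j = l}"

lemma finite_Jl[simp]: "finite (Jl J k l)" by (simp add: Jl_def)

text \<open>Patterns are required to use every index below l: a pattern omitting an index belongs to
  a smaller l. By \<open>list_enumeration\<close> this covers every slot list over a configuration
  when n is positive.\<close>

definition drep :: "nat \<Rightarrow> ('a, 'n) Gform \<Rightarrow> nat \<Rightarrow> (nat \<Rightarrow> nat) \<Rightarrow> (nat \<Rightarrow> real) \<Rightarrow> (nat \<Rightarrow> 'a set \<Rightarrow> real)
    \<Rightarrow> (nat \<Rightarrow> (nat \<Rightarrow> 'a) \<Rightarrow> (nat, 'n) tensor) \<Rightarrow> bool" where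
  "drep n V J k a F \<omega> \<longleftrightarrow> (\<forall>j<J. k j \<in> {1..n} \<and> F j \<in> cylinder_fun M \<and> \<omega> j \<in> Psi_sym M n (k j)) \<and>
    (\<forall>\<gamma>\<in>Gamma. \<forall>l\<in>{1..n}. \<forall>x\<in>Inj l \<gamma>. \<forall>is\<in>tuples {..<l} n. set is = {..<l} \<longrightarrow> (\<forall>vs. length vs = n \<longrightarrow>
       V \<gamma> (map x is) vs = (\<Sum>j\<in>Jl J k l. a j * sqrt (fact l) * F j (\<gamma> - x ` {..<l}) * \<omega> j x is vs)))"

lemma Psi_T_space:
  assumes "\<omega> \<in> Psi_sym M n l" "x \<in> Inj l \<gamma>" "is \<notin> T_tuples TYPE('n) n l"
  shows "\<omega> x is vs = 0"
proof -
  have "x \<in> PiE {..<l} (\<lambda>_. UNIV)" "inj_on x {..<l}" using assms(2) by (auto simp: Inj_def PiE_def)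
  then have "\<omega> x \<in> T_space M n l x" using assms(1) by (simp add: Psi_sym_def)
  then show ?thesis using assms(3) by (simp add: T_space_def)
qed

lemma DOmega_drep:
  assumes "V \<in> DOmega M n"
  obtains J k a F \<omega> where "drep n V J k a F \<omega>"
proof -
  obtain J :: nat and a G where G: "\<And>j. j < J \<Longrightarrow> G j \<in> DOmega_gen M n" and V: "V = (\<lambda>\<gamma> xs vs. \<Sum>j<J. a j * G j \<gamma> xs vs)"
    using assms unfolding DOmega_def by blast
  have "\<forall>j\<in>{..<J}. \<exists>k F \<omega>. k \<in> {1..n} \<and> F \<in> cylinder_fun M \<and> \<omega> \<in> Psi_sym M n k \<and>
    (\<forall>\<gamma>\<in>Gamma. \<forall>l\<in>{1..n}. \<forall>x\<in>PiE {..<l} (\<lambda>_. \<gamma>). inj_on x {..<l} \<longrightarrow>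
       component n l (G j) \<gamma> x =
         (if l = k then (\<lambda>is vs. sqrt (fact k) * F (\<gamma> - x ` {..<k}) * \<omega> x is vs) else (\<lambda>_ _. 0)))"
    using G unfolding DOmega_gen_def by blast
  then obtain k F \<omega> where kF: "\<And>j. j < J \<Longrightarrow> k j \<in> {1..n} \<and> F j \<in> cylinder_fun M \<and> \<omega> j \<in> Psi_sym M n (k j)"
    and comp: "\<And>j \<gamma> l x. j < J \<Longrightarrow> \<gamma> \<in> Gamma \<Longrightarrow> l \<in> {1..n} \<Longrightarrow> x \<in> PiE {..<l} (\<lambda>_. \<gamma>) \<Longrightarrow> inj_on x {..<l} \<Longrightarrow>
       component n l (G j) \<gamma> x =
         (if l = k j then (\<lambda>is vs. sqrt (fact (k j)) * F j (\<gamma> - x ` {..<k j}) * \<omega> j x is vs) else (\<lambda>_ _. 0))"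
    unfolding bchoice_iff by (metis lessThan_iff)
  have "V \<gamma> (map x is) vs = (\<Sum>j\<in>Jl J k l. a j * sqrt (fact l) * F j (\<gamma> - x ` {..<l}) * \<omega> j x is vs)"
    if \<gamma>: "\<gamma> \<in> Gamma" and l: "l \<in> {1..n}" and x: "x \<in> Inj l \<gamma>" and "is": "is \<in> tuples {..<l} n" "set is = {..<l}" and vs: "length vs = n"
    for \<gamma> l x "is" vs
  proof -
    have Gj: "G j \<gamma> (map x is) vs = (if k j = l then sqrt (fact l) * F j (\<gamma> - x ` {..<l}) * \<omega> j x is vs else 0)" if j: "j < J" for j
    proof (cases "is \<in> T_tuples TYPE('n) n l")
      case True
      then have "G j \<gamma> (map x is) vs = component n l (G j) \<gamma> x is vs" by (simp add: component_def)
      then show ?thesis using comp[OF j \<gamma> l, of x] x by (auto simp: Inj_def)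
    next
      case False
      have "G j \<in> forms M n" using G[OF j] by (simp add: DOmega_gen_def)
      from forms_alternating[OF this \<gamma> x "is" False vs] show ?thesis
        using Psi_T_space[OF _ x False, of "\<omega> j"] kF[OF j] by auto
    qed
    have "V \<gamma> (map x is) vs = (\<Sum>j<J. if k j = l then a j * sqrt (fact l) * F j (\<gamma> - x ` {..<l}) * \<omega> j x is vs else 0)"
      unfolding V using Gj by (intro sum.cong) auto
    also have "\<dots> = (\<Sum>j\<in>Jl J k l. a j * sqrt (fact l) * F j (\<gamma> - x ` {..<l}) * \<omega> j x is vs)"
      by (rule sum.mono_neutral_cong_right) (auto simp: Jl_def)
    finally show ?thesis .
  qed
  then have "drep n V J k a F \<omega>" unfolding drep_def using kF by blast
  then show ?thesis by (rule that)
qed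

lemma drepD:
  assumes "drep n V J k a F \<omega>" "j \<in> Jl J k l"
  shows "l \<in> {1..n}" "F j \<in> cylinder_fun M" "\<omega> j \<in> Psi_sym M n l"
  using assms by (auto simp: drep_def Jl_def)

lemma drep_eq:
  assumes "drep n V J k a F \<omega>" "\<gamma> \<in> Gamma" "l \<in> {1..n}" "x \<in> Inj l \<gamma>" "is \<in> tuples {..<l} n" "set is = {..<l}" "length vs = n"
  shows "V \<gamma> (map x is) vs = (\<Sum>j\<in>Jl J k l. a j * sqrt (fact l) * F j (\<gamma> - x ` {..<l}) * \<omega> j x is vs)"
  using assms unfolding drep_def by blast

text \<open>The condition under which adding the points of x to \<gamma> can be undone and the
  values of \<open>In_map\<close> are meaningful. It holds almost everywhere for
  \<open>mu_k\<close>, by \<open>AE_separated\<close>.\<close>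

definition separated :: "nat \<Rightarrow> 'a set \<Rightarrow> (nat \<Rightarrow> 'a) \<Rightarrow> bool" where
  "separated l \<gamma> x \<longleftrightarrow> x \<in> PiE {..<l} (\<lambda>_. UNIV) \<and> inj_on x {..<l} \<and> \<gamma> \<inter> x ` {..<l} = {}"

lemma separated_Inj: "separated l \<gamma> x \<Longrightarrow> x \<in> Inj l (\<gamma> \<union> x ` {..<l})"
  and separated_Diff: "separated l \<gamma> x \<Longrightarrow> \<gamma> \<union> x ` {..<l} - x ` {..<l} = \<gamma>"
  and separated_PiE: "separated l \<gamma> x \<Longrightarrow> x \<in> PiE {..<l} (\<lambda>_. UNIV)"
  by (auto simp: separated_def Inj_def PiE_def)

lemma Inj_separated: "x \<in> Inj l \<gamma> \<Longrightarrow> separated l (\<gamma> - x ` {..<l}) x"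
  by (auto simp: separated_def Inj_def PiE_def)

text \<open>The factor \<open>sqrt (fact l)\<close> of the test form cancels against the
  normalisation of the unitary, and separation gives back \<gamma> when the points of x are removed
  from the union.\<close>

lemma In_map_eq:
  assumes V: "drep n V J k a F \<omega>" and \<gamma>: "\<gamma> \<in> Gamma" and l: "l \<in> {1..n}" and x: "separated l \<gamma> x" and vs: "length vs = n"
  shows "In_map n V l \<gamma> x is vs = (\<Sum>j\<in>Jl J k l. a j * F j \<gamma> * \<omega> j x is vs)"
proof (cases "is \<in> T_tuples TYPE('n) n l")
  case True
  then have "is": "is \<in> tuples {..<l} n" "set is = {..<l}"
    by (auto simp: T_tuples_def tuples_def Suc_le_eq neq0_conv[symmetric] count_list_0_iff)
  have "\<gamma> \<union> x ` {..<l} \<in> Gamma" using \<gamma> by (intro Gamma_union_finite) auto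
  from drep_eq[OF V this l separated_Inj[OF x] "is" vs]
  have "V (\<gamma> \<union> x ` {..<l}) (map x is) vs = sqrt (fact l) * (\<Sum>j\<in>Jl J k l. a j * F j \<gamma> * \<omega> j x is vs)"
    by (simp add: separated_Diff[OF x] sum_distrib_left mult_ac)
  then show ?thesis using True by (simp add: In_map_def component_def)
next
  case False
  then show ?thesis using Psi_T_space[OF drepD(3)[OF V] separated_Inj[OF x] False]
    by (simp add: In_map_def component_def)
qed

section \<open>Derivatives of test forms\<close>

lemma frechet_sum:
  fixes f :: "'j \<Rightarrow> 'p::real_normed_vector \<Rightarrow> real"
  assumes U: "open U" "p0 \<in> U" and eq: "\<And>p. p \<in> U \<Longrightarrow> g p = (\<Sum>j\<in>I. c j * f j p)"
    and d: "\<And>j. j \<in> I \<Longrightarrow> f j differentiable (at p0)"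
  shows "frechet_derivative g (at p0) u = (\<Sum>j\<in>I. c j * frechet_derivative (f j) (at p0) u)"
proof -
  have "((\<lambda>p. \<Sum>j\<in>I. c j * f j p) has_derivative (\<lambda>u. \<Sum>j\<in>I. c j * frechet_derivative (f j) (at p0) u)) (at p0)"
    using d by (intro has_derivative_sum has_derivative_mult_right) (simp add: frechet_derivative_works)
  then have "(g has_derivative (\<lambda>u. \<Sum>j\<in>I. c j * frechet_derivative (f j) (at p0) u)) (at p0)"
    by (rule has_derivative_transform_within_open[OF _ U]) (simp add: eq)
  from fun_cong[OF frechet_derivative_at[OF this], of u] show ?thesis by simp
qed

lemma grad_conf_eq:
  assumes V: "drep n V J k a F \<omega>" and \<gamma>: "\<gamma> \<in> Gamma" and l: "l \<in> {1..n}" and x: "separated l \<gamma> x"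
    and z: "z \<in> \<gamma>" and vs: "length vs = n"
  shows "grad_conf M (In_map n V l) \<gamma> x z u is vs = (\<Sum>j\<in>Jl J k l. a j * dG (F j) \<gamma> z u * \<omega> j x is vs)"
proof -
  let ?c = "chart_at M z"
  \<comment> \<open>The moving point has to avoid the tuple as well as the configuration, so that
    the pair stays separated along the motion and \<open>In_map_eq\<close> applies.\<close>
  have "\<gamma> \<union> x ` {..<l} \<in> Gamma" using \<gamma> by (intro Gamma_union_finite) auto
  then obtain U where U: "open U" "snd ?c z \<in> U" "U \<subseteq> chart_ran ?c" "\<And>p. p \<in> U \<Longrightarrow> chart_inv ?c p \<notin> \<gamma> \<union> x ` {..<l} - {z}"
    using moving_nhd[of _ z] by blast
  have zx: "z \<notin> x ` {..<l}" using z x by (auto simp: separated_def)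
  have "In_map n V l (insert (chart_inv ?c p) (\<gamma> - {z})) x is vs = (\<Sum>j\<in>Jl J k l. (a j * \<omega> j x is vs) * F j (insert (chart_inv ?c p) (\<gamma> - {z})))"
    if "p \<in> U" for p
  proof -
    have "insert (chart_inv ?c p) (\<gamma> - {z}) \<in> Gamma" using \<gamma> Gamma_subset[of \<gamma> "\<gamma> - {z}"] by (intro Gamma_insert) auto
    moreover have "separated l (insert (chart_inv ?c p) (\<gamma> - {z})) x" using x U(4)[OF that] zx unfolding separated_def by auto
    ultimately show ?thesis using In_map_eq[OF V _ l _ vs] by (simp add: mult_ac)
  qed
  from frechet_sum[where f="\<lambda>j p. F j (insert (chart_inv ?c p) (\<gamma> - {z}))", OF U(1,2) this]
  have "grad_conf M (In_map n V l) \<gamma> x z u is vs = (\<Sum>j\<in>Jl J k l. (a j * \<omega> j x is vs) * dG (F j) \<gamma> z u)"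
    unfolding grad_conf_def dG_def using cylinder_differentiable[OF drepD(2)[OF V] \<gamma> z] by simp
  then show ?thesis by (simp add: mult_ac)
qed

text \<open>Compares a tensor labelled by points of a configuration with tensors labelled by
  positions in a tuple. The labels affect a covariant derivative only through the question which
  slots move, so agreement on that is the sole requirement on them.\<close>

lemma cov_deriv_sum:
  assumes U: "open U" "snd (chart_at M y) y \<in> U"
    and eq: "\<And>p ws. p \<in> U \<Longrightarrow> length ws = length vs \<Longrightarrow> T (chart_inv (chart_at M y) p) xs ws = (\<Sum>j\<in>I. c j * T' j (chart_inv (chart_at M y) p) is ws)"
    and d: "\<And>j. j \<in> I \<Longrightarrow> cov_rep M y i (T' j) is vs differentiable (at (snd (chart_at M y) y))"
    and lab: "length xs = length is" "length vs = length is" "\<And>j. j < length is \<Longrightarrow> xs ! j = i' \<longleftrightarrow> is ! j = i"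
  shows "cov_deriv M y i' T u xs vs = (\<Sum>j\<in>I. c j * cov_deriv M y i (T' j) u is vs)"
proof -
  let ?c = "chart_at M y"
  have tsl: "tsl ?c z i' xs vs = tsl ?c z i is vs" for z
    by (rule nth_equalityI) (use lab in \<open>auto simp: nth_tsl\<close>)
  have eqc: "cov_rep M y i' T xs vs p = (\<Sum>j\<in>I. c j * cov_rep M y i (T' j) is vs p)" if "p \<in> U" for p
    unfolding cov_rep_eq tsl using eq[OF that, of "tsl ?c (chart_inv ?c p) i is vs"] lab by simp
  have D: "frechet_derivative (cov_rep M y i' T xs vs) (at (snd ?c y)) u
    = (\<Sum>j\<in>I. c j * frechet_derivative (cov_rep M y i (T' j) is vs) (at (snd ?c y)) u)"
    by (rule frechet_sum[OF U eqc d])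
  have y: "chart_inv ?c (snd ?c y) = y" by (simp add: chart_inv_left)
  have "(\<Sum>m<length xs. if xs ! m = i' then T y xs (vs[m := christoffel M y u (vs ! m)]) else 0)
    = (\<Sum>m<length is. \<Sum>j\<in>I. c j * (if is ! m = i then T' j y is (vs[m := christoffel M y u (vs ! m)]) else 0))"
    using lab eq[OF U(2), unfolded y] by (intro sum.cong) auto
  also have "\<dots> = (\<Sum>j\<in>I. c j * (\<Sum>m<length is. if is ! m = i then T' j y is (vs[m := christoffel M y u (vs ! m)]) else 0))"
    by (subst sum.swap) (simp add: sum_distrib_left)
  finally show ?thesis
    unfolding cov_deriv_def D by (simp add: right_diff_distrib sum_subtractf)
qed

lemma grad_Xk_eq:
  assumes V: "drep n V J k a F \<omega>" and \<gamma>: "\<gamma> \<in> Gamma" and l: "l \<in> {1..n}" and x: "separated l \<gamma> x"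
    and i: "i < l" and "is": "is \<in> tuples {..<l} n" and vs: "length vs = n"
  shows "grad_Xk M (In_map n V l \<gamma>) x i u is vs = (\<Sum>j\<in>Jl J k l. a j * F j \<gamma> * grad_Xk M (\<omega> j) x i u is vs)"
proof -
  let ?c = "chart_at M (x i)"
  have "\<gamma> \<union> x ` {..<l} \<in> Gamma" using \<gamma> by (intro Gamma_union_finite) auto
  then obtain U where U: "open U" "snd ?c (x i) \<in> U" "U \<subseteq> chart_ran ?c" "\<And>p. p \<in> U \<Longrightarrow> chart_inv ?c p \<notin> \<gamma> \<union> x ` {..<l} - {x i}"
    using moving_nhd[of _ "x i"] by blast
  have dj: "separated l \<gamma> (x(i := chart_inv ?c p))" if "p \<in> U" for p
  proof -
    have y: "chart_inv ?c p \<notin> \<gamma>" "\<And>m. m < l \<Longrightarrow> m \<noteq> i \<Longrightarrow> chart_inv ?c p \<noteq> x m"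
      using U(4)[OF that] x i by (auto simp: separated_def inj_on_def)
    show ?thesis using x i y unfolding separated_def
      by (auto simp: PiE_def extensional_def inj_on_def) metis+
  qed
  have xP: "x \<in> PiE {..<l} (\<lambda>_. UNIV)" by (rule separated_PiE[OF x])
  show ?thesis unfolding grad_Xk_def
  proof (rule cov_deriv_sum[OF U(1,2)])
    show "In_map n V l \<gamma> (x(i := chart_inv ?c p)) is ws = (\<Sum>j\<in>Jl J k l. a j * F j \<gamma> * \<omega> j (x(i := chart_inv ?c p)) is ws)"
      if "p \<in> U" "length ws = length vs" for p ws
      using In_map_eq[OF V \<gamma> l dj[OF that(1)]] that(2) vs by simp
    show "cov_rep M (x i) i (\<lambda>y. \<omega> j (x(i := y))) is vs differentiable at (snd ?c (x i))" if "j \<in> Jl J k l" for j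
      by (rule form_cov_rep_differentiable[OF Psi_smooth[OF drepD(3)[OF V that]] xP i "is" vs])
  qed (use "is" vs in \<open>auto simp: tuples_def\<close>)
qed

text \<open>No slot is attached to z, so neither transport nor Christoffel terms occur, and the form
  on the power is evaluated at the unmoved x. What remains is the derivative of the cylinder
  function.\<close>

lemma grad_Gamma_conf:
  assumes V: "drep n V J k a F \<omega>" and \<gamma>: "\<gamma> \<in> Gamma" and l: "l \<in> {1..n}" and x: "x \<in> Inj l \<gamma>"
    and z: "z \<in> \<gamma> - x ` {..<l}" and "is": "is \<in> tuples {..<l} n" "set is = {..<l}" and vs: "length vs = n"
  shows "grad_Gamma M V \<gamma> (z # map x is) (u # vs) =
    sqrt (fact l) * (\<Sum>j\<in>Jl J k l. a j * dG (F j) (\<gamma> - x ` {..<l}) z u * \<omega> j x is vs)"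
proof -
  let ?c = "chart_at M z" and ?\<gamma> = "\<gamma> - x ` {..<l}"
  have len: "length is = n" using "is" by (simp add: tuples_def)
  have zx: "z \<noteq> x m" if "m < l" for m using z that by auto
  have lab: "x (is ! j) \<noteq> z" if "j < length is" for j
    using zx[of "is ! j"] nth_mem[OF that] "is"(2) by auto
  obtain U where U: "open U" "snd ?c z \<in> U" "U \<subseteq> chart_ran ?c" "\<And>p. p \<in> U \<Longrightarrow> chart_inv ?c p \<notin> \<gamma> - {z}"
    using moving_nhd[OF \<gamma>, of z] by blast
  have "grad_Gamma M V \<gamma> (z # map x is) (u # vs) = cov_deriv M z z (move V \<gamma> z) u (map x is) vs"
    using z by (simp add: grad_Gamma_def)
  also have "\<dots> = frechet_derivative (cov_rep M z z (move V \<gamma> z) (map x is) vs) (at (snd ?c z)) u"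
  proof -
    show ?thesis unfolding cov_deriv_def using lab by simp
  qed
  also have "\<dots> = (\<Sum>j\<in>Jl J k l. (a j * sqrt (fact l) * \<omega> j x is vs) * frechet_derivative (\<lambda>p. F j (insert (chart_inv ?c p) (?\<gamma> - {z}))) (at (snd ?c z)) u)"
  proof (rule frechet_sum[OF U(1,2)])
    show "(\<lambda>p. F j (insert (chart_inv ?c p) (?\<gamma> - {z}))) differentiable at (snd ?c z)" if "j \<in> Jl J k l" for j
      using cylinder_differentiable[OF drepD(2)[OF V that], of ?\<gamma> z] Gamma_subset[OF \<gamma>, of ?\<gamma>] z by auto
    fix p assume p: "p \<in> U"
    let ?y = "chart_inv ?c p"
    have "tsl ?c ?y z (map x is) vs = vs"
      by (rule nth_equalityI) (use lab len vs in \<open>auto simp: nth_tsl\<close>)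
    moreover have "map (\<lambda>w. if w = z then ?y else w) (map x is) = map x is"
      by (rule map_idI) (use zx "is"(2) in auto)
    ultimately have "cov_rep M z z (move V \<gamma> z) (map x is) vs p = V (insert ?y (\<gamma> - {z})) (map x is) vs"
      unfolding cov_rep_eq move_def by (simp only:)
    also have "\<dots> = (\<Sum>j\<in>Jl J k l. a j * sqrt (fact l) * F j (insert ?y (\<gamma> - {z}) - x ` {..<l}) * \<omega> j x is vs)"
    proof (rule drep_eq[OF V _ l _ "is" vs])
      show "insert ?y (\<gamma> - {z}) \<in> Gamma" using Gamma_subset[OF \<gamma>, of "\<gamma> - {z}"] by (intro Gamma_insert) auto
      show "x \<in> Inj l (insert ?y (\<gamma> - {z}))" using x z by (auto simp: Inj_def PiE_def Pi_def)
    qed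
    also have "insert ?y (\<gamma> - {z}) - x ` {..<l} = insert ?y (?\<gamma> - {z})"
      using U(4)[OF p] x z by (auto simp: Inj_def)
    finally show "cov_rep M z z (move V \<gamma> z) (map x is) vs p =
      (\<Sum>j\<in>Jl J k l. (a j * sqrt (fact l) * \<omega> j x is vs) * F j (insert ?y (?\<gamma> - {z})))"
      by (simp add: mult_ac)
  qed
  finally show ?thesis unfolding dG_def by (simp add: sum_distrib_left mult_ac)
qed

text \<open>The moved point belongs to the tuple and is removed together with it before the cylinder
  function is evaluated. The latter is therefore constant along the motion, and only the form on the
  power is differentiated covariantly.\<close>

lemma grad_Gamma_Xk:
  assumes V: "drep n V J k a F \<omega>" and \<gamma>: "\<gamma> \<in> Gamma" and l: "l \<in> {1..n}" and x: "x \<in> Inj l \<gamma>"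
    and i: "i < l" and "is": "is \<in> tuples {..<l} n" "set is = {..<l}" and vs: "length vs = n"
  shows "grad_Gamma M V \<gamma> (x i # map x is) (u # vs) =
    sqrt (fact l) * (\<Sum>j\<in>Jl J k l. a j * F j (\<gamma> - x ` {..<l}) * grad_Xk M (\<omega> j) x i u is vs)"
proof -
  let ?c = "chart_at M (x i)" and ?\<gamma> = "\<gamma> - x ` {..<l}"
  have len: "length is = n" using "is" by (simp add: tuples_def)
  have inj: "inj_on x {..<l}" and xP: "x \<in> PiE {..<l} (\<lambda>_. UNIV)" and x\<gamma>: "x ` {..<l} \<subseteq> \<gamma>"
    using x by (auto simp: Inj_def PiE_def)
  have iff: "x m = x i \<longleftrightarrow> m = i" if "m < l" for m using inj i that by (auto simp: inj_on_def)
  obtain U where U: "open U" "snd ?c (x i) \<in> U" "U \<subseteq> chart_ran ?c" "\<And>p. p \<in> U \<Longrightarrow> chart_inv ?c p \<notin> \<gamma> - {x i}"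
    using moving_nhd[OF \<gamma>, of "x i"] by blast
  have nth: "is ! j < l" if "j < length is" for j using nth_mem[OF that] "is"(2) by auto
  have "grad_Gamma M V \<gamma> (x i # map x is) (u # vs) = cov_deriv M (x i) (x i) (move V \<gamma> (x i)) u (map x is) vs"
    using x\<gamma> i by (auto simp: grad_Gamma_def)
  also have "\<dots> = (\<Sum>j\<in>Jl J k l. (a j * sqrt (fact l) * F j ?\<gamma>) * cov_deriv M (x i) i (\<lambda>y. \<omega> j (x(i := y))) u is vs)"
  proof (rule cov_deriv_sum[OF U(1,2)])
    show "cov_rep M (x i) i (\<lambda>y. \<omega> j (x(i := y))) is vs differentiable at (snd ?c (x i))" if "j \<in> Jl J k l" for j
      by (rule form_cov_rep_differentiable[OF Psi_smooth[OF drepD(3)[OF V that]] xP i "is"(1) vs])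
    fix p and ws :: "(real ^ 'n) list" assume p: "p \<in> U" and ws: "length ws = length vs"
    let ?y = "chart_inv ?c p" and ?x = "x(i := chart_inv ?c p)"
    have yx: "?y \<noteq> x m" if "m < l" "m \<noteq> i" for m
      using U(4)[OF p] x\<gamma> iff[OF that(1)] that by auto
    have "map (\<lambda>w. if w = x i then ?y else w) (map x is) = map ?x is"
      using "is"(2) iff by (auto simp: map_eq_conv)
    then have "move V \<gamma> (x i) ?y (map x is) ws = V (insert ?y (\<gamma> - {x i})) (map ?x is) ws"
      unfolding move_def by (simp only:)
    also have "\<dots> = (\<Sum>j\<in>Jl J k l. a j * sqrt (fact l) * F j (insert ?y (\<gamma> - {x i}) - ?x ` {..<l}) * \<omega> j ?x is ws)"
    proof (rule drep_eq[OF V _ l _ "is"])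
      show "insert ?y (\<gamma> - {x i}) \<in> Gamma" using Gamma_subset[OF \<gamma>, of "\<gamma> - {x i}"] by (intro Gamma_insert) auto
      have "?x m \<in> insert ?y (\<gamma> - {x i})" if "m < l" for m using x\<gamma> iff[OF that] that by auto
      moreover have "inj_on ?x {..<l}"
      proof (rule inj_onI)
        fix m m' assume "m \<in> {..<l}" "m' \<in> {..<l}" "?x m = ?x m'"
        then show "m = m'" using yx[of m] yx[of m'] inj by (auto simp: inj_on_def split: if_splits)
      qed
      ultimately show "?x \<in> Inj l (insert ?y (\<gamma> - {x i}))" using xP i by (auto simp: Inj_def PiE_def Pi_def extensional_def)
    qed (use ws vs in simp)
    \<comment> \<open>The new position y enters both the configuration and the tuple; taking out the
      moved tuple leaves the same points as before the motion.\<close>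
    also have "insert ?y (\<gamma> - {x i}) - ?x ` {..<l} = ?\<gamma>"
    proof -
      have "?x ` {..<l} = insert ?y (x ` {..<l} - {x i})" using i iff by (auto simp: image_iff)
      then show ?thesis using U(4)[OF p] i by auto
    qed
    finally show "move V \<gamma> (x i) ?y (map x is) ws = (\<Sum>j\<in>Jl J k l. a j * sqrt (fact l) * F j ?\<gamma> * \<omega> j ?x is ws)" .
  qed (use len vs iff nth in auto)
  finally show ?thesis by (simp add: grad_Xk_def sum_distrib_left mult_ac)
qed

end

section \<open>Decomposition of the energy density\<close>

definition onto_tuples :: "nat \<Rightarrow> nat \<Rightarrow> nat list set" where
  "onto_tuples l n = {is \<in> tuples {..<l} n. set is = {..<l}}"

lemma finite_onto_tuples[simp]: "finite (onto_tuples l n)" by (simp add: onto_tuples_def)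

lemma finite_Inj: "finite S \<Longrightarrow> finite (Inj l S)"
  unfolding Inj_def using finite_PiE[of "{..<l}" "\<lambda>_. S"] by (auto intro: finite_subset[rotated])

lemma card_Inj: "finite T \<Longrightarrow> card (Inj (card T) T) = fact (card T)"
  unfolding Inj_def using card_inj_on_subset_funcset[of "{..<card T}" T "{..<card T}"]
  by (simp add: fact_prod_rev)

text \<open>A list with exactly l distinct entries is represented by l! pairs: x may be any
  enumeration of its entries, and the pattern is then determined. Hence the division by
  \<open>fact l\<close>.\<close>

lemma sum_tuples_decomposition:
  fixes f :: "'b list \<Rightarrow> real"
  assumes S: "finite S"
  shows "(\<Sum>xs\<in>tuples S n. f xs) = (\<Sum>l\<le>n. (\<Sum>x\<in>Inj l S. \<Sum>is\<in>onto_tuples l n. f (map x is)) / fact l)"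
proof -
  have fin: "finite (tuples S n)" using S by simp
  define A where "A l = {xs \<in> tuples S n. card (set xs) = l}" for l
  have "(\<Sum>x\<in>Inj l S. \<Sum>is\<in>onto_tuples l n. f (map x is)) = fact l * (\<Sum>xs\<in>A l. f xs)" for l
  proof -
    let ?P = "Inj l S \<times> onto_tuples l n" and ?m = "\<lambda>p. map (fst p) (snd p)"
    have P: "finite ?P" using S by (simp add: finite_Inj)
    have im: "?m ` ?P \<subseteq> A l"
    proof safe
      fix x "is" assume "x \<in> Inj l S" "is \<in> onto_tuples l n"
      then show "map (fst (x, is)) (snd (x, is)) \<in> A l"
        by (auto simp: A_def onto_tuples_def tuples_def Inj_def card_image)
    qed
    have fib: "card {p \<in> ?P. ?m p = xs} = fact l" if xs: "xs \<in> A l" for xs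
    proof -
      have T: "finite (set xs)" "card (set xs) = l" "set xs \<subseteq> S" "length xs = n" using xs by (auto simp: A_def tuples_def)
      have injP: "inj_on fst {p \<in> ?P. ?m p = xs}"
      proof (rule inj_onI)
        fix p q assume p: "p \<in> {p \<in> ?P. ?m p = xs}" and q: "q \<in> {p \<in> ?P. ?m p = xs}" and e: "fst p = fst q"
        have "map (fst p) (snd p) = xs" "map (fst q) (snd q) = xs" using p q by simp_all
        then have m: "map (fst p) (snd p) = map (fst p) (snd q)" using e by simp
        have "fst p \<in> Inj l S" "snd p \<in> onto_tuples l n" "snd q \<in> onto_tuples l n" using p q by (auto simp: mem_Times_iff)
        then have "inj_on (fst p) (set (snd p) \<union> set (snd q))" by (simp add: Inj_def onto_tuples_def)
        then have "snd p = snd q" using m by (rule inj_on_map_eq_map[THEN iffD1])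
        then show "p = q" using e by (simp add: prod_eq_iff)
      qed
      have imP: "fst ` {p \<in> ?P. ?m p = xs} = Inj l (set xs)"
      proof safe
        fix x "is" assume "x \<in> Inj l S" "is \<in> onto_tuples l n" "xs = map (fst (x, is)) (snd (x, is))"
        then show "fst (x, is) \<in> Inj l (set (map (fst (x, is)) (snd (x, is))))"
          by (auto simp: Inj_def onto_tuples_def PiE_def Pi_def)
      next
        fix x assume x: "x \<in> Inj l (set xs)"
        then have inj: "inj_on x {..<l}" and sub: "x ` {..<l} \<subseteq> set xs" by (auto simp: Inj_def)
        have im: "x ` {..<l} = set xs" using card_subset_eq[OF T(1) sub] T(2) inj by (simp add: card_image)
        let ?g = "inv_into {..<l} x"
        have "set (map ?g xs) = {..<l}" using bij_betw_inv_into[of x "{..<l}" "set xs"] inj im by (simp add: bij_betw_def)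
        then have "map ?g xs \<in> onto_tuples l n" using T(4) by (simp add: onto_tuples_def tuples_def)
        moreover have "map x (map ?g xs) = xs" using im by (simp add: map_idI f_inv_into_f)
        moreover have "x \<in> Inj l S" using x T(3) by (auto simp: Inj_def PiE_def Pi_def)
        ultimately show "x \<in> fst ` {p \<in> ?P. ?m p = xs}" by (intro image_eqI[of _ _ "(x, map ?g xs)"]) auto
      qed
      have "card {p \<in> ?P. ?m p = xs} = card (Inj l (set xs))" using card_image[OF injP] unfolding imP by (rule sym)
      then show ?thesis using card_Inj[OF T(1)] T(2) by simp
    qed
    have "(\<Sum>x\<in>Inj l S. \<Sum>is\<in>onto_tuples l n. f (map x is)) = (\<Sum>p\<in>?P. f (?m p))"
      by (simp add: sum.cartesian_product case_prod_beta)
    also have "\<dots> = (\<Sum>xs\<in>A l. \<Sum>p\<in>{p \<in> ?P. ?m p = xs}. f (?m p))"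
      by (rule sum.group[symmetric, OF P _ im]) (use fin in \<open>simp add: A_def\<close>)
    also have "\<dots> = (\<Sum>xs\<in>A l. fact l * f xs)"
      using fib by (intro sum.cong refl) simp
    finally show ?thesis by (simp add: sum_distrib_left)
  qed
  then have "(\<Sum>l\<le>n. (\<Sum>x\<in>Inj l S. \<Sum>is\<in>onto_tuples l n. f (map x is)) / fact l) = (\<Sum>l\<le>n. \<Sum>xs\<in>A l. f xs)" by simp
  also have "\<dots> = (\<Sum>xs\<in>tuples S n. f xs)"
    unfolding A_def by (rule sum.group[OF fin]) (auto simp: tuples_def intro: order_trans[OF card_length])
  finally show ?thesis by simp
qed

context riem_mfd begin

text \<open>The two families of points may be indexed differently as long as they give the same
  points slot by slot; this allows components over \<gamma> to be contracted as components over a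
  tuple x.\<close>

lemma comp_inner_bilin:
  assumes A: "\<And>vs. length vs = length is \<Longrightarrow> A is vs = (\<Sum>j\<in>I. c j * A' j is' vs)"
    and B: "\<And>vs. length vs = length is \<Longrightarrow> B is vs = (\<Sum>j\<in>I'. c' j * B' j is' vs)"
    and "is": "map x is = map x' is'"
  shows "comp_inner M x A B is = (\<Sum>j\<in>I. \<Sum>j'\<in>I'. c j * c' j' * comp_inner M x' (A' j) (B' j') is')"
proof -
  have eq: "map (\<lambda>i. onb M (x i)) is = map (\<lambda>i. onb M (x' i)) is'"
    using arg_cong[OF "is", of "map (onb M)"] by (simp add: o_def)
  let ?L = "listset (map (\<lambda>i. onb M (x i)) is)"
  have "comp_inner M x A B is = (\<Sum>vs\<in>?L. \<Sum>j\<in>I. \<Sum>j'\<in>I'. (c j * A' j is' vs) * (c' j' * B' j' is' vs))"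
    unfolding comp_inner_def
  proof (intro sum.cong refl)
    fix vs assume "vs \<in> ?L"
    then have "length vs = length is" using listset_length by fastforce
    then show "A is vs * B is vs = (\<Sum>j\<in>I. \<Sum>j'\<in>I'. (c j * A' j is' vs) * (c' j' * B' j' is' vs))"
      by (simp only: A B sum_product)
  qed
  also have "\<dots> = (\<Sum>j\<in>I. \<Sum>j'\<in>I'. \<Sum>vs\<in>?L. (c j * A' j is' vs) * (c' j' * B' j' is' vs))"
    by (subst sum.swap, intro sum.cong refl, subst sum.swap) simp
  also have "\<dots> = (\<Sum>j\<in>I. \<Sum>j'\<in>I'. c j * c' j' * comp_inner M x' (A' j) (B' j') is')"
    unfolding comp_inner_def eq by (intro sum.cong refl) (simp add: sum_distrib_left mult_ac)
  finally show ?thesis .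
qed

lemma tinner_bilin:
  fixes l :: nat
  assumes A: "\<And>is vs. is \<in> tuples {..<l} n \<Longrightarrow> length vs = n \<Longrightarrow> A is vs = (\<Sum>j\<in>I. c j * A' j is vs)"
    and B: "\<And>is vs. is \<in> tuples {..<l} n \<Longrightarrow> length vs = n \<Longrightarrow> B is vs = (\<Sum>j\<in>I'. c' j * B' j is vs)"
  shows "tinner M x {..<l} n A B = (\<Sum>j\<in>I. \<Sum>j'\<in>I'. c j * c' j' * tinner M x {..<l} n (A' j) (B' j'))"
proof -
  have "tinner M x {..<l} n A B = (\<Sum>is\<in>tuples {..<l} n. \<Sum>j\<in>I. \<Sum>j'\<in>I'. c j * c' j' * comp_inner M x (A' j) (B' j') is)"
    unfolding tinner_finite[OF finite_lessThan]
    by (intro sum.cong refl comp_inner_bilin A B) (auto simp: tuples_def)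
  also have "\<dots> = (\<Sum>j\<in>I. \<Sum>j'\<in>I'. c j * c' j' * tinner M x {..<l} n (A' j) (B' j'))"
    unfolding tinner_finite[OF finite_lessThan] sum_distrib_left
    by (subst sum.swap, intro sum.cong refl, subst sum.swap) simp
  finally show ?thesis .
qed

text \<open>At an injective tuple the form vanishes on the excluded patterns not only at x but at
  all nearby tuples, which are again injective; so its derivative vanishes there too.\<close>

lemma grad_Xk_T:
  assumes \<omega>: "\<omega> \<in> Psi_sym M n l" and x: "x \<in> Inj l \<gamma>" and i: "i < l"
    and nT: "is \<notin> T_tuples TYPE('n) n l" and vs: "length vs = length is"
  shows "grad_Xk M \<omega> x i u is vs = 0"
proof -
  let ?c = "chart_at M (x i)"
  have inj: "inj_on x {..<l}" and xP: "x \<in> PiE {..<l} (\<lambda>_. UNIV)" using x by (auto simp: Inj_def PiE_def)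
  have "{} \<union> x ` {..<l} \<in> Gamma" by (rule Gamma_union_finite) (auto simp: Gamma_def)
  then obtain U where U: "open U" "snd ?c (x i) \<in> U" "U \<subseteq> chart_ran ?c" "\<And>p. p \<in> U \<Longrightarrow> chart_inv ?c p \<notin> {} \<union> x ` {..<l} - {x i}"
    using moving_nhd[of _ "x i"] by blast
  \<comment> \<open>The empty index set turns \<open>cov_deriv_sum\<close> into the statement that a
    section vanishing near the point has zero covariant derivative.\<close>
  have "grad_Xk M \<omega> x i u is vs = (\<Sum>j\<in>({} :: nat set). 0 * cov_deriv M (x i) i (\<lambda>_ _ _. 0) u is vs)"
    unfolding grad_Xk_def
  proof (rule cov_deriv_sum[OF U(1,2)])
    fix p and ws :: "(real ^ 'n) list" assume p: "p \<in> U"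
    let ?x = "x(i := chart_inv ?c p)"
    have yx: "chart_inv ?c p \<noteq> x m" if "m < l" "m \<noteq> i" for m
      using U(4)[OF p] that inj i by (auto simp: inj_on_def)
    have "inj_on ?x {..<l}"
    proof (rule inj_onI)
      fix m m' assume "m \<in> {..<l}" "m' \<in> {..<l}" "?x m = ?x m'"
      then show "m = m'" using yx[of m] yx[of m'] inj by (auto simp: inj_on_def split: if_splits)
    qed
    then have "?x \<in> Inj l UNIV" using xP i by (auto simp: Inj_def PiE_def extensional_def)
    from Psi_T_space[OF \<omega> this nT]
    show "\<omega> ?x is ws = (\<Sum>j\<in>({} :: nat set). 0 * (0 :: real))" by simp
  qed (use vs in auto)
  then show ?thesis by simp
qed

text \<open>A pattern that misses an index is outside \<open>T_tuples\<close> since it counts that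
  index zero times; such terms may therefore be added freely to complete the inner product over all
  patterns.\<close>

lemma sum_onto_tuples_eq:
  assumes "\<And>is. is \<in> tuples {..<l} n \<Longrightarrow> is \<notin> T_tuples TYPE('n) n l \<Longrightarrow> f is = 0"
  shows "(\<Sum>is\<in>onto_tuples l n. f is) = (\<Sum>is\<in>tuples {..<l} n. f is :: real)"
proof (rule sum.mono_neutral_left)
  show "\<forall>is\<in>tuples {..<l} n - onto_tuples l n. f is = 0"
  proof
    fix "is" assume a: "is \<in> tuples {..<l} n - onto_tuples l n"
    then obtain i where "i < l" "i \<notin> set is" by (auto simp: onto_tuples_def tuples_def)
    then have "is \<notin> T_tuples TYPE('n) n l" by (auto simp: T_tuples_def Suc_le_eq count_list_0_iff[symmetric])
    then show "f is = 0" using a assms by blast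
  qed
qed (auto simp: onto_tuples_def)

context
  fixes n :: nat and V1 V2 :: "('a, 'n) Gform" and J1 J2 :: nat and k1 k2 :: "nat \<Rightarrow> nat" and a1 a2 :: "nat \<Rightarrow> real"
    and F1 F2 :: "nat \<Rightarrow> 'a set \<Rightarrow> real" and \<omega>1 \<omega>2 :: "nat \<Rightarrow> (nat \<Rightarrow> 'a) \<Rightarrow> (nat, 'n) tensor"
  assumes n: "1 \<le> n" and V1: "drep n V1 J1 k1 a1 F1 \<omega>1" and V2: "drep n V2 J2 k2 a2 F2 \<omega>2"
begin

abbreviation "I1 l \<equiv> Jl J1 k1 l"
abbreviation "I2 l \<equiv> Jl J2 k2 l"

text \<open>An explicit version of the right-hand integrand, equal to it on separated pairs by
  \<open>inner_grads_eq\<close>. Its factors depend separately on \<gamma> and on x, which gives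
  measurability and growth bounds everywhere.\<close>

definition energy_density :: "nat \<Rightarrow> 'a set \<Rightarrow> (nat \<Rightarrow> 'a) \<Rightarrow> real" where
  "energy_density l \<gamma> x = (\<Sum>j\<in>I1 l. \<Sum>j'\<in>I2 l. a1 j * a2 j' * (cprod (F1 j) (F2 j') \<gamma> * iprod n l (\<omega>1 j) (\<omega>2 j') x
     + F1 j \<gamma> * F2 j' \<gamma> * gprod n l (\<omega>1 j) (\<omega>2 j') x))"

text \<open>A common compact set for the data of the first form. Every term of the density contains
  a factor from that form, so this also localises the mixed expressions.\<close>

definition supp_set :: "'a set \<Rightarrow> bool" where
  "supp_set K \<longleftrightarrow> compact K \<and>
    (\<forall>j<J1. (\<forall>\<gamma>\<in>Gamma. \<forall>z\<in>\<gamma> - K. \<forall>u. dG (F1 j) \<gamma> z u = 0) \<and>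
       (\<forall>x\<in>PiE {..<k1 j} (\<lambda>_. UNIV). \<forall>i<k1 j. x i \<notin> K \<longrightarrow> \<omega>1 j x = (\<lambda>_ _. 0)))"

lemma supp_set_exists: "\<exists>K. supp_set K"
proof -
  have "\<exists>K. compact K \<and> (\<forall>\<gamma>\<in>Gamma. \<forall>z\<in>\<gamma> - K. \<forall>u. dG (F1 j) \<gamma> z u = 0)" if "j < J1" for j
    using cylinder_support[of "F1 j"] V1 that by (simp add: drep_def)
  then have "\<forall>j\<in>{..<J1}. \<exists>K. compact K \<and> (\<forall>\<gamma>\<in>Gamma. \<forall>z\<in>\<gamma> - K. \<forall>u. dG (F1 j) \<gamma> z u = 0)" by simp
  from bchoice[OF this] have "\<exists>KF. \<forall>j\<in>{..<J1}. compact (KF j) \<and> (\<forall>\<gamma>\<in>Gamma. \<forall>z\<in>\<gamma> - KF j. \<forall>u. dG (F1 j) \<gamma> z u = 0)" .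
  then obtain KF where KF: "\<And>j. j < J1 \<Longrightarrow> compact (KF j)" "\<And>j \<gamma> z u. j < J1 \<Longrightarrow> \<gamma> \<in> Gamma \<Longrightarrow> z \<in> \<gamma> - KF j \<Longrightarrow> dG (F1 j) \<gamma> z u = 0"
    by blast
  have "\<exists>K. compact K \<and> (\<forall>x\<in>PiE {..<k1 j} (\<lambda>_. UNIV). \<forall>i<k1 j. x i \<notin> K \<longrightarrow> \<omega>1 j x = (\<lambda>_ _. 0))" if "j < J1" for j
  proof -
    have "\<omega>1 j \<in> Psi_sym M n (k1 j)" using V1 that by (simp add: drep_def)
    then obtain K where "compact K" "\<And>x i. x \<in> PiE {..<k1 j} (\<lambda>_. UNIV) \<Longrightarrow> i < k1 j \<Longrightarrow> x i \<notin> K \<Longrightarrow> \<omega>1 j x = (\<lambda>_ _. 0)"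
      by (rule Psi_support) (rule that)
    then show ?thesis by (intro exI[of _ K] conjI ballI allI impI)
  qed
  then have "\<forall>j\<in>{..<J1}. \<exists>K. compact K \<and> (\<forall>x\<in>PiE {..<k1 j} (\<lambda>_. UNIV). \<forall>i<k1 j. x i \<notin> K \<longrightarrow> \<omega>1 j x = (\<lambda>_ _. 0))" by simp
  from bchoice[OF this] have "\<exists>K\<omega>. \<forall>j\<in>{..<J1}. compact (K\<omega> j) \<and> (\<forall>x\<in>PiE {..<k1 j} (\<lambda>_. UNIV). \<forall>i<k1 j. x i \<notin> K\<omega> j \<longrightarrow> \<omega>1 j x = (\<lambda>_ _. 0))" .
  then obtain K\<omega> where K\<omega>: "\<And>j. j < J1 \<Longrightarrow> compact (K\<omega> j)"
    "\<And>j x i. j < J1 \<Longrightarrow> x \<in> PiE {..<k1 j} (\<lambda>_. UNIV) \<Longrightarrow> i < k1 j \<Longrightarrow> x i \<notin> K\<omega> j \<Longrightarrow> \<omega>1 j x = (\<lambda>_ _. 0)"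
    by blast
  have "supp_set (\<Union>j\<in>{..<J1}. KF j \<union> K\<omega> j)"
    unfolding supp_set_def
  proof (intro conjI allI impI ballI)
    show "compact (\<Union>j\<in>{..<J1}. KF j \<union> K\<omega> j)" using KF(1) K\<omega>(1) by (intro compact_UN compact_Un) auto
    show "dG (F1 j) \<gamma> z u = 0" if "j < J1" "\<gamma> \<in> Gamma" "z \<in> \<gamma> - (\<Union>j\<in>{..<J1}. KF j \<union> K\<omega> j)" for j \<gamma> z u
      using KF(2)[OF that(1,2)] that(1,3) by auto
    show "\<omega>1 j x = (\<lambda>_ _. 0)" if "j < J1" "x \<in> PiE {..<k1 j} (\<lambda>_. UNIV)" "i < k1 j" "x i \<notin> (\<Union>j\<in>{..<J1}. KF j \<union> K\<omega> j)" for j x i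
      using K\<omega>(2)[OF that(1,2,3)] that(1,4) by auto
  qed
  then show ?thesis by blast
qed

lemma supp_dG: "supp_set K \<Longrightarrow> j \<in> I1 l \<Longrightarrow> \<gamma> \<in> Gamma \<Longrightarrow> z \<in> \<gamma> \<Longrightarrow> z \<notin> K \<Longrightarrow> dG (F1 j) \<gamma> z u = 0"
  by (auto simp: supp_set_def Jl_def)

lemma supp_form: "supp_set K \<Longrightarrow> j \<in> I1 l \<Longrightarrow> x \<in> PiE {..<l} (\<lambda>_. UNIV) \<Longrightarrow> i < l \<Longrightarrow> x i \<notin> K \<Longrightarrow> \<omega>1 j x = (\<lambda>_ _. 0)"
  by (auto simp: supp_set_def Jl_def)

lemma supp_grad:
  assumes "supp_set K" "j \<in> I1 l" "x \<in> PiE {..<l} (\<lambda>_. UNIV)" "i < l" "x i \<notin> K" "i' < l"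
  shows "grad_Xk M (\<omega>1 j) x i' u is vs = 0"
  by (rule grad_Xk_eq_0[OF _ supp_form[OF assms(1,2)] assms(3-6)]) (use assms(1) in \<open>auto simp: supp_set_def\<close>)

lemma supp_iprod:
  assumes "supp_set K" "j \<in> I1 l" "x \<in> PiE {..<l} (\<lambda>_. UNIV)" "i < l" "x i \<notin> K"
  shows "iprod n l (\<omega>1 j) \<omega>' x = 0" "gprod n l (\<omega>1 j) \<omega>' x = 0"
  using supp_form[OF assms] supp_grad[OF assms]
  by (simp_all add: iprod_def gprod_def tinner_finite comp_inner_def)

lemma energy_density_eq_0:
  assumes "supp_set K" "x \<in> PiE {..<l} (\<lambda>_. UNIV)" "i < l" "x i \<notin> K"
  shows "energy_density l \<gamma> x = 0"
  unfolding energy_density_def using supp_iprod[OF assms(1) _ assms(2-4)] by (intro sum.neutral ballI) simp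

lemma cprod_sum:
  assumes K: "supp_set K" and j: "j \<in> I1 l" and \<gamma>: "\<gamma> \<in> Gamma"
  shows "cprod (F1 j) F' \<gamma> = (\<Sum>z\<in>\<gamma> \<inter> K. \<Sum>u\<in>onb M z. dG (F1 j) \<gamma> z u * dG F' \<gamma> z u)"
proof -
  have fin: "finite (\<gamma> \<inter> K)" using K Gamma_finite[OF \<gamma>] by (simp add: supp_set_def)
  have "cprod (F1 j) F' \<gamma> = (\<Sum>\<^sub>\<infinity>z\<in>\<gamma> \<inter> K. \<Sum>u\<in>onb M z. dG (F1 j) \<gamma> z u * dG F' \<gamma> z u)"
    unfolding cprod_def using supp_dG[OF K j \<gamma>] by (intro infsum_cong_neutral) auto
  then show ?thesis using fin by simp
qed

lemma inner_grads_eq: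
  assumes \<gamma>: "\<gamma> \<in> Gamma" and l: "l \<in> {1..n}" and x: "separated l \<gamma> x"
  shows "inner_grad_conf M n l (In_map n V1 l) (In_map n V2 l) \<gamma> x
    + inner_grad_Xk M n l (In_map n V1 l) (In_map n V2 l) \<gamma> x = energy_density l \<gamma> x"
proof -
  obtain K where K: "supp_set K" using supp_set_exists by blast
  have fin: "finite (\<gamma> \<inter> K)" using K Gamma_finite[OF \<gamma>] by (simp add: supp_set_def)
  have t: "(\<Sum>u\<in>onb M z. tinner M x {..<l} n (grad_conf M (In_map n V1 l) \<gamma> x z u) (grad_conf M (In_map n V2 l) \<gamma> x z u))
    = (\<Sum>j\<in>I1 l. \<Sum>j'\<in>I2 l. a1 j * a2 j' * iprod n l (\<omega>1 j) (\<omega>2 j') x * (\<Sum>u\<in>onb M z. dG (F1 j) \<gamma> z u * dG (F2 j') \<gamma> z u))"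
    if z: "z \<in> \<gamma>" for z
  proof -
    have "(\<Sum>u\<in>onb M z. tinner M x {..<l} n (grad_conf M (In_map n V1 l) \<gamma> x z u) (grad_conf M (In_map n V2 l) \<gamma> x z u))
      = (\<Sum>u\<in>onb M z. \<Sum>j\<in>I1 l. \<Sum>j'\<in>I2 l. (a1 j * dG (F1 j) \<gamma> z u) * (a2 j' * dG (F2 j') \<gamma> z u) * iprod n l (\<omega>1 j) (\<omega>2 j') x)"
      unfolding iprod_def
      by (intro sum.cong refl tinner_bilin) (simp_all add: grad_conf_eq[OF V1 \<gamma> l x z] grad_conf_eq[OF V2 \<gamma> l x z])
    also have "\<dots> = (\<Sum>j\<in>I1 l. \<Sum>j'\<in>I2 l. \<Sum>u\<in>onb M z. (a1 j * dG (F1 j) \<gamma> z u) * (a2 j' * dG (F2 j') \<gamma> z u) * iprod n l (\<omega>1 j) (\<omega>2 j') x)"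
      by (subst sum.swap, intro sum.cong refl, subst sum.swap) simp
    finally show ?thesis by (simp add: sum_distrib_left mult_ac)
  qed
  have "inner_grad_conf M n l (In_map n V1 l) (In_map n V2 l) \<gamma> x = (\<Sum>\<^sub>\<infinity>z\<in>\<gamma>. \<Sum>j\<in>I1 l. \<Sum>j'\<in>I2 l. a1 j * a2 j' * iprod n l (\<omega>1 j) (\<omega>2 j') x * (\<Sum>u\<in>onb M z. dG (F1 j) \<gamma> z u * dG (F2 j') \<gamma> z u))"
    unfolding inner_grad_conf_def by (intro infsum_cong t)
  also have "\<dots> = (\<Sum>\<^sub>\<infinity>z\<in>\<gamma> \<inter> K. \<Sum>j\<in>I1 l. \<Sum>j'\<in>I2 l. a1 j * a2 j' * iprod n l (\<omega>1 j) (\<omega>2 j') x * (\<Sum>u\<in>onb M z. dG (F1 j) \<gamma> z u * dG (F2 j') \<gamma> z u))"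
    using supp_dG[OF K _ \<gamma>] by (intro infsum_cong_neutral) (auto intro!: sum.neutral)
  also have "\<dots> = (\<Sum>z\<in>\<gamma> \<inter> K. \<Sum>j\<in>I1 l. \<Sum>j'\<in>I2 l. a1 j * a2 j' * iprod n l (\<omega>1 j) (\<omega>2 j') x * (\<Sum>u\<in>onb M z. dG (F1 j) \<gamma> z u * dG (F2 j') \<gamma> z u))"
    using fin by simp
  also have "\<dots> = (\<Sum>j\<in>I1 l. \<Sum>j'\<in>I2 l. \<Sum>z\<in>\<gamma> \<inter> K. a1 j * a2 j' * iprod n l (\<omega>1 j) (\<omega>2 j') x * (\<Sum>u\<in>onb M z. dG (F1 j) \<gamma> z u * dG (F2 j') \<gamma> z u))"
    by (subst sum.swap, intro sum.cong refl, subst sum.swap) simp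
  also have "\<dots> = (\<Sum>j\<in>I1 l. \<Sum>j'\<in>I2 l. a1 j * a2 j' * (cprod (F1 j) (F2 j') \<gamma> * iprod n l (\<omega>1 j) (\<omega>2 j') x))"
    by (intro sum.cong refl) (simp add: cprod_sum[OF K _ \<gamma>] sum_distrib_left[symmetric] mult_ac)
  finally have 1: "inner_grad_conf M n l (In_map n V1 l) (In_map n V2 l) \<gamma> x =
    (\<Sum>j\<in>I1 l. \<Sum>j'\<in>I2 l. a1 j * a2 j' * (cprod (F1 j) (F2 j') \<gamma> * iprod n l (\<omega>1 j) (\<omega>2 j') x))" .
  have "inner_grad_Xk M n l (In_map n V1 l) (In_map n V2 l) \<gamma> x
    = (\<Sum>i<l. \<Sum>u\<in>onb M (x i). \<Sum>j\<in>I1 l. \<Sum>j'\<in>I2 l. (a1 j * F1 j \<gamma>) * (a2 j' * F2 j' \<gamma>)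
        * tinner M x {..<l} n (grad_Xk M (\<omega>1 j) x i u) (grad_Xk M (\<omega>2 j') x i u))"
    unfolding inner_grad_Xk_def
    by (intro sum.cong refl tinner_bilin) (simp_all add: grad_Xk_eq[OF V1 \<gamma> l x] grad_Xk_eq[OF V2 \<gamma> l x])
  also have "\<dots> = (\<Sum>i<l. \<Sum>j\<in>I1 l. \<Sum>j'\<in>I2 l. \<Sum>u\<in>onb M (x i). (a1 j * F1 j \<gamma>) * (a2 j' * F2 j' \<gamma>)
        * tinner M x {..<l} n (grad_Xk M (\<omega>1 j) x i u) (grad_Xk M (\<omega>2 j') x i u))"
    by (intro sum.cong refl, subst sum.swap, intro sum.cong refl, subst sum.swap) simp
  also have "\<dots> = (\<Sum>j\<in>I1 l. \<Sum>j'\<in>I2 l. \<Sum>i<l. \<Sum>u\<in>onb M (x i). (a1 j * F1 j \<gamma>) * (a2 j' * F2 j' \<gamma>)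
        * tinner M x {..<l} n (grad_Xk M (\<omega>1 j) x i u) (grad_Xk M (\<omega>2 j') x i u))"
    by (subst sum.swap, rule sum.cong[OF refl], subst sum.swap) simp
  also have "\<dots> = (\<Sum>j\<in>I1 l. \<Sum>j'\<in>I2 l. a1 j * a2 j' * (F1 j \<gamma> * F2 j' \<gamma> * gprod n l (\<omega>1 j) (\<omega>2 j') x))"
    unfolding gprod_def by (intro sum.cong refl) (simp add: sum_distrib_left mult_ac)
  finally show ?thesis unfolding 1 energy_density_def by (simp add: sum.distrib distrib_left)
qed

abbreviation "Q \<gamma> z xs \<equiv> comp_inner M (\<lambda>x. x) (grad_Gamma M V1 \<gamma>) (grad_Gamma M V2 \<gamma>) (z # xs)"

lemma Q_expand: "Q \<gamma> z xs = (\<Sum>u\<in>onb M z. comp_inner M (\<lambda>x. x) (\<lambda>xs vs. grad_Gamma M V1 \<gamma> (z # xs) (u # vs)) (\<lambda>xs vs. grad_Gamma M V2 \<gamma> (z # xs) (u # vs)) xs)"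
  unfolding comp_inner_def list.map by (subst sum_listset_Cons) auto

text \<open>Each of the two forms contributes a factor \<open>sqrt (fact l)\<close>. The resulting
  \<open>fact l\<close>, also present in \<open>Q_Xk\<close>, is compensated by the number of
  enumerations in \<open>sum_tuples_decomposition\<close>.\<close>

lemma Q_conf:
  assumes \<gamma>: "\<gamma> \<in> Gamma" and l: "l \<in> {1..n}" and x: "x \<in> Inj l \<gamma>" and z: "z \<in> \<gamma> - x ` {..<l}" and "is": "is \<in> onto_tuples l n"
  shows "Q \<gamma> z (map x is) = fact l * (\<Sum>j\<in>I1 l. \<Sum>j'\<in>I2 l. a1 j * a2 j' *
     (\<Sum>u\<in>onb M z. dG (F1 j) (\<gamma> - x ` {..<l}) z u * dG (F2 j') (\<gamma> - x ` {..<l}) z u) * comp_inner M x (\<omega>1 j x) (\<omega>2 j' x) is)"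
proof -
  let ?\<gamma> = "\<gamma> - x ` {..<l}"
  have ist: "is \<in> tuples {..<l} n" "set is = {..<l}" "length is = n" using "is" by (auto simp: onto_tuples_def tuples_def)
  have "Q \<gamma> z (map x is) = (\<Sum>u\<in>onb M z. \<Sum>j\<in>I1 l. \<Sum>j'\<in>I2 l. (sqrt (fact l) * (a1 j * dG (F1 j) ?\<gamma> z u)) * (sqrt (fact l) * (a2 j' * dG (F2 j') ?\<gamma> z u)) * comp_inner M x (\<omega>1 j x) (\<omega>2 j' x) is)"
    unfolding Q_expand
    by (intro sum.cong refl comp_inner_bilin)
       (simp_all add: ist grad_Gamma_conf[OF V1 \<gamma> l x z ist(1,2)] grad_Gamma_conf[OF V2 \<gamma> l x z ist(1,2)] sum_distrib_left mult_ac)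
  also have "\<dots> = (\<Sum>j\<in>I1 l. \<Sum>j'\<in>I2 l. \<Sum>u\<in>onb M z. (sqrt (fact l) * (a1 j * dG (F1 j) ?\<gamma> z u)) * (sqrt (fact l) * (a2 j' * dG (F2 j') ?\<gamma> z u)) * comp_inner M x (\<omega>1 j x) (\<omega>2 j' x) is)"
    by (subst sum.swap, intro sum.cong refl, subst sum.swap) simp
  also have "\<dots> = (\<Sum>j\<in>I1 l. \<Sum>j'\<in>I2 l. fact l * (a1 j * a2 j' *
     (\<Sum>u\<in>onb M z. dG (F1 j) ?\<gamma> z u * dG (F2 j') ?\<gamma> z u) * comp_inner M x (\<omega>1 j x) (\<omega>2 j' x) is))"
  proof (intro sum.cong refl)
    fix j j'
    have s: "(sqrt (fact l) * (a1 j * p)) * (sqrt (fact l) * (a2 j' * q)) * r = (fact l * (a1 j * a2 j' * r)) * (p * q)" for p q r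
    proof -
      have "(sqrt (fact l) * (a1 j * p)) * (sqrt (fact l) * (a2 j' * q)) * r = (sqrt (fact l) * sqrt (fact l)) * ((a1 j * a2 j' * r) * (p * q))"
        by (simp only: mult_ac)
      then show ?thesis by simp
    qed
    show "(\<Sum>u\<in>onb M z. (sqrt (fact l) * (a1 j * dG (F1 j) ?\<gamma> z u)) * (sqrt (fact l) * (a2 j' * dG (F2 j') ?\<gamma> z u)) * comp_inner M x (\<omega>1 j x) (\<omega>2 j' x) is)
      = fact l * (a1 j * a2 j' * (\<Sum>u\<in>onb M z. dG (F1 j) ?\<gamma> z u * dG (F2 j') ?\<gamma> z u) * comp_inner M x (\<omega>1 j x) (\<omega>2 j' x) is)"
      unfolding s sum_distrib_left[symmetric] by (simp only: mult_ac)
  qed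
  finally show ?thesis by (simp add: sum_distrib_left)
qed

lemma Q_Xk:
  assumes \<gamma>: "\<gamma> \<in> Gamma" and l: "l \<in> {1..n}" and x: "x \<in> Inj l \<gamma>" and i: "i < l" and "is": "is \<in> onto_tuples l n"
  shows "Q \<gamma> (x i) (map x is) = fact l * (\<Sum>j\<in>I1 l. \<Sum>j'\<in>I2 l. a1 j * a2 j' *
     (F1 j (\<gamma> - x ` {..<l}) * F2 j' (\<gamma> - x ` {..<l}) * (\<Sum>u\<in>onb M (x i). comp_inner M x (grad_Xk M (\<omega>1 j) x i u) (grad_Xk M (\<omega>2 j') x i u) is)))"
proof -
  let ?\<gamma> = "\<gamma> - x ` {..<l}"
  have ist: "is \<in> tuples {..<l} n" "set is = {..<l}" "length is = n" using "is" by (auto simp: onto_tuples_def tuples_def)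
  let ?c = "\<lambda>j j' u. comp_inner M x (grad_Xk M (\<omega>1 j) x i u) (grad_Xk M (\<omega>2 j') x i u) is"
  have "Q \<gamma> (x i) (map x is) = (\<Sum>u\<in>onb M (x i). \<Sum>j\<in>I1 l. \<Sum>j'\<in>I2 l. (sqrt (fact l) * (a1 j * F1 j ?\<gamma>)) * (sqrt (fact l) * (a2 j' * F2 j' ?\<gamma>)) * ?c j j' u)"
    unfolding Q_expand
    by (intro sum.cong refl comp_inner_bilin)
       (simp_all add: ist grad_Gamma_Xk[OF V1 \<gamma> l x i ist(1,2)] grad_Gamma_Xk[OF V2 \<gamma> l x i ist(1,2)] sum_distrib_left mult_ac)
  also have "\<dots> = (\<Sum>j\<in>I1 l. \<Sum>j'\<in>I2 l. \<Sum>u\<in>onb M (x i). (sqrt (fact l) * (a1 j * F1 j ?\<gamma>)) * (sqrt (fact l) * (a2 j' * F2 j' ?\<gamma>)) * ?c j j' u)"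
    by (subst sum.swap, intro sum.cong refl, subst sum.swap) simp
  also have "\<dots> = (\<Sum>j\<in>I1 l. \<Sum>j'\<in>I2 l. fact l * (a1 j * a2 j' * (F1 j ?\<gamma> * F2 j' ?\<gamma> * (\<Sum>u\<in>onb M (x i). ?c j j' u))))"
  proof (intro sum.cong refl)
    fix j j'
    have "(sqrt (fact l) * (a1 j * F1 j ?\<gamma>)) * (sqrt (fact l) * (a2 j' * F2 j' ?\<gamma>)) = (sqrt (fact l) * sqrt (fact l)) * (a1 j * a2 j' * (F1 j ?\<gamma> * F2 j' ?\<gamma>))"
      by (simp only: mult_ac)
    also have "\<dots> = fact l * (a1 j * a2 j' * (F1 j ?\<gamma> * F2 j' ?\<gamma>))" by simp
    finally have s: "(sqrt (fact l) * (a1 j * F1 j ?\<gamma>)) * (sqrt (fact l) * (a2 j' * F2 j' ?\<gamma>)) = fact l * (a1 j * a2 j' * (F1 j ?\<gamma> * F2 j' ?\<gamma>))" .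
    show "(\<Sum>u\<in>onb M (x i). (sqrt (fact l) * (a1 j * F1 j ?\<gamma>)) * (sqrt (fact l) * (a2 j' * F2 j' ?\<gamma>)) * ?c j j' u)
      = fact l * (a1 j * a2 j' * (F1 j ?\<gamma> * F2 j' ?\<gamma> * (\<Sum>u\<in>onb M (x i). ?c j j' u)))"
      unfolding s sum_distrib_left[symmetric] by (simp only: mult_ac)
  qed
  finally show ?thesis by (simp add: sum_distrib_left)
qed

lemma Ginner_decomposition:
  assumes K: "supp_set K" and \<gamma>: "\<gamma> \<in> Gamma"
  shows "Ginner M (Suc n) \<gamma> (grad_Gamma M V1 \<gamma>) (grad_Gamma M V2 \<gamma>)
    = (\<Sum>l\<in>{1..n}. \<Sum>x\<in>Inj l (\<gamma> \<inter> K). energy_density l (\<gamma> - x ` {..<l}) x)"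
proof -
  let ?S = "\<gamma> \<inter> K"
  have S: "finite ?S" using K Gamma_finite[OF \<gamma>] by (simp add: supp_set_def)
  let ?q = "comp_inner M (\<lambda>x. x) (grad_Gamma M V1 \<gamma>) (grad_Gamma M V2 \<gamma>)"
  have out: "?q zs = 0" if zs: "zs \<in> tuples \<gamma> (Suc n) - tuples ?S (Suc n)" for zs
  proof -
    obtain z xs where zx: "zs = z # xs" "length xs = n" "z \<in> \<gamma>" "set xs \<subseteq> \<gamma>"
      using zs by (cases zs) (auto simp: tuples_def)
    obtain l x "is" where x: "x \<in> Inj l (set xs)" "xs = map x is" "set is = {..<l}" "length is = length xs" "l \<le> length xs"
      using list_enumeration[of xs] by metis
    have x\<gamma>: "x \<in> Inj l \<gamma>" using x(1) Inj_mono[OF zx(4)] by blast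
    have xP: "x \<in> PiE {..<l} (\<lambda>_. UNIV)" using x\<gamma> by (auto simp: Inj_def PiE_def)
    have "l \<noteq> 0"
    proof
      assume "l = 0"
      then have "is = []" using x(3) by simp
      then show False using x(4) zx(2) n by simp
    qed
    then have l: "l \<in> {1..n}" using x(5) zx(2) by auto
    have ist: "is \<in> onto_tuples l n" using x zx(2) by (auto simp: onto_tuples_def tuples_def)
    have G: "\<gamma> - x ` {..<l} \<in> Gamma" using Gamma_subset[OF \<gamma>] by auto
    \<comment> \<open>A slot point outside K annihilates the form on the power and its gradient,
      whatever the direction. If all slot points lie in K, then the direction z is outside K, hence
      not among them, and the derivative of the cylinder function is zero.\<close>
    consider i where "i < l" "x i \<notin> K" | "\<And>i. i < l \<Longrightarrow> x i \<in> K" "z \<notin> K"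
    proof -
      have "\<not> (z \<in> K \<and> (\<forall>i<l. x i \<in> K))"
      proof
        assume a: "z \<in> K \<and> (\<forall>i<l. x i \<in> K)"
        then have "set xs \<subseteq> K" using x(2,3) by auto
        then show False using zs zx a by (auto simp: tuples_def)
      qed
      then show ?thesis using that by blast
    qed
    then show ?thesis
    proof cases
      case (1 i)
      show ?thesis
      proof (cases "z \<in> x ` {..<l}")
        case True
        then obtain i' where i': "i' < l" "z = x i'" by auto
        show ?thesis unfolding zx(1) x(2) i'(2) Q_Xk[OF \<gamma> l x\<gamma> i'(1) ist]
          using supp_grad[OF K _ xP 1 i'(1)] by (simp add: comp_inner_def)
      next
        case False
        then have z: "z \<in> \<gamma> - x ` {..<l}" using zx by auto
        show ?thesis unfolding zx(1) x(2) Q_conf[OF \<gamma> l x\<gamma> z ist]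
          using supp_form[OF K _ xP 1] by (simp add: comp_inner_def)
      qed
    next
      case 2
      then have z: "z \<in> \<gamma> - x ` {..<l}" using zx by auto
      show ?thesis unfolding zx(1) x(2) Q_conf[OF \<gamma> l x\<gamma> z ist]
        using supp_dG[OF K _ G z 2(2)] by simp
    qed
  qed
  have "tuples ?S (Suc n) \<subseteq> tuples \<gamma> (Suc n)" by (auto simp: tuples_def)
  then have "Ginner M (Suc n) \<gamma> (grad_Gamma M V1 \<gamma>) (grad_Gamma M V2 \<gamma>) = (\<Sum>\<^sub>\<infinity>zs\<in>tuples ?S (Suc n). ?q zs)"
    unfolding tinner_def using out by (intro infsum_cong_neutral) auto
  also have "\<dots> = (\<Sum>zs\<in>tuples ?S (Suc n). ?q zs)" using S by simp
  also have "\<dots> = (\<Sum>p\<in>?S \<times> tuples ?S n. Q \<gamma> (fst p) (snd p))"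
  proof (rule sum.reindex_bij_witness[where i="\<lambda>p. fst p # snd p" and j="\<lambda>zs. (hd zs, tl zs)"])
    fix zs assume "zs \<in> tuples ?S (Suc n)"
    then obtain z xs where "zs = z # xs" "length xs = n" "z \<in> ?S" "set xs \<subseteq> ?S" by (cases zs) (auto simp: tuples_def)
    then show "(hd zs, tl zs) \<in> ?S \<times> tuples ?S n" "fst (hd zs, tl zs) # snd (hd zs, tl zs) = zs"
       "Q \<gamma> (fst (hd zs, tl zs)) (snd (hd zs, tl zs)) = ?q zs" by (auto simp: tuples_def)
  qed (auto simp: tuples_def)
  also have "\<dots> = (\<Sum>xs\<in>tuples ?S n. \<Sum>z\<in>?S. Q \<gamma> z xs)"
    by (subst sum.swap) (simp add: sum.cartesian_product case_prod_beta)
  \<comment> \<open>Only the slots of the form are decomposed into points and pattern; the direction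
    z stays a separate summation variable, to be sorted afterwards according to whether it is one of
    the points.\<close>
  also have "\<dots> = (\<Sum>l\<le>n. (\<Sum>x\<in>Inj l ?S. \<Sum>is\<in>onto_tuples l n. \<Sum>z\<in>?S. Q \<gamma> z (map x is)) / fact l)"
    by (rule sum_tuples_decomposition[OF S])
  \<comment> \<open>Since n is positive there is no pattern of length n without indices, and the
    term for l = 0 is empty.\<close>
  also have "\<dots> = (\<Sum>l\<in>{1..n}. (\<Sum>x\<in>Inj l ?S. \<Sum>is\<in>onto_tuples l n. \<Sum>z\<in>?S. Q \<gamma> z (map x is)) / fact l)"
  proof (rule sum.mono_neutral_right)
    have "onto_tuples 0 n = {}" using n by (auto simp: onto_tuples_def tuples_def)
    moreover have "{..n} - {1..n} = {0}" by auto
    ultimately show "\<forall>l\<in>{..n} - {1..n}. (\<Sum>x\<in>Inj l ?S. \<Sum>is\<in>onto_tuples l n. \<Sum>z\<in>?S. Q \<gamma> z (map x is)) / fact l = 0" by simp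
  qed auto
  also have "\<dots> = (\<Sum>l\<in>{1..n}. \<Sum>x\<in>Inj l ?S. energy_density l (\<gamma> - x ` {..<l}) x)"
  proof (intro sum.cong refl)
    fix l assume l: "l \<in> {1..n}"
    have "(\<Sum>is\<in>onto_tuples l n. \<Sum>z\<in>?S. Q \<gamma> z (map x is)) = fact l * energy_density l (\<gamma> - x ` {..<l}) x" if xS: "x \<in> Inj l ?S" for x
    proof -
      let ?\<gamma> = "\<gamma> - x ` {..<l}"
      have x: "x \<in> Inj l \<gamma>" using xS Inj_mono[of ?S \<gamma>] by blast
      have inj: "inj_on x {..<l}" and xim: "x ` {..<l} \<subseteq> ?S" using xS by (auto simp: Inj_def)
      have G: "?\<gamma> \<in> Gamma" using Gamma_subset[OF \<gamma>] by auto
      let ?ci = "\<lambda>j j' is. comp_inner M x (\<omega>1 j x) (\<omega>2 j' x) is"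
      let ?cg = "\<lambda>j j' i u is. comp_inner M x (grad_Xk M (\<omega>1 j) x i u) (grad_Xk M (\<omega>2 j') x i u) is"
      let ?d = "\<lambda>j j' z. \<Sum>u\<in>onb M z. dG (F1 j) ?\<gamma> z u * dG (F2 j') ?\<gamma> z u"
      \<comment> \<open>The direction is either a point of \<gamma> outside the tuple or one of the
        points of the tuple; the points of x all lie in K, so the second alternative is summed over
        all i below l.\<close>
      have split: "(\<Sum>z\<in>?S. Q \<gamma> z xs) = (\<Sum>z\<in>?\<gamma> \<inter> K. Q \<gamma> z xs) + (\<Sum>i<l. Q \<gamma> (x i) xs)" for xs
      proof -
        have "?S = (?\<gamma> \<inter> K) \<union> x ` {..<l}" using xim by auto
        then have "(\<Sum>z\<in>?S. Q \<gamma> z xs) = (\<Sum>z\<in>(?\<gamma> \<inter> K) \<union> x ` {..<l}. Q \<gamma> z xs)" by simp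
        also have "\<dots> = (\<Sum>z\<in>?\<gamma> \<inter> K. Q \<gamma> z xs) + (\<Sum>z\<in>x ` {..<l}. Q \<gamma> z xs)"
          using S by (intro sum.union_disjoint) (auto intro: finite_subset[OF _ S])
        finally show ?thesis using inj by (simp add: sum.reindex)
      qed
      have c: "(\<Sum>z\<in>?\<gamma> \<inter> K. Q \<gamma> z (map x is)) = fact l * (\<Sum>j\<in>I1 l. \<Sum>j'\<in>I2 l. a1 j * a2 j' * (cprod (F1 j) (F2 j') ?\<gamma> * ?ci j j' is))"
        if "is": "is \<in> onto_tuples l n" for "is"
      proof -
        have "(\<Sum>z\<in>?\<gamma> \<inter> K. Q \<gamma> z (map x is)) = (\<Sum>z\<in>?\<gamma> \<inter> K. fact l * (\<Sum>j\<in>I1 l. \<Sum>j'\<in>I2 l. a1 j * a2 j' * ?d j j' z * ?ci j j' is))"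
          by (intro sum.cong refl Q_conf[OF \<gamma> l x _ "is"]) auto
        also have "\<dots> = fact l * (\<Sum>j\<in>I1 l. \<Sum>j'\<in>I2 l. \<Sum>z\<in>?\<gamma> \<inter> K. a1 j * a2 j' * ?d j j' z * ?ci j j' is)"
          unfolding sum_distrib_left[symmetric]
          by (subst sum.swap, intro arg_cong2[where f=times] sum.cong refl, subst sum.swap) simp
        also have "\<dots> = fact l * (\<Sum>j\<in>I1 l. \<Sum>j'\<in>I2 l. a1 j * a2 j' * (cprod (F1 j) (F2 j') ?\<gamma> * ?ci j j' is))"
          by (intro arg_cong2[where f=times] sum.cong refl)
             (simp only: cprod_sum[OF K _ G] sum_distrib_left[symmetric] sum_distrib_right[symmetric] mult.assoc)
        finally show ?thesis .
      qed
      have g: "(\<Sum>i<l. Q \<gamma> (x i) (map x is)) = fact l * (\<Sum>j\<in>I1 l. \<Sum>j'\<in>I2 l. a1 j * a2 j' * (F1 j ?\<gamma> * F2 j' ?\<gamma> * (\<Sum>i<l. \<Sum>u\<in>onb M (x i). ?cg j j' i u is)))"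
        if "is": "is \<in> onto_tuples l n" for "is"
      proof -
        have "(\<Sum>i<l. Q \<gamma> (x i) (map x is)) = (\<Sum>i<l. fact l * (\<Sum>j\<in>I1 l. \<Sum>j'\<in>I2 l. a1 j * a2 j' * (F1 j ?\<gamma> * F2 j' ?\<gamma> * (\<Sum>u\<in>onb M (x i). ?cg j j' i u is))))"
          by (intro sum.cong refl Q_Xk[OF \<gamma> l x _ "is"]) auto
        also have "\<dots> = fact l * (\<Sum>j\<in>I1 l. \<Sum>j'\<in>I2 l. \<Sum>i<l. a1 j * a2 j' * (F1 j ?\<gamma> * F2 j' ?\<gamma> * (\<Sum>u\<in>onb M (x i). ?cg j j' i u is)))"
          unfolding sum_distrib_left[symmetric]
          by (subst sum.swap, rule arg_cong[where f="times (fact l)"], rule sum.cong[OF refl], subst sum.swap) (simp only: sum_distrib_left[symmetric])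
        finally show ?thesis by (simp only: sum_distrib_left[symmetric])
      qed
      \<comment> \<open>So far only patterns using every index occur. The components on all other
        patterns vanish, so the partial sums are already the full inner products on the
        power.\<close>
      have ip: "(\<Sum>is\<in>onto_tuples l n. ?ci j j' is) = iprod n l (\<omega>1 j) (\<omega>2 j') x" if "j \<in> I1 l" for j j'
        unfolding iprod_def tinner_finite[OF finite_lessThan]
        using Psi_T_space[OF drepD(3)[OF V1 that] x] by (intro sum_onto_tuples_eq) (simp add: comp_inner_def)
      have gp: "(\<Sum>is\<in>onto_tuples l n. \<Sum>i<l. \<Sum>u\<in>onb M (x i). ?cg j j' i u is) = gprod n l (\<omega>1 j) (\<omega>2 j') x" if j: "j \<in> I1 l" for j j'
      proof -
        have "(\<Sum>is\<in>onto_tuples l n. \<Sum>i<l. \<Sum>u\<in>onb M (x i). ?cg j j' i u is) = (\<Sum>is\<in>tuples {..<l} n. \<Sum>i<l. \<Sum>u\<in>onb M (x i). ?cg j j' i u is)"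
        proof (rule sum_onto_tuples_eq, intro sum.neutral ballI)
          fix "is" i u assume a: "is \<in> tuples {..<l} n" "is \<notin> T_tuples TYPE('n) n l" "i \<in> {..<l}"
          have "grad_Xk M (\<omega>1 j) x i u is vs = 0" if "vs \<in> listset (map (\<lambda>i. onb M (x i)) is)" for vs
            by (rule grad_Xk_T[OF drepD(3)[OF V1 j] x _ a(2)]) (use a that listset_length in fastforce)+
          then show "?cg j j' i u is = 0" by (simp add: comp_inner_def)
        qed
        also have "\<dots> = gprod n l (\<omega>1 j) (\<omega>2 j') x"
          unfolding gprod_def tinner_finite[OF finite_lessThan]
          by (subst sum.swap, intro sum.cong refl, subst sum.swap) simp
        finally show ?thesis .
      qed
      have "(\<Sum>is\<in>onto_tuples l n. \<Sum>z\<in>?S. Q \<gamma> z (map x is)) = (\<Sum>is\<in>onto_tuples l n. fact l * (\<Sum>j\<in>I1 l. \<Sum>j'\<in>I2 l. a1 j * a2 j' *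
         (cprod (F1 j) (F2 j') ?\<gamma> * ?ci j j' is + F1 j ?\<gamma> * F2 j' ?\<gamma> * (\<Sum>i<l. \<Sum>u\<in>onb M (x i). ?cg j j' i u is))))"
        by (intro sum.cong refl) (simp only: split c g distrib_left sum.distrib)
      also have "\<dots> = fact l * (\<Sum>j\<in>I1 l. \<Sum>j'\<in>I2 l. \<Sum>is\<in>onto_tuples l n. a1 j * a2 j' *
         (cprod (F1 j) (F2 j') ?\<gamma> * ?ci j j' is + F1 j ?\<gamma> * F2 j' ?\<gamma> * (\<Sum>i<l. \<Sum>u\<in>onb M (x i). ?cg j j' i u is)))"
        by (subst sum_distrib_left[symmetric], subst sum.swap, rule arg_cong[where f="times (fact l)"], rule sum.cong[OF refl], rule sum.swap)
      also have "\<dots> = fact l * energy_density l ?\<gamma> x"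
        unfolding energy_density_def
      proof (intro arg_cong2[where f=times] sum.cong refl)
        fix j j' assume "j \<in> I1 l"
        then show "(\<Sum>is\<in>onto_tuples l n. a1 j * a2 j' * (cprod (F1 j) (F2 j') ?\<gamma> * ?ci j j' is + F1 j ?\<gamma> * F2 j' ?\<gamma> * (\<Sum>i<l. \<Sum>u\<in>onb M (x i). ?cg j j' i u is)))
          = a1 j * a2 j' * (cprod (F1 j) (F2 j') ?\<gamma> * iprod n l (\<omega>1 j) (\<omega>2 j') x + F1 j ?\<gamma> * F2 j' ?\<gamma> * gprod n l (\<omega>1 j) (\<omega>2 j') x)"
          by (simp only: sum_distrib_left[symmetric] sum.distrib ip gp)
      qed
      finally show ?thesis .
    qed
    then show "(\<Sum>x\<in>Inj l ?S. \<Sum>is\<in>onto_tuples l n. \<Sum>z\<in>?S. Q \<gamma> z (map x is)) / fact l = (\<Sum>x\<in>Inj l ?S. energy_density l (\<gamma> - x ` {..<l}) x)"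
      by (simp add: sum_distrib_left[symmetric])
  qed
  finally show ?thesis .
qed

end

end

section \<open>Integration\<close>

text \<open>Meant for an f whose measurability is unknown: it differs from the measurable g inside a
  null set, which suffices for measurability with respect to the completion.\<close>

lemma integral_completion_AE:
  fixes f g :: "'b \<Rightarrow> real"
  assumes g: "integrable M g" and eq: "AE x in M. f x = g x"
  shows "integrable (completion M) f" and "integral\<^sup>L (completion M) f = integral\<^sup>L M g"
proof -
  obtain N where N: "{x \<in> space M. f x \<noteq> g x} \<subseteq> N" "N \<in> null_sets M"
    using eq by (auto elim!: AE_E simp: null_sets_def)
  have gm: "g \<in> borel_measurable M" using g by simp
  have fm: "f \<in> borel_measurable (completion M)"
  proof (rule measurableI)
    fix A :: "real set" assume A: "A \<in> sets borel"
    have "g -` A \<inter> space M - N \<in> sets M" using measurable_sets[OF gm A] N(2) by auto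
    moreover have "f -` A \<inter> space M = (g -` A \<inter> space M - N) \<union> (f -` A \<inter> space M \<inter> N)"
    proof (rule set_eqI)
      fix x show "x \<in> f -` A \<inter> space M \<longleftrightarrow> x \<in> (g -` A \<inter> space M - N) \<union> (f -` A \<inter> space M \<inter> N)"
        using N(1) by (cases "x \<in> N") auto
    qed
    ultimately show "f -` A \<inter> space (completion M) \<in> sets (completion M)"
      using N(2) by (auto intro!: sets_completionI[of _ "g -` A \<inter> space M - N" "f -` A \<inter> space M \<inter> N" N])
  qed auto
  have gc: "g \<in> borel_measurable (completion M)" using measurable_completion[OF gm] .
  have e: "AE x in completion M. f x = g x" using AE_completion[OF eq] .
  show "integrable (completion M) f"
    using integrable_cong_AE[OF fm gc e] integrable_completion[OF gm] g by simp
  show "integral\<^sup>L (completion M) f = integral\<^sup>L M g"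
    using integral_cong_AE[OF fm gc e] integral_completion[OF gm] by simp
qed

lemma card_Inj_le: "finite S \<Longrightarrow> card (Inj l S) \<le> card S ^ l"
proof -
  assume S: "finite S"
  have "card (Inj l S) \<le> card (PiE {..<l} (\<lambda>_. S))"
    using S by (intro card_mono finite_PiE) (auto simp: Inj_def)
  then show ?thesis by (simp add: card_PiE)
qed

lemma pairing_nonneg: "(\<And>x. 0 \<le> f x) \<Longrightarrow> 0 \<le> pairing f \<gamma>"
  unfolding pairing_def by (rule sum_nonneg) auto

lemma pairing_mono:
  fixes \<gamma> :: "'a::topological_space set"
  assumes g: "g \<in> C0" and \<gamma>: "\<gamma> \<in> Gamma" and f: "\<And>x. 0 \<le> f x" and fg: "\<And>x. f x \<le> g x"
  shows "pairing f \<gamma> \<le> pairing g \<gamma>"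
proof -
  let ?S = "{x\<in>\<gamma>. g x \<noteq> 0}"
  have "pairing f \<gamma> = sum f ?S"
  proof (rule pairing_eq_sum)
    fix x assume "x \<in> \<gamma>" "f x \<noteq> 0"
    then show "x \<in> ?S" using f[of x] fg[of x] by auto
  qed (use Gamma_finite_supp[OF \<gamma> g] in auto)
  also have "\<dots> \<le> sum g ?S" by (rule sum_mono) (rule fg)
  finally show ?thesis by (simp add: pairing_def)
qed

lemma pairing_mono2:
  fixes \<gamma> :: "'a::topological_space set"
  assumes g: "g \<in> C0" and \<gamma>: "\<gamma> \<in> Gamma" and g0: "\<And>x. 0 \<le> g x" and sub: "\<gamma>' \<subseteq> \<gamma>"
  shows "pairing g \<gamma>' \<le> pairing g \<gamma>"
  unfolding pairing_def using Gamma_finite_supp[OF \<gamma> g] g0 sub by (intro sum_mono2) auto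

lemma card_le_pairing:
  fixes \<gamma> :: "'a::topological_space set"
  assumes g: "g \<in> C0" and \<gamma>: "\<gamma> \<in> Gamma" and g0: "\<And>x. 0 \<le> g x" and K: "\<And>x. x \<in> K \<Longrightarrow> 1 \<le> g x"
  shows "real (card (\<gamma> \<inter> K)) \<le> pairing g \<gamma>"
proof -
  have sub: "\<gamma> \<inter> K \<subseteq> {x\<in>\<gamma>. g x \<noteq> 0}" using K by force
  have "real (card (\<gamma> \<inter> K)) = (\<Sum>x\<in>\<gamma> \<inter> K. 1)" by simp
  also have "\<dots> \<le> sum g (\<gamma> \<inter> K)" using K by (intro sum_mono) auto
  also have "\<dots> \<le> pairing g \<gamma>"
    unfolding pairing_def using Gamma_finite_supp[OF \<gamma> g] g0 sub by (intro sum_mono2) auto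
  finally show ?thesis .
qed

text \<open>Growth of this kind makes the function integrable by the moment condition on the measure.\<close>

definition conf_bounded :: "nat \<Rightarrow> ('a::topological_space set \<Rightarrow> (nat \<Rightarrow> 'a) \<Rightarrow> real) \<Rightarrow> bool" where
  "conf_bounded l h \<longleftrightarrow> (\<exists>f\<in>C0. \<exists>D\<ge>0. (\<forall>x. 0 \<le> f x) \<and>
     (\<forall>\<gamma>\<in>Gamma. \<forall>x\<in>PiE {..<l} (\<lambda>_. UNIV). \<bar>h \<gamma> x\<bar> \<le> D * (1 + pairing f \<gamma>)))"

lemma C0_add: "f \<in> C0 \<Longrightarrow> g \<in> C0 \<Longrightarrow> (\<lambda>x. f x + g x) \<in> (C0 :: ('a::t2_space \<Rightarrow> real) set)"
proof -
  assume f: "f \<in> C0" and g: "g \<in> C0"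
  have "(\<lambda>x. \<Sum>b\<in>UNIV. (if b then f else g) x) \<in> C0" by (rule C0_sum) (use f g in simp_all)
  then show ?thesis by (simp add: UNIV_bool add.commute)
qed

lemma conf_bounded_add:
  fixes h h' :: "'a::t2_space set \<Rightarrow> (nat \<Rightarrow> 'a) \<Rightarrow> real"
  assumes "conf_bounded l h" "conf_bounded l h'"
  shows "conf_bounded l (\<lambda>\<gamma> x. h \<gamma> x + h' \<gamma> x)"
proof -
  obtain f D where f: "f \<in> C0" "D \<ge> 0" "\<And>x. 0 \<le> f x" "\<And>\<gamma> x. \<gamma> \<in> Gamma \<Longrightarrow> x \<in> PiE {..<l} (\<lambda>_. UNIV) \<Longrightarrow> \<bar>h \<gamma> x\<bar> \<le> D * (1 + pairing f \<gamma>)"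
    using assms(1) unfolding conf_bounded_def by blast
  obtain f' D' where f': "f' \<in> C0" "D' \<ge> 0" "\<And>x. 0 \<le> f' x" "\<And>\<gamma> x. \<gamma> \<in> Gamma \<Longrightarrow> x \<in> PiE {..<l} (\<lambda>_. UNIV) \<Longrightarrow> \<bar>h' \<gamma> x\<bar> \<le> D' * (1 + pairing f' \<gamma>)"
    using assms(2) unfolding conf_bounded_def by blast
  let ?g = "\<lambda>x. f x + f' x"
  have g: "?g \<in> C0" using f(1) f'(1) by (rule C0_add)
  show ?thesis unfolding conf_bounded_def
  proof (intro bexI[OF _ g] exI[of _ "D + D'"] conjI allI ballI)
    fix \<gamma> :: "'a set" and x :: "nat \<Rightarrow> 'a" assume \<gamma>: "\<gamma> \<in> Gamma" and x: "x \<in> PiE {..<l} (\<lambda>_. UNIV)"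
    have "pairing f \<gamma> \<le> pairing ?g \<gamma>" "pairing f' \<gamma> \<le> pairing ?g \<gamma>"
      using f(3) f'(3) by (auto intro!: pairing_mono[OF g \<gamma>])
    then have "D * (1 + pairing f \<gamma>) \<le> D * (1 + pairing ?g \<gamma>)" "D' * (1 + pairing f' \<gamma>) \<le> D' * (1 + pairing ?g \<gamma>)"
      using f(2) f'(2) by (auto intro!: mult_left_mono)
    then show "\<bar>h \<gamma> x + h' \<gamma> x\<bar> \<le> (D + D') * (1 + pairing ?g \<gamma>)"
      unfolding distrib_right[of D D'] using f(4)[OF \<gamma> x] f'(4)[OF \<gamma> x] by linarith
  qed (use f(2,3) f'(2,3) in auto)
qed

lemma conf_bounded_sum:
  fixes h :: "'i \<Rightarrow> 'a::t2_space set \<Rightarrow> (nat \<Rightarrow> 'a) \<Rightarrow> real"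
  assumes "finite I" "\<And>i. i \<in> I \<Longrightarrow> conf_bounded l (h i)"
  shows "conf_bounded l (\<lambda>\<gamma> x. \<Sum>i\<in>I. h i \<gamma> x)"
  using assms
proof (induction I)
  case empty
  have "(\<lambda>_. 0) \<in> (C0 :: ('a \<Rightarrow> real) set)" by (auto simp: C0_def)
  then show ?case unfolding conf_bounded_def by (intro bexI[of _ "\<lambda>_. 0"] exI[of _ 0]) auto
next
  case (insert i I)
  then have "conf_bounded l (\<lambda>\<gamma> x. h i \<gamma> x + (\<Sum>i\<in>I. h i \<gamma> x))" by (intro conf_bounded_add) auto
  then show ?case using insert(1,2) by simp
qed

lemma conf_bounded_mult:
  fixes h :: "'a::t2_space set \<Rightarrow> (nat \<Rightarrow> 'a) \<Rightarrow> real"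
  assumes h: "conf_bounded l h" and c: "\<And>\<gamma> x. \<gamma> \<in> Gamma \<Longrightarrow> x \<in> PiE {..<l} (\<lambda>_. UNIV) \<Longrightarrow> \<bar>c \<gamma> x\<bar> \<le> C"
  shows "conf_bounded l (\<lambda>\<gamma> x. c \<gamma> x * h \<gamma> x)"
proof -
  obtain f D where f: "f \<in> C0" "D \<ge> 0" "\<And>x. 0 \<le> f x" "\<And>\<gamma> x. \<gamma> \<in> Gamma \<Longrightarrow> x \<in> PiE {..<l} (\<lambda>_. UNIV) \<Longrightarrow> \<bar>h \<gamma> x\<bar> \<le> D * (1 + pairing f \<gamma>)"
    using h unfolding conf_bounded_def by blast
  show ?thesis unfolding conf_bounded_def
  proof (intro bexI[OF _ f(1)] exI[of _ "\<bar>C\<bar> * D"] conjI allI ballI)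
    fix \<gamma> :: "'a set" and x :: "nat \<Rightarrow> 'a" assume \<gamma>: "\<gamma> \<in> Gamma" and x: "x \<in> PiE {..<l} (\<lambda>_. UNIV)"
    have "\<bar>c \<gamma> x * h \<gamma> x\<bar> = \<bar>c \<gamma> x\<bar> * \<bar>h \<gamma> x\<bar>" by (rule abs_mult)
    also have "\<dots> \<le> \<bar>C\<bar> * (D * (1 + pairing f \<gamma>))"
      using c[OF \<gamma> x] f(4)[OF \<gamma> x] by (intro mult_mono) auto
    finally show "\<bar>c \<gamma> x * h \<gamma> x\<bar> \<le> \<bar>C\<bar> * D * (1 + pairing f \<gamma>)" by (simp add: mult.assoc)
  qed (use f(2,3) in auto)
qed

lemma conf_bounded_const: "conf_bounded l (\<lambda>(\<gamma> :: 'a::topological_space set) x. c)"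
proof -
  have "(\<lambda>_. 0) \<in> (C0 :: ('a \<Rightarrow> real) set)" by (auto simp: C0_def)
  then show ?thesis unfolding conf_bounded_def by (intro bexI[of _ "\<lambda>_. 0"] exI[of _ "\<bar>c\<bar>"]) (auto simp: pairing_def)
qed

section \<open>Integrability and the Campbell formula\<close>

context gnz_space begin

text \<open>The support condition makes the Campbell sum finite for each configuration. It has at
  most as many terms as there are l-tuples of points in K, each growing at most linearly in a
  pairing; so T is bounded by the l-th and (l+1)-st powers of one pairing, which are
  integrable.\<close>

lemma campbell_nonneg:
  fixes u :: "'a set \<times> (nat \<Rightarrow> 'a) \<Rightarrow> real"
  assumes u[measurable]: "u \<in> borel_measurable (GammaM \<Otimes>\<^sub>M PiM {..<l} (\<lambda>_. borel))" and u0: "\<And>p. 0 \<le> u p"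
    and b: "conf_bounded l (\<lambda>\<gamma> x. u (\<gamma>, x))" and K: "compact K"
    and 0: "\<And>\<gamma> x i. \<gamma> \<in> Gamma \<Longrightarrow> x \<in> PiE {..<l} (\<lambda>_. UNIV) \<Longrightarrow> i < l \<Longrightarrow> x i \<notin> K \<Longrightarrow> u (\<gamma>, x) = 0"
  defines "T \<equiv> \<lambda>\<gamma>. \<Sum>x\<in>Inj l (\<gamma> \<inter> K). u (\<gamma> - x ` {..<l}, x)"
  shows "integrable (mu_k \<mu> \<sigma> l) u" "integrable \<mu> T" "integral\<^sup>L (mu_k \<mu> \<sigma> l) u = integral\<^sup>L \<mu> T"
proof -
  have T0: "0 \<le> T \<gamma>" for \<gamma> unfolding T_def by (intro sum_nonneg u0)
  have camp: "camp l \<gamma> (\<lambda>\<gamma> x. ennreal (u (\<gamma>, x))) = ennreal (T \<gamma>)" if \<gamma>: "\<gamma> \<in> Gamma" for \<gamma>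
  proof -
    have "camp l \<gamma> (\<lambda>\<gamma> x. ennreal (u (\<gamma>, x))) = (\<Sum>x\<in>Inj l (\<gamma> \<inter> K). ennreal (u (\<gamma> - x ` {..<l}, x)))"
    proof (rule camp_finite_sum)
      show "finite (\<gamma> \<inter> K)" using Gamma_finite[OF \<gamma> K] .
      fix x assume x: "x \<in> Inj l \<gamma>" "x \<notin> Inj l (\<gamma> \<inter> K)"
      then obtain i where "i < l" "x i \<notin> K" by (auto simp: Inj_def PiE_def Pi_def)
      moreover have "x \<in> PiE {..<l} (\<lambda>_. UNIV)" using x(1) by (auto simp: Inj_def PiE_def)
      ultimately show "ennreal (u (\<gamma> - x ` {..<l}, x)) = 0" using 0 Gamma_subset[OF \<gamma>, of "\<gamma> - x ` {..<l}"] by simp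
    qed auto
    then show ?thesis unfolding T_def using u0 by (simp add: sum_ennreal)
  qed
  have Tm: "T \<in> borel_measurable \<mu>"
  proof -
    have "(\<lambda>\<gamma>. enn2real (camp l \<gamma> (\<lambda>\<gamma> x. ennreal (u (\<gamma>, x))))) \<in> borel_measurable GammaM"
      by (intro borel_measurable_enn2real camp_measurable[of "\<lambda>p. ennreal (u p)", simplified]) measurable
    then have "(\<lambda>\<gamma>. enn2real (camp l \<gamma> (\<lambda>\<gamma> x. ennreal (u (\<gamma>, x))))) \<in> borel_measurable \<mu>"
      using sets_mu by (simp cong: measurable_cong_sets)
    moreover have "T \<gamma> = enn2real (camp l \<gamma> (\<lambda>\<gamma> x. ennreal (u (\<gamma>, x))))" if "\<gamma> \<in> space \<mu>" for \<gamma>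
      using that camp[of \<gamma>] T0[of \<gamma>] by (simp add: space_mu)
    ultimately show ?thesis by (simp cong: measurable_cong)
  qed
  have eq: "(\<integral>\<^sup>+p. ennreal (u p) \<partial>mu_k \<mu> \<sigma> l) = (\<integral>\<^sup>+\<gamma>. ennreal (T \<gamma>) \<partial>\<mu>)"
  proof -
    have "(\<integral>\<^sup>+p. ennreal (u p) \<partial>mu_k \<mu> \<sigma> l) = (\<integral>\<^sup>+\<gamma>. camp l \<gamma> (\<lambda>\<gamma> x. ennreal (u (\<gamma>, x))) \<partial>\<mu>)"
      by (rule nn_integral_mu_k) measurable
    also have "\<dots> = (\<integral>\<^sup>+\<gamma>. ennreal (T \<gamma>) \<partial>\<mu>)" by (rule nn_integral_cong) (simp add: space_mu camp)
    finally show ?thesis .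
  qed
  obtain f D where f: "f \<in> C0" "D \<ge> 0" "\<And>x. 0 \<le> f x"
    "\<And>\<gamma> x. \<gamma> \<in> Gamma \<Longrightarrow> x \<in> PiE {..<l} (\<lambda>_. UNIV) \<Longrightarrow> \<bar>u (\<gamma>, x)\<bar> \<le> D * (1 + pairing f \<gamma>)"
    using b unfolding conf_bounded_def by blast
  obtain \<eta> where \<eta>: "\<eta> \<in> C0" "\<And>x. 0 \<le> \<eta> x" "\<And>x. x \<in> K \<Longrightarrow> 1 \<le> \<eta> x" using C0_ge_1[OF K] by blast
  \<comment> \<open>A single function dominates both f, which controls the size of each term, and
    the indicator of K, which controls their number.\<close>
  define \<psi> where "\<psi> x = f x + \<eta> x" for x
  have \<psi>: "\<psi> \<in> C0" unfolding \<psi>_def[abs_def] using f(1) \<eta>(1) by (rule C0_add)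
  have \<psi>0: "0 \<le> \<psi> x" for x using f(3)[of x] \<eta>(2)[of x] by (simp add: \<psi>_def)
  have \<psi>1: "1 \<le> \<psi> x" if "x \<in> K" for x using f(3)[of x] \<eta>(3)[OF that] by (simp add: \<psi>_def)
  have bound: "T \<gamma> \<le> D * pairing \<psi> \<gamma> ^ l + D * pairing \<psi> \<gamma> ^ Suc l" if \<gamma>: "\<gamma> \<in> Gamma" for \<gamma>
  proof -
    let ?p = "pairing \<psi> \<gamma>"
    have p0: "0 \<le> ?p" by (rule pairing_nonneg) (rule \<psi>0)
    have fin: "finite (\<gamma> \<inter> K)" using Gamma_finite[OF \<gamma> K] .
    have "T \<gamma> \<le> (\<Sum>x\<in>Inj l (\<gamma> \<inter> K). D * (1 + ?p))"
      unfolding T_def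
    proof (rule sum_mono)
      fix x assume x: "x \<in> Inj l (\<gamma> \<inter> K)"
      have xP: "x \<in> PiE {..<l} (\<lambda>_. UNIV)" using x by (auto simp: Inj_def PiE_def)
      have G: "\<gamma> - x ` {..<l} \<in> Gamma" using Gamma_subset[OF \<gamma>] by auto
      have "u (\<gamma> - x ` {..<l}, x) \<le> D * (1 + pairing f (\<gamma> - x ` {..<l}))" using f(4)[OF G xP] by simp
      also have "pairing f (\<gamma> - x ` {..<l}) \<le> pairing f \<gamma>" by (rule pairing_mono2[OF f(1) \<gamma> f(3)]) auto
      also have "pairing f \<gamma> \<le> ?p" by (rule pairing_mono[OF \<psi> \<gamma> f(3)]) (simp add: \<psi>_def \<eta>(2))
      finally show "u (\<gamma> - x ` {..<l}, x) \<le> D * (1 + ?p)" using f(2) by (simp add: mult_left_mono)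
    qed
    also have "\<dots> = real (card (Inj l (\<gamma> \<inter> K))) * (D * (1 + ?p))" by simp
    also have "\<dots> \<le> ?p ^ l * (D * (1 + ?p))"
    proof (rule mult_right_mono)
      have "real (card (Inj l (\<gamma> \<inter> K))) \<le> real (card (\<gamma> \<inter> K)) ^ l"
        using card_Inj_le[OF fin, of l] by (metis of_nat_le_iff of_nat_power)
      also have "\<dots> \<le> ?p ^ l" using card_le_pairing[OF \<psi> \<gamma> \<psi>0 \<psi>1] by (intro power_mono) auto
      finally show "real (card (Inj l (\<gamma> \<inter> K))) \<le> ?p ^ l" .
    qed (use f(2) p0 in simp)
    finally show ?thesis by (simp add: algebra_simps)
  qed
  have pm[measurable]: "pairing \<psi> \<in> borel_measurable \<mu>" using pairing_measurable[OF \<psi>] sets_mu by (simp cong: measurable_cong_sets)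
  have "(\<integral>\<^sup>+\<gamma>. ennreal (T \<gamma>) \<partial>\<mu>) \<le> (\<integral>\<^sup>+\<gamma>. ennreal D * ennreal (pairing \<psi> \<gamma> ^ l) + ennreal D * ennreal (pairing \<psi> \<gamma> ^ Suc l) \<partial>\<mu>)"
  proof (rule nn_integral_mono)
    fix \<gamma> assume "\<gamma> \<in> space \<mu>"
    then have "ennreal (T \<gamma>) \<le> ennreal (D * pairing \<psi> \<gamma> ^ l + D * pairing \<psi> \<gamma> ^ Suc l)" by (intro ennreal_leI bound) (simp add: space_mu)
    also have "\<dots> = ennreal D * ennreal (pairing \<psi> \<gamma> ^ l) + ennreal D * ennreal (pairing \<psi> \<gamma> ^ Suc l)"
      using f(2) pairing_nonneg[of \<psi> \<gamma>] \<psi>0 by (subst ennreal_plus) (auto simp: ennreal_mult simp del: power_Suc)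
    finally show "ennreal (T \<gamma>) \<le> ennreal D * ennreal (pairing \<psi> \<gamma> ^ l) + ennreal D * ennreal (pairing \<psi> \<gamma> ^ Suc l)" .
  qed
  also have "\<dots> = ennreal D * (\<integral>\<^sup>+\<gamma>. ennreal (pairing \<psi> \<gamma> ^ l) \<partial>\<mu>) + ennreal D * (\<integral>\<^sup>+\<gamma>. ennreal (pairing \<psi> \<gamma> ^ Suc l) \<partial>\<mu>)"
    by (subst nn_integral_add) (simp_all add: nn_integral_cmult del: power_Suc)
  also have "\<dots> < \<infinity>"
    using moments[OF \<psi> \<psi>0, of l] moments[OF \<psi> \<psi>0, of "Suc l"] by (simp add: ennreal_mult_less_top del: power_Suc)
  finally have fin: "(\<integral>\<^sup>+\<gamma>. ennreal (T \<gamma>) \<partial>\<mu>) < \<infinity>" .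
  have um: "u \<in> borel_measurable (mu_k \<mu> \<sigma> l)" using u by (simp cong: measurable_cong_sets add: sets_mu_k)
  show iu: "integrable (mu_k \<mu> \<sigma> l) u" using um fin eq u0 by (intro integrableI_nonneg) auto
  show iT: "integrable \<mu> T" using Tm fin T0 by (intro integrableI_nonneg) auto
  show "integral\<^sup>L (mu_k \<mu> \<sigma> l) u = integral\<^sup>L \<mu> T"
    using integral_eq_nn_integral[OF um] integral_eq_nn_integral[OF Tm] eq u0 T0 by simp
qed

lemma campbell:
  fixes h :: "'a set \<times> (nat \<Rightarrow> 'a) \<Rightarrow> real"
  assumes h[measurable]: "h \<in> borel_measurable (GammaM \<Otimes>\<^sub>M PiM {..<l} (\<lambda>_. borel))"
    and b: "conf_bounded l (\<lambda>\<gamma> x. h (\<gamma>, x))" and K: "compact K"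
    and 0: "\<And>\<gamma> x i. \<gamma> \<in> Gamma \<Longrightarrow> x \<in> PiE {..<l} (\<lambda>_. UNIV) \<Longrightarrow> i < l \<Longrightarrow> x i \<notin> K \<Longrightarrow> h (\<gamma>, x) = 0"
  defines "T \<equiv> \<lambda>\<gamma>. \<Sum>x\<in>Inj l (\<gamma> \<inter> K). h (\<gamma> - x ` {..<l}, x)"
  shows "integrable (mu_k \<mu> \<sigma> l) h" "integrable \<mu> T" "integral\<^sup>L (mu_k \<mu> \<sigma> l) h = integral\<^sup>L \<mu> T"
proof -
  \<comment> \<open>The values 1 and -1 of s give the positive and the negative part, to which the
    nonnegative case is applied.\<close>
  have bm: "conf_bounded l (\<lambda>\<gamma> x. max 0 (s * h (\<gamma>, x)))" if s: "\<bar>s\<bar> = 1" for s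
  proof -
    have "\<bar>max 0 (s * t)\<bar> \<le> \<bar>t\<bar>" for t :: real using s abs_mult[of s t] by (auto simp: max_def)
    then show ?thesis using b unfolding conf_bounded_def by (meson order_trans)
  qed
  have m: "(\<lambda>p. max 0 (s * h p)) \<in> borel_measurable (GammaM \<Otimes>\<^sub>M PiM {..<l} (\<lambda>_. borel))" for s by measurable
  let ?T = "\<lambda>s \<gamma>. \<Sum>x\<in>Inj l (\<gamma> \<inter> K). max 0 (s * h (\<gamma> - x ` {..<l}, x))"
  have c: "integrable (mu_k \<mu> \<sigma> l) (\<lambda>p. max 0 (s * h p))" "integrable \<mu> (?T s)"
    "integral\<^sup>L (mu_k \<mu> \<sigma> l) (\<lambda>p. max 0 (s * h p)) = integral\<^sup>L \<mu> (?T s)" if s: "\<bar>s\<bar> = 1" for s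
    using campbell_nonneg[OF m _ bm[OF s] K] 0 by simp_all
  have t: "t = max 0 (1 * t) - max 0 (-1 * t)" for t :: real by simp
  have h': "h = (\<lambda>p. max 0 (1 * h p) - max 0 (-1 * h p))" by (rule ext) (rule t)
  have T': "T = (\<lambda>\<gamma>. ?T 1 \<gamma> - ?T (-1) \<gamma>)"
    unfolding T_def sum_subtractf[symmetric] t[symmetric] ..
  show "integrable (mu_k \<mu> \<sigma> l) h" by (subst h', rule Bochner_Integration.integrable_diff) (intro c, simp)+
  show "integrable \<mu> T" unfolding T' by (rule Bochner_Integration.integrable_diff) (intro c, simp)+
  have "integral\<^sup>L (mu_k \<mu> \<sigma> l) h = integral\<^sup>L (mu_k \<mu> \<sigma> l) (\<lambda>p. max 0 (1 * h p)) - integral\<^sup>L (mu_k \<mu> \<sigma> l) (\<lambda>p. max 0 (-1 * h p))"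
    by (subst h', rule Bochner_Integration.integral_diff) (intro c, simp)+
  also have "\<dots> = integral\<^sup>L \<mu> (?T 1) - integral\<^sup>L \<mu> (?T (-1))" by (simp only: c(3) abs_one abs_minus)
  also have "\<dots> = integral\<^sup>L \<mu> T"
    unfolding T' by (rule Bochner_Integration.integral_diff[symmetric]) (intro c, simp)+
  finally show "integral\<^sup>L (mu_k \<mu> \<sigma> l) h = integral\<^sup>L \<mu> T" .
qed

end

section \<open>Integrating the energy density\<close>

locale conf_mfd = riem_mfd M + gnz_space "TYPE('a)" m \<mu> \<sigma>
  for M :: "('a::{t2_space, second_countable_topology}, 'n::finite) riem" and m \<mu> \<sigma>
begin

text \<open>In the Campbell representation of \<open>mu_k\<close> only pairs formed by distinct
  points of a configuration and the rest of that configuration are charged, and these are separated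
  by construction.\<close>

lemma AE_separated: "AE p in mu_k \<mu> \<sigma> l. separated l (fst p) (snd p)"
proof -
  let ?P = "GammaM \<Otimes>\<^sub>M PiM {..<l} (\<lambda>_. borel :: 'a measure)"
  have mi: "(\<lambda>p. snd p i) \<in> measurable ?P borel" if "i < l" for i
    using measurable_compose[OF measurable_snd measurable_component_singleton[of i "{..<l}" "\<lambda>_. borel"]] that by auto
  have "{p \<in> space ?P. snd p i = snd p j} \<in> sets ?P" if "i < l" "j < l" for i j
    using measurable_equality_set[OF mi[OF that(1)] mi[OF that(2)]] .
  then have e: "Measurable.pred ?P (\<lambda>p. snd p i = snd p j)" if "i < l" "j < l" for i j using that by (simp add: pred_def)
  have n: "Measurable.pred ?P (\<lambda>p. snd p i \<in> fst p)" if i: "i < l" for i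
    using measurable_compose[OF measurable_Pair[OF measurable_fst mi[OF i]] pred_mem] by simp
  let ?B = "\<lambda>p. \<forall>i\<in>{..<l}. snd p i \<notin> fst p \<and> (\<forall>j\<in>{..<l}. snd p i = snd p j \<longrightarrow> i = j)"
  have pB: "Measurable.pred ?P (\<lambda>p. \<not> ?B p)"
    by (intro pred_intros_logic pred_intros_finite n e) auto
  have B: "separated l \<gamma> x \<longleftrightarrow> ?B (\<gamma>, x)" if "x \<in> PiE {..<l} (\<lambda>_. UNIV)" for \<gamma> x
    using that by (fastforce simp: separated_def inj_on_def)
  let ?N = "{p \<in> space ?P. \<not> ?B p}"
  have N: "?N \<in> sets ?P" using pB by (simp add: pred_def)
  have "emeasure (mu_k \<mu> \<sigma> l) ?N = (\<integral>\<^sup>+\<gamma>. camp l \<gamma> (\<lambda>\<gamma> x. indicator ?N (\<gamma>, x)) \<partial>\<mu>)" by (rule emeasure_mu_k[OF N])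
  also have "\<dots> = (\<integral>\<^sup>+\<gamma>. 0 \<partial>\<mu>)"
  proof (rule nn_integral_cong)
    fix \<gamma>
    have "camp l \<gamma> (\<lambda>\<gamma> x. indicator ?N (\<gamma>, x)) = camp l \<gamma> (\<lambda>_ _. 0)"
      using B[OF separated_PiE[OF Inj_separated]] Inj_separated[of _ l \<gamma>] by (intro camp_cong) simp
    then show "camp l \<gamma> (\<lambda>\<gamma> x. indicator ?N (\<gamma>, x)) = 0" by (simp add: camp_def)
  qed
  finally have "?N \<in> null_sets (mu_k \<mu> \<sigma> l)" using N by (simp add: null_sets_def sets_mu_k)
  then show ?thesis
  proof (rule AE_I')
    show "{p \<in> space (mu_k \<mu> \<sigma> l). \<not> separated l (fst p) (snd p)} \<subseteq> ?N"
      using B by (auto simp: space_mu_k space_pair_measure space_PiM)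
  qed
qed

context
  fixes n :: nat and V1 V2 :: "('a, 'n) Gform" and J1 J2 :: nat and k1 k2 :: "nat \<Rightarrow> nat" and a1 a2 :: "nat \<Rightarrow> real"
    and F1 F2 :: "nat \<Rightarrow> 'a set \<Rightarrow> real" and \<omega>1 \<omega>2 :: "nat \<Rightarrow> (nat \<Rightarrow> 'a) \<Rightarrow> (nat, 'n) tensor"
  assumes n: "1 \<le> n" and V1: "drep n V1 J1 k1 a1 F1 \<omega>1" and V2: "drep n V2 J2 k2 a2 F2 \<omega>2"
begin

private abbreviation "g \<equiv> energy_density n J1 J2 k1 k2 a1 a2 F1 F2 \<omega>1 \<omega>2"

lemma energy_density_measurable: "(\<lambda>p. g l (fst p) (snd p)) \<in> borel_measurable (GammaM \<Otimes>\<^sub>M PiM {..<l} (\<lambda>_. borel))"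
  unfolding energy_density_def[OF n V1 V2]
proof (intro borel_measurable_sum borel_measurable_times borel_measurable_add borel_measurable_const)
  fix j j' assume j: "j \<in> Jl J1 k1 l" and j': "j' \<in> Jl J2 k2 l"
  note s = Psi_smooth[OF drepD(3)[OF V1 j]] Psi_smooth[OF drepD(3)[OF V2 j']]
  note F = drepD(2)[OF V1 j] drepD(2)[OF V2 j']
  let ?P = "GammaM \<Otimes>\<^sub>M PiM {..<l} (\<lambda>_. borel :: 'a measure)"
  show "(\<lambda>p. cprod (F1 j) (F2 j') (fst p)) \<in> borel_measurable ?P"
    by (rule measurable_compose[OF measurable_fst cprod_measurable_bounded(1)[OF F]])
  show "(\<lambda>p. F1 j (fst p)) \<in> borel_measurable ?P" "(\<lambda>p. F2 j' (fst p)) \<in> borel_measurable ?P"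
    by (rule measurable_compose[OF measurable_fst cylinder_measurable] F)+
  show "(\<lambda>p. iprod n l (\<omega>1 j) (\<omega>2 j') (snd p)) \<in> borel_measurable ?P"
    by (rule measurable_compose[OF measurable_snd continuous_on_extensional_measurable[OF iprod_continuous[OF s]]])
  show "(\<lambda>p. gprod n l (\<omega>1 j) (\<omega>2 j') (snd p)) \<in> borel_measurable ?P"
    by (rule measurable_compose[OF measurable_snd continuous_on_extensional_measurable[OF gprod_continuous[OF s]]])
qed

lemma energy_density_bounded: "conf_bounded l (g l)"
proof -
  obtain K where K: "supp_set J1 k1 F1 \<omega>1 K" using supp_set_exists[OF n V1 V2] by blast
  have cK: "compact K" using K by (simp add: supp_set_def[OF n V1 V2])
  have "conf_bounded l (\<lambda>\<gamma> x. (a1 j * a2 j') * (cprod (F1 j) (F2 j') \<gamma> * iprod n l (\<omega>1 j) (\<omega>2 j') x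
     + F1 j \<gamma> * F2 j' \<gamma> * gprod n l (\<omega>1 j) (\<omega>2 j') x))" if j: "j \<in> Jl J1 k1 l" and j': "j' \<in> Jl J2 k2 l" for j j'
  proof -
    note s = Psi_smooth[OF drepD(3)[OF V1 j]] Psi_smooth[OF drepD(3)[OF V2 j']]
    note F = drepD(2)[OF V1 j] drepD(2)[OF V2 j']
    note z = supp_iprod[OF n V1 V2 K j]
    have "\<exists>C\<ge>0. \<forall>x\<in>PiE {..<l} (\<lambda>_. UNIV). \<bar>iprod n l (\<omega>1 j) (\<omega>2 j') x\<bar> \<le> C"
      by (rule bounded_on_compact_support[OF iprod_continuous[OF s] cK]) (rule z)
    then obtain Ci where Ci: "\<And>x. x \<in> PiE {..<l} (\<lambda>_. UNIV) \<Longrightarrow> \<bar>iprod n l (\<omega>1 j) (\<omega>2 j') x\<bar> \<le> Ci"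
      by blast
    have "\<exists>C\<ge>0. \<forall>x\<in>PiE {..<l} (\<lambda>_. UNIV). \<bar>gprod n l (\<omega>1 j) (\<omega>2 j') x\<bar> \<le> C"
      by (rule bounded_on_compact_support[OF gprod_continuous[OF s] cK]) (rule z)
    then obtain Cg where Cg: "\<And>x. x \<in> PiE {..<l} (\<lambda>_. UNIV) \<Longrightarrow> \<bar>gprod n l (\<omega>1 j) (\<omega>2 j') x\<bar> \<le> Cg"
      by blast
    obtain C1 where C1: "\<And>\<gamma>. \<bar>F1 j \<gamma>\<bar> \<le> C1" using cylinder_bounded[OF F(1)] by blast
    obtain C2 where C2: "\<And>\<gamma>. \<bar>F2 j' \<gamma>\<bar> \<le> C2" using cylinder_bounded[OF F(2)] by blast
    obtain f D where f: "f \<in> C0" "D \<ge> 0" "\<And>x. 0 \<le> f x" "\<And>\<gamma>. \<gamma> \<in> Gamma \<Longrightarrow> \<bar>cprod (F1 j) (F2 j') \<gamma>\<bar> \<le> D * pairing f \<gamma>"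
      using cprod_measurable_bounded(2)[OF F] by blast
    have c: "conf_bounded l (\<lambda>\<gamma> x. cprod (F1 j) (F2 j') \<gamma>)"
      unfolding conf_bounded_def
    proof (intro bexI[OF _ f(1)] exI[of _ D] conjI allI ballI)
      fix \<gamma> :: "'a set" and x :: "nat \<Rightarrow> 'a" assume \<gamma>: "\<gamma> \<in> Gamma"
      show "\<bar>cprod (F1 j) (F2 j') \<gamma>\<bar> \<le> D * (1 + pairing f \<gamma>)" using f(4)[OF \<gamma>] f(2) by (simp add: distrib_left)
    qed (use f(2,3) in auto)
    have 1: "conf_bounded l (\<lambda>\<gamma> x. iprod n l (\<omega>1 j) (\<omega>2 j') x * cprod (F1 j) (F2 j') \<gamma>)"
      by (rule conf_bounded_mult[OF c]) (rule Ci)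
    have 2: "conf_bounded l (\<lambda>(\<gamma> :: 'a set) x. gprod n l (\<omega>1 j) (\<omega>2 j') x * 1)"
      by (rule conf_bounded_mult[OF conf_bounded_const]) (rule Cg)
    have 3: "conf_bounded l (\<lambda>\<gamma> x. F1 j \<gamma> * (F2 j' \<gamma> * (gprod n l (\<omega>1 j) (\<omega>2 j') x * 1)))"
      by (rule conf_bounded_mult[OF conf_bounded_mult[OF 2 C2] C1])
    have "conf_bounded l (\<lambda>\<gamma> x. (a1 j * a2 j') * (iprod n l (\<omega>1 j) (\<omega>2 j') x * cprod (F1 j) (F2 j') \<gamma>
       + F1 j \<gamma> * (F2 j' \<gamma> * (gprod n l (\<omega>1 j) (\<omega>2 j') x * 1))))"
      by (rule conf_bounded_mult[OF conf_bounded_add[OF 1 3] order_refl])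
    then show ?thesis by (simp add: mult_ac)
  qed
  then have "conf_bounded l (\<lambda>\<gamma> x. \<Sum>j\<in>Jl J1 k1 l. \<Sum>j'\<in>Jl J2 k2 l. (a1 j * a2 j') * (cprod (F1 j) (F2 j') \<gamma> * iprod n l (\<omega>1 j) (\<omega>2 j') x
     + F1 j \<gamma> * F2 j' \<gamma> * gprod n l (\<omega>1 j) (\<omega>2 j') x))"
    by (intro conf_bounded_sum) simp_all
  then show ?thesis unfolding energy_density_def[OF n V1 V2, abs_def] .
qed

lemma energy_drep:
  "(\<forall>k\<in>{1..n}. integrable (completion (mu_k \<mu> \<sigma> k))
      (\<lambda>(\<gamma>, x). inner_grad_conf M n k (In_map n V1 k) (In_map n V2 k) \<gamma> x
              + inner_grad_Xk M n k (In_map n V1 k) (In_map n V2 k) \<gamma> x)) \<and>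
   energy M \<mu> n V1 V2 =
     (\<Sum>k = 1..n. \<integral>(\<gamma>, x). inner_grad_conf M n k (In_map n V1 k) (In_map n V2 k) \<gamma> x
              + inner_grad_Xk M n k (In_map n V1 k) (In_map n V2 k) \<gamma> x \<partial>completion (mu_k \<mu> \<sigma> k))"
proof -
  obtain K where K: "supp_set J1 k1 F1 \<omega>1 K" using supp_set_exists[OF n V1 V2] by blast
  have cK: "compact K" using K by (simp add: supp_set_def[OF n V1 V2])
  let ?f = "\<lambda>k. \<lambda>(\<gamma>, x). inner_grad_conf M n k (In_map n V1 k) (In_map n V2 k) \<gamma> x
              + inner_grad_Xk M n k (In_map n V1 k) (In_map n V2 k) \<gamma> x"
  let ?g = "\<lambda>k p. g k (fst p) (snd p)"
  let ?T = "\<lambda>k \<gamma>. \<Sum>x\<in>Inj k (\<gamma> \<inter> K). g k (\<gamma> - x ` {..<k}) x"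
  \<comment> \<open>Off separated pairs the given integrand is built from irrelevant values of
    \<open>In_map\<close> and cannot be compared with the density; these pairs form a null
    set.\<close>
  have ae: "AE p in mu_k \<mu> \<sigma> k. ?f k p = ?g k p" if k: "k \<in> {1..n}" for k
  proof -
    have eq: "?f k p = ?g k p" if "p \<in> space (mu_k \<mu> \<sigma> k)" "separated k (fst p) (snd p)" for p
    proof -
      obtain \<gamma> x where p: "p = (\<gamma>, x)" by (rule prod.exhaust)
      have \<gamma>: "\<gamma> \<in> Gamma" using that(1) unfolding p space_mu_k by (rule SigmaD1)
      have x: "separated k \<gamma> x" using that(2) unfolding p fst_conv snd_conv .
      show ?thesis unfolding p prod.case fst_conv snd_conv by (rule inner_grads_eq[OF n V1 V2 \<gamma> k x])
    qed
    show ?thesis by (rule AE_mp[OF AE_separated[of k] AE_I2], rule impI, rule eq)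
  qed
  have c: "integrable (mu_k \<mu> \<sigma> k) (?g k)" "integrable \<mu> (?T k)" "integral\<^sup>L (mu_k \<mu> \<sigma> k) (?g k) = integral\<^sup>L \<mu> (?T k)" for k
    using campbell[OF energy_density_measurable[of k] _ cK] energy_density_bounded[of k] energy_density_eq_0[OF n V1 V2 K] by simp_all
  have "energy M \<mu> n V1 V2 = (\<integral>\<gamma>. (\<Sum>k = 1..n. ?T k \<gamma>) \<partial>\<mu>)"
    unfolding energy_def
    by (rule Bochner_Integration.integral_cong[OF refl], rule Ginner_decomposition[OF n V1 V2 K]) (simp add: space_mu)
  also have "\<dots> = (\<Sum>k = 1..n. integral\<^sup>L \<mu> (?T k))"
    by (rule Bochner_Integration.integral_sum) (rule c(2))
  also have "\<dots> = (\<Sum>k = 1..n. integral\<^sup>L (completion (mu_k \<mu> \<sigma> k)) (?f k))"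
    by (rule sum.cong[OF refl]) (simp only: c(3)[symmetric] integral_completion_AE(2)[OF c(1) ae])
  finally show ?thesis using integral_completion_AE(1)[OF c(1) ae] by blast
qed

end

end

text \<open>In a chart the volume of a point is an integral over a single point of Euclidean space,
  a Lebesgue null set.\<close>

lemma volume_measure_singleton:
  fixes M :: "('a::{t2_space, second_countable_topology}, 'n::finite) riem"
  assumes "riemannian M" and vol: "volume_measure M m"
  shows "emeasure m {x} = 0"
proof -
  have c: "chart_at M x \<in> charts M" "x \<in> fst (chart_at M x)"
    using assms(1) by (auto simp: riemannian_def smooth_manifold_def)
  have "{x} \<in> sets borel" by simp
  then have "emeasure m {x} = (\<integral>\<^sup>+p\<in>snd (chart_at M x) ` {x}. ennreal (sqrt (det (\<chi> i j. gram M (chart_at M x) p (axis i 1) (axis j 1)))) \<partial>lborel)"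
    using vol c unfolding volume_measure_def by blast
  also have "\<dots> = 0"
    by (rule nn_integral_null_set) (auto simp: null_sets_def)
  finally show ?thesis .
qed

theorem proposition3p8:
  fixes M :: "('a::{t2_space, second_countable_topology}, 'n::finite) riem"
    and m :: "'a measure"
    and \<mu> :: "'a set measure"
    and \<sigma> :: "'a set \<Rightarrow> 'a measure"
    and \<rho> :: "'a set \<Rightarrow> 'a \<Rightarrow> real"
    and d\<rho> :: "'a set \<Rightarrow> 'a \<Rightarrow> real ^ 'n"
    and n :: nat
    and DE :: "('a, 'n) Gform set"
    and E :: "('a, 'n) Gform \<Rightarrow> ('a, 'n) Gform \<Rightarrow> real"
    and W1 W2 :: "nat \<Rightarrow> 'a set \<Rightarrow> (nat \<Rightarrow> 'a) \<Rightarrow> (nat, 'n) tensor"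
  assumes "riemannian M" and "oriented M" and "riem_complete M"
    and "connected (UNIV :: 'a set)"
    and "volume_measure M m" and "emeasure m UNIV = \<infinity>"
    and "admissible M m \<mu> \<sigma> \<rho> d\<rho>"
    and "1 \<le> n"
    and "form_closure M \<mu> n (DOmega M n) (energy M \<mu> n) DE E"
    and "W1 \<in> In_map n ` DOmega M n" and "W2 \<in> In_map n ` DOmega M n"
  shows "(\<forall>k\<in>{1..n}. integrable (completion (mu_k \<mu> \<sigma> k))
            (\<lambda>(\<gamma>, x). inner_grad_conf M n k (W1 k) (W2 k) \<gamma> x
                    + inner_grad_Xk M n k (W1 k) (W2 k) \<gamma> x)) \<and>
         image_form M \<mu> n E W1 W2 =
           (\<Sum>k = 1..n. \<integral>(\<gamma>, x). inner_grad_conf M n k (W1 k) (W2 k) \<gamma> x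
                    + inner_grad_Xk M n k (W1 k) (W2 k) \<gamma> x \<partial>completion (mu_k \<mu> \<sigma> k))"
proof -
  interpret riem_mfd M by standard (fact assms(1))
  note adm1 = assms(7)[unfolded admissible_def, THEN conjunct2]
  note adm2 = adm1[THEN conjunct2] note adm3 = adm2[THEN conjunct2]
  note adm4 = adm3[THEN conjunct2] note adm5 = adm4[THEN conjunct2]
  note adm6 = adm5[THEN conjunct2]
  have "bump_space TYPE('a)" by (rule bump_space_axioms)
  moreover have "gnz_space_axioms m \<mu> \<sigma>"
  proof (rule gnz_space_axioms.intro)
    show "sets m = sets borel" using assms(5) by (simp add: volume_measure_def)
    show "emeasure m {x} = 0" for x by (rule volume_measure_singleton[OF assms(1,5)])
    show "prob_space \<mu>" by (rule assms(7)[unfolded admissible_def, THEN conjunct1])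
    show "sets \<mu> = sets GammaM" by (rule adm1[THEN conjunct1])
    show "(\<integral>\<^sup>+\<gamma>. ennreal (pairing \<phi> \<gamma> ^ k) \<partial>\<mu>) < \<infinity>" if "\<phi> \<in> C0" "\<And>x. 0 \<le> \<phi> x" for k \<phi>
      by (rule adm2[THEN conjunct1, rule_format]) (use that in auto)
    show "sets (\<sigma> \<gamma>) = sets borel" if "\<gamma> \<in> Gamma" for \<gamma>
      by (rule adm3[THEN conjunct1, rule_format, OF that])
    show "(\<lambda>\<gamma>. emeasure (\<sigma> \<gamma>) A) \<in> borel_measurable GammaM" if "A \<in> sets borel" for A
      by (rule adm4[THEN conjunct1, rule_format, OF that])
    show "(\<integral>\<^sup>+\<gamma>. (\<integral>\<^sup>+x. ennreal (F (\<gamma>, x)) \<partial>count_space \<gamma>) \<partial>\<mu>) =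
        (\<integral>\<^sup>+\<gamma>. (\<integral>\<^sup>+x. ennreal (F (insert x \<gamma>, x)) \<partial>\<sigma> \<gamma>) \<partial>\<mu>)"
      if "F \<in> borel_measurable (GammaM \<Otimes>\<^sub>M borel)" "\<And>z. 0 \<le> F z" for F
      by (rule adm5[THEN conjunct1, rule_format]) (use that in auto)
    show "AE \<gamma> in \<mu>. absolutely_continuous m (\<sigma> \<gamma>)" by (rule adm6[THEN conjunct1])
  qed
  ultimately interpret gnz_space "TYPE('a)" m \<mu> \<sigma> by (rule gnz_space.intro)
  interpret conf_mfd M m \<mu> \<sigma> ..
  obtain V1 V2 where V: "V1 \<in> DOmega M n" "W1 = In_map n V1" "V2 \<in> DOmega M n" "W2 = In_map n V2"
    using assms(10,11) by blast
  \<comment> \<open>The closure is a form on a subset of \<open>L2_forms\<close> which extends the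
    energy on test forms; at test forms its value is therefore an explicit integral.\<close>
  have D: "DOmega M n \<subseteq> L2_forms M \<mu> n" and E: "E V1 V2 = energy M \<mu> n V1 V2"
    using assms(9) V(1,3) unfolding form_closure_def by auto
  \<comment> \<open>\<open>image_form\<close> chooses a preimage within \<open>L2_forms\<close>.
    Representatives there are genuine forms, so the preimage is unique and is the test form
    itself.\<close>
  have "inj_on (In_map n) (L2_forms M \<mu> n)"
    by (rule inj_on_subset[OF In_map_inj[of n]]) (auto simp: L2_forms_def)
  then have "inv_into (L2_forms M \<mu> n) (In_map n) (In_map n V) = V" if "V \<in> DOmega M n" for V
    using D that by (intro inv_into_f_f) auto
  then have "image_form M \<mu> n E W1 W2 = energy M \<mu> n V1 V2"
    using V E by (simp add: image_form_def)
  moreover obtain J1 k1 a1 F1 \<omega>1 where "drep n V1 J1 k1 a1 F1 \<omega>1" using DOmega_drep[OF V(1)] by blast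
  moreover obtain J2 k2 a2 F2 \<omega>2 where "drep n V2 J2 k2 a2 F2 \<omega>2" using DOmega_drep[OF V(3)] by blast
  ultimately show ?thesis using energy_drep[OF assms(8)] unfolding V(2,4) by simp
qed

end
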